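(* The huge multicommodity flow problem (defined in the context) with $l$ commodities, $t$ consumer types, unary-encoded number $m$ of suppliers, binary-encoded supplies, consumptions and capacities $s^k_i$, $c^k_r$ and $u_{i,r}$, and binary-encoded numbers $n_r$ of consumers of type $r=1,\dots,t$, parameterized by $l$ and $t$, is fixed-parameter tractable.
   Context: $\mathbb{Z}_+$ denotes the nonnegative integers. Huge multicommodity flow problem (over the complete bipartite graph between suppliers and consumers). There are $l$ commodities and $m$ suppliers, and nonnegative integers $s^k_i$ ($1\le i\le m$, $1\le k\le l$), the number of units that supplier $i$ is to supply of commodity $k$. There are $t$ consumer types; for $r=1,\dots,t$ there are $n_r$ consumers of type $r$ ($n_r$ a positive integer), each of which is to consume $c^k_r\in\mathbb{Z}_+$ units of commodity $k$ for each $1\le k\le l$; and $u_{i,r}\in\mathbb{Z}_+$ is the capacity of allowed total flow of all commodities from supplier $i$ to each consumer of type $r$. Let $n=n_1+\cdots+n_t$ be the total number of consumers, and let $r(j)$ denote the type of consumer $j$. A feasible flow is a collection of nonnegative integers $x^k_{i,j}$ (the flow of commodity $k$ from supplier $i$ to consumer $j$; $1\le k\le l$, $1\le i\le m$, $1\le j\le n$) such that $\sum_{j=1}^n x^k_{i,j}=s^k_i$ for all $i,k$; $\sum_{i=1}^m x^k_{i,j}=c^k_{r(j)}$ for all $j,k$; and $\sum_{k=1}^l x^k_{i,j}\le u_{i,r(j)}$ for all $i,j$. The problem is to decide whether a feasible flow exists and, if so, to find one in compact representation. Compact representation: for each type $r$, a finite list of pairs $(\lambda,z)$ where $z=(z^k_i)\in\mathbb{Z}_+^{l\times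 m}$ is a pattern of flows to a single consumer of type $r$ and $\lambda\in\mathbb{Z}_+$ is the binary-encoded number of consumers of type $r$ receiving that pattern, the multiplicities $\lambda$ for type $r$ summing to $n_r$. Fixed-parameter tractability. A parameterized problem with parameter $p$ (possibly a tuple of integers) and input $I$ is fixed-parameter tractable if it admits an algorithm running in time $O(f(p)\cdot\mathrm{size}(I)^{q})$ for some computable function $f(p)$ of $p$ that is independent of $I$ and some constant $q$ that is independent of $p$ and $I$, where $\mathrm{size}(I)$ is the encoding length of $I$. *)

theory Defs
  imports Main
begin

text \<open>
  Model of computation: Jones' WHILE language over binary trees (N. D. Jones, Computability and
  Complexity, 1997), which is Turing complete. Instead of Jones' unit costs, every evaluation
  of a subexpression is charged the size of its value. A program has a fixed finite set
  of variables, so with these charges running times agree with those of deterministic multi-tape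
  Turing machines up to a polynomial, and the length of the output is bounded by the running time.
  There are no arithmetic primitives: numbers are bit lists.
\<close>

datatype tree = Leaf | Node tree tree

fun tree_size :: "tree \<Rightarrow> nat" where
  "tree_size Leaf = 1"
| "tree_size (Node a b) = 1 + tree_size a + tree_size b"

datatype expr = Var nat | Nil_E | Cons_E expr expr | Hd expr | Tl expr

datatype com =
    Assign nat expr
  | Seq com com
  | If expr com com
  | While expr com

type_synonym state = "nat \<Rightarrow> tree"

fun tree_hd :: "tree \<Rightarrow> tree" where
  "tree_hd Leaf = Leaf"
| "tree_hd (Node a b) = a"

fun tree_tl :: "tree \<Rightarrow> tree" where
  "tree_tl Leaf = Leaf"
| "tree_tl (Node a b) = b"

fun eval_expr :: "expr \<Rightarrow> state \<Rightarrow> tree" where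
  "eval_expr (Var v) s = s v"
| "eval_expr Nil_E s = Leaf"
| "eval_expr (Cons_E d e) s = Node (eval_expr d s) (eval_expr e s)"
| "eval_expr (Hd e) s = tree_hd (eval_expr e s)"
| "eval_expr (Tl e) s = tree_tl (eval_expr e s)"

fun expr_cost :: "expr \<Rightarrow> state \<Rightarrow> nat" where
  "expr_cost (Var v) s = tree_size (s v)"
| "expr_cost Nil_E s = 1"
| "expr_cost (Cons_E d e) s =
     expr_cost d s + expr_cost e s + tree_size (eval_expr (Cons_E d e) s)"
| "expr_cost (Hd e) s = expr_cost e s + tree_size (eval_expr (Hd e) s)"
| "expr_cost (Tl e) s = expr_cost e s + tree_size (eval_expr (Tl e) s)"

text \<open>
  \<open>exec c s T s'\<close>: started in state \<open>s\<close>, the command \<open>c\<close> halts in state \<open>s'\<close> after time \<open>T\<close>.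
  \<open>Leaf\<close> is false, every other tree is true.
\<close>

inductive exec :: "com \<Rightarrow> state \<Rightarrow> nat \<Rightarrow> state \<Rightarrow> bool" where
  Assign: "exec (Assign v e) s (expr_cost e s) (s(v := eval_expr e s))"
| Seq: "exec c s T s' \<Longrightarrow> exec d s' T' s'' \<Longrightarrow> exec (Seq c d) s (T + T') s''"
| If_True: "eval_expr e s \<noteq> Leaf \<Longrightarrow> exec c s T s' \<Longrightarrow> exec (If e c d) s (expr_cost e s + T) s'"
| If_False: "eval_expr e s = Leaf \<Longrightarrow> exec d s T s' \<Longrightarrow> exec (If e c d) s (expr_cost e s + T) s'"
| While_True: "eval_expr e s \<noteq> Leaf \<Longrightarrow> exec c s T s' \<Longrightarrow> exec (While e c) s' T' s'' \<Longrightarrow>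
    exec (While e c) s (expr_cost e s + T + T') s''"
| While_False: "eval_expr e s = Leaf \<Longrightarrow> exec (While e c) s (expr_cost e s) s"

inductive_cases Assign_elim: "exec (Assign v e) s T s'"
inductive_cases Seq_elim: "exec (Seq c d) s T s'"
inductive_cases If_elim: "exec (If e c d) s T s'"
inductive_cases While_elim: "exec (While e c) s T s'"

lemma exec_deterministic:
  assumes "exec c s T s'" and "exec c s T1 s1"
  shows "T1 = T \<and> s1 = s'"
  using assms
proof (induction arbitrary: T1 s1 rule: exec.induct)
  case (While_True e s c T s' T' s'')
  from While_True.prems show ?case
    by (rule While_elim) (use While_True in blast)+
next
  case (Seq c s T s' d T' s'')
  from Seq.prems show ?case
    by (rule Seq_elim) (use Seq in blast)
qed (blast elim: Assign_elim If_elim While_elim)+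

text \<open>Input and output are passed in variable 0; all other variables initially hold \<open>Leaf\<close>.\<close>

definition runs :: "com \<Rightarrow> tree \<Rightarrow> tree \<Rightarrow> nat \<Rightarrow> bool" where
  "runs P inp out T \<longleftrightarrow> (\<exists>s. exec P ((\<lambda>_. Leaf)(0 := inp)) T s \<and> s 0 = out)"

fun bits :: "nat \<Rightarrow> bool list" where
  "bits n = (if n = 0 then [] else odd n # bits (n div 2))"

declare bits.simps [simp del]

definition enc_bit :: "bool \<Rightarrow> tree" where
  "enc_bit b = (if b then Node Leaf Leaf else Leaf)"

definition enc_list :: "('a \<Rightarrow> tree) \<Rightarrow> 'a list \<Rightarrow> tree" where
  "enc_list e xs = foldr (\<lambda>x. Node (e x)) xs Leaf"

definition enc_binary :: "nat \<Rightarrow> tree" where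
  "enc_binary n = enc_list enc_bit (bits n)"

definition enc_unary :: "nat \<Rightarrow> tree" where
  "enc_unary n = enc_list enc_bit (replicate n True)"

fun enc_option :: "('a \<Rightarrow> tree) \<Rightarrow> 'a option \<Rightarrow> tree" where
  "enc_option e None = Leaf"
| "enc_option e (Some x) = Node (e x) Leaf"

definition computable :: "(nat list \<Rightarrow> nat) \<Rightarrow> bool" where
  "computable f \<longleftrightarrow>
    (\<exists>P. \<forall>p. \<exists>T. runs P (enc_list enc_binary p) (enc_binary (f p)) T)"

text \<open>
  Parameterized search problems: \<open>answers I\<close> is the set of correct answers to \<open>I\<close>. The encoding
  length of an input \<open>I\<close> is the number of nodes of the tree \<open>enc I\<close>.
\<close>

definition fixed_parameter_tractable ::
    "'i set \<Rightarrow> ('i \<Rightarrow> nat list) \<Rightarrow> ('i \<Rightarrow> tree) \<Rightarrow> ('i \<Rightarrow> 'a set) \<Rightarrow> ('a \<Rightarrow> tree) \<Rightarrow> bool" where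
  "fixed_parameter_tractable inputs param enc answers enc_answer \<longleftrightarrow>
    (\<exists>P f C q. computable f \<and>
      (\<forall>I\<in>inputs. \<exists>a\<in>answers I. \<exists>T.
         runs P (enc I) (enc_answer a) T \<and> T \<le> C * (f (param I) * tree_size (enc I) ^ q)))"

text \<open>
  Commodities, suppliers, consumers and types are numbered from 0. Only the values of
  the functions at indices in range matter.
\<close>

record huge_mcf =
  commodities :: nat                        \<comment> \<open>\<open>l\<close>\<close>
  suppliers :: nat                          \<comment> \<open>\<open>m\<close>\<close>
  types :: nat                              \<comment> \<open>\<open>t\<close>\<close>
  supplies :: "nat \<Rightarrow> nat \<Rightarrow> nat"             \<comment> \<open>\<open>supplies k i\<close>\<close>
  consumptions :: "nat \<Rightarrow> nat \<Rightarrow> nat"        \<comment> \<open>\<open>consumptions k r\<close>\<close>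
  capacities :: "nat \<Rightarrow> nat \<Rightarrow> nat"           \<comment> \<open>\<open>capacities i r\<close>\<close>
  type_count :: "nat \<Rightarrow> nat"                \<comment> \<open>\<open>n\<^sub>r\<close>\<close>

definition huge_mcf_instances :: "huge_mcf set" where
  "huge_mcf_instances = {I. \<forall>r<types I. type_count I r > 0}"

definition num_consumers :: "huge_mcf \<Rightarrow> nat" where
  "num_consumers I = (\<Sum>r<types I. type_count I r)"

text \<open>The consumers are ordered by type.\<close>

definition consumer_type :: "huge_mcf \<Rightarrow> nat \<Rightarrow> nat" where
  "consumer_type I j = concat (map (\<lambda>r. replicate (type_count I r) r) [0..<types I]) ! j"

text \<open>\<open>x k i j\<close> is the flow of commodity \<open>k\<close> from supplier \<open>i\<close> to consumer \<open>j\<close>.\<close>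

definition feasible_flow :: "huge_mcf \<Rightarrow> (nat \<Rightarrow> nat \<Rightarrow> nat \<Rightarrow> nat) \<Rightarrow> bool" where
  "feasible_flow I x \<longleftrightarrow>
    (\<forall>i<suppliers I. \<forall>k<commodities I. (\<Sum>j<num_consumers I. x k i j) = supplies I k i) \<and>
    (\<forall>j<num_consumers I. \<forall>k<commodities I.
       (\<Sum>i<suppliers I. x k i j) = consumptions I k (consumer_type I j)) \<and>
    (\<forall>i<suppliers I. \<forall>j<num_consumers I.
       (\<Sum>k<commodities I. x k i j) \<le> capacities I i (consumer_type I j))"

text \<open>A pattern \<open>z\<close> is an \<open>l \<times> m\<close> matrix: \<open>z ! k ! i\<close> units of commodity \<open>k\<close> from supplier \<open>i\<close>.\<close>

type_synonym pattern = "nat list list"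

definition is_pattern :: "huge_mcf \<Rightarrow> pattern \<Rightarrow> bool" where
  "is_pattern I z \<longleftrightarrow> length z = commodities I \<and> (\<forall>row\<in>set z. length row = suppliers I)"

type_synonym compact = "(nat \<times> pattern) list list"

text \<open>
  \<open>R\<close> represents the flow \<open>x\<close> if, for each type \<open>r\<close> and each pattern \<open>z\<close>, the multiplicities with
  which \<open>z\<close> is listed for type \<open>r\<close> add up to the number of consumers of type \<open>r\<close> that receive \<open>z\<close>.
\<close>

definition represents :: "huge_mcf \<Rightarrow> compact \<Rightarrow> (nat \<Rightarrow> nat \<Rightarrow> nat \<Rightarrow> nat) \<Rightarrow> bool" where
  "represents I R x \<longleftrightarrow> length R = types I \<and>
    (\<forall>r<types I.
       (\<forall>(\<mu>, z)\<in>set (R ! r). is_pattern I z) \<and>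
       (\<Sum>(\<mu>, z)\<leftarrow>R ! r. \<mu>) = type_count I r \<and>
       (\<forall>z. is_pattern I z \<longrightarrow>
          (\<Sum>(\<mu>, w)\<leftarrow>R ! r. if w = z then \<mu> else 0) =
          card {j. j < num_consumers I \<and> consumer_type I j = r \<and>
                   (\<forall>k<commodities I. \<forall>i<suppliers I. x k i j = z ! k ! i)}))"

definition huge_mcf_answers :: "huge_mcf \<Rightarrow> compact option set" where
  "huge_mcf_answers I =
    (if \<exists>x. feasible_flow I x then {Some R | R. \<exists>x. feasible_flow I x \<and> represents I R x}
     else {None})"

definition enc_huge_mcf :: "huge_mcf \<Rightarrow> tree" where
  "enc_huge_mcf I = enc_list id
    [enc_binary (commodities I),
     enc_unary (suppliers I),
     enc_binary (types I),
     enc_list (\<lambda>k. enc_list (\<lambda>i. enc_binary (supplies I k i)) [0..<suppliers I]) [0..<commodities I],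
     enc_list (\<lambda>k. enc_list (\<lambda>r. enc_binary (consumptions I k r)) [0..<types I]) [0..<commodities I],
     enc_list (\<lambda>i. enc_list (\<lambda>r. enc_binary (capacities I i r)) [0..<types I]) [0..<suppliers I],
     enc_list (\<lambda>r. enc_binary (type_count I r)) [0..<types I]]"

definition enc_huge_mcf_answer :: "compact option \<Rightarrow> tree" where
  "enc_huge_mcf_answer = enc_option (enc_list (enc_list
     (\<lambda>(\<mu>, z). Node (enc_binary \<mu>) (enc_list (enc_list enc_binary) z))))"

text \<open>Different answers have different encodings.\<close>

lemma inj_enc_list:
  assumes "inj e" shows "inj (enc_list e)"
proof (rule injI)
  fix xs ys show "enc_list e xs = enc_list e ys \<Longrightarrow> xs = ys"
  proof (induction xs arbitrary: ys)
    case Nil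
    then show ?case by (cases ys) (auto simp: enc_list_def)
  next
    case (Cons x xs)
    then show ?case using assms by (cases ys) (auto simp: enc_list_def dest: injD)
  qed
qed

lemma inj_bits: "inj bits"
proof (rule injI)
  fix m n show "bits m = bits n \<Longrightarrow> m = n"
  proof (induction m arbitrary: n rule: less_induct)
    case (less m)
    show ?case
    proof (cases "m = 0 \<or> n = 0")
      case True
      then show ?thesis using less.prems by (auto simp: bits.simps split: if_splits)
    next
      case False
      then have "odd m = odd n" "bits (m div 2) = bits (n div 2)"
        using less.prems bits.simps[of m] bits.simps[of n] by auto
      moreover from this have "m div 2 = n div 2" using less.IH[of "m div 2"] False by simp
      ultimately show ?thesis by presburger
    qed
  qed
qed

lemma inj_enc_binary: "inj enc_binary"
proof -
  have "inj enc_bit" by (auto simp: inj_def enc_bit_def)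
  then have "inj (enc_list enc_bit \<circ> bits)"
    by (intro inj_compose inj_bits inj_enc_list)
  moreover have "enc_list enc_bit \<circ> bits = enc_binary" by (auto simp: enc_binary_def)
  ultimately show ?thesis by simp
qed

lemma inj_enc_huge_mcf_answer: "inj enc_huge_mcf_answer"
proof -
  define e where
    "e = enc_list (enc_list (\<lambda>(\<mu>, z). Node (enc_binary \<mu>) (enc_list (enc_list enc_binary) z)))"
  have "inj (enc_list (enc_list enc_binary))" by (intro inj_enc_list inj_enc_binary)
  then have "inj (\<lambda>(\<mu>, z). Node (enc_binary \<mu>) (enc_list (enc_list enc_binary) z))"
    using inj_enc_binary by (auto simp: inj_def)
  then have e: "inj e" unfolding e_def by (intro inj_enc_list)
  show ?thesis unfolding enc_huge_mcf_answer_def e_def[symmetric]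
  proof (rule injI)
    fix a b show "enc_option e a = enc_option e b \<Longrightarrow> a = b"
      using e by (cases a; cases b) (auto dest: injD)
  qed
qed

end

theory Submission
  imports Defs "HOL-Library.FuncSet"
begin

text \<open>
  Transportation polytopes have the integer decomposition property, so only the total flow of
  each commodity from each supplier to each consumer type matters: a table of total flows with the
  right margins for type \<open>r\<close> splits into \<open>n\<^sub>r\<close> patterns. The total flows solve an \<open>n\<close>-fold packing
  problem whose bricks, one per supplier, have a size depending only on \<open>l\<close> and \<open>t\<close>. Starting
  from \<open>0\<close>, steps of length \<open>2\<^sup>L, \<dots>, 2, 1\<close> times a small integral vector improve the packing.
  Grouping unit vectors into sign-compatible blocks of bounded size, first within each brick and
  then across bricks, gives a bounded number of types of blocks. If the gap to the optimum is
  large compared with the step length, some improving type occurs often enough to yield a step of that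
  length, and for length \<open>1\<close> any gap suffices. A step whose partial sums over the bricks are
  bounded is found by dynamic programming. To split a table of total flows of type \<open>r\<close> compactly, round
  its \<open>1/n\<^sub>r\<close>-fraction to a pattern by the same packing algorithm and peel it off as often as
  possible; every round makes one more entry divisible by the number of remaining consumers.

  The running time is polynomial in the input together with a budget, a unary number that is an iterated
  exponential of \<open>l + t\<close>, and the number of iterations of every loop is read off from the input and the budget.
\<close>

section \<open>Clean programs\<close>

text \<open>The number of consumers is exponential in the input, so they cannot be treated one by
  one; the number of suppliers is unary but no parameter, so the exponential bounds may not depend
  on it. Hence one brick per supplier, with \<open>l * t\<close> entries and \<open>l + t\<close>
  inequalities. Stated as packing, the problem has the zero flow as a starting point, and a feasible
  flow exists exactly if the optimum meets all supplies and demands with equality. The difference to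
  a better packing may have huge entries and huge partial sums. A step assembled from few bounded
  blocks has bounded sums over every set of bricks, so the dynamic program works in a box of fixed
  dimension and radius. As the blocks have the sign of the difference in every constraint, adding a
  multiple of the step violates no constraint that both packings satisfy. Doubling lengths keep the
  number of steps polynomial in the bit lengths: a phase of length \<open>2 * l\<close> leaves a gap
  that a bounded number of steps of length \<open>l\<close> closes. The bounds themselves are never
  evaluated; any sufficiently long unary list can take their place.\<close>

fun expr_bound :: "expr \<Rightarrow> nat" where
  "expr_bound (Var v) = Suc v"
| "expr_bound Nil_E = 0"
| "expr_bound (Cons_E d e) = max (expr_bound d) (expr_bound e)"
| "expr_bound (Hd e) = expr_bound e"
| "expr_bound (Tl e) = expr_bound e"

fun com_bound :: "com \<Rightarrow> nat" where
  "com_bound (Assign v e) = max (Suc v) (expr_bound e)"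
| "com_bound (Seq c d) = max (com_bound c) (com_bound d)"
| "com_bound (If e c d) = max (expr_bound e) (max (com_bound c) (com_bound d))"
| "com_bound (While e c) = max (expr_bound e) (com_bound c)"

fun shift_expr :: "nat \<Rightarrow> expr \<Rightarrow> expr" where
  "shift_expr d (Var v) = Var (d + v)"
| "shift_expr d Nil_E = Nil_E"
| "shift_expr d (Cons_E a b) = Cons_E (shift_expr d a) (shift_expr d b)"
| "shift_expr d (Hd e) = Hd (shift_expr d e)"
| "shift_expr d (Tl e) = Tl (shift_expr d e)"

fun shift_com :: "nat \<Rightarrow> com \<Rightarrow> com" where
  "shift_com d (Assign v e) = Assign (d + v) (shift_expr d e)"
| "shift_com d (Seq a b) = Seq (shift_com d a) (shift_com d b)"
| "shift_com d (If e a b) = If (shift_expr d e) (shift_com d a) (shift_com d b)"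
| "shift_com d (While e a) = While (shift_expr d e) (shift_com d a)"

text \<open>A call frame: the callee owns the window of \<open>k\<close> variables from
  \<open>d\<close> on, the caller all others.\<close>

definition embed :: "nat \<Rightarrow> nat \<Rightarrow> state \<Rightarrow> state \<Rightarrow> state" where
  "embed d k s t = (\<lambda>v. if d \<le> v \<and> v < d + k then s (v - d) else t v)"

lemma eval_shift_expr:
  "expr_bound e \<le> k \<Longrightarrow> eval_expr (shift_expr d e) (embed d k s t) = eval_expr e s"
  by (induction e) (auto simp: embed_def)

lemma cost_shift_expr:
  "expr_bound e \<le> k \<Longrightarrow> expr_cost (shift_expr d e) (embed d k s t) = expr_cost e s"
proof (induction e)
  case (Cons_E e1 e2)
  then show ?case using eval_shift_expr[of "Cons_E e1 e2"] by simp
next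
  case (Hd e)
  then show ?case using eval_shift_expr[of "Hd e"] by simp
next
  case (Tl e)
  then show ?case using eval_shift_expr[of "Tl e"] by simp
qed (auto simp: embed_def)

text \<open>A program that touches only its first \<open>k\<close> variables runs unchanged inside
  the window and cannot disturb \<open>t\<close>. Costs depend only on values, so the running time
  is preserved exactly.\<close>

lemma exec_shift:
  "exec c s T s' \<Longrightarrow> com_bound c \<le> k \<Longrightarrow> exec (shift_com d c) (embed d k s t) T (embed d k s' t)"
proof (induction rule: exec.induct)
  case (Assign v e s)
  have "embed d k (s(v := eval_expr e s)) t = (embed d k s t)(d + v := eval_expr (shift_expr d e) (embed d k s t))"
    using Assign by (auto simp: eval_shift_expr) (auto simp: embed_def fun_eq_iff)
  then show ?case
    using exec.Assign[of "d + v" "shift_expr d e" "embed d k s t"] Assign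
    by (simp add: cost_shift_expr del: fun_upd_apply)
next
  case (Seq c s T s' d T' s'')
  then show ?case by (auto intro: exec.Seq)
next
  case (If_True e s c T s' d')
  then show ?case
    using exec.If_True[of "shift_expr d e" "embed d k s t" "shift_com d c" T "embed d k s' t" "shift_com d d'"]
    by (simp add: eval_shift_expr cost_shift_expr)
next
  case (If_False e s d' T s' c)
  then show ?case
    using exec.If_False[of "shift_expr d e" "embed d k s t" "shift_com d d'" T "embed d k s' t" "shift_com d c"]
    by (simp add: eval_shift_expr cost_shift_expr)
next
  case (While_True e s c T s' T' s'')
  then show ?case
    using exec.While_True[of "shift_expr d e" "embed d k s t" "shift_com d c" T "embed d k s' t" T' "embed d k s'' t"]
    by (simp add: eval_shift_expr cost_shift_expr)
next
  case (While_False e s c)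
  then show ?case
    using exec.While_False[of "shift_expr d e" "embed d k s t" "shift_com d c"]
    by (simp add: eval_shift_expr cost_shift_expr)
qed

lemma tree_size_pos: "0 < tree_size t"
  by (cases t) auto

lemma eval_size_le_cost: "tree_size (eval_expr e s) \<le> expr_cost e s"
  by (cases e) auto

text \<open>Every assignment is charged at least the size of the value it stores. Time bounds
  therefore bound the sizes of results too, on which the composition of polynomial bounds
  relies.\<close>

lemma exec_size: "exec c s T s' \<Longrightarrow> tree_size (s' v) \<le> tree_size (s v) + T"
proof (induction rule: exec.induct)
  case (Assign v e s)
  then show ?case using eval_size_le_cost[of e s] by (auto simp: trans_le_add2)
qed auto

section \<open>Encodable types\<close>

text \<open>Encoding by type lets the running-time rules follow the structure of terms. Injectivity
  is no axiom of the class: coinciding encodings, such as those of \<open>()\<close> and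
  \<open>[]\<close>, make conversions free of charge.\<close>

class encodable =
  fixes enc :: "'a \<Rightarrow> tree"

instantiation bool :: encodable begin
definition enc_bool :: "bool \<Rightarrow> tree" where "enc_bool = enc_bit"
instance ..
end

instantiation nat :: encodable begin
definition enc_nat :: "nat \<Rightarrow> tree" where "enc_nat = enc_binary"
instance ..
end

instantiation unit :: encodable begin
definition enc_unit :: "unit \<Rightarrow> tree" where "enc_unit _ = Leaf"
instance ..
end

instantiation list :: (encodable) encodable begin
definition enc_list :: "'a list \<Rightarrow> tree" where "enc_list = Defs.enc_list enc"
instance ..
end

instantiation option :: (encodable) encodable begin
definition enc_option :: "'a option \<Rightarrow> tree" where "enc_option = Defs.enc_option enc"
instance ..
end

instantiation prod :: (encodable, encodable) encodable begin
definition enc_prod :: "'a \<times> 'b \<Rightarrow> tree" where "enc_prod p = Node (enc (fst p)) (enc (snd p))"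
instance ..
end

lemma enc_simps [simp]:
  "enc () = Leaf"
  "enc True = Node Leaf Leaf"
  "enc False = Leaf"
  "enc (a, b) = Node (enc a) (enc b)"
  "enc ([] :: 'a::encodable list) = Leaf"
  "enc (x # xs) = Node (enc x) (enc xs)"
  "enc (None :: 'a::encodable option) = Leaf"
  "enc (Some x) = Node (enc x) Leaf"
  by (simp_all add: enc_unit_def enc_bool_def enc_bit_def enc_prod_def enc_list_def Defs.enc_list_def enc_option_def)

text \<open>Passing between a number and its bits thus costs no computation, and arithmetic becomes
  a matter of list functions.\<close>

lemma enc_nat_bits: "enc (n :: nat) = enc (bits n)"
proof -
  have "enc = enc_bit" by (simp add: fun_eq_iff enc_bool_def)
  then show ?thesis by (simp add: enc_nat_def enc_binary_def enc_list_def)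
qed

definition sz :: "'a::encodable \<Rightarrow> nat" where
  "sz x = tree_size (enc x)"

lemma sz_pos [simp]: "0 < sz x"
  by (simp add: sz_def tree_size_pos)

lemma sz_ge_1 [simp]: "Suc 0 \<le> sz x"
  using sz_pos[of x] by linarith

lemma sz_simps [simp]:
  "sz () = 1" "sz True = 3" "sz False = 1"
  "sz (a, b) = 1 + sz a + sz b"
  "sz ([] :: 'a::encodable list) = 1"
  "sz (x # xs) = 1 + sz x + sz xs"
  "sz (None :: 'a::encodable option) = 1"
  "sz (Some x) = 2 + sz x"
  by (simp_all add: sz_def)

section \<open>Functions computed by clean programs\<close>

text \<open>
  A clean program restores all variables other than its argument to \<open>Leaf\<close>, so it can be shifted
  above the variables in use and called repeatedly.
\<close>

definition init :: "tree \<Rightarrow> state" where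
  "init x = (\<lambda>_. Leaf)(0 := x)"

definition computes :: "('a::encodable \<Rightarrow> 'b::encodable) \<Rightarrow> ('a \<Rightarrow> nat) \<Rightarrow> bool" where
  "computes f \<tau> \<longleftrightarrow> (\<exists>P. \<forall>x. \<exists>T\<le>\<tau> x. exec P (init (enc x)) T (init (enc (f x))))"

text \<open>Shifted to variable \<open>d\<close>, a clean program is a subroutine: it asks for its
  argument in \<open>d\<close> and blank variables above, and leaves everything else as
  found.\<close>

lemma computes_at:
  assumes "computes f \<tau>"
  shows "\<exists>P. \<forall>x t. t d = enc x \<longrightarrow> (\<forall>v>d. t v = Leaf) \<longrightarrow> (\<exists>T\<le>\<tau> x. exec P t T (t(d := enc (f x))))"
proof -
  from assms obtain P where P: "\<And>x. \<exists>T\<le>\<tau> x. exec P (init (enc x)) T (init (enc (f x)))"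
    unfolding computes_def by blast
  let ?k = "Suc (com_bound P)"
  have "\<exists>T\<le>\<tau> x. exec (shift_com d P) t T (t(d := enc (f x)))"
    if t: "t d = enc x" "\<forall>v>d. t v = Leaf" for x t
  proof -
    obtain T where T: "T \<le> \<tau> x" "exec P (init (enc x)) T (init (enc (f x)))" using P by blast
    from exec_shift[OF this(2), of ?k d t]
    have "exec (shift_com d P) (embed d ?k (init (enc x)) t) T (embed d ?k (init (enc (f x))) t)" by simp
    moreover have "embed d ?k (init (enc x)) t = t"
      using t by (auto simp: embed_def init_def fun_eq_iff)
    moreover have "embed d ?k (init (enc (f x))) t = t(d := enc (f x))"
      using t by (auto simp: embed_def init_def fun_eq_iff)
    ultimately show ?thesis using T(1) by auto
  qed
  then show ?thesis by blast
qed

lemma computes_mono: "computes f \<sigma> \<Longrightarrow> (\<And>x. \<sigma> x \<le> \<tau> x) \<Longrightarrow> computes f \<tau>"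
  unfolding computes_def by (meson order_trans)

lemma computes_recode:
  assumes "computes g \<tau>" "\<And>x. enc (f x) = enc (g x)"
  shows "computes f \<tau>"
  using assms by (simp add: computes_def)

lemma computes_comp:
  assumes "computes f \<tau>" "computes g \<sigma>"
  shows "computes (\<lambda>x. g (f x)) (\<lambda>x. \<tau> x + \<sigma> (f x))"
proof -
  from assms obtain P Q where P: "\<And>x. \<exists>T\<le>\<tau> x. exec P (init (enc x)) T (init (enc (f x)))"
    and Q: "\<And>x. \<exists>T\<le>\<sigma> x. exec Q (init (enc x)) T (init (enc (g x)))"
    unfolding computes_def by blast
  have "\<exists>T\<le>\<tau> x + \<sigma> (f x). exec (Seq P Q) (init (enc x)) T (init (enc (g (f x))))" for x
  proof -
    obtain T T' where "T \<le> \<tau> x" "exec P (init (enc x)) T (init (enc (f x)))"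
      "T' \<le> \<sigma> (f x)" "exec Q (init (enc (f x))) T' (init (enc (g (f x))))"
      using P Q by meson
    then show ?thesis by (intro exI[of _ "T + T'"]) (auto intro: exec.Seq)
  qed
  then show ?thesis unfolding computes_def by blast
qed

lemma computes_sz:
  assumes "computes f \<tau>"
  shows "sz (f x) \<le> sz x + \<tau> x"
proof -
  from assms obtain P T where "T \<le> \<tau> x" "exec P (init (enc x)) T (init (enc (f x)))"
    unfolding computes_def by blast
  from exec_size[OF this(2), of 0] this(1) show ?thesis by (simp add: init_def sz_def)
qed

lemma computes_expr:
  assumes "\<And>x. eval_expr e (init (enc x)) = enc (f x)"
  shows "computes f (\<lambda>x. expr_cost e (init (enc x)))"
  unfolding computes_def
proof (intro exI[of _ "Assign 0 e"] allI)
  fix x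
  have "(init (enc x))(0 := eval_expr e (init (enc x))) = init (enc (f x))"
    using assms[of x] by (simp add: init_def)
  then show "\<exists>T\<le>expr_cost e (init (enc x)). exec (Assign 0 e) (init (enc x)) T (init (enc (f x)))"
    using exec.Assign[of 0 e "init (enc x)"] by auto
qed

lemma computes_id: "computes (\<lambda>x. x) sz"
  using computes_expr[of "Var 0" "\<lambda>x. x"] by (simp add: init_def sz_def[abs_def])

fun tree_expr :: "tree \<Rightarrow> expr" where
  "tree_expr Leaf = Nil_E"
| "tree_expr (Node a b) = Cons_E (tree_expr a) (tree_expr b)"

lemma eval_tree_expr: "eval_expr (tree_expr t) s = t"
  by (induction t) auto

lemma cost_tree_expr: "expr_cost (tree_expr t) s = expr_cost (tree_expr t) s'"
  by (induction t) (auto simp: eval_tree_expr)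

lemma computes_const: "\<exists>C. computes (\<lambda>x. c) (\<lambda>_. C)"
proof -
  have "computes (\<lambda>x::'a. c) (\<lambda>x. expr_cost (tree_expr (enc c)) (init (enc x)))"
    by (rule computes_expr) (rule eval_tree_expr)
  moreover have "(\<lambda>x::'a. expr_cost (tree_expr (enc c)) (init (enc x))) =
      (\<lambda>_. expr_cost (tree_expr (enc c)) (\<lambda>_. Leaf))"
    by (rule ext) (rule cost_tree_expr)
  ultimately show ?thesis by auto
qed

lemma computes_fst: "computes (fst :: 'a::encodable \<times> 'b::encodable \<Rightarrow> 'a) (\<lambda>x. 2 * sz x)"
proof (rule computes_mono)
  show "computes (fst :: 'a \<times> 'b \<Rightarrow> 'a) (\<lambda>x. expr_cost (Hd (Var 0)) (init (enc x)))"
    by (rule computes_expr) (simp add: init_def enc_prod_def)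
qed (auto simp: init_def enc_prod_def sz_def)

lemma computes_snd: "computes (snd :: 'a::encodable \<times> 'b::encodable \<Rightarrow> 'b) (\<lambda>x. 2 * sz x)"
proof (rule computes_mono)
  show "computes (snd :: 'a \<times> 'b \<Rightarrow> 'b) (\<lambda>x. expr_cost (Tl (Var 0)) (init (enc x)))"
    by (rule computes_expr) (simp add: init_def enc_prod_def)
qed (auto simp: init_def enc_prod_def sz_def)

lemma exec_Seq_le:
  assumes "\<exists>T\<le>A. exec P s T s'" "\<exists>T\<le>B. exec Q s' T s''"
  shows "\<exists>T\<le>A + B. exec (Seq P Q) s T s''"
proof -
  from assms obtain T T' where "T \<le> A" "exec P s T s'" "T' \<le> B" "exec Q s' T' s''" by blast
  then show ?thesis by (intro exI[of _ "T + T'"]) (auto intro: exec.Seq)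
qed

lemma exec_Assign_le:
  "expr_cost e s \<le> A \<Longrightarrow> s' = s(v := eval_expr e s) \<Longrightarrow> \<exists>T\<le>A. exec (Assign v e) s T s'"
  by (intro exI[of _ "expr_cost e s"]) (auto intro: exec.Assign)

lemma computes_Pair:
  fixes f :: "'a::encodable \<Rightarrow> 'b::encodable" and g :: "'a \<Rightarrow> 'c::encodable"
  assumes f: "computes f \<tau>" and g: "computes g \<sigma>"
  shows "computes (\<lambda>x. (f x, g x)) (\<lambda>x. \<tau> x + \<sigma> x + 2 * sz x + 2 * sz (f x) + 2 * sz (g x) + 3)"
proof -
  from computes_at[OF f, of 1] obtain P where P: "\<And>x t. t 1 = enc x \<Longrightarrow> (\<forall>v>1. t v = Leaf) \<Longrightarrow>
    \<exists>T\<le>\<tau> x. exec P t T (t(1 := enc (f x)))" by blast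
  from computes_at[OF g, of 2] obtain Q where Q: "\<And>x t. t 2 = enc x \<Longrightarrow> (\<forall>v>2. t v = Leaf) \<Longrightarrow>
    \<exists>T\<le>\<sigma> x. exec Q t T (t(2 := enc (g x)))" by blast
  let ?R = "Seq (Assign 1 (Var 0)) (Seq P (Seq (Assign 2 (Var 0)) (Seq Q
     (Seq (Assign 0 (Cons_E (Var 1) (Var 2))) (Seq (Assign 1 Nil_E) (Assign 2 Nil_E))))))"
  have "\<exists>T\<le>\<tau> x + \<sigma> x + 2 * sz x + 2 * sz (f x) + 2 * sz (g x) + 3.
      exec ?R (init (enc x)) T (init (enc (f x, g x)))" for x
  proof -
    let ?s0 = "init (enc x)"
    let ?s1 = "?s0(1 := enc x)"
    let ?s2 = "?s1(1 := enc (f x))"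
    let ?s3 = "?s2(2 := enc x)"
    let ?s4 = "?s3(2 := enc (g x))"
    let ?s5 = "?s4(0 := enc (f x, g x))"
    let ?s6 = "?s5(1 := Leaf)"
    let ?s7 = "?s6(2 := Leaf)"
    have 1: "\<exists>T\<le>sz x. exec (Assign 1 (Var 0)) ?s0 T ?s1"
      by (rule exec_Assign_le) (auto simp: init_def sz_def)
    have 2: "\<exists>T\<le>\<tau> x. exec P ?s1 T ?s2" by (rule P) (auto simp: init_def)
    have 3: "\<exists>T\<le>sz x. exec (Assign 2 (Var 0)) ?s2 T ?s3"
      by (rule exec_Assign_le) (auto simp: init_def sz_def)
    have 4: "\<exists>T\<le>\<sigma> x. exec Q ?s3 T ?s4" by (rule Q) (auto simp: init_def)
    have 5: "\<exists>T\<le>2 * sz (f x) + 2 * sz (g x) + 1. exec (Assign 0 (Cons_E (Var 1) (Var 2))) ?s4 T ?s5"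
      by (rule exec_Assign_le) (auto simp: init_def sz_def)
    have 6: "\<exists>T\<le>1. exec (Assign 1 Nil_E) ?s5 T ?s6" by (rule exec_Assign_le) auto
    have 7: "\<exists>T\<le>1. exec (Assign 2 Nil_E) ?s6 T ?s7" by (rule exec_Assign_le) auto
    have eq: "?s7 = init (enc (f x, g x))" by (auto simp: init_def)
    from exec_Seq_le[OF 1 exec_Seq_le[OF 2 exec_Seq_le[OF 3 exec_Seq_le[OF 4 exec_Seq_le[OF 5 exec_Seq_le[OF 6 7]]]]]]
    obtain T where "T \<le> sz x + (\<tau> x + (sz x + (\<sigma> x + (2 * sz (f x) + 2 * sz (g x) + 1 + (1 + 1)))))" "exec ?R ?s0 T ?s7" by blast
    then show ?thesis unfolding eq by (intro exI[of _ T]) auto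
  qed
  then show ?thesis unfolding computes_def by blast
qed

lemma computes_if_enc:
  fixes p :: "'a::encodable \<Rightarrow> 'c::encodable" and f g :: "'a \<Rightarrow> 'b::encodable"
  assumes p: "computes p \<rho>" and f: "computes f \<tau>" and g: "computes g \<sigma>"
  shows "computes (\<lambda>x. if enc (p x) \<noteq> Leaf then f x else g x)
     (\<lambda>x. sz x + \<rho> x + 2 * sz (p x) + 8 + \<tau> x + \<sigma> x)"
proof -
  from computes_at[OF p, of 1] obtain R where R: "\<And>x t. t 1 = enc x \<Longrightarrow> (\<forall>v>1. t v = Leaf) \<Longrightarrow>
    \<exists>T\<le>\<rho> x. exec R t T (t(1 := enc (p x)))" by blast
  from f g obtain P Q where P: "\<And>x. \<exists>T\<le>\<tau> x. exec P (init (enc x)) T (init (enc (f x)))"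
    and Q: "\<And>x. \<exists>T\<le>\<sigma> x. exec Q (init (enc x)) T (init (enc (g x)))"
    unfolding computes_def by blast
  let ?C = "Seq (Assign 1 (Var 0)) (Seq R (If (Var 1) (Seq (Assign 1 Nil_E) P) (Seq (Assign 1 Nil_E) Q)))"
  have "\<exists>T\<le>sz x + \<rho> x + 2 * sz (p x) + 8 + \<tau> x + \<sigma> x.
      exec ?C (init (enc x)) T (init (enc (if enc (p x) \<noteq> Leaf then f x else g x)))" for x
  proof -
    let ?s0 = "init (enc x)"
    let ?s1 = "?s0(1 := enc x)"
    let ?s2 = "?s1(1 := enc (p x))"
    let ?y = "if enc (p x) \<noteq> Leaf then f x else g x"
    have 1: "\<exists>T\<le>sz x. exec (Assign 1 (Var 0)) ?s0 T ?s1"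
      by (rule exec_Assign_le) (auto simp: init_def sz_def)
    have 2: "\<exists>T\<le>\<rho> x. exec R ?s1 T ?s2" by (rule R) (auto simp: init_def)
    have 3: "\<exists>T\<le>1. exec (Assign 1 Nil_E) ?s2 T ?s0"
      by (rule exec_Assign_le) (auto simp: init_def)
    have "\<exists>T\<le>sz (p x) + (1 + (\<tau> x + \<sigma> x)). exec (If (Var 1) (Seq (Assign 1 Nil_E) P) (Seq (Assign 1 Nil_E) Q)) ?s2 T (init (enc ?y))"
    proof (cases "enc (p x) \<noteq> Leaf")
      case True
      from exec_Seq_le[OF 3 P[of x]] obtain T where "T \<le> 1 + \<tau> x" "exec (Seq (Assign 1 Nil_E) P) ?s2 T (init (enc (f x)))" by blast
      with True exec.If_True[of "Var 1" ?s2 "Seq (Assign 1 Nil_E) P" T] show ?thesis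
        by (intro exI[of _ "sz (p x) + T"]) (auto simp: sz_def)
    next
      case False
      from exec_Seq_le[OF 3 Q[of x]] obtain T where "T \<le> 1 + \<sigma> x" "exec (Seq (Assign 1 Nil_E) Q) ?s2 T (init (enc (g x)))" by blast
      with False exec.If_False[of "Var 1" ?s2 "Seq (Assign 1 Nil_E) Q" T] show ?thesis
        by (intro exI[of _ "sz (p x) + T"]) (auto simp: sz_def)
    qed
    from exec_Seq_le[OF 1 exec_Seq_le[OF 2 this]] obtain T where
      "T \<le> sz x + (\<rho> x + (sz (p x) + (1 + (\<tau> x + \<sigma> x))))" "exec ?C ?s0 T (init (enc ?y))" by blast
    then show ?thesis by (intro exI[of _ T]) auto
  qed
  then show ?thesis unfolding computes_def by blast
qed

text \<open>The encodings of a nonempty list and of the pair of its head and tail coincide.\<close>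

lemma computes_case_list:
  fixes xs :: "'a::encodable \<Rightarrow> 'b::encodable list" and g :: "'a \<times> 'b \<times> 'b list \<Rightarrow> 'c::encodable"
  assumes xs: "computes xs \<rho>" and f: "computes f \<tau>" and g: "computes g \<sigma>"
  shows "computes (\<lambda>x. case xs x of [] \<Rightarrow> f x | y # ys \<Rightarrow> g (x, y, ys))
     (\<lambda>x. \<rho> x + 8 * sz x + 5 * sz (xs x) + 8 + \<tau> x + (case xs x of [] \<Rightarrow> 0 | y # ys \<Rightarrow> \<sigma> (x, y, ys)))"
    (is "computes ?h ?t")
proof -
  from computes_Pair[OF computes_id xs] obtain R where R: "\<And>x. \<exists>T\<le>sz x + \<rho> x + 2 * sz x + 2 * sz x + 2 * sz (xs x) + 3.
      exec R (init (enc x)) T (init (enc (x, xs x)))" unfolding computes_def by blast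
  from f g obtain P Q where P: "\<And>x. \<exists>T\<le>\<tau> x. exec P (init (enc x)) T (init (enc (f x)))"
    and Q: "\<And>x. \<exists>T\<le>\<sigma> x. exec Q (init (enc x)) T (init (enc (g x)))"
    unfolding computes_def by blast
  let ?C = "Seq R (If (Tl (Var 0)) Q (Seq (Assign 0 (Hd (Var 0))) P))"
  have "\<exists>T\<le>?t x. exec ?C (init (enc x)) T (init (enc (?h x)))" for x
  proof -
    let ?D = "If (Tl (Var 0)) Q (Seq (Assign 0 (Hd (Var 0))) P)"
    have D: "\<exists>T\<le>3 * sz x + 3 * sz (xs x) + 5 + \<tau> x + (case xs x of [] \<Rightarrow> 0 | y # ys \<Rightarrow> \<sigma> (x, y, ys)). exec ?D (init (enc (x, xs x))) T (init (enc (?h x)))"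
    proof (cases "xs x")
      case Nil
      let ?s = "init (enc (x, xs x))"
      have "\<exists>T\<le>2 + sz x + sz x. exec (Assign 0 (Hd (Var 0))) ?s T (init (enc x))"
        by (rule exec_Assign_le) (auto simp: init_def sz_def Nil)
      from exec_Seq_le[OF this P[of x]] obtain T where
        "T \<le> 2 + sz x + sz x + \<tau> x" "exec (Seq (Assign 0 (Hd (Var 0))) P) ?s T (init (enc (f x)))" by blast
      then show ?thesis
        using exec.If_False[of "Tl (Var 0)" ?s "Seq (Assign 0 (Hd (Var 0))) P" T "init (enc (f x))" Q] Nil
        by (intro exI[of _ "expr_cost (Tl (Var 0)) ?s + T"]) (auto simp: init_def sz_def)
    next
      case (Cons y ys)
      let ?s = "init (enc (x, y, ys))"
      from Q[of "(x, y, ys)"] obtain T where "T \<le> \<sigma> (x, y, ys)" "exec Q ?s T (init (enc (g (x, y, ys))))" by blast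
      then show ?thesis
        using exec.If_True[of "Tl (Var 0)" ?s Q T "init (enc (g (x, y, ys)))" "Seq (Assign 0 (Hd (Var 0))) P"] Cons
        by (intro exI[of _ "expr_cost (Tl (Var 0)) ?s + T"]) (auto simp: init_def sz_def)
    qed
    from exec_Seq_le[OF R[of x] D] obtain T where
      "T \<le> sz x + \<rho> x + 2 * sz x + 2 * sz x + 2 * sz (xs x) + 3 + (3 * sz x + 3 * sz (xs x) + 5 + \<tau> x + (case xs x of [] \<Rightarrow> 0 | y # ys \<Rightarrow> \<sigma> (x, y, ys)))"
      "exec ?C (init (enc x)) T (init (enc (?h x)))" by blast
    then show ?thesis by (intro exI[of _ T]) auto
  qed
  then show ?thesis unfolding computes_def by blast
qed


text \<open>Variable 0 keeps the parameter, 1 the rest of the list, 2 the accumulator, 3 the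
  argument and the result of the loop body. \<open>S\<close> and \<open>B\<close> bound cost and
  accumulator only along the actual run, that is, for prefixes \<open>us\<close> of the
  list.\<close>

lemma while_fold:
  fixes f :: "('a::encodable \<times> 'b::encodable) \<times> 'c::encodable \<Rightarrow> 'c"
  assumes R: "\<And>z t. t 3 = enc z \<Longrightarrow> (\<forall>v>3. t v = Leaf) \<Longrightarrow> \<exists>T\<le>\<sigma> z. exec R t T (t(3 := enc (f z)))"
    and S: "\<And>us y vs. ys = us @ y # vs \<Longrightarrow> \<sigma> ((x, y), fold (\<lambda>y a. f ((x, y), a)) us a) \<le> S"
    and B: "\<And>us vs. ys = us @ vs \<Longrightarrow> sz (fold (\<lambda>y a. f ((x, y), a)) us a) \<le> B"
    and n: "sz ys \<le> n"
    and t: "t 0 = enc x" "t 1 = enc ys" "t 2 = enc a" "\<forall>v>2. t v = Leaf"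
  shows "\<exists>T\<le>length ys * (S + 3 * sz x + 9 * n + 5 * B + 5) + 1.
    exec (While (Var 1) (Seq (Assign 3 (Cons_E (Cons_E (Var 0) (Hd (Var 1))) (Var 2)))
       (Seq R (Seq (Assign 2 (Var 3)) (Seq (Assign 3 Nil_E) (Assign 1 (Tl (Var 1)))))))) t T
      (t(1 := Leaf, 2 := enc (fold (\<lambda>y a. f ((x, y), a)) ys a)))"
  using S B n t
proof (induction ys arbitrary: t a)
  case Nil
  let ?W = "While (Var 1) (Seq (Assign 3 (Cons_E (Cons_E (Var 0) (Hd (Var 1))) (Var 2)))
       (Seq R (Seq (Assign 2 (Var 3)) (Seq (Assign 3 Nil_E) (Assign 1 (Tl (Var 1)))))))"
  have "exec ?W t (expr_cost (Var 1) t) t" by (rule exec.While_False) (use Nil in auto)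
  moreover have "t(1 := Leaf, 2 := enc a) = t" using Nil by auto
  moreover have "expr_cost (Var 1) t = 1" using Nil by simp
  ultimately have "exec ?W t 1 (t(1 := Leaf, 2 := enc a))" by simp
  then show ?case by (intro exI[of _ 1]) (simp del: fun_upd_apply)
next
  case (Cons y ys)
  let ?body = "Seq (Assign 3 (Cons_E (Cons_E (Var 0) (Hd (Var 1))) (Var 2)))
       (Seq R (Seq (Assign 2 (Var 3)) (Seq (Assign 3 Nil_E) (Assign 1 (Tl (Var 1))))))"
  let ?W = "While (Var 1) ?body"
  let ?a = "f ((x, y), a)"
  let ?t1 = "t(3 := enc ((x, y), a))"
  let ?t2 = "?t1(3 := enc ?a)"
  let ?t3 = "?t2(2 := enc ?a)"
  let ?t4 = "?t3(3 := Leaf)"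
  let ?t5 = "?t4(1 := enc ys)"
  have a: "sz a \<le> B" using Cons.prems(2)[of "[]"] by simp
  have fa: "sz ?a \<le> B" using Cons.prems(2)[of "[y]" ys] by simp
  have s: "\<sigma> ((x, y), a) \<le> S" using Cons.prems(1)[of "[]"] by simp
  have n: "1 + sz y + sz ys \<le> n" using Cons.prems(3) by simp
  have 1: "\<exists>T\<le>3 * sz x + 4 * n + 2 * B + 2. exec (Assign 3 (Cons_E (Cons_E (Var 0) (Hd (Var 1))) (Var 2))) t T ?t1"
    by (rule exec_Assign_le) (use Cons.prems a n in \<open>auto simp: sz_def\<close>)
  have 2: "\<exists>T\<le>\<sigma> ((x, y), a). exec R ?t1 T ?t2" by (rule R) (use Cons.prems in auto)
  have 3: "\<exists>T\<le>B. exec (Assign 2 (Var 3)) ?t2 T ?t3"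
    by (rule exec_Assign_le) (use fa in \<open>auto simp: sz_def\<close>)
  have 4: "\<exists>T\<le>1. exec (Assign 3 Nil_E) ?t3 T ?t4"
    by (rule exec_Assign_le) auto
  have 5: "\<exists>T\<le>2 * n. exec (Assign 1 (Tl (Var 1))) ?t4 T ?t5"
    by (rule exec_Assign_le) (use Cons.prems n in \<open>auto simp: sz_def\<close>)
  from exec_Seq_le[OF 1 exec_Seq_le[OF 2 exec_Seq_le[OF 3 exec_Seq_le[OF 4 5]]]]
  obtain T1 where T1: "T1 \<le> 3 * sz x + 4 * n + 2 * B + 2 + (\<sigma> ((x, y), a) + (B + (1 + 2 * n)))"
    "exec ?body t T1 ?t5" by blast
  have "\<exists>T\<le>length ys * (S + 3 * sz x + 9 * n + 5 * B + 5) + 1. exec ?W ?t5 T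
      (?t5(1 := Leaf, 2 := enc (fold (\<lambda>y a. f ((x, y), a)) ys ?a)))"
  proof (rule Cons.IH)
    fix us y' vs assume "ys = us @ y' # vs"
    then show "\<sigma> ((x, y'), fold (\<lambda>y a. f ((x, y), a)) us ?a) \<le> S"
      using Cons.prems(1)[of "y # us" y' vs] by simp
  next
    fix us vs assume "ys = us @ vs"
    then show "sz (fold (\<lambda>y a. f ((x, y), a)) us ?a) \<le> B"
      using Cons.prems(2)[of "y # us" vs] by simp
  qed (use Cons.prems n in auto)
  then obtain T2 where T2: "T2 \<le> length ys * (S + 3 * sz x + 9 * n + 5 * B + 5) + 1"
    "exec ?W ?t5 T2 (?t5(1 := Leaf, 2 := enc (fold (\<lambda>y a. f ((x, y), a)) ys ?a)))" by blast
  have "exec ?W t (expr_cost (Var 1) t + T1 + T2) (?t5(1 := Leaf, 2 := enc (fold (\<lambda>y a. f ((x, y), a)) ys ?a)))"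
    by (rule exec.While_True[OF _ T1(2) T2(2)]) (use Cons.prems in auto)
  moreover have "?t5(1 := Leaf, 2 := enc (fold (\<lambda>y a. f ((x, y), a)) ys ?a)) =
      t(1 := Leaf, 2 := enc (fold (\<lambda>y a. f ((x, y), a)) (y # ys) a))"
    using Cons.prems by (auto simp: fun_eq_iff)
  ultimately have "exec ?W t (expr_cost (Var 1) t + T1 + T2) (t(1 := Leaf, 2 := enc (fold (\<lambda>y a. f ((x, y), a)) (y # ys) a)))"
    by metis
  moreover have "expr_cost (Var 1) t \<le> n" using Cons.prems by (simp add: sz_def)
  then have "expr_cost (Var 1) t + T1 + T2 \<le> length (y # ys) * (S + 3 * sz x + 9 * n + 5 * B + 5) + 1"
    using T1(1) T2(1) s by (simp add: algebra_simps)
  ultimately show ?case by blast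
qed

lemma length_le_sz: "length xs \<le> sz xs"
  by (induction xs) auto

text \<open>Since bounds are demanded only for accumulators that really occur, an invariant of the
  particular loop can keep them small even if the body could enlarge arbitrary arguments
  quickly.\<close>

lemma computes_fold:
  fixes f :: "('a::encodable \<times> 'b::encodable) \<times> 'c::encodable \<Rightarrow> 'c"
  assumes f: "computes f \<sigma>" and g: "computes (\<lambda>x. (x, ys x, a x)) \<rho>"
    and S: "\<And>x us y vs. ys x = us @ y # vs \<Longrightarrow> \<sigma> ((x, y), fold (\<lambda>y a. f ((x, y), a)) us (a x)) \<le> S x"
    and B: "\<And>x us vs. ys x = us @ vs \<Longrightarrow> sz (fold (\<lambda>y a. f ((x, y), a)) us (a x)) \<le> B x"
  shows "computes (\<lambda>x. fold (\<lambda>y a. f ((x, y), a)) (ys x) (a x))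
     (\<lambda>x. \<rho> x + sz (ys x) * (S x + 3 * sz x + 9 * sz (ys x) + 5 * B x + 5) + 8 * sz (x, ys x, a x) + B x + 2)"
    (is "computes ?h ?t")
proof -
  from computes_at[OF f, of 3] obtain R where R: "\<And>z t. t 3 = enc z \<Longrightarrow> (\<forall>v>3. t v = Leaf) \<Longrightarrow>
    \<exists>T\<le>\<sigma> z. exec R t T (t(3 := enc (f z)))" by blast
  from g obtain G where G: "\<And>x. \<exists>T\<le>\<rho> x. exec G (init (enc x)) T (init (enc (x, ys x, a x)))"
    unfolding computes_def by blast
  let ?W = "While (Var 1) (Seq (Assign 3 (Cons_E (Cons_E (Var 0) (Hd (Var 1))) (Var 2)))
       (Seq R (Seq (Assign 2 (Var 3)) (Seq (Assign 3 Nil_E) (Assign 1 (Tl (Var 1)))))))"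
  let ?C = "Seq G (Seq (Assign 1 (Hd (Tl (Var 0)))) (Seq (Assign 2 (Tl (Tl (Var 0)))) (Seq (Assign 0 (Hd (Var 0)))
     (Seq ?W (Seq (Assign 0 (Var 2)) (Assign 2 Nil_E))))))"
  have "\<exists>T\<le>?t x. exec ?C (init (enc x)) T (init (enc (?h x)))" for x
  proof -
    let ?z = "(x, ys x, a x)"
    let ?s0 = "init (enc ?z)"
    let ?s1 = "?s0(1 := enc (ys x))"
    let ?s2 = "?s1(2 := enc (a x))"
    let ?s3 = "?s2(0 := enc x)"
    let ?r = "fold (\<lambda>y a. f ((x, y), a)) (ys x) (a x)"
    let ?s4 = "?s3(1 := Leaf, 2 := enc ?r)"
    let ?s5 = "?s4(0 := enc ?r)"
    let ?s6 = "?s5(2 := Leaf)"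
    let ?n = "length (ys x) * (S x + 3 * sz x + 9 * sz (ys x) + 5 * B x + 5)"
    have 1: "\<exists>T\<le>3 * sz ?z. exec (Assign 1 (Hd (Tl (Var 0)))) ?s0 T ?s1"
      by (rule exec_Assign_le) (auto simp: init_def sz_def)
    have 2: "\<exists>T\<le>3 * sz ?z. exec (Assign 2 (Tl (Tl (Var 0)))) ?s1 T ?s2"
      by (rule exec_Assign_le) (auto simp: init_def sz_def)
    have 3: "\<exists>T\<le>2 * sz ?z. exec (Assign 0 (Hd (Var 0))) ?s2 T ?s3"
      by (rule exec_Assign_le) (auto simp: init_def sz_def)
    have 4: "\<exists>T\<le>?n + 1. exec ?W ?s3 T ?s4"
    proof (rule while_fold[OF R])
      fix us y vs assume "ys x = us @ y # vs"
      then show "\<sigma> ((x, y), fold (\<lambda>y a. f ((x, y), a)) us (a x)) \<le> S x" using S by blast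
    next
      fix us vs assume "ys x = us @ vs"
      then show "sz (fold (\<lambda>y a. f ((x, y), a)) us (a x)) \<le> B x" using B by blast
    qed (auto simp: init_def)
    have r: "sz ?r \<le> B x" using B[of x "ys x" "[]"] by simp
    have 5: "\<exists>T\<le>B x. exec (Assign 0 (Var 2)) ?s4 T ?s5"
      by (rule exec_Assign_le) (use r in \<open>auto simp: init_def sz_def\<close>)
    have 6: "\<exists>T\<le>1. exec (Assign 2 Nil_E) ?s5 T ?s6"
      by (rule exec_Assign_le) auto
    have eq: "?s6 = init (enc (?h x))" by (auto simp: init_def)
    have l: "?n \<le> sz (ys x) * (S x + 3 * sz x + 9 * sz (ys x) + 5 * B x + 5)"
      using length_le_sz[of "ys x"] by (rule mult_le_mono1)
    from exec_Seq_le[OF G exec_Seq_le[OF 1 exec_Seq_le[OF 2 exec_Seq_le[OF 3 exec_Seq_le[OF 4 exec_Seq_le[OF 5 6]]]]]]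
    obtain T where T: "T \<le> \<rho> x + (3 * sz ?z + (3 * sz ?z + (2 * sz ?z + (?n + 1 + (B x + 1)))))"
      "exec ?C (init (enc x)) T ?s6" by blast
    have "T \<le> ?t x" using T(1) l by linarith
    then show ?thesis using T(2) unfolding eq by blast
  qed
  then show ?thesis unfolding computes_def by auto
qed

section \<open>Polynomial bounds and polynomial time\<close>

text \<open>A single monomial can serve as normal form because sizes are positive: adding the
  exponents dominates a sum.\<close>

definition poly_bounded :: "('a::encodable \<Rightarrow> nat) \<Rightarrow> bool" where
  "poly_bounded g \<longleftrightarrow> (\<exists>C q. \<forall>x. g x \<le> C * sz x ^ q)"

lemma poly_bounded_mono: "poly_bounded h \<Longrightarrow> (\<And>x. g x \<le> h x) \<Longrightarrow> poly_bounded g"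
  unfolding poly_bounded_def by (meson order_trans)

lemma poly_bounded_const [intro, simp]: "poly_bounded (\<lambda>_. c)"
  unfolding poly_bounded_def by (rule exI[of _ c], rule exI[of _ 0]) simp

lemma poly_bounded_sz [intro, simp]: "poly_bounded sz"
  unfolding poly_bounded_def by (rule exI[of _ 1], rule exI[of _ 1]) simp

lemma poly_bounded_add [intro]:
  assumes "poly_bounded g" "poly_bounded h"
  shows "poly_bounded (\<lambda>x. g x + h x)"
proof -
  from assms obtain C q D r where 1: "\<And>x. g x \<le> C * sz x ^ q" and 2: "\<And>x. h x \<le> D * sz x ^ r"
    unfolding poly_bounded_def by blast
  have "g x + h x \<le> (C + D) * sz x ^ (q + r)" for x
  proof -
    have "sz x ^ q \<le> sz x ^ (q + r)" "sz x ^ r \<le> sz x ^ (q + r)"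
      by (auto intro!: power_increasing)
    then have "C * sz x ^ q \<le> C * sz x ^ (q + r)" "D * sz x ^ r \<le> D * sz x ^ (q + r)"
      by (auto simp del: mult_le_cancel1 intro: mult_le_mono2)
    with 1[of x] 2[of x] show ?thesis unfolding add_mult_distrib by linarith
  qed
  then show ?thesis unfolding poly_bounded_def by blast
qed

lemma poly_bounded_mult [intro]:
  assumes "poly_bounded g" "poly_bounded h"
  shows "poly_bounded (\<lambda>x. g x * h x)"
proof -
  from assms obtain C q D r where 1: "\<And>x. g x \<le> C * sz x ^ q" and 2: "\<And>x. h x \<le> D * sz x ^ r"
    unfolding poly_bounded_def by blast
  have "g x * h x \<le> (C * D) * sz x ^ (q + r)" for x
    using mult_le_mono[OF 1[of x] 2[of x]] by (simp add: power_add algebra_simps)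
  then show ?thesis unfolding poly_bounded_def by blast
qed

lemma poly_bounded_power [intro]: "poly_bounded g \<Longrightarrow> poly_bounded (\<lambda>x. g x ^ n)"
  by (induction n) auto

lemma poly_bounded_comp:
  assumes "poly_bounded g" "poly_bounded (\<lambda>x. sz (f x))"
  shows "poly_bounded (\<lambda>x. g (f x))"
proof -
  from assms(1) obtain C q where 1: "\<And>x. g x \<le> C * sz x ^ q" unfolding poly_bounded_def by blast
  have "poly_bounded (\<lambda>x. C * sz (f x) ^ q)" using assms(2) by auto
  then show ?thesis by (rule poly_bounded_mono) (rule 1)
qed

definition ptime :: "('a::encodable \<Rightarrow> 'b::encodable) \<Rightarrow> bool" where
  "ptime f \<longleftrightarrow> (\<exists>\<tau>. computes f \<tau> \<and> poly_bounded \<tau>)"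

lemma ptimeI: "computes f \<tau> \<Longrightarrow> poly_bounded \<tau> \<Longrightarrow> ptime f"
  unfolding ptime_def by blast

lemma poly_bounded_ptime [intro]: "ptime f \<Longrightarrow> poly_bounded (\<lambda>x. sz (f x))"
  unfolding ptime_def
  by (metis (no_types, lifting) computes_sz poly_bounded_add poly_bounded_mono poly_bounded_sz)

named_theorems ptime_intros

lemma poly_bounded_Suc: "poly_bounded g \<Longrightarrow> poly_bounded (\<lambda>x. Suc (g x))"
  using poly_bounded_add[OF poly_bounded_const[of 1]] by simp

lemmas poly_bounded_intros = poly_bounded_Suc poly_bounded_add poly_bounded_mult poly_bounded_power poly_bounded_const
  poly_bounded_sz poly_bounded_ptime

lemma ptime_id [ptime_intros]: "ptime (\<lambda>x. x)"
  using computes_id poly_bounded_sz by (rule ptimeI)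

lemma ptime_const [ptime_intros]: "ptime (\<lambda>_. c)"
  using computes_const poly_bounded_const by (blast intro: ptimeI)

lemma ptime_comp:
  assumes "ptime g" "ptime f"
  shows "ptime (\<lambda>x. g (f x))"
proof -
  from assms obtain \<tau> \<sigma> where "computes f \<tau>" "poly_bounded \<tau>" "computes g \<sigma>" "poly_bounded \<sigma>"
    unfolding ptime_def by blast
  moreover from this have "poly_bounded (\<lambda>x. \<sigma> (f x))" using assms by (auto intro: poly_bounded_comp)
  ultimately show ?thesis by (intro ptimeI[OF computes_comp] poly_bounded_add)
qed

lemma ptime_fst [ptime_intros]: "ptime f \<Longrightarrow> ptime (\<lambda>x. fst (f x))"
  by (rule ptime_comp[of fst]) (auto intro!: ptimeI computes_fst)

lemma ptime_snd [ptime_intros]: "ptime f \<Longrightarrow> ptime (\<lambda>x. snd (f x))"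
  by (rule ptime_comp[of snd]) (auto intro!: ptimeI computes_snd)

lemma ptime_Pair [ptime_intros]:
  assumes "ptime f" "ptime g"
  shows "ptime (\<lambda>x. (f x, g x))"
proof -
  from assms obtain \<tau> \<sigma> where *: "computes f \<tau>" "poly_bounded \<tau>" "computes g \<sigma>" "poly_bounded \<sigma>"
    unfolding ptime_def by blast
  show ?thesis
    by (rule ptimeI[OF computes_Pair[OF *(1,3)]]) (intro poly_bounded_intros * assms)
qed

lemma ptime_recode:
  assumes "ptime g" "\<And>x. enc (f x) = enc (g x)"
  shows "ptime f"
  using assms unfolding ptime_def by (blast intro: computes_recode)

lemma ptime_case_prod [ptime_intros]:
  "ptime (\<lambda>x. g x (fst (h x)) (snd (h x))) \<Longrightarrow> ptime (\<lambda>x. case h x of (a, b) \<Rightarrow> g x a b)"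
  by (simp add: case_prod_unfold)

text \<open>A function with free variables is treated as a function of the pair of context and bound
  variable. The same convention explains the hypotheses on \<open>f (fst p) (snd p)\<close> in the
  rules for higher-order list functions.\<close>

lemma ptime_Let [ptime_intros]:
  assumes "ptime (\<lambda>p. f (fst p) (snd p))" "ptime g"
  shows "ptime (\<lambda>x. let y = g x in f x y)"
  using ptime_comp[OF assms(1) ptime_Pair[OF ptime_id assms(2)]] by simp

lemma ptime_if_enc:
  fixes p :: "'a::encodable \<Rightarrow> 'c::encodable"
  assumes "ptime p" "ptime f" "ptime g"
  shows "ptime (\<lambda>x. if enc (p x) \<noteq> Leaf then f x else g x)"
proof -
  from assms obtain \<rho> \<tau> \<sigma> where *: "computes p \<rho>" "poly_bounded \<rho>" "computes f \<tau>" "poly_bounded \<tau>"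
    "computes g \<sigma>" "poly_bounded \<sigma>"
    unfolding ptime_def by blast
  show ?thesis
    by (rule ptimeI[OF computes_if_enc[OF *(1,3,5)]]) (intro poly_bounded_intros * assms)
qed

lemma ptime_If [ptime_intros]:
  assumes "ptime p" "ptime f" "ptime g"
  shows "ptime (\<lambda>x. if p x then f x else g x)"
proof -
  have "(enc (p x) \<noteq> Leaf) = p x" for x by (cases "p x") auto
  with ptime_if_enc[OF assms] show ?thesis by simp
qed

lemma ptime_Cons [ptime_intros]: "ptime f \<Longrightarrow> ptime g \<Longrightarrow> ptime (\<lambda>x. f x # g x)"
  by (rule ptime_recode[OF ptime_Pair]) auto

lemma ptime_Some [ptime_intros]: "ptime f \<Longrightarrow> ptime (\<lambda>x. Some (f x))"
  by (rule ptime_recode[OF ptime_Pair[OF _ ptime_const[of "()"]]]) auto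

lemma ptime_case_list [ptime_intros]:
  assumes xs: "ptime xs" and f: "ptime f" and g: "ptime (\<lambda>p. g (fst p) (fst (snd p)) (snd (snd p)))"
  shows "ptime (\<lambda>x. case xs x of [] \<Rightarrow> f x | y # ys \<Rightarrow> g x y ys)"
proof -
  from assms obtain \<rho> \<tau> \<sigma> where *: "computes xs \<rho>" "poly_bounded \<rho>" "computes f \<tau>" "poly_bounded \<tau>"
    "computes (\<lambda>p. g (fst p) (fst (snd p)) (snd (snd p))) \<sigma>" "poly_bounded \<sigma>"
    unfolding ptime_def by blast
  from \<open>poly_bounded \<sigma>\<close> obtain C q where \<sigma>: "\<And>x. \<sigma> x \<le> C * sz x ^ q" unfolding poly_bounded_def by blast
  have "(case xs x of [] \<Rightarrow> 0 | y # ys \<Rightarrow> \<sigma> (x, y, ys)) \<le> C * (sz x + sz (xs x) + 1) ^ q" for x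
    using \<sigma> by (auto split: list.split intro!: order_trans[OF \<sigma>] mult_left_mono power_mono)
  moreover have "poly_bounded (\<lambda>x. C * (sz x + sz (xs x) + 1) ^ q)"
    by (intro poly_bounded_intros xs)
  ultimately have **: "poly_bounded (\<lambda>x. case xs x of [] \<Rightarrow> 0 | y # ys \<Rightarrow> \<sigma> (x, y, ys))"
    by (blast intro: poly_bounded_mono)
  have "ptime (\<lambda>x. case xs x of [] \<Rightarrow> f x | y # ys \<Rightarrow>
      (\<lambda>p. g (fst p) (fst (snd p)) (snd (snd p))) (x, y, ys))"
    by (rule ptimeI[OF computes_case_list[OF *(1,3,5)]]) (intro poly_bounded_intros * ** assms)
  then show ?thesis unfolding fst_conv snd_conv .
qed

text \<open>A polynomial-time body alone does not make a polynomial-time loop, since repeated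
  doubling is exponential. The separate bound \<open>B\<close> on all intermediate accumulators
  excludes this.\<close>

lemma ptime_fold:
  fixes f :: "'x::encodable \<Rightarrow> 'b::encodable \<Rightarrow> 'c::encodable \<Rightarrow> 'c"
  assumes f: "ptime (\<lambda>p. f (fst (fst p)) (snd (fst p)) (snd p))" and xs: "ptime xs" and a: "ptime a"
    and B: "poly_bounded B"
    and le: "\<And>x us vs. xs x = us @ vs \<Longrightarrow> sz (fold (f x) us (a x)) \<le> B x"
  shows "ptime (\<lambda>x. fold (f x) (xs x) (a x))"
proof -
  let ?f = "\<lambda>p. f (fst (fst p)) (snd (fst p)) (snd p)"
  from f obtain \<sigma> where \<sigma>: "computes ?f \<sigma>" "poly_bounded \<sigma>" unfolding ptime_def by blast
  from ptime_Pair[OF ptime_id ptime_Pair[OF xs a]] obtain \<rho>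
    where \<rho>: "computes (\<lambda>x. (x, xs x, a x)) \<rho>" "poly_bounded \<rho>" unfolding ptime_def by blast
  from \<sigma>(2) obtain C q where C: "\<And>z. \<sigma> z \<le> C * sz z ^ q" unfolding poly_bounded_def by blast
  define S where "S x = C * (sz x + sz (xs x) + B x + 2) ^ q" for x
  have S: "\<sigma> ((x, y), fold (f x) us (a x)) \<le> S x" if "xs x = us @ y # vs" for x us y vs
  proof -
    have "sz y \<le> sz (us @ y # vs)" by (induction us) auto
    then have "sz ((x, y), fold (f x) us (a x)) \<le> sz x + sz (xs x) + B x + 2"
      using le[of x us "y # vs"] that by simp
    then show ?thesis unfolding S_def by (meson C order_trans mult_le_mono2 power_mono zero_le)
  qed
  have "poly_bounded S" unfolding S_def using xs B
    by (intro poly_bounded_intros)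
  moreover have "poly_bounded (\<lambda>x. sz (x, xs x, a x))"
    by (intro poly_bounded_ptime ptime_Pair ptime_id xs a)
  moreover have "poly_bounded (\<lambda>x. sz (xs x))" using xs by (rule poly_bounded_ptime)
  ultimately have "poly_bounded (\<lambda>x. \<rho> x + sz (xs x) * (S x + 3 * sz x + 9 * sz (xs x) + 5 * B x + 5) + 8 * sz (x, xs x, a x) + B x + 2)"
    by (intro poly_bounded_intros \<rho> B xs ptime_Pair ptime_id a)
  moreover have "computes (\<lambda>x. fold (f x) (xs x) (a x))
    (\<lambda>x. \<rho> x + sz (xs x) * (S x + 3 * sz x + 9 * sz (xs x) + 5 * B x + 5) + 8 * sz (x, xs x, a x) + B x + 2)"
    using computes_fold[OF \<sigma>(1) \<rho>(1), of S B] S le by simp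
  ultimately show ?thesis by (blast intro: ptimeI)
qed

section \<open>Polynomial-time list functions\<close>

lemma sz_append: "sz (xs @ ys) + 1 = sz xs + sz ys"
  by (induction xs) auto

lemma sz_append_le: "sz (xs @ ys) \<le> sz xs + sz ys"
  using sz_append[of xs ys] by simp

lemma sz_rev [simp]: "sz (rev xs) = sz xs"
proof (induction xs)
  case (Cons x xs)
  then show ?case using sz_append[of "rev xs" "[x]"] by simp
qed simp

lemma sz_member: "x \<in> set xs \<Longrightarrow> sz x < sz xs"
  by (induction xs) auto

lemma sz_list_le:
  assumes "\<And>x. x \<in> set xs \<Longrightarrow> sz x \<le> b"
  shows "sz xs \<le> length xs * (b + 1) + 1"
  using assms
proof (induction xs)
  case (Cons x xs)
  then have "sz x \<le> b" "sz xs \<le> length xs * (b + 1) + 1" by simp_all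
  then show ?case by simp
qed simp

text \<open>The benign kind of loop: each round adds an amount that does not depend on the
  accumulator, so sizes grow linearly in the number of rounds.\<close>

lemma ptime_fold_growth:
  fixes f :: "'x::encodable \<Rightarrow> 'b::encodable \<Rightarrow> 'c::encodable \<Rightarrow> 'c"
  assumes f: "ptime (\<lambda>p. f (fst (fst p)) (snd (fst p)) (snd p))" and xs: "ptime xs" and a: "ptime a"
    and G: "poly_bounded G"
    and le: "\<And>x y c. y \<in> set (xs x) \<Longrightarrow> sz (f x y c) \<le> sz c + G x"
  shows "ptime (\<lambda>x. fold (f x) (xs x) (a x))"
proof (rule ptime_fold[OF f xs a, of "\<lambda>x. sz (a x) + sz (xs x) * G x"])
  show "poly_bounded (\<lambda>x. sz (a x) + sz (xs x) * G x)" by (intro poly_bounded_intros a xs G)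
  fix x us vs assume "xs x = us @ vs"
  then have us: "set us \<subseteq> set (xs x)" "length us \<le> sz (xs x)"
    using length_le_sz[of "xs x"] by auto
  have "sz (fold (f x) us c) \<le> sz c + length us * G x" for c
    using us(1)
  proof (induction us arbitrary: c)
    case (Cons y us)
    then have "sz (fold (f x) us (f x y c)) \<le> sz (f x y c) + length us * G x" "y \<in> set (xs x)" by auto
    with le[of y x c] show ?case by simp
  qed simp
  also have "sz (a x) + length us * G x \<le> sz (a x) + sz (xs x) * G x"
    using us(2) by (intro add_left_mono mult_le_mono1)
  finally show "sz (fold (f x) us (a x)) \<le> sz (a x) + sz (xs x) * G x" .
qed

lemma ptime_rev [ptime_intros]: "ptime xs \<Longrightarrow> ptime (\<lambda>x. rev (xs x))"
proof -
  assume xs: "ptime xs"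
  have "ptime (\<lambda>x. fold (\<lambda>y a. y # a) (xs x) [])"
    by (rule ptime_fold_growth[where f = "\<lambda>x y a. y # a" and G = "\<lambda>x. sz (xs x)"])
      (auto intro!: ptime_intros xs dest: sz_member)
  moreover have "fold (\<lambda>y a. y # a) ys zs = rev ys @ zs" for ys zs :: "'b list"
    by (induction ys arbitrary: zs) auto
  ultimately show ?thesis by simp
qed

lemma ptime_append [ptime_intros]:
  assumes xs: "ptime xs" and ys: "ptime ys"
  shows "ptime (\<lambda>x. xs x @ ys x)"
proof -
  have "ptime (\<lambda>x. fold (\<lambda>y a. y # a) (rev (xs x)) (ys x))"
    by (rule ptime_fold_growth[where f = "\<lambda>x y a. y # a" and G = "\<lambda>x. sz (xs x)"])
      (auto intro!: ptime_intros xs ys dest: sz_member)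
  moreover have "fold (\<lambda>y a. y # a) ys zs = rev ys @ zs" for ys zs :: "'b list"
    by (induction ys arbitrary: zs) auto
  ultimately show ?thesis by simp
qed

text \<open>Turns a bound in the size of a pair into one in the context alone, as the elements of a
  list are smaller than the list.\<close>

lemma poly_bounded_member:
  fixes f :: "'x::encodable \<Rightarrow> 'b::encodable \<Rightarrow> 'c::encodable"
  assumes f: "ptime (\<lambda>p. f (fst p) (snd p))" and xs: "ptime xs"
  shows "\<exists>G. poly_bounded G \<and> (\<forall>x. \<forall>y\<in>set (xs x). sz (f x y) \<le> G x)"
proof -
  from poly_bounded_ptime[OF f] obtain C q where C: "\<And>p. sz (f (fst p) (snd p)) \<le> C * sz p ^ q"
    unfolding poly_bounded_def by blast
  have "sz (f x y) \<le> C * (sz x + sz (xs x) + 1) ^ q" if "y \<in> set (xs x)" for x y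
  proof -
    have "sz (x, y) \<le> sz x + sz (xs x) + 1" using sz_member[OF that] by simp
    then have "C * sz (x, y) ^ q \<le> C * (sz x + sz (xs x) + 1) ^ q"
      by (intro mult_le_mono2 power_mono) auto
    from order_trans[OF C[of "(x, y)"] this] show ?thesis by simp
  qed
  moreover have "poly_bounded (\<lambda>x. C * (sz x + sz (xs x) + 1) ^ q)" by (intro poly_bounded_intros xs)
  ultimately show ?thesis by blast
qed

lemma ptime_map [ptime_intros]:
  fixes f :: "'x::encodable \<Rightarrow> 'b::encodable \<Rightarrow> 'c::encodable"
  assumes f: "ptime (\<lambda>p. f (fst p) (snd p))" and xs: "ptime xs"
  shows "ptime (\<lambda>x. map (f x) (xs x))"
proof -
  from poly_bounded_member[OF f xs] obtain G where G: "poly_bounded G"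
    "\<And>x y. y \<in> set (xs x) \<Longrightarrow> sz (f x y) \<le> G x" by blast
  have "ptime (\<lambda>x. rev (fold (\<lambda>y a. f x y # a) (xs x) []))"
  proof (rule ptime_rev, rule ptime_fold_growth[where f = "\<lambda>x y a. f x y # a" and G = "\<lambda>x. G x + 1"])
    show "ptime (\<lambda>p. f (fst (fst p)) (snd (fst p)) # snd p)"
      using ptime_comp[OF f ptime_fst[OF ptime_id]] by (intro ptime_intros) auto
  qed (auto intro!: ptime_intros poly_bounded_intros xs G)
  moreover have "fold (\<lambda>y a. g y # a) ys zs = rev (map g ys) @ zs" for ys zs and g :: "'b \<Rightarrow> 'c"
    by (induction ys arbitrary: zs) auto
  ultimately show ?thesis by simp
qed

lemma ptime_filter [ptime_intros]:
  fixes f :: "'x::encodable \<Rightarrow> 'b::encodable \<Rightarrow> bool"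
  assumes f: "ptime (\<lambda>p. f (fst p) (snd p))" and xs: "ptime xs"
  shows "ptime (\<lambda>x. filter (f x) (xs x))"
proof -
  have "ptime (\<lambda>x. rev (fold (\<lambda>y a. if f x y then y # a else a) (xs x) []))"
  proof (rule ptime_rev, rule ptime_fold_growth[where f = "\<lambda>x y a. if f x y then y # a else a" and G = "\<lambda>x. sz (xs x)"])
    show "ptime (\<lambda>p. if f (fst (fst p)) (snd (fst p)) then snd (fst p) # snd p else snd p)"
      using ptime_comp[OF f ptime_fst[OF ptime_id]] by (intro ptime_intros) auto
  qed (auto intro!: ptime_intros poly_bounded_intros xs dest: sz_member)
  moreover have "fold (\<lambda>y a. if g y then y # a else a) ys zs = rev (filter g ys) @ zs" for ys zs and g :: "'b \<Rightarrow> bool"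
    by (induction ys arbitrary: zs) auto
  ultimately show ?thesis by simp
qed

lemma ptime_concat [ptime_intros]:
  assumes xs: "ptime xs"
  shows "ptime (\<lambda>x. concat (xs x))"
proof -
  have "ptime (\<lambda>x. fold (\<lambda>y a. a @ y) (xs x) [])"
  proof (rule ptime_fold_growth[where f = "\<lambda>x y a. a @ y" and G = "\<lambda>x. sz (xs x)"])
    fix x :: 'a and y c :: "'b list" assume "y \<in> set (xs x)"
    then show "sz (c @ y) \<le> sz c + sz (xs x)" using sz_member[of y "xs x"] sz_append_le[of c y] by simp
  qed (auto intro!: ptime_intros poly_bounded_intros xs)
  moreover have "fold (\<lambda>y a. a @ y) ys zs = zs @ concat ys" for ys and zs :: "'b list"
    by (induction ys arbitrary: zs) auto
  ultimately show ?thesis by simp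
qed

lemma ptime_not [ptime_intros]: "ptime p \<Longrightarrow> ptime (\<lambda>x. \<not> p x)"
  using ptime_If[of p "\<lambda>_. False" "\<lambda>_. True"] by (auto simp: ptime_const if_bool_eq_conj)

lemma ptime_conj [ptime_intros]: "ptime p \<Longrightarrow> ptime q \<Longrightarrow> ptime (\<lambda>x. p x \<and> q x)"
proof -
  assume "ptime p" "ptime q"
  then have "ptime (\<lambda>x. if p x then q x else False)" by (intro ptime_intros)
  moreover have "(\<lambda>x. if p x then q x else False) = (\<lambda>x. p x \<and> q x)" by auto
  ultimately show ?thesis by simp
qed

lemma ptime_disj [ptime_intros]: "ptime p \<Longrightarrow> ptime q \<Longrightarrow> ptime (\<lambda>x. p x \<or> q x)"
proof -
  assume "ptime p" "ptime q"
  then have "ptime (\<lambda>x. if p x then True else q x)" by (intro ptime_intros)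
  moreover have "(\<lambda>x. if p x then True else q x) = (\<lambda>x. p x \<or> q x)" by auto
  ultimately show ?thesis by simp
qed

lemma ptime_eq_bool [ptime_intros]:
  fixes p q :: "_ \<Rightarrow> bool"
  shows "ptime p \<Longrightarrow> ptime q \<Longrightarrow> ptime (\<lambda>x. p x = q x)"
proof -
  assume "ptime p" "ptime q"
  then have "ptime (\<lambda>x. if p x then q x else \<not> q x)" by (intro ptime_intros)
  moreover have "(\<lambda>x. if p x then q x else \<not> q x) = (\<lambda>x. p x = q x)" by auto
  ultimately show ?thesis by simp
qed

lemma ptime_list_all [ptime_intros]:
  fixes f :: "'x::encodable \<Rightarrow> 'b::encodable \<Rightarrow> bool"
  assumes f: "ptime (\<lambda>p. f (fst p) (snd p))" and xs: "ptime xs"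
  shows "ptime (\<lambda>x. list_all (f x) (xs x))"
proof -
  have "ptime (\<lambda>x. case filter (\<lambda>y. \<not> f x y) (xs x) of [] \<Rightarrow> True | y # ys \<Rightarrow> False)"
    using f by (intro ptime_intros xs)
  moreover have "(case filter (\<lambda>y. \<not> f x y) (xs x) of [] \<Rightarrow> True | y # ys \<Rightarrow> False) = list_all (f x) (xs x)" for x
    by (induction "xs x") (auto simp: list_all_iff filter_empty_conv split: list.split dest!: filter_eq_ConsD)
  ultimately show ?thesis by simp
qed

lemma ptime_tl [ptime_intros]: "ptime xs \<Longrightarrow> ptime (\<lambda>x. tl (xs x))"
proof -
  assume "ptime xs"
  then have "ptime (\<lambda>x. case xs x of [] \<Rightarrow> [] | y # ys \<Rightarrow> ys)" by (intro ptime_intros)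
  moreover have "(case xs x of [] \<Rightarrow> [] | y # ys \<Rightarrow> ys) = tl (xs x)" for x by (cases "xs x") auto
  ultimately show ?thesis by simp
qed

definition head_or :: "'a \<Rightarrow> 'a list \<Rightarrow> 'a" where
  "head_or d xs = (case xs of [] \<Rightarrow> d | x # _ \<Rightarrow> x)"

lemma head_or_simps [simp]: "head_or d [] = d" "head_or d (x # xs) = x"
  by (auto simp: head_or_def)

lemma ptime_head_or [ptime_intros]: "ptime d \<Longrightarrow> ptime xs \<Longrightarrow> ptime (\<lambda>x. head_or (d x) (xs x))"
  unfolding head_or_def by (intro ptime_intros)

lemma ptime_zip [ptime_intros]:
  fixes xs :: "'x::encodable \<Rightarrow> 'b::encodable list" and ys :: "'x \<Rightarrow> 'c::encodable list"
  assumes xs: "ptime xs" and ys: "ptime ys"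
  shows "ptime (\<lambda>x. zip (xs x) (ys x))"
proof -
  define f :: "'b \<Rightarrow> 'c list \<times> ('b \<times> 'c) list \<Rightarrow> 'c list \<times> ('b \<times> 'c) list" where
    "f = (\<lambda>y a. case fst a of [] \<Rightarrow> a | z # zs \<Rightarrow> (zs, (y, z) # snd a))"
  have "fold f us (vs, ws) = (drop (length us) vs, rev (zip us vs) @ ws)" for us vs ws
  proof (induction us arbitrary: vs ws)
    case (Cons u us)
    show ?case
    proof (cases vs)
      case Nil
      then show ?thesis using Cons[of "[]" ws] by (simp add: f_def)
    next
      case (Cons v vs')
      then show ?thesis using Cons.IH[of vs' "(u, v) # ws"] by (simp add: f_def)
    qed
  qed simp
  then have *: "zip (xs x) (ys x) = rev (snd (fold f (xs x) (ys x, [])))" for x by simp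
  have "ptime (\<lambda>x. fold f (xs x) (ys x, []))"
  proof (rule ptime_fold_growth[where f = "\<lambda>x. f" and G = "\<lambda>x. sz (xs x) + 1"])
    show "ptime (\<lambda>p::('x \<times> 'b) \<times> _. f (snd (fst p)) (snd p))" unfolding f_def by (intro ptime_intros)
    fix x y c assume "y \<in> set (xs x)"
    from sz_member[OF this] show "sz (f y c) \<le> sz c + (sz (xs x) + 1)"
      by (cases c) (auto simp: f_def split: list.split)
  qed (auto intro!: ptime_intros poly_bounded_intros xs ys)
  then show ?thesis unfolding * by (intro ptime_intros)
qed

section \<open>Polynomial-time arithmetic\<close>

fun val :: "bool list \<Rightarrow> nat" where
  "val [] = 0"
| "val (b # bs) = of_bool b + 2 * val bs"

lemma val_bits [simp]: "val (bits n) = n"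
proof (induction n rule: less_induct)
  case (less n)
  show ?case
  proof (cases "n = 0")
    case False
    then have "val (bits (n div 2)) = n div 2" using less by simp
    with False show ?thesis by (simp add: bits.simps[of n])
  qed (simp add: bits.simps)
qed

lemma val_less: "val bs < 2 ^ length bs"
  by (induction bs) auto

lemma val_append: "val (as @ bs) = val as + 2 ^ length as * val bs"
  by (induction as) (auto simp: algebra_simps)

text \<open>Removes zeros at the most significant end, which yields the canonical bit list of the
  same value. The fold runs from that end and drops \<open>False\<close> as long as the output is
  empty.\<close>

definition strip :: "bool list \<Rightarrow> bool list" where
  "strip bs = fold (\<lambda>b a. case a of [] \<Rightarrow> if b then [b] else [] | _ # _ \<Rightarrow> b # a) (rev bs) []"

lemma strip_simps:
  "strip [] = []"
  "strip (b # bs) = (if strip bs = [] \<and> \<not> b then [] else b # strip bs)"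
  by (auto simp: strip_def split: list.split)

lemma strip_Nil_iff: "strip bs = [] \<longleftrightarrow> val bs = 0"
  by (induction bs) (auto simp: strip_simps)

lemma bits_val: "bits (val bs) = strip bs"
proof (induction bs)
  case (Cons b bs)
  show ?case
  proof (cases "val (b # bs) = 0")
    case True
    then show ?thesis using strip_Nil_iff[of "b # bs"] by (simp add: bits.simps)
  next
    case False
    then show ?thesis using Cons strip_Nil_iff[of bs]
      by (subst bits.simps) (auto simp: strip_simps)
  qed
qed (simp add: bits.simps strip_simps)

lemma length_bits_le: "n < 2 ^ k \<Longrightarrow> length (bits n) \<le> k"
proof (induction k arbitrary: n)
  case (Suc k)
  then have "length (bits (n div 2)) \<le> k" by (intro Suc.IH) auto
  then show ?case by (subst bits.simps) auto
qed (simp add: bits.simps)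

lemma sz_bool_list: "sz (bs :: bool list) \<le> 4 * length bs + 1" "2 * length bs + 1 \<le> sz bs"
proof (induction bs)
  case (Cons b bs)
  { case 1 then show ?case using Cons by (cases b) auto }
  { case 2 then show ?case using Cons by (cases b) auto }
qed auto

lemma sz_bits: "sz (bits n) = sz n"
  by (simp add: sz_def enc_nat_bits)

lemma sz_nat_le: "(n::nat) < 2 ^ k \<Longrightarrow> sz n \<le> 4 * k + 1"
  using sz_bool_list(1)[of "bits n"] length_bits_le[of n k] by (simp add: sz_bits)

lemma nat_less_sz: "(n::nat) < 2 ^ sz n"
proof -
  have "n < 2 ^ length (bits n)" using val_less[of "bits n"] by simp
  also have "\<dots> \<le> 2 ^ sz n" using sz_bool_list(2)[of "bits n"] by (simp add: sz_bits)
  finally show ?thesis .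
qed

lemma ptime_val: "ptime bs \<Longrightarrow> ptime (\<lambda>x. val (bs x))"
proof (rule ptime_recode)
  show "enc (val (bs x)) = enc (strip (bs x))" for x by (simp add: enc_nat_bits bits_val)
  assume bs: "ptime bs"
  let ?f = "\<lambda>b a. case a of [] \<Rightarrow> if b then [b] else [] | _ # _ \<Rightarrow> b # a"
  show "ptime (\<lambda>x. strip (bs x))" unfolding strip_def
    by (rule ptime_fold_growth[where f = "\<lambda>x. ?f" and G = "\<lambda>x. 4"])
      (auto intro!: ptime_intros bs split: list.split simp: sz_def enc_bool_def enc_bit_def)
qed

lemma ptime_bits: "ptime n \<Longrightarrow> ptime (\<lambda>x. bits (n x))"
  by (erule ptime_recode) (simp add: enc_nat_bits)

text \<open>One position of a ripple-carry adder: the carry is the majority of three bits, the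
  double equivalence their exclusive or. Exhausted lists count as zeros, and the output comes out
  reversed.\<close>

definition add_step :: "bool list \<times> bool list \<times> bool \<times> bool list \<Rightarrow> bool list \<times> bool list \<times> bool \<times> bool list" where
  "add_step = (\<lambda>(as, bs, c, out). let a = head_or False as; b = head_or False bs in
     (tl as, tl bs, a \<and> b \<or> c \<and> (a \<or> b), ((a \<longleftrightarrow> b) \<longleftrightarrow> c) # out))"

text \<open>The same with a borrow in place of the carry; the result bit is again the exclusive
  or.\<close>

definition sub_step :: "bool list \<times> bool list \<times> bool \<times> bool list \<Rightarrow> bool list \<times> bool list \<times> bool \<times> bool list" where
  "sub_step = (\<lambda>(as, bs, c, out). let a = head_or False as; b = head_or False bs in
     (tl as, tl bs, \<not> a \<and> (b \<or> c) \<or> b \<and> c, ((a \<longleftrightarrow> b) \<longleftrightarrow> c) # out))"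

lemma val_Cons_head_tl: "val bs = of_bool (head_or False bs) + 2 * val (tl bs)"
  by (cases bs) auto

text \<open>The invariant weighs what is still unread, together with the carry, by the number of
  positions done. New output is separated from \<open>out\<close>, so that the induction can start
  anywhere.\<close>

lemma fold_add_step:
  "\<exists>as' bs' c' out'. fold (\<lambda>_. add_step) us (as, bs, c, out) = (as', bs', c', out' @ out) \<and>
     length out' = length us \<and>
     val as + val bs + of_bool c = val (rev out') + 2 ^ length us * (val as' + val bs' + of_bool c')"
proof (induction us arbitrary: as bs c out)
  case (Cons u us)
  define a b where "a = head_or False as" and "b = head_or False bs"
  define d where "d = ((a \<longleftrightarrow> b) \<longleftrightarrow> c)"
  from Cons[of "tl as" "tl bs" "a \<and> b \<or> c \<and> (a \<or> b)" "d # out"] obtain as' bs' c' out' where *: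
    "fold (\<lambda>_. add_step) us (tl as, tl bs, a \<and> b \<or> c \<and> (a \<or> b), d # out) = (as', bs', c', out' @ d # out)"
    "length out' = length us"
    "val (tl as) + val (tl bs) + of_bool (a \<and> b \<or> c \<and> (a \<or> b)) = val (rev out') + 2 ^ length us * (val as' + val bs' + of_bool c')"
    by blast
  have "fold (\<lambda>_. add_step) (u # us) (as, bs, c, out) = (as', bs', c', (out' @ [d]) @ out)"
    using *(1) by (simp add: add_step_def a_def b_def d_def Let_def)
  moreover have "val as + val bs + of_bool c = of_bool d + 2 * (val (tl as) + val (tl bs) + of_bool (a \<and> b \<or> c \<and> (a \<or> b)))"
    unfolding val_Cons_head_tl[of as] val_Cons_head_tl[of bs] a_def[symmetric] b_def[symmetric] d_def
    by (cases a; cases b; cases c) auto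
  then have "val as + val bs + of_bool c = val (rev (out' @ [d])) + 2 ^ length (u # us) * (val as' + val bs' + of_bool c')"
    unfolding *(3) by (simp add: algebra_simps)
  ultimately show ?case using *(2) by (intro exI[of _ as'] exI[of _ bs'] exI[of _ c'] exI[of _ "out' @ [d]"]) auto
qed auto

lemma fold_sub_step:
  "\<exists>as' bs' c' out'. fold (\<lambda>_. sub_step) us (as, bs, c, out) = (as', bs', c', out' @ out) \<and>
     length out' = length us \<and>
     val as + 2 ^ length us * (val bs' + of_bool c') = val (rev out') + val bs + of_bool c + 2 ^ length us * val as'"
proof (induction us arbitrary: as bs c out)
  case (Cons u us)
  define a b where "a = head_or False as" and "b = head_or False bs"
  define d where "d = ((a \<longleftrightarrow> b) \<longleftrightarrow> c)"
  define e where "e = (\<not> a \<and> (b \<or> c) \<or> b \<and> c)"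
  from Cons[of "tl as" "tl bs" e "d # out"] obtain as' bs' c' out' where *:
    "fold (\<lambda>_. sub_step) us (tl as, tl bs, e, d # out) = (as', bs', c', out' @ d # out)"
    "length out' = length us"
    "val (tl as) + 2 ^ length us * (val bs' + of_bool c') = val (rev out') + val (tl bs) + of_bool e + 2 ^ length us * val as'"
    by blast
  have "fold (\<lambda>_. sub_step) (u # us) (as, bs, c, out) = (as', bs', c', (out' @ [d]) @ out)"
    using *(1) by (simp add: sub_step_def a_def b_def d_def e_def Let_def)
  moreover have "val as + 2 * of_bool e + 2 * val (tl bs) = of_bool d + val bs + of_bool c + 2 * val (tl as)"
    unfolding val_Cons_head_tl[of as] val_Cons_head_tl[of bs] a_def[symmetric] b_def[symmetric] d_def e_def
    by (cases a; cases b; cases c) auto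
  then have "val as + 2 ^ length (u # us) * (val bs' + of_bool c') = val (rev (out' @ [d])) + val bs + of_bool c + 2 ^ length (u # us) * val as'"
    using *(3) by (simp add: algebra_simps)
  ultimately show ?case using *(2) by (intro exI[of _ as'] exI[of _ bs'] exI[of _ c'] exI[of _ "out' @ [d]"]) auto
qed auto

lemma fold_add_step_rest:
  "fst (fold (\<lambda>_. add_step) us (as, r)) = drop (length us) as \<and>
   fst (snd (fold (\<lambda>_. add_step) us (as, bs, s))) = drop (length us) bs"
  "fst (fold (\<lambda>_. sub_step) us (as, r)) = drop (length us) as \<and>
   fst (snd (fold (\<lambda>_. sub_step) us (as, bs, s))) = drop (length us) bs"
proof (induction us arbitrary: as r bs s)
  case (Cons u us)
  { case 1 show ?case using Cons(1)
      by (cases r, cases s) (simp add: add_step_def Let_def drop_Suc split: prod.split) }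
  { case 2 show ?case using Cons(2)
      by (cases r, cases s) (simp add: sub_step_def Let_def drop_Suc split: prod.split) }
qed auto

lemma add_by_steps:
  "a + b = val (rev (snd (snd (snd (fold (\<lambda>_. add_step) (bits a @ bits b @ [True]) (bits a, bits b, False, []))))))"
proof -
  \<comment> \<open>The list is a loop counter with room for both summands and one final carry, so
    nothing is left over at the end.\<close>
  let ?us = "bits a @ bits b @ [True]"
  let ?F = "fold (\<lambda>_. add_step) ?us (bits a, bits b, False, [])"
  obtain as' bs' c' out' where *: "?F = (as', bs', c', out')" "length out' = length ?us"
    "a + b = val (rev out') + 2 ^ length ?us * (val as' + val bs' + of_bool c')"
    using fold_add_step[of ?us "bits a" "bits b" False "[]"] by auto
  have "a < 2 ^ length (bits a)" "b < 2 ^ length (bits b)"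
    using val_less[of "bits a"] val_less[of "bits b"] by auto
  moreover have "(2::nat) ^ length (bits a) \<le> 2 ^ (length (bits a) + length (bits b))"
    "(2::nat) ^ length (bits b) \<le> 2 ^ (length (bits a) + length (bits b))" by (auto intro: power_increasing)
  ultimately have "a + b < 2 ^ (length (bits a) + length (bits b)) + 2 ^ (length (bits a) + length (bits b))"
    by linarith
  then have "a + b < 2 ^ length ?us" by simp
  then have lt: "val (rev out') + 2 ^ length ?us * (val as' + val bs' + of_bool c') < 2 ^ length ?us"
    unfolding *(3) .
  have "val as' + val bs' + of_bool c' = (0::nat)"
  proof (rule ccontr)
    assume "val as' + val bs' + of_bool c' \<noteq> (0::nat)"
    then have "2 ^ length ?us * 1 \<le> 2 ^ length ?us * (val as' + val bs' + of_bool c' :: nat)"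
      by (intro mult_le_mono2) linarith
    with lt show False by linarith
  qed
  then show ?thesis using *(3) unfolding *(1) by simp
qed

text \<open>The loop exhausts both lists, so the last borrow decides the comparison, and without a
  borrow the output is the difference. One loop thus yields both \<open><\<close> and truncated
  subtraction.\<close>

lemma sub_by_steps:
  fixes a b :: nat
  defines "r \<equiv> snd (snd (fold (\<lambda>_. sub_step) (bits a @ bits b) (bits a, bits b, False, [])))"
  shows "a < b \<longleftrightarrow> fst r" and "a - b = (if fst r then 0 else val (rev (snd r)))"
proof -
  let ?us = "bits a @ bits b"
  let ?F = "fold (\<lambda>_. sub_step) ?us (bits a, bits b, False, [])"
  obtain as' bs' c' out' where *: "?F = (as', bs', c', out')" "length out' = length ?us"
    "a + 2 ^ length ?us * (val bs' + of_bool c') = val (rev out') + b + 2 ^ length ?us * val as'"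
    using fold_sub_step[of ?us "bits a" "bits b" False "[]"] by auto
  have "fst ?F = drop (length ?us) (bits a)" "fst (snd ?F) = drop (length ?us) (bits b)"
    using fold_add_step_rest(2) by blast+
  then have "as' = []" "bs' = []" unfolding *(1) by simp_all
  then have 3: "a + 2 ^ length ?us * of_bool c' = val (rev out') + b" using *(3) by simp
  have l: "val (rev out') < 2 ^ length ?us" using val_less[of "rev out'"] *(2) by simp
  have r: "r = (c', out')" using *(1) by (simp add: r_def)
  show "a < b \<longleftrightarrow> fst r" using 3 l by (cases c') (auto simp: r)
  show "a - b = (if fst r then 0 else val (rev (snd r)))" using 3 l by (cases c') (auto simp: r)
qed

lemma ptime_add_steps:
  assumes "ptime us" "ptime z"
  shows "ptime (\<lambda>x. fold (\<lambda>_. add_step) (us x :: bool list) (z x))"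
    "ptime (\<lambda>x. fold (\<lambda>_. sub_step) (us x :: bool list) (z x))"
proof -
  have b: "sz b \<le> 3" for b :: bool by (cases b) auto
  have tl: "sz (tl bs) \<le> sz bs" for bs :: "bool list" by (cases bs) auto
  show "ptime (\<lambda>x. fold (\<lambda>_. add_step) (us x :: bool list) (z x))"
  proof (rule ptime_fold_growth[where f = "\<lambda>_ _. add_step" and G = "\<lambda>_. 7"])
    show "ptime (\<lambda>p::('a \<times> bool) \<times> _. add_step (snd p))" unfolding add_step_def by (intro ptime_intros)
    fix c show "sz (add_step c) \<le> sz c + 7"
    proof -
      obtain as bs d out where c: "c = (as, bs, d, out)" by (cases c) auto
      show ?thesis using tl[of as] tl[of bs] b[of "fst (snd (snd (add_step c)))"] b[of "hd (snd (snd (snd (add_step c))))"]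
        by (simp add: c add_step_def Let_def)
    qed
  qed (use assms in auto)
  show "ptime (\<lambda>x. fold (\<lambda>_. sub_step) (us x :: bool list) (z x))"
  proof (rule ptime_fold_growth[where f = "\<lambda>_ _. sub_step" and G = "\<lambda>_. 7"])
    show "ptime (\<lambda>p::('a \<times> bool) \<times> _. sub_step (snd p))" unfolding sub_step_def by (intro ptime_intros)
    fix c show "sz (sub_step c) \<le> sz c + 7"
    proof -
      obtain as bs d out where c: "c = (as, bs, d, out)" by (cases c) auto
      show ?thesis using tl[of as] tl[of bs] b[of "fst (snd (snd (sub_step c)))"] b[of "hd (snd (snd (snd (sub_step c))))"]
        by (simp add: c sub_step_def Let_def)
    qed
  qed (use assms in auto)
qed

lemma ptime_add_nat [ptime_intros]:
  fixes a b :: "'x::encodable \<Rightarrow> nat"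
  assumes "ptime a" "ptime b"
  shows "ptime (\<lambda>x. a x + b x)"
  unfolding add_by_steps by (intro ptime_intros ptime_val ptime_add_steps ptime_bits assms)

lemma ptime_diff_nat [ptime_intros]:
  fixes a b :: "'x::encodable \<Rightarrow> nat"
  assumes "ptime a" "ptime b"
  shows "ptime (\<lambda>x. a x - b x)"
  unfolding sub_by_steps(2) by (intro ptime_intros ptime_val ptime_add_steps ptime_bits assms)

lemma ptime_less_nat [ptime_intros]:
  fixes a b :: "'x::encodable \<Rightarrow> nat"
  assumes "ptime a" "ptime b"
  shows "ptime (\<lambda>x. a x < b x)"
  unfolding sub_by_steps(1) by (intro ptime_intros ptime_val ptime_add_steps ptime_bits assms)

lemma ptime_le_nat [ptime_intros]:
  fixes a b :: "'x::encodable \<Rightarrow> nat"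
  assumes "ptime a" "ptime b"
  shows "ptime (\<lambda>x. a x \<le> b x)"
  unfolding not_less[symmetric] by (intro ptime_intros assms)

lemma ptime_eq_nat [ptime_intros]:
  fixes a b :: "'x::encodable \<Rightarrow> nat"
  assumes "ptime a" "ptime b"
  shows "ptime (\<lambda>x. a x = b x)"
  unfolding order_eq_iff by (intro ptime_intros assms)

lemma ptime_min_nat [ptime_intros]:
  fixes a b :: "'x::encodable \<Rightarrow> nat"
  assumes "ptime a" "ptime b"
  shows "ptime (\<lambda>x. min (a x) (b x))"
  unfolding min_def by (intro ptime_intros assms)

text \<open>The values met in Horner's scheme are those of leading digits of the operand and never
  exceed it; this bounds the accumulators in multiplication and division.\<close>

lemma val_prefix:
  assumes "rev (bits a) = us @ vs"
  shows "val (rev us) \<le> a"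
proof -
  have "bits a = rev vs @ rev us" using arg_cong[OF assms, of rev] by simp
  then have "a = val (rev vs) + 2 ^ length vs * val (rev us)" using val_append[of "rev vs" "rev us"] val_bits[of a] by simp
  then show ?thesis by (metis add.commute le_add1 mult.commute mult_le_mono2 nat_mult_1_right one_le_numeral one_le_power order_trans)
qed

lemma ptime_mult_nat [ptime_intros]:
  fixes a b :: "'x::encodable \<Rightarrow> nat"
  assumes a: "ptime a" and b: "ptime b"
  shows "ptime (\<lambda>x. a x * b x)"
proof -
  define f :: "nat \<Rightarrow> bool \<Rightarrow> nat \<Rightarrow> nat" where "f n d c = c + c + (if d then n else 0)" for n d c
  have f: "fold (f n) us c = 2 ^ length us * c + val (rev us) * n" for n us c
    by (induction us arbitrary: c) (auto simp: f_def algebra_simps val_append)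
  have "ptime (\<lambda>x. fold (f (b x)) (rev (bits (a x))) 0)"
  proof (rule ptime_fold[where f = "\<lambda>x. f (b x)" and B = "\<lambda>x. 4 * (sz (a x) + sz (b x)) + 1"])
    show "ptime (\<lambda>p. f (b (fst (fst p))) (snd (fst p)) (snd p))"
      unfolding f_def by (intro ptime_intros ptime_comp[OF b])
    fix x us vs assume "rev (bits (a x)) = us @ vs"
    then have "val (rev us) \<le> a x" by (rule val_prefix)
    moreover have "a x < 2 ^ sz (a x)" "b x < 2 ^ sz (b x)" by (rule nat_less_sz)+
    ultimately have "val (rev us) * b x < 2 ^ (sz (a x) + sz (b x))"
      unfolding power_add by (intro mult_strict_mono) auto
    then show "sz (fold (f (b x)) us 0) \<le> 4 * (sz (a x) + sz (b x)) + 1"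
      unfolding f by (intro sz_nat_le) simp
  qed (intro ptime_intros ptime_bits poly_bounded_intros a b)+
  then show ?thesis by (simp add: f)
qed

text \<open>Long division, one bit of the dividend at a time. The test \<open>b \<noteq> 0\<close>
  gives the conventional results \<open>v div 0 = 0\<close> and \<open>v mod 0 = v\<close>.\<close>

definition div_step :: "nat \<Rightarrow> bool \<Rightarrow> nat \<times> nat \<Rightarrow> nat \<times> nat" where
  "div_step b d qr = (let q = fst qr + fst qr; r = snd qr + snd qr + (if d then 1 else 0) in
     if b \<noteq> 0 \<and> b \<le> r then (q + 1, r - b) else (q, r))"

lemma div_step: "div_step b d (v div b, v mod b) = ((2 * v + of_bool d) div b, (2 * v + of_bool d) mod b)"
proof (cases "b = 0")
  case False
  define q r where "q = v div b" and "r = v mod b"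
  have v: "v = b * q + r" "r < b" using False by (auto simp: q_def r_def)
  let ?r = "2 * r + of_bool d"
  have eq: "2 * v + of_bool d = b * (2 * q) + ?r" by (simp add: v)
  show ?thesis
  proof (cases "b \<le> ?r")
    case True
    have lt: "?r - b < b" using v(2) by (cases d) auto
    have "2 * v + of_bool d = b * (2 * q + 1) + (?r - b)" using eq True by simp
    then have "(2 * v + of_bool d) div b = 2 * q + 1" "(2 * v + of_bool d) mod b = ?r - b"
      using lt by (metis div_mult_self4 div_less add_0_right False, metis mod_mult_self4 mod_less)
    then show ?thesis using True False
      by (auto simp: div_step_def Let_def q_def[symmetric] r_def[symmetric] of_bool_def mult_2)
  next
    case lt: False
    then have "(2 * v + of_bool d) div b = 2 * q" "(2 * v + of_bool d) mod b = ?r"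
      unfolding eq using False by auto
    then show ?thesis using lt False
      by (auto simp: div_step_def Let_def q_def[symmetric] r_def[symmetric] of_bool_def mult_2)
  qed
qed (auto simp: div_step_def)

lemma fold_div_step:
  "fold (div_step b) us (v div b, v mod b) = ((2 ^ length us * v + val (rev us)) div b, (2 ^ length us * v + val (rev us)) mod b)"
proof (induction us arbitrary: v)
  case (Cons d us)
  show ?case using Cons[of "2 * v + of_bool d"] by (simp add: div_step val_append algebra_simps)
qed simp

lemma ptime_div_steps:
  fixes a b :: "'x::encodable \<Rightarrow> nat"
  assumes a: "ptime a" and b: "ptime b"
  shows "ptime (\<lambda>x. (a x div b x, a x mod b x))"
proof -
  have f: "fold (div_step n) us (0, 0) = (val (rev us) div n, val (rev us) mod n)" for n us
    using fold_div_step[of n us 0] by simp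
  have "ptime (\<lambda>x. fold (div_step (b x)) (rev (bits (a x))) (0, 0))"
  proof (rule ptime_fold[where f = "\<lambda>x. div_step (b x)" and B = "\<lambda>x. 8 * sz (a x) + 3"])
    show "ptime (\<lambda>p. div_step (b (fst (fst p))) (snd (fst p)) (snd p))"
      unfolding div_step_def by (intro ptime_intros ptime_comp[OF b])
    fix x us vs assume "rev (bits (a x)) = us @ vs"
    then have "val (rev us) \<le> a x" by (rule val_prefix)
    with nat_less_sz[of "a x"] have "val (rev us) < 2 ^ sz (a x)" by linarith
    then have "val (rev us) div b x < 2 ^ sz (a x)" "val (rev us) mod b x < 2 ^ sz (a x)"
      by (meson div_le_dividend le_less_trans mod_less_eq_dividend)+
    then show "sz (fold (div_step (b x)) us (0, 0)) \<le> 8 * sz (a x) + 3"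
      unfolding f by (auto dest!: sz_nat_le)
  qed (intro ptime_intros ptime_bits poly_bounded_intros a b)+
  then show ?thesis by (simp add: f)
qed

lemma ptime_div_nat [ptime_intros]:
  fixes a b :: "'x::encodable \<Rightarrow> nat"
  assumes "ptime a" "ptime b"
  shows "ptime (\<lambda>x. a x div b x)"
  using ptime_fst[OF ptime_div_steps[OF assms]] by simp

lemma ptime_mod_nat [ptime_intros]:
  fixes a b :: "'x::encodable \<Rightarrow> nat"
  assumes "ptime a" "ptime b"
  shows "ptime (\<lambda>x. a x mod b x)"
  using ptime_snd[OF ptime_div_steps[OF assms]] by simp

subsection \<open>Integers\<close>

instantiation int :: encodable begin
definition enc_int :: "int \<Rightarrow> tree" where "enc_int i = enc (0 \<le> i, nat \<bar>i\<bar>)"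
instance ..
end

lemma sz_int_le: "\<bar>i::int\<bar> < 2 ^ k \<Longrightarrow> sz i \<le> 4 * k + 5"
proof -
  assume "\<bar>i\<bar> < 2 ^ k"
  then have "nat \<bar>i\<bar> < 2 ^ k" by (simp add: nat_less_iff)
  then have "sz (nat \<bar>i\<bar>) \<le> 4 * k + 1" by (rule sz_nat_le)
  moreover have "sz (0 \<le> i) \<le> 3" by (cases "0 \<le> i") auto
  moreover have "sz i = 1 + sz (0 \<le> i) + sz (nat \<bar>i\<bar>)" by (simp add: sz_def enc_int_def)
  ultimately show ?thesis by linarith
qed

lemma int_less_sz: "\<bar>i::int\<bar> < 2 ^ sz i"
proof -
  have "nat \<bar>i\<bar> < 2 ^ sz (nat \<bar>i\<bar>)" by (rule nat_less_sz)
  also have "\<dots> \<le> 2 ^ sz i" by (intro power_increasing) (simp_all add: sz_def enc_int_def)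
  finally show ?thesis by (simp add: nat_less_iff)
qed

lemma ptime_sign_abs: "ptime i \<Longrightarrow> ptime (\<lambda>x. (0 \<le> (i x :: int), nat \<bar>i x\<bar>))"
  by (rule ptime_recode) (auto simp: enc_int_def)

lemma ptime_nat [ptime_intros]:
  fixes i :: "'x::encodable \<Rightarrow> int"
  assumes "ptime i"
  shows "ptime (\<lambda>x. nat (i x))"
proof -
  have "ptime (\<lambda>x. if fst (0 \<le> i x, nat \<bar>i x\<bar>) then snd (0 \<le> i x, nat \<bar>i x\<bar>) else 0)"
    by (intro ptime_If ptime_fst ptime_snd ptime_sign_abs ptime_const assms)
  then show ?thesis by (rule ptime_recode) auto
qed

lemma ptime_nat_minus [ptime_intros]:
  fixes i :: "'x::encodable \<Rightarrow> int"
  assumes "ptime i"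
  shows "ptime (\<lambda>x. nat (- i x))"
proof -
  have "ptime (\<lambda>x. if fst (0 \<le> i x, nat \<bar>i x\<bar>) then 0 else snd (0 \<le> i x, nat \<bar>i x\<bar>))"
    by (intro ptime_If ptime_fst ptime_snd ptime_sign_abs ptime_const assms)
  then show ?thesis by (rule ptime_recode) auto
qed

definition int_diff :: "nat \<Rightarrow> nat \<Rightarrow> int" where
  "int_diff p n = int p - int n"

lemma ptime_int_diff:
  assumes "ptime p" "ptime n"
  shows "ptime (\<lambda>x. int_diff (p x) (n x))"
proof -
  have "ptime (\<lambda>x. (n x \<le> p x, if n x \<le> p x then p x - n x else n x - p x))"
    by (intro ptime_intros assms)
  then show ?thesis
  proof (rule ptime_recode)
    fix x
    have "(0 \<le> int_diff (p x) (n x)) = (n x \<le> p x)"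
      "nat \<bar>int_diff (p x) (n x)\<bar> = (if n x \<le> p x then p x - n x else n x - p x)"
      by (auto simp: int_diff_def)
    then show "enc (int_diff (p x) (n x)) = enc (n x \<le> p x, if n x \<le> p x then p x - n x else n x - p x)"
      unfolding enc_int_def by simp
  qed
qed

text \<open>Splitting integers into positive and negative part reduces every operation to naturals,
  with at most one final \<open>int_diff\<close>.\<close>

lemma int_arith_by_nat:
  fixes a b :: int
  shows "int n = int_diff n 0"
    and "a + b = int_diff (nat a + nat b) (nat (- a) + nat (- b))"
    and "a - b = int_diff (nat a + nat (- b)) (nat (- a) + nat b)"
    and "a * b = int_diff (nat a * nat b + nat (- a) * nat (- b)) (nat a * nat (- b) + nat (- a) * nat b)"
    and "a \<le> b \<longleftrightarrow> nat a + nat (- b) \<le> nat b + nat (- a)"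
    and "a < b \<longleftrightarrow> nat a + nat (- b) < nat b + nat (- a)"
    and "a = b \<longleftrightarrow> nat a + nat (- b) = nat b + nat (- a)"
proof -
  define p q r s where "p = nat a" and "q = nat (- a)" and "r = nat b" and "s = nat (- b)"
  have a: "a = int p - int q" and b: "b = int r - int s" by (auto simp: p_def q_def r_def s_def)
  show "int n = int_diff n 0" by (simp add: int_diff_def)
  show "a + b = int_diff (nat a + nat b) (nat (- a) + nat (- b))"
    and "a - b = int_diff (nat a + nat (- b)) (nat (- a) + nat b)"
    and "a * b = int_diff (nat a * nat b + nat (- a) * nat (- b)) (nat a * nat (- b) + nat (- a) * nat b)"
    and "a \<le> b \<longleftrightarrow> nat a + nat (- b) \<le> nat b + nat (- a)"
    and "a < b \<longleftrightarrow> nat a + nat (- b) < nat b + nat (- a)"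
    and "a = b \<longleftrightarrow> nat a + nat (- b) = nat b + nat (- a)"
    unfolding p_def[symmetric] q_def[symmetric] r_def[symmetric] s_def[symmetric]
    unfolding a b int_diff_def by (auto simp: algebra_simps)
qed

lemma ptime_int [ptime_intros]: "ptime n \<Longrightarrow> ptime (\<lambda>x. int (n x))"
  unfolding int_arith_by_nat(1) by (intro ptime_int_diff ptime_const)

context
  fixes a b :: "'x::encodable \<Rightarrow> int"
  assumes ab: "ptime a" "ptime b"
begin

lemma ptime_add_int [ptime_intros]: "ptime (\<lambda>x. a x + b x)"
  unfolding int_arith_by_nat(2) by (intro ptime_int_diff ptime_intros ab)

lemma ptime_diff_int [ptime_intros]: "ptime (\<lambda>x. a x - b x)"
  unfolding int_arith_by_nat(3) by (intro ptime_int_diff ptime_intros ab)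

lemma ptime_mult_int [ptime_intros]: "ptime (\<lambda>x. a x * b x)"
  unfolding int_arith_by_nat(4) by (intro ptime_int_diff ptime_intros ab)

lemma ptime_le_int [ptime_intros]: "ptime (\<lambda>x. a x \<le> b x)"
  unfolding int_arith_by_nat(5) by (intro ptime_intros ab)

lemma ptime_less_int [ptime_intros]: "ptime (\<lambda>x. a x < b x)"
  unfolding int_arith_by_nat(6) by (intro ptime_intros ab)

lemma ptime_eq_int [ptime_intros]: "ptime (\<lambda>x. a x = b x)"
  unfolding int_arith_by_nat(7) by (intro ptime_intros ab)

end

lemma ptime_sum_list_int [ptime_intros]:
  fixes xs :: "'x::encodable \<Rightarrow> int list"
  assumes xs: "ptime xs"
  shows "ptime (\<lambda>x. sum_list (xs x))"
proof -
  have f: "fold (\<lambda>y a. a + y) us c = c + sum_list us" for us and c :: int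
    by (induction us arbitrary: c) auto
  have s: "\<bar>sum_list us\<bar> < 2 ^ sz us" for us :: "int list"
  proof (induction us)
    case (Cons u us)
    have "\<bar>sum_list (u # us)\<bar> < 2 ^ sz u + 2 ^ sz us" using Cons int_less_sz[of u] by simp
    also have "\<dots> \<le> 2 ^ (sz u + sz us) + 2 ^ (sz u + sz us)" by (intro add_mono power_increasing) auto
    also have "\<dots> = 2 ^ sz (u # us)" by simp
    finally show ?case .
  qed simp
  have "ptime (\<lambda>x. fold (\<lambda>y a. a + y) (xs x) 0)"
  proof (rule ptime_fold[where f = "\<lambda>x y a. a + y" and B = "\<lambda>x. 4 * sz (xs x) + 5"])
    fix x us vs assume us: "xs x = us @ vs"
    have "sz us \<le> sz (xs x)" using sz_append[of us vs] sz_ge_1[of vs] unfolding us by linarith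
    then have "(2::int) ^ sz us \<le> 2 ^ sz (xs x)" by (intro power_increasing) auto
    with s[of us] have "\<bar>sum_list us\<bar> < 2 ^ sz (xs x)" by (rule less_le_trans)
    then show "sz (fold (\<lambda>y a. a + y) us 0) \<le> 4 * sz (xs x) + 5"
      unfolding f by (intro sz_int_le) simp
  qed (intro ptime_intros poly_bounded_intros xs)+
  then show ?thesis by (simp add: f)
qed

lemma ptime_sum_list_nat [ptime_intros]:
  assumes "ptime xs"
  shows "ptime (\<lambda>x. sum_list (xs x :: nat list))"
proof -
  have "ptime (\<lambda>x. nat (sum_list (map int (xs x))))" by (intro ptime_intros assms)
  moreover have "nat (sum_list (map int ns)) = sum_list ns" for ns
  proof -
    have "sum_list (map int ns) = int (sum_list ns)" by (induction ns) auto
    then show ?thesis by simp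
  qed
  ultimately show ?thesis by simp
qed

text \<open>A list is a unary number, so counting up to its length is harmless, whereas counting up
  to a binary number would take exponential time. All index ranges of the algorithm therefore come
  from lists.\<close>

lemma ptime_upt_length [ptime_intros]:
  fixes xs :: "'x::encodable \<Rightarrow> 'b::encodable list"
  assumes xs: "ptime xs"
  shows "ptime (\<lambda>x. [0..<length (xs x)])"
proof -
  define f :: "'b \<Rightarrow> nat \<times> nat list \<Rightarrow> nat \<times> nat list" where "f = (\<lambda>_ p. (fst p + 1, fst p # snd p))"
  have f: "fold f us (k, rev [0..<k]) = (k + length us, rev [0..<k + length us])" for us k
  proof (induction us arbitrary: k)
    case (Cons u us)
    show ?case using Cons[of "Suc k"] by (simp add: f_def)
  qed simp
  have f0: "fold f us (0, []) = (length us, rev [0..<length us])" for us using f[of us 0] by simp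
  have s: "sz n \<le> 4 * k + 1" if "n \<le> k" for n k :: nat
    using that less_exp[of k] by (intro sz_nat_le) linarith
  have "ptime (\<lambda>x. fold f (xs x) (0, []))"
  proof (rule ptime_fold[where f = "\<lambda>x. f" and B = "\<lambda>x. (sz (xs x) + 1) * (4 * sz (xs x) + 2) + 2"])
    show "ptime (\<lambda>p::('x \<times> 'b) \<times> _. f (snd (fst p)) (snd p))" unfolding f_def by (intro ptime_intros)
    fix x us vs assume "xs x = us @ vs"
    then have l: "length us \<le> sz (xs x)" using length_le_sz[of "xs x"] by simp
    have "sz [0..<length us] \<le> length [0..<length us] * (4 * sz (xs x) + 1 + 1) + 1"
      by (rule sz_list_le) (use l in \<open>auto intro!: s simp del: One_nat_def add_Suc_right\<close>)
    also have "\<dots> \<le> sz (xs x) * (4 * sz (xs x) + 2) + 1" using l by (simp del: mult_Suc_right)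
    finally show "sz (fold f us (0, [])) \<le> (sz (xs x) + 1) * (4 * sz (xs x) + 2) + 2"
      using s[OF l] by (simp add: f0)
  qed (intro ptime_intros poly_bounded_intros xs)+
  then have "ptime (\<lambda>x. rev (snd (fold f (xs x) (0, []))))" by (intro ptime_intros)
  then show ?thesis by (simp add: f0)
qed

lemma ptime_length [ptime_intros]:
  assumes xs: "ptime xs"
  shows "ptime (\<lambda>x. length (xs x))"
proof -
  have "ptime (\<lambda>x. sum_list (map (\<lambda>_. 1::nat) (xs x)))" by (intro ptime_intros xs)
  then show ?thesis by (simp add: sum_list_triv)
qed

text \<open>Lookup by scanning the whole list: a loop over the list instead of a countdown of the
  binary index stays polynomial.\<close>

definition nth_or :: "'a \<Rightarrow> 'a list \<Rightarrow> nat \<Rightarrow> 'a" where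
  "nth_or d xs n = head_or d (map snd (filter (\<lambda>p. fst p = n) (zip [0..<length xs] xs)))"

lemma nth_or_eq [simp]: "n < length xs \<Longrightarrow> nth_or d xs n = xs ! n"
proof -
  assume n: "n < length xs"
  let ?ps = "filter (\<lambda>p. fst p = n) (zip [0..<length xs] xs)"
  have "set ?ps = {(n, xs ! n)}" using n by (auto simp: set_zip intro!: exI[of _ n])
  then show ?thesis by (cases ?ps) (auto simp: nth_or_def)
qed

lemma ptime_nth_or [ptime_intros]:
  assumes "ptime d" "ptime xs" "ptime n"
  shows "ptime (\<lambda>x. nth_or (d x) (xs x) (n x))"
  unfolding nth_or_def by (intro ptime_intros assms ptime_comp[OF assms(3)])

lemma ptime_eq_int_list [ptime_intros]:
  fixes xs ys :: "'x::encodable \<Rightarrow> int list"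
  assumes "ptime xs" "ptime ys"
  shows "ptime (\<lambda>x. xs x = ys x)"
proof -
  have "ptime (\<lambda>x. length (xs x) = length (ys x) \<and> list_all (\<lambda>p. fst p = snd p) (zip (xs x) (ys x)))"
    by (intro ptime_intros assms)
  moreover have "(length us = length vs \<and> list_all (\<lambda>p. fst p = snd p) (zip us vs)) = (us = vs)" for us vs :: "int list"
  proof -
    have "(length us = length vs \<and> list_all (\<lambda>p. fst p = snd p) (zip us vs)) = list_all2 (=) us vs"
      by (simp add: list_all2_iff list_all_iff case_prod_unfold)
    then show ?thesis by (simp only: list.rel_eq)
  qed
  ultimately show ?thesis by simp
qed

section \<open>Sign-compatible block decompositions\<close>

text \<open>For \<open>S = 0\<close> both implications apply and force \<open>s = 0\<close>. For
  fixed \<open>S\<close> the relation is closed under sums, so it survives the merging of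
  blocks.\<close>

definition conform :: "int \<Rightarrow> int \<Rightarrow> bool" where
  "conform S s \<longleftrightarrow> (0 \<le> S \<longrightarrow> 0 \<le> s) \<and> (S \<le> 0 \<longrightarrow> s \<le> 0)"

lemma conform_sum: "(\<And>b. b \<in> B \<Longrightarrow> conform S (s b)) \<Longrightarrow> conform S (sum s B)"
  unfolding conform_def by (auto intro: sum_nonneg sum_nonpos)

text \<open>A Steinitz-type argument. Elements are ordered greedily such that prefix sums stay in a
  half-open interval with \<open>2 * D\<close> integers. Without a block as claimed, all prefix sums
  are distinct and the order can be continued to \<open>2 * D\<close> elements, one prefix sum too
  many.\<close>

lemma small_block:
  fixes a :: "'j \<Rightarrow> int" and D :: nat
  assumes J: "finite J" "J \<noteq> {}" and a: "\<And>j. j \<in> J \<Longrightarrow> \<bar>a j\<bar> \<le> int D" and D: "D \<ge> 1"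
    and S: "0 \<le> sum a J"
  shows "\<exists>T\<subseteq>J. T \<noteq> {} \<and> card T \<le> 2 * D \<and> 0 \<le> sum a T \<and> sum a T \<le> sum a J"
proof (rule ccontr)
  assume none: "\<not> ?thesis"
  define p where "p js k = sum_list (map a (take k js))" for js k
  define good where "good js \<longleftrightarrow> distinct js \<and> set js \<subseteq> J \<and> (\<forall>k\<le>length js. - int D < p js k \<and> p js k \<le> int D) \<and>
    inj_on (p js) {..length js}" for js
  have "\<exists>js. good js \<and> length js = n" if "n \<le> 2 * D" for n
    using that
  proof (induction n)
    case 0
    have "good []" using D by (simp add: good_def p_def)
    then show ?case by auto
  next
    case (Suc n)
    then obtain js where js: "good js" "length js = n" by auto
    have dj: "distinct js" "set js \<subseteq> J" using js by (auto simp: good_def)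
    let ?q = "p js n"
    have q: "- int D < ?q" "?q \<le> int D" using js by (auto simp: good_def)
    have q_sum: "?q = sum a (set js)" using dj js by (simp add: p_def sum_list_distinct_conv_sum_set)
    have split: "sum a J = ?q + sum a (J - set js)"
      using q_sum J(1) dj(2) by (metis add.commute sum.subset_diff)
    have p0: "p js 0 = 0" by (simp add: p_def)
    \<comment> \<open>Some element not yet chosen drives the prefix sum back towards 0. Otherwise
      either all elements vanish and a single one is a block, or the elements chosen so far form
      one.\<close>
    have "\<exists>j\<in>J - set js. if ?q \<le> 0 then 0 < a j else a j < 0"
    proof (cases "?q \<le> 0")
      case True
      show ?thesis
      proof (rule ccontr)
        assume "\<not> ?thesis"
        then have le: "\<And>j. j \<in> J - set js \<Longrightarrow> a j \<le> 0" using True by force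
        then have "sum a (J - set js) \<le> 0" by (rule sum_nonpos)
        with split True S have q0: "?q = 0" and r0: "sum a (J - set js) = 0" and S0: "sum a J = 0" by linarith+
        have "n = 0"
          using inj_onD[of "p js" "{..n}" n 0] js p0 q0 by (simp add: good_def)
        with js have "js = []" by simp
        with r0 le J(1) have "\<And>j. j \<in> J \<Longrightarrow> a j = 0"
          using sum_nonneg_eq_0_iff[of J "\<lambda>j. - a j"] by (auto simp: sum_negf)
        moreover obtain j where "j \<in> J" using J(2) by blast
        ultimately have "{j} \<subseteq> J \<and> {j} \<noteq> {} \<and> card {j} \<le> 2 * D \<and> 0 \<le> sum a {j} \<and> sum a {j} \<le> sum a J"
          using D S by auto
        with none show False by blast
      qed
    next
      case False
      show ?thesis
      proof (rule ccontr)
        assume "\<not> ?thesis"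
        then have "\<And>j. j \<in> J - set js \<Longrightarrow> 0 \<le> a j" using False by force
        then have "0 \<le> sum a (J - set js)" by (rule sum_nonneg)
        then have "set js \<subseteq> J \<and> set js \<noteq> {} \<and> card (set js) \<le> 2 * D \<and> 0 \<le> sum a (set js) \<and> sum a (set js) \<le> sum a J"
        proof (intro conjI)
          show "set js \<noteq> {}" using False q_sum by auto
          show "card (set js) \<le> 2 * D" using distinct_card[OF dj(1)] js(2) Suc.prems by linarith
          show "sum a (set js) \<le> sum a J" "0 \<le> sum a (set js)"
            using split False q_sum \<open>0 \<le> sum a (J - set js)\<close> by linarith+
        qed (rule dj(2))
        with none show False by blast
      qed
    qed
    then obtain j where j: "j \<in> J" "j \<notin> set js" "if ?q \<le> 0 then 0 < a j else a j < 0" by blast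
    let ?js = "js @ [j]"
    have pre: "p ?js k = p js k" if "k \<le> n" for k using that js(2) by (simp add: p_def)
    have last: "p ?js (Suc n) = ?q + a j" using js(2) by (simp add: p_def)
    \<comment> \<open>Equal prefix sums enclose a segment of sum 0, which is a block of the excluded
      kind.\<close>
    have new: "p ?js (Suc n) \<noteq> p js k" if k: "k \<le> n" for k
    proof
      assume eq: "p ?js (Suc n) = p js k"
      let ?T = "set (drop k ?js)"
      have d: "distinct ?js" using dj j by simp
      have "sum_list (map a ?js) = sum_list (map a (take k ?js)) + sum_list (map a (drop k ?js))"
        unfolding sum_list_append[symmetric] map_append[symmetric] append_take_drop_id ..
      moreover have "take k ?js = take k js" using k js(2) by simp
      then have "sum_list (map a (take k ?js)) = p js k" unfolding p_def by simp
      moreover have "sum_list (map a ?js) = p ?js (Suc n)" using js(2) by (simp add: p_def)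
      ultimately have "sum_list (map a (drop k ?js)) = 0" using eq by linarith
      then have "sum a ?T = 0" using d sum_list_distinct_conv_sum_set[of "drop k ?js" a]
        by (simp only: distinct_drop)
      moreover have "?T \<subseteq> J" using dj j set_drop_subset[of k ?js] by auto
      moreover have "?T \<noteq> {}" using k js(2) by simp
      moreover have "card ?T \<le> 2 * D" using card_length[of "drop k ?js"] Suc.prems js(2) by simp
      ultimately have "?T \<subseteq> J \<and> ?T \<noteq> {} \<and> card ?T \<le> 2 * D \<and> 0 \<le> sum a ?T \<and> sum a ?T \<le> sum a J"
        using S by simp
      with none show False by blast
    qed
    have "inj_on (p ?js) {..Suc n}"
    proof (rule inj_onI)
      fix k l assume kl: "k \<in> {..Suc n}" "l \<in> {..Suc n}" "p ?js k = p ?js l"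
      show "k = l"
      proof (cases "k \<le> n"; cases "l \<le> n")
        assume "k \<le> n" "l \<le> n"
        then show ?thesis using kl js pre unfolding good_def inj_on_def by auto
      next
        assume "k \<le> n" "\<not> l \<le> n"
        then show ?thesis using kl new[of k] pre[of k] by (auto simp: le_Suc_eq)
      next
        assume "\<not> k \<le> n" "l \<le> n"
        then show ?thesis using kl new[of l] pre[of l] by (auto simp: le_Suc_eq)
      qed (use kl in auto)
    qed
    moreover have "- int D < p ?js k \<and> p ?js k \<le> int D" if "k \<le> Suc n" for k
    proof (cases "k \<le> n")
      case True
      then show ?thesis using pre js by (auto simp: good_def)
    next
      case False
      then have "k = Suc n" using that by simp
      then show ?thesis using last q a[OF j(1)] j(3) by (auto split: if_splits)
    qed
    ultimately have "good ?js" using dj j js(2) by (auto simp: good_def)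
    then show ?case using js(2) by (intro exI[of _ ?js]) auto
  qed
  then obtain js where js: "good js" "length js = 2 * D" by auto
  \<comment> \<open>With the empty prefix there are \<open>2 * D + 1\<close> distinct sums for
    \<open>2 * D\<close> values.\<close>
  then have "p js ` {..2 * D} \<subseteq> {- int D<..int D}" by (auto simp: good_def)
  then have "card (p js ` {..2 * D}) \<le> card {- int D<..int D}" by (rule card_mono[rotated]) simp
  moreover have "card (p js ` {..2 * D}) = 2 * D + 1" using js by (simp add: good_def card_image)
  ultimately show False by simp
qed

text \<open>Blocks are split off one by one; the bound \<open>sum a T \<le> sum a J\<close> from
  \<open>small_block\<close> keeps the sum of the rest nonnegative.\<close>

lemma nonneg_blocks:
  fixes a :: "'j \<Rightarrow> int" and D :: nat
  assumes "finite J" and "\<And>j. j \<in> J \<Longrightarrow> \<bar>a j\<bar> \<le> int D" and "D \<ge> 1" and "0 \<le> sum a J"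
  shows "\<exists>\<pi>::'j \<Rightarrow> nat. (\<forall>j\<in>J. \<pi> j < card J) \<and> (\<forall>b. card {j\<in>J. \<pi> j = b} \<le> 2 * D \<and> 0 \<le> sum a {j\<in>J. \<pi> j = b})"
  using assms
proof (induction "card J" arbitrary: J rule: less_induct)
  case less
  show ?case
  proof (cases "J = {}")
    case False
    obtain T where T: "T \<subseteq> J" "T \<noteq> {}" "card T \<le> 2 * D" "0 \<le> sum a T" "sum a T \<le> sum a J"
      using small_block[of J a D] less.prems False by auto
    have c: "card (J - T) < card J" using T less.prems(1) False by (intro psubset_card_mono) auto
    have "sum a J = sum a (J - T) + sum a T" using T(1) less.prems(1) by (rule sum.subset_diff)
    then have "\<exists>\<pi>::'j \<Rightarrow> nat. (\<forall>j\<in>J - T. \<pi> j < card (J - T)) \<and> (\<forall>b. card {j\<in>J - T. \<pi> j = b} \<le> 2 * D \<and> 0 \<le> sum a {j\<in>J - T. \<pi> j = b})"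
      using T less.prems c by (intro less.hyps) auto
    then obtain \<pi> :: "'j \<Rightarrow> nat" where \<pi>: "\<And>j. j \<in> J - T \<Longrightarrow> \<pi> j < card (J - T)"
      "\<And>b. card {j\<in>J - T. \<pi> j = b} \<le> 2 * D" "\<And>b. 0 \<le> sum a {j\<in>J - T. \<pi> j = b}" by auto
    let ?\<pi> = "\<lambda>j. if j \<in> T then card (J - T) else \<pi> j"
    have "{j\<in>J. ?\<pi> j = b} = (if b = card (J - T) then T else {j\<in>J - T. \<pi> j = b})" for b
      using T(1) \<pi>(1) by (auto split: if_splits) (metis DiffI less_irrefl)+
    moreover have "\<forall>j\<in>J. ?\<pi> j < card J" using c \<pi>(1) by force
    ultimately show ?thesis using T \<pi> by (intro exI[of _ ?\<pi>]) auto
  qed auto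
qed

lemma sum_fibers:
  fixes \<pi> :: "'j \<Rightarrow> 'k"
  assumes "finite J"
  shows "(\<Sum>b\<in>\<pi> ` J. sum a {j\<in>J. \<pi> j = b}) = sum a J"
  using sum.image_gen[OF assms, of a \<pi>] by simp

lemma conform_blocks:
  fixes a :: "'j \<Rightarrow> int" and D :: nat
  assumes J: "finite J" and a: "\<And>j. j \<in> J \<Longrightarrow> \<bar>a j\<bar> \<le> int D" and D: "D \<ge> 1"
  shows "\<exists>\<pi>::'j \<Rightarrow> nat. \<forall>b. card {j\<in>J. \<pi> j = b} \<le> 2 * D \<and> conform (sum a J) (sum a {j\<in>J. \<pi> j = b})"
proof -
  have *: "\<exists>\<pi>::'j \<Rightarrow> nat. \<forall>b. card {j\<in>J. \<pi> j = b} \<le> 2 * D \<and> conform (sum a J) (sum a {j\<in>J. \<pi> j = b})"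
    if S: "0 \<le> sum a J" and a: "\<And>j. j \<in> J \<Longrightarrow> \<bar>a j\<bar> \<le> int D" for a :: "'j \<Rightarrow> int"
  proof -
    from nonneg_blocks[OF J a D S] obtain \<pi> :: "'j \<Rightarrow> nat"
      where \<pi>: "\<And>b. card {j\<in>J. \<pi> j = b} \<le> 2 * D" "\<And>b. 0 \<le> sum a {j\<in>J. \<pi> j = b}" by auto
    \<comment> \<open>The block sums are nonnegative and add up to the total. If the total is 0,
      each of them is therefore 0, as conformity requires.\<close>
    have "sum a {j\<in>J. \<pi> j = b} \<le> sum a J" for b
    proof (cases "b \<in> \<pi> ` J")
      case True
      then have "sum a {j\<in>J. \<pi> j = b} \<le> (\<Sum>b\<in>\<pi> ` J. sum a {j\<in>J. \<pi> j = b})"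
        using \<pi>(2) J by (intro member_le_sum) auto
      then show ?thesis unfolding sum_fibers[OF J] .
    next
      case False
      then have "{j\<in>J. \<pi> j = b} = {}" by auto
      then show ?thesis using S by (simp only: sum.empty)
    qed
    then have "conform (sum a J) (sum a {j\<in>J. \<pi> j = b})" for b
      unfolding conform_def using \<pi>(2) order_trans by blast
    with \<pi>(1) show ?thesis by blast
  qed
  show ?thesis
  proof (cases "0 \<le> sum a J")
    case True
    then show ?thesis using *[of a] a by auto
  next
    case False
    then show ?thesis using *[of "\<lambda>j. - a j"] a by (auto simp: sum_negf conform_def)
  qed
qed

text \<open>One functional at a time: the blocks found so far become the elements to be grouped for
  the next functional, and merging preserves conformity for the earlier ones. The block size grows
  from \<open>\<beta>\<close> to \<open>2 * D * \<beta> * \<beta>\<close>, whence the exponent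
  \<open>2 ^ card K - 1\<close>.\<close>

lemma conform_blocks_multi:
  fixes c :: "'k \<Rightarrow> 'j \<Rightarrow> int" and D :: nat
  assumes K: "finite K" and J: "finite J" and c: "\<And>k j. k \<in> K \<Longrightarrow> j \<in> J \<Longrightarrow> \<bar>c k j\<bar> \<le> int D" and D: "D \<ge> 1"
  shows "\<exists>\<pi>::'j \<Rightarrow> nat. \<forall>b. card {j\<in>J. \<pi> j = b} \<le> (2 * D) ^ (2 ^ card K - 1) \<and>
     (\<forall>k\<in>K. conform (sum (c k) J) (sum (c k) {j\<in>J. \<pi> j = b}))"
  using K c
proof (induction K rule: finite_induct)
  case empty
  obtain \<pi> :: "'j \<Rightarrow> nat" where inj: "inj_on \<pi> J" using finite_imp_inj_to_nat_seg[OF J] by auto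
  have "card {j\<in>J. \<pi> j = b} \<le> 1" for b
  proof -
    have "{j\<in>J. \<pi> j = b} \<subseteq> {j}" if "j \<in> J" "\<pi> j = b" for j using that inj by (auto simp: inj_on_def)
    then have "\<exists>j. {j\<in>J. \<pi> j = b} \<subseteq> {j}" by (cases "\<exists>j\<in>J. \<pi> j = b") auto
    then show ?thesis using card_mono[of "{_}" "{j\<in>J. \<pi> j = b}"] by auto
  qed
  then show ?case by auto
next
  case (insert k K)
  define \<beta> where "\<beta> = (2 * D) ^ (2 ^ card K - 1)"
  have "\<exists>\<pi>::'j \<Rightarrow> nat. \<forall>b. card {j\<in>J. \<pi> j = b} \<le> \<beta> \<and> (\<forall>k\<in>K. conform (sum (c k) J) (sum (c k) {j\<in>J. \<pi> j = b}))"
    unfolding \<beta>_def using insert.prems by (intro insert.IH) auto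
  then obtain \<pi> :: "'j \<Rightarrow> nat" where \<pi>: "\<And>b. card {j\<in>J. \<pi> j = b} \<le> \<beta>"
    "\<And>b k. k \<in> K \<Longrightarrow> conform (sum (c k) J) (sum (c k) {j\<in>J. \<pi> j = b})"
    by blast
  have \<beta>: "\<beta> \<ge> 1" using D by (simp add: \<beta>_def)
  define a where "a b = sum (c k) {j\<in>J. \<pi> j = b}" for b
  have "\<bar>a b\<bar> \<le> int (\<beta> * D)" for b
  proof -
    have "\<bar>a b\<bar> \<le> (\<Sum>j\<in>{j\<in>J. \<pi> j = b}. \<bar>c k j\<bar>)" unfolding a_def by (rule sum_abs)
    also have "\<dots> \<le> int (card {j\<in>J. \<pi> j = b}) * int D" using insert.prems by (intro sum_bounded_above) auto
    also have "\<dots> \<le> int \<beta> * int D" using \<pi>(1)[of b] by (intro mult_right_mono) auto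
    finally show ?thesis by simp
  qed
  moreover have "\<beta> * D \<ge> 1" using \<beta> D by simp
  ultimately obtain \<pi>' :: "nat \<Rightarrow> nat" where \<pi>': "\<And>b. card {j\<in>\<pi> ` J. \<pi>' j = b} \<le> 2 * (\<beta> * D)"
    "\<And>b. conform (sum a (\<pi> ` J)) (sum a {j\<in>\<pi> ` J. \<pi>' j = b})"
    using conform_blocks[of "\<pi> ` J" a "\<beta> * D"] J by auto
  have fib: "{j\<in>J. (\<pi>' \<circ> \<pi>) j = b} = (\<Union>b'\<in>{j\<in>\<pi> ` J. \<pi>' j = b}. {j\<in>J. \<pi> j = b'})" for b by auto
  have fin: "finite {j\<in>\<pi> ` J. \<pi>' j = b}" for b using J by simp
  have sum_fib: "sum f {j\<in>J. (\<pi>' \<circ> \<pi>) j = b} = (\<Sum>b'\<in>{j\<in>\<pi> ` J. \<pi>' j = b}. sum f {j\<in>J. \<pi> j = b'})" for b and f :: "'j \<Rightarrow> int"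
    unfolding fib using J by (intro sum.UNION_disjoint) auto
  have "card {j\<in>J. (\<pi>' \<circ> \<pi>) j = b} \<le> (2 * D) ^ (2 ^ card (insert k K) - 1)" for b
  proof -
    have "card {j\<in>J. (\<pi>' \<circ> \<pi>) j = b} \<le> (\<Sum>b'\<in>{j\<in>\<pi> ` J. \<pi>' j = b}. card {j\<in>J. \<pi> j = b'})"
      unfolding fib using fin by (rule card_UN_le)
    also have "\<dots> \<le> card {j\<in>\<pi> ` J. \<pi>' j = b} * \<beta>" using \<pi>(1) by (metis (no_types, lifting) of_nat_id sum_bounded_above)
    also have "\<dots> \<le> 2 * (\<beta> * D) * \<beta>" using \<pi>'(1) by (rule mult_le_mono1)
    also have "\<dots> = (2 * D) ^ (1 + (2 ^ card K - 1) + (2 ^ card K - 1))"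
      unfolding \<beta>_def power_add power_one_right by (simp only: ac_simps)
    also have "1 + (2 ^ card K - 1) + (2 ^ card K - 1) = 2 ^ card (insert k K) - (1::nat)"
      using insert.hyps by (simp add: algebra_simps)
    finally show ?thesis .
  qed
  moreover have "conform (sum (c k') J) (sum (c k') {j\<in>J. (\<pi>' \<circ> \<pi>) j = b})" if "k' \<in> insert k K" for k' b
  proof (cases "k' = k")
    case True
    have "sum a (\<pi> ` J) = sum (c k) J" unfolding a_def using sum_fibers[OF J] .
    then show ?thesis using \<pi>'(2)[of b] unfolding True sum_fib a_def by simp
  next
    case False
    then have "k' \<in> K" using that by simp
    then show ?thesis unfolding sum_fib by (intro conform_sum \<pi>(2))
  qed
  ultimately show ?case by blast
qed

section \<open>Augmenting steps for packing problems with many bricks\<close>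

lemma choose_below:
  fixes a :: "nat \<Rightarrow> nat"
  shows "t \<le> sum a {..<m} \<Longrightarrow> \<exists>b. (\<forall>i. b i \<le> a i) \<and> sum b {..<m} = t"
proof (induction m arbitrary: t)
  case 0
  then show ?case by (intro exI[of _ "\<lambda>_. 0"]) auto
next
  case (Suc m)
  have "t - min t (a m) \<le> sum a {..<m}" using Suc.prems by auto
  from Suc.IH[OF this] obtain b where "\<forall>i. b i \<le> a i" "sum b {..<m} = t - min t (a m)" by blast
  then show ?case by (intro exI[of _ "b(m := min t (a m))"]) auto
qed

text \<open>The difference is written as signed unit vectors, as many for each edge as its absolute
  value, and these are grouped for the functionals in \<open>F\<close>. Units of one edge share
  their sign, so conformity in the coordinates is automatic; a constraint sum of a unit is at most 1
  in absolute value, hence \<open>D = 1\<close>.\<close>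

lemma brick_blocks:
  fixes h :: "'e \<Rightarrow> int" and supp :: "'f \<Rightarrow> 'e set"
  assumes E: "finite E" and F: "finite F" and supp: "\<And>f. f \<in> F \<Longrightarrow> supp f \<subseteq> E"
  shows "\<exists>(B::nat set) w. finite B \<and> (\<forall>e\<in>E. (\<Sum>b\<in>B. w b e) = h e) \<and>
     (\<forall>b\<in>B. (\<Sum>e\<in>E. \<bar>w b e\<bar>) \<le> 2 ^ (2 ^ card F - 1) \<and> (\<forall>e\<in>E. conform (h e) (w b e)) \<and>
        (\<forall>f\<in>F. conform (sum h (supp f)) (sum (w b) (supp f))))"
proof -
  define J where "J = (SIGMA e:E. {..<nat \<bar>h e\<bar>})"
  have J: "finite J" using E by (simp add: J_def)
  define u where "u j e = (if fst j = e then sgn (h e) else 0)" for j :: "'e \<times> nat" and e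
  define c where "c f j = sum (u j) (supp f)" for f j
  have c: "\<bar>c f j\<bar> \<le> int 1" if "f \<in> F" for f j
  proof -
    have "c f j = (if fst j \<in> supp f then sgn (h (fst j)) else 0)"
      using finite_subset[OF supp[OF that] E] by (simp add: c_def u_def)
    then show ?thesis by (auto simp: abs_sgn_eq)
  qed
  have "\<exists>\<pi>::'e \<times> nat \<Rightarrow> nat. \<forall>b. card {j\<in>J. \<pi> j = b} \<le> (2 * 1) ^ (2 ^ card F - 1) \<and>
     (\<forall>f\<in>F. conform (sum (c f) J) (sum (c f) {j\<in>J. \<pi> j = b}))"
    by (rule conform_blocks_multi) (use F J c in auto)
  then obtain \<pi> :: "'e \<times> nat \<Rightarrow> nat" where \<pi>: "\<And>b. card {j\<in>J. \<pi> j = b} \<le> 2 ^ (2 ^ card F - 1)"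
    "\<And>b f. f \<in> F \<Longrightarrow> conform (sum (c f) J) (sum (c f) {j\<in>J. \<pi> j = b})" by auto
  define w where "w b e = (\<Sum>j\<in>{j\<in>J. \<pi> j = b}. u j e)" for b e
  have uJ: "(\<Sum>j\<in>J. u j e) = h e" if "e \<in> E" for e
  proof -
    have "(\<Sum>j\<in>J. u j e) = (\<Sum>e'\<in>E. \<Sum>n<nat \<bar>h e'\<bar>. u (e', n) e)"
      unfolding J_def using E by (subst sum.Sigma) auto
    also have "\<dots> = (\<Sum>e'\<in>E. if e' = e then \<bar>h e'\<bar> * sgn (h e) else 0)"
      by (intro sum.cong) (auto simp: u_def)
    also have "\<dots> = h e" using E that by (simp add: abs_mult_sgn)
    finally show ?thesis .
  qed
  have cJ: "sum (c f) J = sum h (supp f)" if f: "f \<in> F" for f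
    unfolding c_def sum.swap[of _ _ J] using supp[OF f] by (intro sum.cong uJ) auto
  have cw: "sum (c f) {j\<in>J. \<pi> j = b} = sum (w b) (supp f)" for f b
    unfolding c_def w_def by (rule sum.swap)
  have "(\<Sum>b\<in>\<pi> ` J. w b e) = h e" if "e \<in> E" for e
    unfolding w_def sum_fibers[OF J] using uJ[OF that] .
  moreover have "(\<Sum>e\<in>E. \<bar>w b e\<bar>) \<le> 2 ^ (2 ^ card F - 1)" for b
  proof -
    have "(\<Sum>e\<in>E. \<bar>w b e\<bar>) \<le> (\<Sum>e\<in>E. \<Sum>j\<in>{j\<in>J. \<pi> j = b}. \<bar>u j e\<bar>)"
      unfolding w_def by (intro sum_mono sum_abs)
    also have "\<dots> = (\<Sum>j\<in>{j\<in>J. \<pi> j = b}. \<Sum>e\<in>E. \<bar>u j e\<bar>)" by (rule sum.swap)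
    also have "\<dots> \<le> (\<Sum>j\<in>{j\<in>J. \<pi> j = b}. 1)"
    proof (rule sum_mono)
      fix j
      have "(\<Sum>e\<in>E. \<bar>u j e\<bar>) = (\<Sum>e\<in>E. if fst j = e then \<bar>sgn (h e)\<bar> else 0)"
        by (intro sum.cong) (auto simp: u_def)
      also have "\<dots> \<le> 1" using E by (simp add: abs_sgn_eq)
      finally show "(\<Sum>e\<in>E. \<bar>u j e\<bar>) \<le> 1" .
    qed
    also have "\<dots> = int (card {j\<in>J. \<pi> j = b})" by simp
    also have "\<dots> \<le> int (2 ^ (2 ^ card F - 1))" using \<pi>(1)[of b] by (simp only: of_nat_le_iff)
    finally show ?thesis by simp
  qed
  moreover have "conform (h e) (w b e)" for b e
    unfolding w_def u_def by (rule conform_sum) (auto simp: conform_def sgn_if)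
  moreover have "conform (sum h (supp f)) (sum (w b) (supp f))" if "f \<in> F" for f b
    using \<pi>(2)[OF that, of b] unfolding cJ[OF that] cw .
  ultimately show ?thesis using J by (intro exI[of _ "\<pi> ` J"] exI[of _ w]) auto
qed

text \<open>If all vectors present have the sign of their weighted sum \<open>H\<close>, then
  \<open>l\<close> copies of a selection contained in the whole stay between 0 and \<open>H\<close>.
  This is applied to coordinates and to constraint sums alike.\<close>

lemma scaled_conform:
  fixes p :: "'v \<Rightarrow> int" and \<mu> \<beta> :: "'v \<Rightarrow> nat"
  assumes W: "finite W" and H: "H = (\<Sum>v\<in>W. int (\<mu> v) * p v)"
    and conform: "\<And>v. v \<in> W \<Longrightarrow> \<mu> v > 0 \<Longrightarrow> conform H (p v)"
    and \<beta>: "\<And>v. v \<in> W \<Longrightarrow> l * \<beta> v \<le> \<mu> v"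
  shows "min 0 H \<le> int l * (\<Sum>v\<in>W. int (\<beta> v) * p v)" "int l * (\<Sum>v\<in>W. int (\<beta> v) * p v) \<le> max 0 H"
proof -
  have eq: "int l * (\<Sum>v\<in>W. int (\<beta> v) * p v) = (\<Sum>v\<in>W. int (l * \<beta> v) * p v)"
    by (simp add: sum_distrib_left mult.assoc)
  have *: "0 \<le> int (l * \<beta> v) * p v \<and> int (l * \<beta> v) * p v \<le> int (\<mu> v) * p v" if "v \<in> W" "0 \<le> H" for v
  proof (cases "\<mu> v = 0")
    case True
    have 0: "l * \<beta> v = 0" using \<beta>[OF that(1)] True by simp
    show ?thesis unfolding True 0 by simp
  next
    case False
    then have "0 \<le> p v" using conform[OF that(1)] that(2) by (simp add: conform_def)
    then show ?thesis using \<beta>[OF that(1)] by (simp add: mult_right_mono del: of_nat_mult)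
  qed
  have **: "int (\<mu> v) * p v \<le> int (l * \<beta> v) * p v \<and> int (l * \<beta> v) * p v \<le> 0" if "v \<in> W" "H \<le> 0" for v
  proof (cases "\<mu> v = 0")
    case True
    have 0: "l * \<beta> v = 0" using \<beta>[OF that(1)] True by simp
    show ?thesis unfolding True 0 by simp
  next
    case False
    then have "p v \<le> 0" using conform[OF that(1)] that(2) by (simp add: conform_def)
    then show ?thesis using \<beta>[OF that(1)]
      by (simp add: mult_right_mono_neg mult_nonneg_nonpos del: of_nat_mult)
  qed
  have "0 \<le> H \<Longrightarrow> 0 \<le> (\<Sum>v\<in>W. int (l * \<beta> v) * p v) \<and> (\<Sum>v\<in>W. int (l * \<beta> v) * p v) \<le> H"
    unfolding H using * by (fold H) (auto intro!: sum_nonneg sum_mono simp: H simp del: of_nat_mult)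
  moreover have "H \<le> 0 \<Longrightarrow> H \<le> (\<Sum>v\<in>W. int (l * \<beta> v) * p v) \<and> (\<Sum>v\<in>W. int (l * \<beta> v) * p v) \<le> 0"
    using ** by (auto intro!: sum_nonpos sum_mono simp: H simp del: of_nat_mult)
  ultimately show "min 0 H \<le> int l * (\<Sum>v\<in>W. int (\<beta> v) * p v)" "int l * (\<Sum>v\<in>W. int (\<beta> v) * p v) \<le> max 0 H"
    unfolding eq by linarith+
qed

text \<open>The threshold \<open>k\<close> may be 0, hence the separate claim that the fibre is
  nonempty; steps of length 1 use this case.\<close>

lemma pigeonhole_mult:
  assumes "finite A" "finite T" "\<And>a. a \<in> A \<Longrightarrow> f a \<in> T" "k * card T \<le> card A" "A \<noteq> {}"
  shows "\<exists>t\<in>T. k \<le> card {a\<in>A. f a = t} \<and> {a\<in>A. f a = t} \<noteq> {}"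
proof (rule ccontr)
  assume "\<not> ?thesis"
  then have *: "card {a\<in>A. f a = t} < k \<or> {a\<in>A. f a = t} = {}" if "t \<in> T" for t
    using that not_less by blast
  have f: "f ` A \<subseteq> T" using assms(3) by auto
  have "card A = (\<Sum>t\<in>f ` A. card {a\<in>A. f a = t})"
    using sum.image_gen[OF assms(1), of "\<lambda>_. 1::nat" f] by simp
  also have "\<dots> < (\<Sum>t\<in>f ` A. k)"
  proof (rule sum_strict_mono)
    fix t assume "t \<in> f ` A"
    then show "card {a\<in>A. f a = t} < k" using * f by blast
  qed (use assms in auto)
  also have "\<dots> \<le> k * card T" using card_mono[OF assms(2) f] by simp
  finally show False using assms(4) by simp
qed

definition brick_fits :: "'e set \<Rightarrow> 'f set \<Rightarrow> ('f \<Rightarrow> 'e set) \<Rightarrow> ('f \<Rightarrow> int) \<Rightarrow> ('e \<Rightarrow> int) \<Rightarrow> bool" where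
  "brick_fits E F supp cap x \<longleftrightarrow> (\<forall>e\<in>E. 0 \<le> x e) \<and> (\<forall>f\<in>F. sum x (supp f) \<le> cap f)"

text \<open>
  With \<open>a\<close> edges and \<open>b\<close> constraints per brick, \<open>block_bound b\<close> bounds the blocks inside one brick, \<open>step_bound\<close> the
  entries and partial sums of an augmenting step, and \<open>gap_bound\<close> the number of types of
  steps times their largest gain.
\<close>

definition block_bound :: "nat \<Rightarrow> nat" where
  "block_bound b = 2 ^ (2 ^ b - 1)"

text \<open>The blocks of all bricks are grouped for \<open>a + 1\<close> functionals, the column of
  each edge and the total gain, whose values on a block are at most
  \<open>block_bound b\<close>.\<close>

definition mixed_bound :: "nat \<Rightarrow> nat \<Rightarrow> nat" where
  "mixed_bound a b = (2 * block_bound b) ^ (2 ^ (a + 1) - 1)"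

definition step_bound :: "nat \<Rightarrow> nat \<Rightarrow> nat" where
  "step_bound a b = block_bound b * mixed_bound a b"

definition gap_bound :: "nat \<Rightarrow> nat \<Rightarrow> nat" where
  "gap_bound a b = (mixed_bound a b + 1) ^ ((2 * block_bound b + 1) ^ a) * step_bound a b"

text \<open>Of a group of blocks only its multiset of brick vectors is remembered. A vector may be
  used in any brick whose difference contains enough copies of it, so many groups of one type can be
  traded for \<open>l\<close> copies of a single group, redistributed over the bricks. By conformity
  no brick constraint and no column is exceeded.\<close>

theorem augmenting_step:
  fixes x y :: "nat \<Rightarrow> 'e \<Rightarrow> int" and l m :: nat
  assumes E: "finite E" and F: "finite F" and supp: "\<And>f. f \<in> F \<Longrightarrow> supp f \<subseteq> E"
    and x: "\<And>i. i < m \<Longrightarrow> brick_fits E F supp (cap i) (x i)" "\<And>e. e \<in> E \<Longrightarrow> (\<Sum>i<m. x i e) \<le> d e"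
    and y: "\<And>i. i < m \<Longrightarrow> brick_fits E F supp (cap i) (y i)" "\<And>e. e \<in> E \<Longrightarrow> (\<Sum>i<m. y i e) \<le> d e"
    and l: "l \<ge> 1" and gap: "(\<Sum>i<m. \<Sum>e\<in>E. y i e) - (\<Sum>i<m. \<Sum>e\<in>E. x i e) = gap" "gap > 0"
    and large: "l = 1 \<or> gap \<ge> int (l * (m + 1) * gap_bound (card E) (card F))"
  shows "\<exists>g. (\<forall>i<m. brick_fits E F supp (cap i) (\<lambda>e. x i e + int l * g i e)) \<and>
     (\<forall>e\<in>E. (\<Sum>i<m. x i e) + int l * (\<Sum>i<m. g i e) \<le> d e) \<and>
     0 < (\<Sum>e\<in>E. \<Sum>i<m. g i e) \<and>
     (\<forall>e\<in>E. \<forall>j\<le>m. \<bar>\<Sum>i<j. g i e\<bar> \<le> int (step_bound (card E) (card F))) \<and>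
     (\<forall>e\<in>E. \<forall>i<m. \<bar>g i e\<bar> \<le> int (step_bound (card E) (card F)))"
proof -
  define B1 where "B1 = block_bound (card F)"
  define B2 where "B2 = mixed_bound (card E) (card F)"
  define N where "N = (B2 + 1) ^ ((2 * B1 + 1) ^ card E)"
  have B1: "B1 \<ge> 1" by (simp add: B1_def block_bound_def)
  define h where "h i e = y i e - x i e" for i e
  have "\<exists>(B::nat set) w. finite B \<and> (\<forall>e\<in>E. (\<Sum>b\<in>B. w b e) = h i e) \<and>
     (\<forall>b\<in>B. (\<Sum>e\<in>E. \<bar>w b e\<bar>) \<le> int B1 \<and> (\<forall>e\<in>E. conform (h i e) (w b e)) \<and>
        (\<forall>f\<in>F. conform (sum (h i) (supp f)) (sum (w b) (supp f))))" for i
    using brick_blocks[where h = "h i" and supp = supp and E = E and F = F] E F supp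
    by (simp add: B1_def block_bound_def)
  then obtain B :: "nat \<Rightarrow> nat set" and w where
    fin: "\<And>i. finite (B i)" and w_sum: "\<And>i e. e \<in> E \<Longrightarrow> (\<Sum>b\<in>B i. w i b e) = h i e"
    and w_abs: "\<And>i b. b \<in> B i \<Longrightarrow> (\<Sum>e\<in>E. \<bar>w i b e\<bar>) \<le> int B1"
    and w_e: "\<And>i b e. b \<in> B i \<Longrightarrow> e \<in> E \<Longrightarrow> conform (h i e) (w i b e)"
    and w_f: "\<And>i b f. b \<in> B i \<Longrightarrow> f \<in> F \<Longrightarrow> conform (sum (h i) (supp f)) (sum (w i b) (supp f))"
    by metis
  have w_abs1: "\<bar>w i b e\<bar> \<le> int B1" if "b \<in> B i" "e \<in> E" for i b e
    using w_abs[OF that(1)] member_le_sum[of e E "\<lambda>e. \<bar>w i b e\<bar>"] that(2) E by force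
  define J where "J = (SIGMA i:{..<m}. B i)"
  have J: "finite J" using fin by (simp add: J_def)
  \<comment> \<open>\<open>Some e\<close> reads off the column of edge \<open>e\<close>,
    \<open>None\<close> the gain in the objective.\<close>
  define c where "c k p = (case k of None \<Rightarrow> \<Sum>e\<in>E. w (fst p) (snd p) e | Some e \<Rightarrow> w (fst p) (snd p) e)" for k p
  define K where "K = insert None (Some ` E)"
  have cK: "card K = card E + 1" using E by (simp add: K_def card_image)
  have "\<exists>\<pi>::nat \<times> nat \<Rightarrow> nat. \<forall>b. card {j\<in>J. \<pi> j = b} \<le> (2 * B1) ^ (2 ^ card K - 1) \<and>
     (\<forall>k\<in>K. conform (sum (c k) J) (sum (c k) {j\<in>J. \<pi> j = b}))"
  proof (rule conform_blocks_multi)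
    fix k p assume k: "k \<in> K" and "p \<in> J"
    then have b: "snd p \<in> B (fst p)" by (auto simp: J_def)
    have "\<bar>\<Sum>e\<in>E. w (fst p) (snd p) e\<bar> \<le> int B1" using w_abs[OF b] sum_abs order_trans by blast
    then show "\<bar>c k p\<bar> \<le> int B1" using w_abs1[OF b] k by (auto simp: c_def K_def)
  qed (use E J B1 in \<open>auto simp: K_def\<close>)
  then obtain \<pi> :: "nat \<times> nat \<Rightarrow> nat" where
    \<pi>_card: "\<And>b. card {j\<in>J. \<pi> j = b} \<le> B2" and
    \<pi>: "\<And>b k. k \<in> K \<Longrightarrow> conform (sum (c k) J) (sum (c k) {j\<in>J. \<pi> j = b})"
    unfolding cK B2_def mixed_bound_def B1_def by blast
  define fib where "fib \<gamma> = {j\<in>J. \<pi> j = \<gamma>}" for \<gamma>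
  have fib: "finite (fib \<gamma>)" "fib \<gamma> \<subseteq> J" for \<gamma> using J by (auto simp: fib_def)
  have sumJ: "sum f J = (\<Sum>i<m. \<Sum>b\<in>B i. f (i, b))" for f :: "nat \<times> nat \<Rightarrow> int"
    unfolding J_def using fin by (subst sum.Sigma) auto
  have sumJ_e: "sum (c (Some e)) J = (\<Sum>i<m. h i e)" if "e \<in> E" for e
    unfolding sumJ using w_sum[OF that] by (simp add: c_def)
  have sumJ_None: "sum (c None) J = gap"
  proof -
    have "sum (c None) J = (\<Sum>i<m. \<Sum>e\<in>E. \<Sum>b\<in>B i. w i b e)"
      unfolding sumJ by (simp add: c_def sum.swap[of _ E])
    also have "\<dots> = (\<Sum>i<m. \<Sum>e\<in>E. h i e)" using w_sum by (intro sum.cong) auto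
    also have "\<dots> = gap" using gap(1) by (simp add: h_def sum_subtractf)
    finally show ?thesis .
  qed
  define G where "G = {\<gamma>\<in>\<pi> ` J. sum (c None) (fib \<gamma>) > 0}"
  have finG: "finite G" using J by (simp add: G_def)
  have c_None_le: "sum (c None) (fib \<gamma>) \<le> int (B1 * B2)" for \<gamma>
  proof -
    have "c None p \<le> int B1" if "p \<in> fib \<gamma>" for p
    proof -
      have b: "snd p \<in> B (fst p)" using that by (auto simp: fib_def J_def)
      have "c None p \<le> (\<Sum>e\<in>E. \<bar>w (fst p) (snd p) e\<bar>)" unfolding c_def by (auto intro: sum_mono)
      then show ?thesis using w_abs[OF b] by linarith
    qed
    then have "sum (c None) (fib \<gamma>) \<le> int (card (fib \<gamma>)) * int B1" by (rule sum_bounded_above)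
    also have "\<dots> \<le> int B2 * int B1" using \<pi>_card[of \<gamma>] by (intro mult_right_mono) (auto simp: fib_def)
    finally show ?thesis by (simp add: mult.commute)
  qed
  \<comment> \<open>Group gains are nonnegative and bounded, so a large gap needs many improving
    groups.\<close>
  have gap_le: "gap \<le> int (card G * (B1 * B2))"
  proof -
    have "gap = (\<Sum>\<gamma>\<in>\<pi> ` J. sum (c None) (fib \<gamma>))" unfolding fib_def sum_fibers[OF J] sumJ_None ..
    also have "\<dots> = (\<Sum>\<gamma>\<in>G. sum (c None) (fib \<gamma>))"
    proof (rule sum.mono_neutral_right)
      show "\<forall>\<gamma>\<in>\<pi> ` J - G. sum (c None) (fib \<gamma>) = 0"
      proof
        fix \<gamma> assume "\<gamma> \<in> \<pi> ` J - G"
        then have "sum (c None) (fib \<gamma>) \<le> 0" unfolding G_def not_less[symmetric] by blast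
        moreover have "0 \<le> sum (c None) (fib \<gamma>)"
          using \<pi>[of None \<gamma>] gap(2) unfolding fib_def[symmetric] sumJ_None conform_def K_def by simp
        ultimately show "sum (c None) (fib \<gamma>) = 0" by simp
      qed
    qed (use J in \<open>auto simp: G_def\<close>)
    also have "\<dots> \<le> int (card G) * int (B1 * B2)" using c_None_le by (rule sum_bounded_above)
    finally show ?thesis by simp
  qed
  have G_ne: "G \<noteq> {}" using gap_le gap(2) by auto
  \<comment> \<open>Forgetting the brick leaves a vector from a finite box that does not depend on
    \<open>m\<close>.\<close>
  define vec where "vec p = restrict (w (fst p) (snd p)) E" for p
  define W where "W = E \<rightarrow>\<^sub>E {- int B1..int B1}"
  have W: "finite W" "card W = (2 * B1 + 1) ^ card E"
    using E by (auto simp: W_def finite_PiE card_PiE nat_add_distrib nat_mult_distrib)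
  have vec: "vec p \<in> W" if "p \<in> J" for p
  proof -
    have b: "snd p \<in> B (fst p)" using that by (auto simp: J_def)
    have "- int B1 \<le> w (fst p) (snd p) e \<and> w (fst p) (snd p) e \<le> int B1" if "e \<in> E" for e
      using w_abs1[OF b that] by linarith
    then show ?thesis by (auto simp: vec_def W_def)
  qed
  define ty where "ty \<gamma> = restrict (\<lambda>v. card {p\<in>fib \<gamma>. vec p = v}) W" for \<gamma>
  define T where "T = W \<rightarrow>\<^sub>E {..B2}"
  have T: "finite T" "card T = N" using W by (auto simp: T_def finite_PiE card_PiE N_def)
  have ty: "ty \<gamma> \<in> T" for \<gamma>
  proof -
    have "card {p\<in>fib \<gamma>. vec p = v} \<le> B2" for v
      using card_mono[OF fib(1), of "{p\<in>fib \<gamma>. vec p = v}" \<gamma>] \<pi>_card[of \<gamma>]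
      unfolding fib_def[symmetric] by (auto intro: order_trans)
    then show ?thesis by (auto simp: ty_def T_def)
  qed
  \<comment> \<open>Rounding the multiplicities in \<open>m\<close> bricks down to multiples of
    \<open>l\<close> loses less than \<open>l\<close> in each, so \<open>l * (m + 1)\<close> groups
    leave enough. For \<open>l = 1\<close> nothing is lost and one group is enough.\<close>
  define k where "k = (if l = 1 then 0 else l * (m + 1))"
  have "k * card T \<le> card G"
  proof (cases "l = 1")
    case False
    then have "int (l * (m + 1) * (N * (B1 * B2))) \<le> gap"
      using large unfolding gap_bound_def step_bound_def N_def B1_def B2_def by simp
    with gap_le have "int (l * (m + 1) * N * (B1 * B2)) \<le> int (card G * (B1 * B2))"
      by (simp only: mult.assoc)
    then have "l * (m + 1) * N * (B1 * B2) \<le> card G * (B1 * B2)" by (simp only: of_nat_le_iff)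
    moreover have "B1 * B2 > 0"
      using gap_le gap(2) by (cases "B1 * B2 = 0") auto
    ultimately show ?thesis using False by (simp add: k_def T)
  qed (simp add: k_def)
  from pigeonhole_mult[OF finG T(1) _ this G_ne, of ty] ty obtain \<tau> where
    \<tau>: "k \<le> card {\<gamma>\<in>G. ty \<gamma> = \<tau>}" "{\<gamma>\<in>G. ty \<gamma> = \<tau>} \<noteq> {}" by auto
  define \<Gamma> where "\<Gamma> = {\<gamma>\<in>G. ty \<gamma> = \<tau>}"
  have \<Gamma>: "finite \<Gamma>" "k \<le> card \<Gamma>" "\<Gamma> \<noteq> {}" "1 \<le> card \<Gamma>" "l \<le> card \<Gamma>"
    using finG \<tau> l by (auto simp: \<Gamma>_def k_def card_gt_0_iff Suc_le_eq split: if_splits)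
  have tyv: "card {p\<in>fib \<gamma>. vec p = v} = \<tau> v" if "\<gamma> \<in> \<Gamma>" "v \<in> W" for \<gamma> v
    using that unfolding \<Gamma>_def ty_def by (auto dest: fun_cong[of _ _ v])
  define \<mu> where "\<mu> i v = card {b\<in>B i. vec (i, b) = v}" for i v
  have vsum: "(\<Sum>b\<in>B i. \<phi> (vec (i, b))) = (\<Sum>v\<in>W. int (\<mu> i v) * \<phi> v)" if "i < m" for i and \<phi> :: "('e \<Rightarrow> int) \<Rightarrow> int"
  proof -
    have "(\<Sum>b\<in>B i. \<phi> (vec (i, b))) = (\<Sum>v\<in>W. \<Sum>b\<in>{b\<in>B i. vec (i, b) = v}. \<phi> (vec (i, b)))"
      using fin W(1) vec that by (intro sum.group[symmetric]) (auto simp: J_def)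
    also have "\<dots> = (\<Sum>v\<in>W. int (\<mu> i v) * \<phi> v)" by (intro sum.cong) (auto simp: \<mu>_def)
    finally show ?thesis .
  qed
  have fsum: "(\<Sum>p\<in>fib \<gamma>. \<phi> (vec p)) = (\<Sum>v\<in>W. int (\<tau> v) * \<phi> v)" if "\<gamma> \<in> \<Gamma>" for \<gamma> and \<phi> :: "('e \<Rightarrow> int) \<Rightarrow> int"
  proof -
    have "(\<Sum>p\<in>fib \<gamma>. \<phi> (vec p)) = (\<Sum>v\<in>W. \<Sum>p\<in>{p\<in>fib \<gamma>. vec p = v}. \<phi> (vec p))"
      using fib W(1) vec by (intro sum.group[symmetric]) (auto simp: fib_def)
    also have "\<dots> = (\<Sum>v\<in>W. int (\<tau> v) * \<phi> v)" using tyv[OF that] by (intro sum.cong) auto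
    finally show ?thesis .
  qed
  have \<mu>_sum: "card \<Gamma> * \<tau> v \<le> (\<Sum>i<m. \<mu> i v)" if "v \<in> W" for v
  proof -
    have "card \<Gamma> * \<tau> v = (\<Sum>\<gamma>\<in>\<Gamma>. card {p\<in>fib \<gamma>. vec p = v})" using tyv that by simp
    also have "\<dots> = card (\<Union>\<gamma>\<in>\<Gamma>. {p\<in>fib \<gamma>. vec p = v})"
      using \<Gamma>(1) J by (intro card_UN_disjoint[symmetric]) (auto simp: fib_def)
    also have "\<dots> \<le> card {p\<in>J. vec p = v}" using J by (intro card_mono) (auto simp: fib_def)
    also have "{p\<in>J. vec p = v} = (SIGMA i:{..<m}. {b\<in>B i. vec (i, b) = v})" by (auto simp: J_def)
    also have "card \<dots> = (\<Sum>i<m. \<mu> i v)" using fin by (simp add: \<mu>_def)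
    finally show ?thesis .
  qed
  have div_sum: "\<tau> v \<le> (\<Sum>i<m. \<mu> i v div l)" if v: "v \<in> W" for v
  proof (cases "l = 1")
    case True
    have "1 * \<tau> v \<le> card \<Gamma> * \<tau> v" using \<Gamma>(4) by (rule mult_le_mono1)
    with \<mu>_sum[OF v] have "\<tau> v \<le> (\<Sum>i<m. \<mu> i v)" by linarith
    then show ?thesis using True by simp
  next
    case False
    show ?thesis
    proof (cases "\<tau> v = 0")
      case nz: False
      have "\<mu> i v \<le> l * (\<mu> i v div l) + l" for i
      proof -
        have "\<mu> i v mod l < l" using l by (intro mod_less_divisor) simp
        then show ?thesis using mult_div_mod_eq[of l "\<mu> i v"] by linarith
      qed
      then have "(\<Sum>i<m. \<mu> i v) \<le> (\<Sum>i<m. l * (\<mu> i v div l) + l)" by (intro sum_mono)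
      also have "\<dots> = l * (\<Sum>i<m. \<mu> i v div l) + m * l" by (simp add: sum.distrib sum_distrib_left)
      finally have 1: "(\<Sum>i<m. \<mu> i v) \<le> l * (\<Sum>i<m. \<mu> i v div l) + m * l" .
      have "k * \<tau> v \<le> card \<Gamma> * \<tau> v" using \<Gamma>(2) by (rule mult_le_mono1)
      then have "k * \<tau> v \<le> (\<Sum>i<m. \<mu> i v)" using \<mu>_sum[OF v] by (rule order_trans)
      then have "l * (m + 1) * \<tau> v \<le> (\<Sum>i<m. \<mu> i v)" using False by (simp add: k_def)
      with 1 have 2: "l * m * \<tau> v + l * \<tau> v \<le> l * (\<Sum>i<m. \<mu> i v div l) + m * l" by (simp add: algebra_simps)
      have "l * m * 1 \<le> l * m * \<tau> v" using nz by (intro mult_le_mono2) simp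
      with 2 have "l * \<tau> v \<le> l * (\<Sum>i<m. \<mu> i v div l)" unfolding mult.commute[of m l] by linarith
      then show ?thesis using l by simp
    qed simp
  qed
  have "\<exists>b. (\<forall>i. b i \<le> \<mu> i v div l) \<and> (v \<in> W \<longrightarrow> sum b {..<m} = \<tau> v)" for v
    using choose_below[OF div_sum[of v]] by (cases "v \<in> W") (auto intro: exI[of _ "\<lambda>_. 0"])
  then obtain \<beta>' where \<beta>': "\<And>v i. \<beta>' v i \<le> \<mu> i v div l" "\<And>v. v \<in> W \<Longrightarrow> (\<Sum>i<m. \<beta>' v i) = \<tau> v" by metis
  define \<beta> where "\<beta> i v = \<beta>' v i" for i v
  have \<beta>: "l * \<beta> i v \<le> \<mu> i v" "v \<in> W \<Longrightarrow> (\<Sum>i<m. \<beta> i v) = \<tau> v" for i v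
  proof -
    have "l * \<beta>' v i \<le> l * (\<mu> i v div l)" using \<beta>'(1) by (rule mult_le_mono2)
    then show "l * \<beta> i v \<le> \<mu> i v" unfolding \<beta>_def using times_div_less_eq_dividend order_trans by blast
  qed (simp add: \<beta>_def \<beta>'(2))
  define g where "g i e = (\<Sum>v\<in>W. int (\<beta> i v) * v e)" for i e
  have \<mu>_pos: "\<exists>b\<in>B i. vec (i, b) = v" if "\<mu> i v > 0" for i v
    using that fin by (auto simp: \<mu>_def card_gt_0_iff)
  have bnd_e: "min 0 (h i e) \<le> int l * g i e \<and> int l * g i e \<le> max 0 (h i e)" if i: "i < m" and e: "e \<in> E" for i e
  proof -
    have 1: "h i e = (\<Sum>v\<in>W. int (\<mu> i v) * v e)"
      using vsum[OF i, of "\<lambda>v. v e"] w_sum[OF e, of i] e by (simp add: vec_def)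
    have 2: "conform (h i e) (v e)" if "\<mu> i v > 0" for v
      using \<mu>_pos[OF that] w_e[of _ i e] e by (auto simp: vec_def)
    show ?thesis unfolding g_def using scaled_conform[of W "h i e" "\<mu> i" "\<lambda>v. v e" l "\<beta> i"] W(1) 1 2 \<beta>(1) by blast
  qed
  have bnd_f: "int l * sum (g i) (supp f) \<le> max 0 (sum (h i) (supp f))" if i: "i < m" and f: "f \<in> F" for i f
  proof -
    have sub: "supp f \<subseteq> E" using supp[OF f] .
    have m: "sum (vec (i, b)) (supp f) = sum (w i b) (supp f)" for b
      using sub by (intro sum.cong) (auto simp: vec_def)
    have "(\<Sum>b\<in>B i. sum (w i b) (supp f)) = sum (h i) (supp f)"
      using sub w_sum by (subst sum.swap) (auto intro!: sum.cong)
    then have 1: "sum (h i) (supp f) = (\<Sum>v\<in>W. int (\<mu> i v) * sum v (supp f))"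
      using vsum[OF i, of "\<lambda>v. sum v (supp f)"] by (simp add: m)
    have 2: "conform (sum (h i) (supp f)) (sum v (supp f))" if "\<mu> i v > 0" for v
      using \<mu>_pos[OF that] w_f[of _ i f] f m by auto
    have 3: "sum (g i) (supp f) = (\<Sum>v\<in>W. int (\<beta> i v) * sum v (supp f))"
      unfolding g_def by (subst sum.swap) (simp add: sum_distrib_left)
    show ?thesis unfolding 3 using scaled_conform[of W "sum (h i) (supp f)" "\<mu> i" "\<lambda>v. sum v (supp f)" l "\<beta> i"] W(1) 1 2 \<beta>(1) by blast
  qed
  obtain \<gamma> where \<gamma>: "\<gamma> \<in> \<Gamma>" using \<Gamma>(3) by blast
  have g_sum: "(\<Sum>i<m. g i e) = (\<Sum>v\<in>W. int (\<tau> v) * v e)" for e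
  proof -
    have "(\<Sum>i<m. g i e) = (\<Sum>v\<in>W. int (\<Sum>i<m. \<beta> i v) * v e)"
      unfolding g_def by (subst sum.swap) (simp add: sum_distrib_right)
    then show ?thesis using \<beta>(2) by simp
  qed
  have g_fib: "(\<Sum>i<m. g i e) = sum (c (Some e)) (fib \<gamma>')" if "\<gamma>' \<in> \<Gamma>" "e \<in> E" for \<gamma>' e
    unfolding g_sum using fsum[OF that(1), of "\<lambda>v. v e"] that(2) by (simp add: vec_def c_def)
  \<comment> \<open>The step has the column sums of one group of type \<open>\<tau>\<close>, and
    there are at least \<open>l\<close> such groups. As all groups conform to the total
    \<open>?V\<close>, these \<open>l\<close> copies cannot exceed it.\<close>
  have glob: "int l * (\<Sum>i<m. g i e) \<le> max 0 (\<Sum>i<m. h i e)" if e: "e \<in> E" for e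
  proof -
    let ?s = "\<Sum>i<m. g i e" and ?V = "\<Sum>i<m. h i e"
    have conf: "conform ?V (sum (c (Some e)) (fib \<gamma>))" for \<gamma>
      using \<pi>[of "Some e" \<gamma>] e unfolding fib_def[symmetric] sumJ_e[OF e] by (simp add: K_def)
    show ?thesis
    proof (cases "0 \<le> ?V")
      case True
      then have s0: "0 \<le> ?s" using conf[of \<gamma>] g_fib[OF \<gamma> e] by (simp add: conform_def)
      have "int l * ?s \<le> int (card \<Gamma>) * ?s" using \<Gamma>(5) s0 by (intro mult_right_mono) auto
      also have "\<dots> = (\<Sum>\<gamma>\<in>\<Gamma>. ?s)" by simp
      also have "\<dots> = (\<Sum>\<gamma>\<in>\<Gamma>. sum (c (Some e)) (fib \<gamma>))"
        by (rule sum.cong[OF refl]) (rule g_fib[OF _ e])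
      also have "\<dots> \<le> (\<Sum>\<gamma>\<in>\<pi> ` J. sum (c (Some e)) (fib \<gamma>))"
        using J conf True by (intro sum_mono2) (auto simp: \<Gamma>_def G_def conform_def)
      also have "\<dots> = ?V" unfolding fib_def sum_fibers[OF J] by (rule sumJ_e[OF e])
      finally show ?thesis by simp
    next
      case False
      then have "?s \<le> 0" using conf[of \<gamma>] g_fib[OF \<gamma> e] by (simp add: conform_def)
      then have "int l * ?s \<le> 0" by (simp add: mult_nonneg_nonpos)
      then show ?thesis by simp
    qed
  qed
  have \<tau>_sum: "(\<Sum>v\<in>W. \<tau> v) \<le> B2"
  proof -
    have "(\<Sum>v\<in>W. int (\<tau> v) * 1) = int (card (fib \<gamma>))" using fsum[OF \<gamma>, of "\<lambda>_. 1"] by simp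
    then have "(\<Sum>v\<in>W. \<tau> v) = card (fib \<gamma>)" by (simp flip: of_nat_sum)
    then show ?thesis using \<pi>_card[of \<gamma>] by (simp add: fib_def)
  qed
  have W_abs: "\<bar>v e\<bar> \<le> int B1" if "v \<in> W" "e \<in> E" for v e
    using that by (auto simp: W_def PiE_def Pi_def abs_le_iff)
  \<comment> \<open>Within any set of bricks a vector is used at most as often as in the whole
    group. So prefix sums and single entries obey the same bound.\<close>
  have part: "\<bar>\<Sum>i\<in>A. g i e\<bar> \<le> int (step_bound (card E) (card F))" if A: "A \<subseteq> {..<m}" and e: "e \<in> E" for A e
  proof -
    have finA: "finite A" using A finite_subset by auto
    have "\<bar>\<Sum>i\<in>A. g i e\<bar> = \<bar>\<Sum>v\<in>W. int (\<Sum>i\<in>A. \<beta> i v) * v e\<bar>"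
      unfolding g_def by (subst sum.swap) (simp add: sum_distrib_right)
    also have "\<dots> \<le> (\<Sum>v\<in>W. \<bar>int (\<Sum>i\<in>A. \<beta> i v) * v e\<bar>)" by (rule sum_abs)
    also have "\<dots> \<le> (\<Sum>v\<in>W. int (\<tau> v) * int B1)"
    proof (rule sum_mono)
      fix v assume v: "v \<in> W"
      have "(\<Sum>i\<in>A. \<beta> i v) \<le> \<tau> v" unfolding \<beta>(2)[OF v, symmetric] using A by (intro sum_mono2) auto
      then have "int (\<Sum>i\<in>A. \<beta> i v) * \<bar>v e\<bar> \<le> int (\<tau> v) * int B1"
        using W_abs[OF v e] by (intro mult_mono) (auto simp del: of_nat_sum)
      then show "\<bar>int (\<Sum>i\<in>A. \<beta> i v) * v e\<bar> \<le> int (\<tau> v) * int B1" unfolding abs_mult by (simp del: of_nat_sum)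
    qed
    also have "\<dots> = int (\<Sum>v\<in>W. \<tau> v) * int B1" by (simp add: sum_distrib_right)
    also have "\<dots> \<le> int B2 * int B1" using \<tau>_sum by (intro mult_right_mono) (auto simp del: of_nat_sum)
    finally show ?thesis by (simp add: step_bound_def B1_def B2_def mult.commute)
  qed
  show ?thesis
  proof (intro exI[of _ g] conjI allI impI ballI)
    fix i assume i: "i < m"
    show "brick_fits E F supp (cap i) (\<lambda>e. x i e + int l * g i e)"
      unfolding brick_fits_def
    proof (intro conjI ballI)
      fix e assume e: "e \<in> E"
      have "0 \<le> x i e" "0 \<le> y i e" using x(1)[OF i] y(1)[OF i] e by (auto simp: brick_fits_def)
      then show "0 \<le> x i e + int l * g i e" using bnd_e[OF i e] unfolding h_def by linarith
    next
      fix f assume f: "f \<in> F"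
      have "sum (x i) (supp f) \<le> cap i f" "sum (y i) (supp f) \<le> cap i f"
        using x(1)[OF i] y(1)[OF i] f by (auto simp: brick_fits_def)
      then show "(\<Sum>e\<in>supp f. x i e + int l * g i e) \<le> cap i f"
        using bnd_f[OF i f] unfolding h_def sum.distrib sum_subtractf sum_distrib_left by linarith
    qed
  next
    fix e assume e: "e \<in> E"
    show "(\<Sum>i<m. x i e) + int l * (\<Sum>i<m. g i e) \<le> d e"
      using glob[OF e] x(2)[OF e] y(2)[OF e] unfolding h_def sum_subtractf by linarith
  next
    have "(\<Sum>e\<in>E. \<Sum>i<m. g i e) = (\<Sum>e\<in>E. sum (c (Some e)) (fib \<gamma>))" using g_fib[OF \<gamma>] by simp
    also have "\<dots> = sum (c None) (fib \<gamma>)" unfolding c_def by (subst sum.swap) simp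
    also have "\<dots> > 0" using \<gamma> by (simp add: \<Gamma>_def G_def)
    finally show "0 < (\<Sum>e\<in>E. \<Sum>i<m. g i e)" .
  next
    fix e j assume "e \<in> E" "j \<le> m"
    then show "\<bar>\<Sum>i<j. g i e\<bar> \<le> int (step_bound (card E) (card F))" by (intro part) auto
  next
    fix e i assume "e \<in> E" "i < m"
    then show "\<bar>g i e\<bar> \<le> int (step_bound (card E) (card F))" using part[of "{i}" e] by simp
  qed
qed

section \<open>The packing algorithm\<close>

definition dot :: "bool list \<Rightarrow> int list \<Rightarrow> int" where
  "dot bs x = sum_list (map2 (\<lambda>b a. if b then a else 0) bs x)"

definition fits :: "bool list list \<Rightarrow> int list \<Rightarrow> int list \<Rightarrow> bool" where
  "fits F cap x \<longleftrightarrow> list_all (\<lambda>a. 0 \<le> a) x \<and> list_all (\<lambda>p. dot (fst p) x \<le> snd p) (zip F cap)"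

definition move :: "int \<Rightarrow> int list \<Rightarrow> int list \<Rightarrow> int list" where
  "move l x g = map2 (\<lambda>a b. a + l * b) x g"

text \<open>
  A table lists the reachable partial sums of a step over the bricks treated so far, each with
  one choice of brick moves (last brick first) that reaches it.
\<close>

type_synonym table = "(int list \<times> int list list) list"

text \<open>One representative per reachable sum is enough, because the brick constraints are
  independent and the remaining conditions depend on the sum alone. \<open>M\<close> is both the set
  of moves of a brick and the set of admissible sums, which bounds the table by its length.\<close>

definition extend_table ::
    "int list list \<Rightarrow> bool list list \<Rightarrow> int \<Rightarrow> int list \<times> int list \<Rightarrow> table \<Rightarrow> table" where
  "extend_table M F l cx tab =
    (let cands = concat (map (\<lambda>c. map (\<lambda>g. (map2 (+) (fst c) g, g # snd c))
       (filter (\<lambda>g. fits F (fst cx) (move l (snd cx) g)) M)) tab)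
     in concat (map (\<lambda>s. case filter (\<lambda>c. fst c = s) cands of [] \<Rightarrow> [] | c # _ \<Rightarrow> [c]) M))"

definition zeros :: "int list \<Rightarrow> int list" where
  "zeros d = map (\<lambda>_. 0) d"

definition full_table ::
    "int list list \<Rightarrow> bool list list \<Rightarrow> int list list \<Rightarrow> int list \<Rightarrow> int \<Rightarrow> int list list \<Rightarrow> table" where
  "full_table M F caps d l X = fold (extend_table M F l) (zip caps X) [(zeros d, [])]"

definition column_sums :: "int list \<Rightarrow> int list list \<Rightarrow> int list" where
  "column_sums d X = map (\<lambda>e. sum_list (map (\<lambda>x. nth_or 0 x e) X)) [0..<length d]"

definition improvements ::
    "int list list \<Rightarrow> bool list list \<Rightarrow> int list list \<Rightarrow> int list \<Rightarrow> int \<Rightarrow> int list list \<Rightarrow> table" where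
  "improvements M F caps d l X =
     filter (\<lambda>c. 0 < sum_list (fst c) \<and>
         list_all (\<lambda>p. fst p \<le> snd p) (zip (move l (column_sums d X) (fst c)) d))
       (full_table M F caps d l X)"

definition improve ::
    "int list list \<Rightarrow> bool list list \<Rightarrow> int list list \<Rightarrow> int list \<Rightarrow> int \<Rightarrow> int list list \<Rightarrow> int list list" where
  "improve M F caps d l X = (case improvements M F caps d l X of [] \<Rightarrow> X
     | c # _ \<Rightarrow> map2 (move l) X (rev (snd c)))"

text \<open>Descending powers of two. The largest exponent is the bit length of
  \<open>sum_list d\<close>, so the first length exceeds every attainable total.\<close>

definition step_lengths :: "int list \<Rightarrow> int list" where
  "step_lengths d = fold (\<lambda>_ ls. (2 * head_or 1 ls) # ls) (bits (nat (sum_list d))) [1]"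

definition maxpack ::
    "int list list \<Rightarrow> bool list list \<Rightarrow> int list list \<Rightarrow> int list \<Rightarrow> bool list \<Rightarrow> int list list" where
  "maxpack M F caps d tries =
     fold (\<lambda>l X. fold (\<lambda>_ X. improve M F caps d l X) tries X) (step_lengths d) (map (\<lambda>_. zeros d) caps)"

section \<open>Correctness of the dynamic program and of the augmentation phases\<close>

lemma extend_table_sound:
  assumes "c' \<in> set (extend_table M F l (cap, x) tab)"
  shows "\<exists>c\<in>set tab. \<exists>g\<in>set M. fits F cap (move l x g) \<and> c' = (map2 (+) (fst c) g, g # snd c) \<and> fst c' \<in> set M"
proof -
  define cands where "cands = concat (map (\<lambda>c. map (\<lambda>g. (map2 (+) (fst c) g, g # snd c))
       (filter (\<lambda>g. fits F cap (move l x g)) M)) tab)"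
  from assms obtain s where s: "s \<in> set M" "c' \<in> set (case filter (\<lambda>c. fst c = s) cands of [] \<Rightarrow> [] | c # _ \<Rightarrow> [c])"
    unfolding extend_table_def Let_def cands_def by auto
  then have "c' \<in> set (filter (\<lambda>c. fst c = s) cands)"
    by (cases "filter (\<lambda>c. fst c = s) cands") auto
  then have "c' \<in> set cands" "fst c' = s" by auto
  with s(1) show ?thesis unfolding cands_def by auto
qed

text \<open>The sum is guaranteed to survive, but the recorded moves may be those of another
  candidate.\<close>

lemma extend_table_complete:
  assumes "c \<in> set tab" "g \<in> set M" "fits F cap (move l x g)" "map2 (+) (fst c) g \<in> set M"
  shows "\<exists>gs. (map2 (+) (fst c) g, gs) \<in> set (extend_table M F l (cap, x) tab)"
proof -
  define cands where "cands = concat (map (\<lambda>c. map (\<lambda>g. (map2 (+) (fst c) g, g # snd c))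
       (filter (\<lambda>g. fits F cap (move l x g)) M)) tab)"
  let ?s = "map2 (+) (fst c) g"
  have "(?s, g # snd c) \<in> set (filter (\<lambda>c. fst c = ?s) cands)"
    using assms(1-3) by (auto simp: cands_def intro!: bexI[of _ c] image_eqI[of _ _ g])
  then obtain c' cs where c': "filter (\<lambda>c. fst c = ?s) cands = c' # cs"
    by (cases "filter (\<lambda>c. fst c = ?s) cands") auto
  then have "fst c' = ?s" by (meson filter_eq_ConsD)
  moreover have "c' \<in> set (extend_table M F l (cap, x) tab)"
  proof -
    have "c' \<in> set (case filter (\<lambda>c. fst c = ?s) cands of [] \<Rightarrow> [] | c # _ \<Rightarrow> [c])" unfolding c' by simp
    with assms(4) have "\<exists>s\<in>set M. c' \<in> set (case filter (\<lambda>c. fst c = s) cands of [] \<Rightarrow> [] | c # _ \<Rightarrow> [c])"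
      by (rule bexI[rotated])
    then show ?thesis
      unfolding extend_table_def Let_def fst_conv snd_conv cands_def[symmetric] set_concat set_map by blast
  qed
  ultimately show ?thesis by (metis prod.collapse)
qed

lemma dot_eq:
  assumes "length bs = n" "length x = n"
  shows "dot bs x = (\<Sum>e\<in>{e. e < n \<and> bs ! e}. x ! e)"
proof -
  have "dot bs x = (\<Sum>e<n. if bs ! e then x ! e else 0)"
    using assms by (simp add: dot_def sum_list_sum_nth atLeast0LessThan)
  also have "\<dots> = (\<Sum>e\<in>{..<n} \<inter> {e. bs ! e}. x ! e)" by (simp add: sum.If_cases)
  also have "{..<n} \<inter> {e. bs ! e} = {e. e < n \<and> bs ! e}" by auto
  finally show ?thesis .
qed

lemma length_move [simp]: "length (move l x g) = min (length x) (length g)"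
  by (simp add: move_def)

lemma nth_move [simp]: "e < length x \<Longrightarrow> e < length g \<Longrightarrow> move l x g ! e = x ! e + l * g ! e"
  by (simp add: move_def)

text \<open>\<open>M\<close> contains the box of radius \<open>step_bound\<close> and may be larger,
  since every candidate step is checked before it is used.\<close>

locale packing =
  fixes M :: "int list list" and F :: "bool list list" and caps :: "int list list" and d :: "int list"
  assumes F_length: "\<And>bs. bs \<in> set F \<Longrightarrow> length bs = length d"
    and caps_length: "\<And>cap. cap \<in> set caps \<Longrightarrow> length cap = length F"
    and d_nonneg: "\<And>a. a \<in> set d \<Longrightarrow> 0 \<le> a"
    and caps_nonneg: "\<And>cap a. cap \<in> set caps \<Longrightarrow> a \<in> set cap \<Longrightarrow> 0 \<le> a"
    and M_length: "\<And>g. g \<in> set M \<Longrightarrow> length g = length d"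
    and M_box: "\<And>g. length g = length d \<Longrightarrow> (\<And>e. e < length d \<Longrightarrow> \<bar>g ! e\<bar> \<le> int (step_bound (length d) (length F))) \<Longrightarrow> g \<in> set M"
begin

abbreviation bricks :: nat where "bricks \<equiv> length caps"

abbreviation dim :: nat where "dim \<equiv> length d"

definition edges :: "nat \<Rightarrow> nat set" where
  "edges f = {e. e < dim \<and> F ! f ! e}"

definition valid_brick :: "nat \<Rightarrow> int list \<Rightarrow> bool" where
  "valid_brick i x \<longleftrightarrow> length x = dim \<and> brick_fits {..<dim} {..<length F} edges (\<lambda>f. caps ! i ! f) (\<lambda>e. x ! e)"

definition valid :: "int list list \<Rightarrow> bool" where
  "valid X \<longleftrightarrow> length X = bricks \<and> (\<forall>i<bricks. valid_brick i (X ! i)) \<and> (\<forall>e<dim. (\<Sum>i<bricks. X ! i ! e) \<le> d ! e)"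

definition total :: "int list list \<Rightarrow> int" where
  "total X = (\<Sum>i<bricks. \<Sum>e<dim. X ! i ! e)"

lemma fits_iff:
  assumes "i < bricks" "length x = dim"
  shows "fits F (caps ! i) x \<longleftrightarrow> valid_brick i x"
proof -
  have "length (caps ! i) = length F" using caps_length assms(1) by simp
  moreover have "dot (F ! f) x = (\<Sum>e\<in>edges f. x ! e)" if "f < length F" for f
    unfolding edges_def using dot_eq[of "F ! f" dim x] F_length[of "F ! f"] that assms(2) by simp
  ultimately show ?thesis
    using assms(2) by (auto simp: fits_def valid_brick_def brick_fits_def list_all_length)
qed

definition tab :: "int \<Rightarrow> int list list \<Rightarrow> nat \<Rightarrow> table" where
  "tab l X k = fold (extend_table M F l) (take k (zip caps X)) [(zeros d, [])]"

lemma tab_Suc: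
  assumes "length X = bricks" "k < bricks"
  shows "tab l X (Suc k) = extend_table M F l (caps ! k, X ! k) (tab l X k)"
  using assms by (simp add: tab_def take_Suc_conv_app_nth)

lemma full_table_eq: "length X = bricks \<Longrightarrow> full_table M F caps d l X = tab l X bricks"
  by (simp add: full_table_def tab_def)

lemma tab_sound:
  assumes X: "length X = bricks" "\<And>i. i < bricks \<Longrightarrow> length (X ! i) = dim"
  shows "k \<le> bricks \<Longrightarrow> (s, gs) \<in> set (tab l X k) \<Longrightarrow>
    length gs = k \<and> length s = dim \<and>
    (\<forall>i<k. rev gs ! i \<in> set M \<and> valid_brick i (move l (X ! i) (rev gs ! i))) \<and>
    (\<forall>e<dim. s ! e = (\<Sum>i<k. rev gs ! i ! e))"
proof (induction k arbitrary: s gs)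
  case 0
  then show ?case by (simp add: tab_def zeros_def)
next
  case (Suc k)
  then have k: "k < bricks" by simp
  from extend_table_sound[OF Suc.prems(2)[unfolded tab_Suc[OF X(1) k]]]
  obtain s' gs' g where *: "(s', gs') \<in> set (tab l X k)" "g \<in> set M" "fits F (caps ! k) (move l (X ! k) g)"
    "s = map2 (+) s' g" "gs = g # gs'" by auto
  have IH: "length gs' = k" "length s' = dim"
    "\<And>i. i < k \<Longrightarrow> rev gs' ! i \<in> set M \<and> valid_brick i (move l (X ! i) (rev gs' ! i))"
    "\<And>e. e < dim \<Longrightarrow> s' ! e = (\<Sum>i<k. rev gs' ! i ! e)"
    using Suc.IH[OF _ *(1)] k by auto
  have g: "length g = dim" using M_length *(2) by blast
  have "valid_brick k (move l (X ! k) g)" using fits_iff[OF k] *(3) X(2)[OF k] g by simp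
  moreover have "rev gs ! i = (if i < k then rev gs' ! i else g)" if "i < Suc k" for i
    using that IH(1) unfolding *(5) by (auto simp: nth_append)
  ultimately show ?case using IH g *(2,4,5) by (auto simp: less_Suc_eq)
qed

text \<open>A step whose brick moves and partial sums lie in \<open>M\<close> is followed through
  the tables. The step recorded in the end may differ from it, but has the same sum and hence the
  same gain.\<close>

lemma tab_complete:
  assumes X: "length X = bricks" "\<And>i. i < bricks \<Longrightarrow> length (X ! i) = dim"
    and g: "\<And>i. i < bricks \<Longrightarrow> map (g i) [0..<dim] \<in> set M"
    and fit: "\<And>i. i < bricks \<Longrightarrow> valid_brick i (move l (X ! i) (map (g i) [0..<dim]))"
    and part: "\<And>j. j \<le> bricks \<Longrightarrow> map (\<lambda>e. \<Sum>i<j. g i e) [0..<dim] \<in> set M"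
  shows "k \<le> bricks \<Longrightarrow> \<exists>gs. (map (\<lambda>e. \<Sum>i<k. g i e) [0..<dim], gs) \<in> set (tab l X k)"
proof (induction k)
  case 0
  then show ?case by (simp add: tab_def zeros_def map_replicate_const)
next
  case (Suc k)
  then have k: "k < bricks" by simp
  from Suc obtain gs where gs: "(map (\<lambda>e. \<Sum>i<k. g i e) [0..<dim], gs) \<in> set (tab l X k)" by auto
  have eq: "map2 (+) (map (\<lambda>e. \<Sum>i<k. g i e) [0..<dim]) (map (g k) [0..<dim]) = map (\<lambda>e. \<Sum>i<Suc k. g i e) [0..<dim]"
    by (rule nth_equalityI) auto
  have "fits F (caps ! k) (move l (X ! k) (map (g k) [0..<dim]))"
    using fits_iff[OF k] fit[OF k] X(2)[OF k] by simp
  with extend_table_complete[OF gs g[OF k], of F "caps ! k" l "X ! k"] part[OF Suc.prems]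
  show ?case unfolding tab_Suc[OF X(1) k] fst_conv eq by blast
qed

lemma column_sums_nth:
  assumes "valid X" "e < dim"
  shows "column_sums d X ! e = (\<Sum>i<bricks. X ! i ! e)"
  using assms unfolding valid_def valid_brick_def
  by (simp add: column_sums_def sum_list_sum_nth atLeast0LessThan)

lemma move_column_sums_le_iff:
  assumes X: "valid X" and s: "length s = dim"
  shows "list_all (\<lambda>p. fst p \<le> snd p) (zip (move l (column_sums d X) s) d) \<longleftrightarrow>
    (\<forall>e<dim. (\<Sum>i<bricks. X ! i ! e) + l * s ! e \<le> d ! e)"
proof -
  have "length (column_sums d X) = dim" by (simp add: column_sums_def)
  then show ?thesis using s column_sums_nth[OF X] by (auto simp: list_all_length)
qed

lemma valid_lengths: "valid X \<Longrightarrow> length X = bricks" "valid X \<Longrightarrow> i < bricks \<Longrightarrow> length (X ! i) = dim"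
  by (auto simp: valid_def valid_brick_def)

lemma improve_progress:
  assumes X: "valid X" and l: "l \<ge> 1"
    and ne: "improvements M F caps d l X \<noteq> []"
  shows "valid (improve M F caps d l X) \<and> total (improve M F caps d l X) \<ge> total X + l"
proof -
  from ne obtain s gs cs where c: "improvements M F caps d l X = (s, gs) # cs"
    by (cases "improvements M F caps d l X") auto
  then have "(s, gs) \<in> set (improvements M F caps d l X)" by simp
  then have t: "(s, gs) \<in> set (tab l X bricks)" and pos: "0 < sum_list s"
    and le: "list_all (\<lambda>p. fst p \<le> snd p) (zip (move l (column_sums d X) s) d)"
    using full_table_eq[OF valid_lengths(1)[OF X]] by (auto simp: improvements_def)
  have s: "length gs = bricks" "length s = dim" "\<And>i. i < bricks \<Longrightarrow> rev gs ! i \<in> set M"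
    "\<And>i. i < bricks \<Longrightarrow> valid_brick i (move l (X ! i) (rev gs ! i))"
    "\<And>e. e < dim \<Longrightarrow> s ! e = (\<Sum>i<bricks. rev gs ! i ! e)"
    using tab_sound[OF valid_lengths[OF X] le_refl t] by auto
  define Y where "Y = improve M F caps d l X"
  have Y: "Y = map2 (move l) X (rev gs)" by (simp add: Y_def improve_def c)
  have lY: "length Y = bricks" using s(1) valid_lengths[OF X] by (simp add: Y)
  have Yi: "Y ! i = move l (X ! i) (rev gs ! i)" if "i < bricks" for i
    using that s(1) valid_lengths[OF X] by (simp add: Y)
  have Yie: "Y ! i ! e = X ! i ! e + l * (rev gs ! i ! e)" if "i < bricks" "e < dim" for i e
    unfolding Yi[OF that(1)] using that valid_lengths(2)[OF X that(1)] M_length[OF s(3)[OF that(1)]]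
    by (intro nth_move) auto
  have col: "(\<Sum>i<bricks. Y ! i ! e) = (\<Sum>i<bricks. X ! i ! e) + l * s ! e" if "e < dim" for e
    using that by (simp add: Yie s(5) sum.distrib sum_distrib_left)
  have "valid Y" unfolding valid_def
    using lY Yi s(4) col le move_column_sums_le_iff[OF X s(2)] by auto
  moreover have "total Y = total X + l * sum_list s"
    unfolding total_def sum.swap[of _ "{..<dim}" "{..<bricks}"] using s(2)
    by (simp add: col sum.distrib sum_distrib_left sum_list_sum_nth atLeast0LessThan)
  moreover have "l * 1 \<le> l * sum_list s" using pos l by (intro mult_left_mono) auto
  ultimately show ?thesis unfolding Y_def[symmetric] by simp
qed

definition gap_factor :: int where
  "gap_factor = int ((bricks + 1) * gap_bound dim (length F))"

lemma gap_factor_pos: "gap_factor \<ge> 1"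
proof -
  have "0 < (bricks + 1) * gap_bound dim (length F)"
    by (simp add: gap_bound_def step_bound_def mixed_bound_def block_bound_def)
  then show ?thesis unfolding gap_factor_def by linarith
qed

text \<open>The contrapositive of \<open>augmenting_step\<close>: entries and prefix sums of its
  step lie in the box, so the dynamic program would have found a step with the same column
  sums.\<close>

lemma no_improvement:
  assumes X: "valid X" and Y: "valid Y" and l: "l \<ge> 1" and none: "improvements M F caps d l X = []"
  shows "total Y - total X \<le> l * gap_factor" "l = 1 \<Longrightarrow> total Y \<le> total X"
proof -
  have False if gap: "total Y - total X > 0" and large: "l = 1 \<or> total Y - total X \<ge> l * gap_factor"
  proof -
    let ?S = "int (step_bound dim (length F))"
    have nl: "int (nat l) = l" using l by simp
    have "\<exists>g. (\<forall>i<bricks. brick_fits {..<dim} {..<length F} edges (\<lambda>f. caps ! i ! f) (\<lambda>e. X ! i ! e + int (nat l) * g i e)) \<and>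
     (\<forall>e\<in>{..<dim}. (\<Sum>i<bricks. X ! i ! e) + int (nat l) * (\<Sum>i<bricks. g i e) \<le> d ! e) \<and>
     0 < (\<Sum>e\<in>{..<dim}. \<Sum>i<bricks. g i e) \<and>
     (\<forall>e\<in>{..<dim}. \<forall>j\<le>bricks. \<bar>\<Sum>i<j. g i e\<bar> \<le> int (step_bound (card {..<dim}) (card {..<length F}))) \<and>
     (\<forall>e\<in>{..<dim}. \<forall>i<bricks. \<bar>g i e\<bar> \<le> int (step_bound (card {..<dim}) (card {..<length F})))"
      (is "\<exists>g. ?P g")
    proof (rule augmenting_step[where y = "\<lambda>i e. Y ! i ! e" and gap = "total Y - total X"])
      show "nat l = 1 \<or> int (nat l * (bricks + 1) * gap_bound (card {..<dim}) (card {..<length F})) \<le> total Y - total X"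
      proof -
        have "int (nat l * (bricks + 1) * gap_bound dim (length F)) = int (nat l) * gap_factor"
          unfolding gap_factor_def by (simp only: of_nat_mult mult.assoc)
        then show ?thesis using large unfolding nl card_lessThan by auto
      qed
    qed (use X Y l gap in \<open>auto simp: valid_def valid_brick_def edges_def total_def\<close>)
    then obtain g where P: "?P g" by blast
    have g: "\<And>i. i < bricks \<Longrightarrow> brick_fits {..<dim} {..<length F} edges (\<lambda>f. caps ! i ! f) (\<lambda>e. X ! i ! e + l * g i e)"
      "\<And>e. e < dim \<Longrightarrow> (\<Sum>i<bricks. X ! i ! e) + l * (\<Sum>i<bricks. g i e) \<le> d ! e"
      "0 < (\<Sum>e<dim. \<Sum>i<bricks. g i e)"
      "\<And>e j. e < dim \<Longrightarrow> j \<le> bricks \<Longrightarrow> \<bar>\<Sum>i<j. g i e\<bar> \<le> ?S"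
      "\<And>e i. e < dim \<Longrightarrow> i < bricks \<Longrightarrow> \<bar>g i e\<bar> \<le> ?S"
      using P unfolding nl card_lessThan by auto
    have Xl: "length X = bricks" "\<And>i. i < bricks \<Longrightarrow> length (X ! i) = dim" using valid_lengths[OF X] by auto
    have box: "map (g i) [0..<dim] \<in> set M" if "i < bricks" for i
      by (rule M_box) (use g(5)[OF _ that] in auto)
    have part: "map (\<lambda>e. \<Sum>i<j. g i e) [0..<dim] \<in> set M" if "j \<le> bricks" for j
      by (rule M_box) (use g(4)[OF _ that] in auto)
    have fit: "valid_brick i (move l (X ! i) (map (g i) [0..<dim]))" if i: "i < bricks" for i
    proof -
      let ?x = "move l (X ! i) (map (g i) [0..<dim])"
      have e: "?x ! e = X ! i ! e + l * g i e" if "e < dim" for e using that Xl(2)[OF i] by simp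
      have "(\<Sum>e\<in>edges f. ?x ! e) = (\<Sum>e\<in>edges f. X ! i ! e + l * g i e)" for f
        by (intro sum.cong refl e) (simp add: edges_def)
      then show ?thesis using g(1)[OF i] e Xl(2)[OF i] by (simp add: valid_brick_def brick_fits_def)
    qed
    let ?s = "map (\<lambda>e. \<Sum>i<bricks. g i e) [0..<dim]"
    from tab_complete[OF Xl box fit part le_refl] obtain gs where gs: "(?s, gs) \<in> set (tab l X bricks)" by blast
    have "0 < sum_list ?s" using g(3) by (simp add: sum_list_sum_nth atLeast0LessThan)
    moreover have "list_all (\<lambda>p. fst p \<le> snd p) (zip (move l (column_sums d X) ?s) d)"
      using move_column_sums_le_iff[OF X, of ?s l] g(2) by simp
    ultimately have "(?s, gs) \<in> set (improvements M F caps d l X)"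
      using gs full_table_eq[OF Xl(1)] by (simp add: improvements_def)
    then show False using none by simp
  qed
  note * = this
  have "0 \<le> l * gap_factor" using l gap_factor_pos by simp
  then show "total Y - total X \<le> l * gap_factor" using * by force
  show "l = 1 \<Longrightarrow> total Y \<le> total X" using * by force
qed

text \<open>Each success closes the gap by at least \<open>l\<close>. So the rounds either reach the
  value of \<open>Y\<close> or end in a packing without improvements, for which
  \<open>no_improvement\<close> bounds the gap.\<close>

lemma phase:
  assumes X: "valid X" and Y: "valid Y" and l: "l \<ge> 1"
    and gap: "total Y - total X \<le> l * int (length tries)"
  defines "Z \<equiv> fold (\<lambda>_ X. improve M F caps d l X) tries X"
  shows "valid Z" "total Y - total Z \<le> l * gap_factor" "l = 1 \<Longrightarrow> total Y \<le> total Z"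
proof -
  \<comment> \<open>Once no improvement exists, the packing stays as it is and the remaining rounds
    are idle.\<close>
  have stuck: "fold (\<lambda>_ X. improve M F caps d l X) us X = X" if "improvements M F caps d l X = []" for us :: "'a list" and X
    using that by (induction us) (auto simp: improve_def)
  have "valid Z \<and> (improvements M F caps d l Z = [] \<or> total Y \<le> total Z)"
    using X gap unfolding Z_def
  proof (induction tries arbitrary: X)
    case (Cons u us)
    show ?case
    proof (cases "improvements M F caps d l X = []")
      case True
      then show ?thesis unfolding stuck[OF True, of "u # us"] using Cons.prems by blast
    next
      case False
      from improve_progress[OF Cons.prems(1) l False] Cons.prems(2)
      show ?thesis using Cons.IH[of "improve M F caps d l X"] by (simp add: algebra_simps)
    qed
  qed simp
  moreover have "0 \<le> l * gap_factor" using l gap_factor_pos by simp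
  ultimately show "valid Z" "total Y - total Z \<le> l * gap_factor" "l = 1 \<Longrightarrow> total Y \<le> total Z"
    using no_improvement[OF _ Y l] by force+
qed

end

lemma step_lengths_eq: "step_lengths d = rev (map (\<lambda>k. 2 ^ k) [0..<Suc (length (bits (nat (sum_list d))))])"
proof -
  have "fold (\<lambda>_ ls. (2 * head_or 1 ls) # ls) us (rev (map (\<lambda>k. 2 ^ k) [0..<Suc n])) = rev (map (\<lambda>k. 2 ^ k) [0..<Suc (n + length us)])"
    for n and us :: "bool list"
  proof (induction us arbitrary: n)
    case (Cons u us)
    show ?case using Cons[of "Suc n"] by simp
  qed simp
  from this[of _ 0] show ?thesis unfolding step_lengths_def by simp
qed

text \<open>After the phase of length \<open>2 * l\<close> the gap is at most
  \<open>2 * l * gap_factor\<close>, which \<open>2 * gap_factor\<close> successful steps of length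
  \<open>l\<close> close. The first phase starts from 0 with a gap below its length, and the phase
  of length 1 leaves no gap.\<close>

theorem (in packing) maxpack_optimal:
  assumes tries: "length tries \<ge> 2 * (bricks + 1) * gap_bound dim (length F)"
  shows "valid (maxpack M F caps d tries)" "valid Y \<Longrightarrow> total Y \<le> total (maxpack M F caps d tries)"
proof -
  define L where "L = length (bits (nat (sum_list d)))"
  let ?X0 = "map (\<lambda>_. zeros d) caps"
  let ?phase = "\<lambda>l X. fold (\<lambda>_ X. improve M F caps d l X) tries X"
  have K: "2 * gap_factor \<le> int (length tries)"
  proof -
    have "int (2 * (bricks + 1) * gap_bound dim (length F)) \<le> int (length tries)"
      using tries by (simp only: of_nat_le_iff)
    moreover have "int (2 * (bricks + 1) * gap_bound dim (length F)) = 2 * gap_factor"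
      unfolding gap_factor_def by (simp only: of_nat_mult of_nat_numeral mult.assoc)
    ultimately show ?thesis by linarith
  qed
  have X0: "valid ?X0"
    unfolding valid_def valid_brick_def brick_fits_def
  proof (intro conjI allI impI ballI)
    fix i f assume "i < bricks" "f \<in> {..<length F}"
    then have "0 \<le> caps ! i ! f" using caps_nonneg[of "caps ! i" "caps ! i ! f"] caps_length by simp
    moreover have "(\<Sum>e\<in>edges f. ?X0 ! i ! e) = 0"
      using \<open>i < bricks\<close> by (intro sum.neutral) (auto simp: edges_def zeros_def)
    ultimately show "(\<Sum>e\<in>edges f. ?X0 ! i ! e) \<le> caps ! i ! f" by simp
  next
    fix e assume "e < dim"
    then have "0 \<le> d ! e" using d_nonneg by simp
    with \<open>e < dim\<close> show "(\<Sum>i<bricks. ?X0 ! i ! e) \<le> d ! e" by (simp add: zeros_def)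
  qed (auto simp: zeros_def)
  have t0: "total ?X0 = 0" by (simp add: total_def zeros_def)
  have upper: "total Y \<le> sum_list d" if "valid Y" for Y
  proof -
    have "total Y = (\<Sum>e<dim. \<Sum>i<bricks. Y ! i ! e)" unfolding total_def by (rule sum.swap)
    also have "\<dots> \<le> (\<Sum>e<dim. d ! e)" using that by (intro sum_mono) (auto simp: valid_def)
    finally show ?thesis by (simp add: sum_list_sum_nth atLeast0LessThan)
  qed
  have d_less: "sum_list d < 2 ^ L"
  proof -
    have "nat (sum_list d) < 2 ^ L" unfolding L_def using val_less[of "bits (nat (sum_list d))"] by simp
    then have *: "int (nat (sum_list d)) < 2 ^ L"
      using of_nat_less_iff[of "nat (sum_list d)" "2 ^ L", where 'a = int] by simp
    have "sum_list d \<le> int (nat (sum_list d))" by simp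
    also note *
    finally show ?thesis .
  qed
  have "k \<le> L \<longrightarrow> (let Z = fold ?phase (rev (map (\<lambda>k. 2 ^ k) [k..<Suc L])) ?X0 in
      valid Z \<and> (\<forall>Y. valid Y \<longrightarrow> total Y - total Z \<le> 2 ^ k * gap_factor \<and> (k = 0 \<longrightarrow> total Y \<le> total Z)))" for k
  proof (cases "k \<le> L")
    case True
    \<comment> \<open>The exponents descend, so the induction runs over the distance
      \<open>j\<close> from the largest one.\<close>
    define j where "j = L - k"
    have "k = L - j" "j \<le> L" using True by (auto simp: j_def)
    have "let Z = fold ?phase (rev (map (\<lambda>k. 2 ^ k) [L - j..<Suc L])) ?X0 in
      valid Z \<and> (\<forall>Y. valid Y \<longrightarrow> total Y - total Z \<le> 2 ^ (L - j) * gap_factor \<and> (L - j = 0 \<longrightarrow> total Y \<le> total Z))"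
      using \<open>j \<le> L\<close>
    proof (induction j)
      case 0
      have "total Y - total ?X0 \<le> 2 ^ L * int (length tries)" if "valid Y" for Y
      proof -
        have "total Y - total ?X0 \<le> 2 ^ L * 1" using upper[OF that] t0 d_less by simp
        also have "(2::int) ^ L * 1 \<le> 2 ^ L * int (length tries)"
          using K gap_factor_pos by (intro mult_left_mono) auto
        finally show ?thesis .
      qed
      then show ?case using phase[OF X0, of _ "2 ^ L" tries] X0 by (auto simp: Let_def)
    next
      case (Suc j)
      let ?Z = "fold ?phase (rev (map (\<lambda>k. 2 ^ k) [L - j..<Suc L])) ?X0"
      have Z: "valid ?Z" "\<And>Y. valid Y \<Longrightarrow> total Y - total ?Z \<le> 2 ^ (L - j) * gap_factor"
        using Suc by (auto simp: Let_def)
      have Lj: "L - j = Suc (L - Suc j)" using Suc.prems by simp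
      have ex: "[L - Suc j..<Suc L] = (L - Suc j) # [L - j..<Suc L]"
        using Suc.prems Lj by (subst upt_conv_Cons) auto
      have "total Y - total ?Z \<le> 2 ^ (L - Suc j) * int (length tries)" if "valid Y" for Y
      proof -
        have "total Y - total ?Z \<le> 2 ^ (L - Suc j) * (2 * gap_factor)" using Z(2)[OF that] unfolding Lj by simp
        also have "\<dots> \<le> 2 ^ (L - Suc j) * int (length tries)" using K by (intro mult_left_mono) auto
        finally show ?thesis .
      qed
      then have "valid (?phase (2 ^ (L - Suc j)) ?Z) \<and> (\<forall>Y. valid Y \<longrightarrow>
          total Y - total (?phase (2 ^ (L - Suc j)) ?Z) \<le> 2 ^ (L - Suc j) * gap_factor \<and>
          (L - Suc j = 0 \<longrightarrow> total Y \<le> total (?phase (2 ^ (L - Suc j)) ?Z)))"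
        using phase[OF Z(1), of _ "2 ^ (L - Suc j)" tries] Z(1) by auto
      then show ?case unfolding ex by (simp add: Let_def del: upt_Suc)
    qed
    then show ?thesis using \<open>k = L - j\<close> by simp
  qed simp
  from this[of 0] have "valid (maxpack M F caps d tries) \<and> (\<forall>Y. valid Y \<longrightarrow> total Y \<le> total (maxpack M F caps d tries))"
    unfolding maxpack_def step_lengths_eq L_def[symmetric] by (simp add: Let_def)
  then show "valid (maxpack M F caps d tries)" "valid Y \<Longrightarrow> total Y \<le> total (maxpack M F caps d tries)" by auto
qed

section \<open>Polynomial running time of the packing algorithm\<close>

lemma ptime_dot [ptime_intros]: "ptime bs \<Longrightarrow> ptime xs \<Longrightarrow> ptime (\<lambda>x. dot (bs x) (xs x))"
  unfolding dot_def by (intro ptime_intros)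

lemma ptime_move [ptime_intros]:
  assumes "ptime l" "ptime xs" "ptime gs"
  shows "ptime (\<lambda>x. move (l x) (xs x) (gs x))"
  unfolding move_def by (intro ptime_intros assms ptime_comp[OF assms(1)])

lemma ptime_fits [ptime_intros]:
  assumes "ptime F" "ptime cap" "ptime y"
  shows "ptime (\<lambda>x. fits (F x) (cap x) (y x))"
  unfolding fits_def by (intro ptime_intros assms ptime_comp[OF assms(3)])

lemma ptime_zeros [ptime_intros]: "ptime d \<Longrightarrow> ptime (\<lambda>x. zeros (d x))"
  unfolding zeros_def by (intro ptime_intros)

lemma ptime_column_sums [ptime_intros]:
  assumes "ptime d" "ptime X"
  shows "ptime (\<lambda>x. column_sums (d x) (X x))"
  unfolding column_sums_def by (intro ptime_intros assms ptime_comp[OF assms(2)])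

lemma ptime_extend_table [ptime_intros]:
  assumes "ptime M" "ptime F" "ptime l" "ptime cx" "ptime tab"
  shows "ptime (\<lambda>x. extend_table (M x) (F x) (l x) (cx x) (tab x))"
  unfolding extend_table_def
  by (intro ptime_intros assms ptime_comp[OF assms(1)] ptime_comp[OF assms(2)] ptime_comp[OF assms(3)] ptime_comp[OF assms(4)])

lemma length_extend_table: "length (extend_table M F l cx tab) \<le> length M"
proof -
  have "length (concat (map (\<lambda>s. case f s of [] \<Rightarrow> [] | c # _ \<Rightarrow> [c]) us)) \<le> length us" for f :: "int list \<Rightarrow> table" and us
    by (induction us) (auto split: list.split)
  then show ?thesis unfolding extend_table_def Let_def .
qed

text \<open>The extra 1 in the length and the extra vector \<open>z\<close> account for the initial
  table, whose zero sum is not assumed to lie in \<open>M\<close>.\<close>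

definition table_inv :: "int list list \<Rightarrow> int list \<Rightarrow> nat \<Rightarrow> table \<Rightarrow> bool" where
  "table_inv M z k tab \<longleftrightarrow> length tab \<le> length M + 1 \<and>
     (\<forall>c\<in>set tab. fst c \<in> insert z (set M) \<and> set (snd c) \<subseteq> set M \<and> length (snd c) \<le> k)"

lemma table_inv_fold:
  "table_inv M z k tab \<Longrightarrow> table_inv M z (k + length us) (fold (extend_table M F l) us tab)"
proof (induction us arbitrary: k tab)
  case (Cons cx us)
  obtain cap x where cx: "cx = (cap, x)" by (cases cx)
  have "table_inv M z (Suc k) (extend_table M F l cx tab)"
    unfolding table_inv_def
  proof (intro conjI ballI)
    show "length (extend_table M F l cx tab) \<le> length M + 1"
      using length_extend_table[of M F l cx tab] by simp
    fix c assume "c \<in> set (extend_table M F l cx tab)"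
    from extend_table_sound[OF this[unfolded cx]] obtain c0 g where
      c: "c0 \<in> set tab" "g \<in> set M" "c = (map2 (+) (fst c0) g, g # snd c0)" "fst c \<in> set M" by blast
    then show "fst c \<in> insert z (set M)" "set (snd c) \<subseteq> set M" "length (snd c) \<le> Suc k"
      using Cons.prems by (auto simp: table_inv_def)
  qed
  then show ?case using Cons.IH[of "Suc k"] by simp
qed simp

lemma table_inv_sz:
  assumes "table_inv M z k tab"
  shows "sz tab \<le> (length M + 1) * (sz z + sz M + (k * (sz M + 1) + 1) + 2) + 1"
proof -
  have "sz c \<le> sz z + sz M + (k * (sz M + 1) + 1) + 1" if "c \<in> set tab" for c
  proof -
    have c: "fst c \<in> insert z (set M)" "set (snd c) \<subseteq> set M" "length (snd c) \<le> k"
      using assms that by (auto simp: table_inv_def)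
    have 1: "sz (fst c) \<le> sz z + sz M" using c(1) by (auto dest: sz_member)
    have "sz (snd c) \<le> length (snd c) * (sz M + 1) + 1"
      using c(2) by (intro sz_list_le less_imp_le sz_member) auto
    also have "\<dots> \<le> k * (sz M + 1) + 1" using c(3) by (intro add_le_mono1 mult_le_mono1)
    finally have 2: "sz (snd c) \<le> k * (sz M + 1) + 1" .
    have "sz c = 1 + sz (fst c) + sz (snd c)" by (cases c) simp
    with 1 2 show ?thesis by linarith
  qed
  then have "sz tab \<le> length tab * (sz z + sz M + (k * (sz M + 1) + 1) + 1 + 1) + 1" by (rule sz_list_le)
  also have "\<dots> \<le> (length M + 1) * (sz z + sz M + (k * (sz M + 1) + 1) + 1 + 1) + 1"
    using assms by (intro add_le_mono1 mult_le_mono1) (simp add: table_inv_def)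
  finally show ?thesis by simp
qed

lemma table_inv_init: "table_inv M z 0 [(z, [])]"
  by (simp add: table_inv_def)

lemma ptime_full_table [ptime_intros]:
  assumes M: "ptime M" and F: "ptime F" and caps: "ptime caps" and d: "ptime d" and l: "ptime l" and X: "ptime X"
  shows "ptime (\<lambda>x. full_table (M x) (F x) (caps x) (d x) (l x) (X x))"
proof -
  define B where "B x = (sz (M x) + 1) * (sz (zeros (d x)) + sz (M x) + (sz (caps x) * (sz (M x) + 1) + 1) + 2) + 1" for x
  show ?thesis unfolding full_table_def
  proof (rule ptime_fold[where f = "\<lambda>x. extend_table (M x) (F x) (l x)" and B = B])
    show "poly_bounded B" unfolding B_def
      by (intro poly_bounded_intros ptime_zeros M caps d)
    show "ptime (\<lambda>p. extend_table (M (fst (fst p))) (F (fst (fst p))) (l (fst (fst p))) (snd (fst p)) (snd p))"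
      by (intro ptime_intros ptime_comp[OF M] ptime_comp[OF F] ptime_comp[OF l])
    fix x us vs assume us: "zip (caps x) (X x) = us @ vs"
    let ?t = "fold (extend_table (M x) (F x) (l x)) us [(zeros (d x), [])]"
    have "length us \<le> length (caps x)" using arg_cong[OF us, of length] by simp
    then have k: "length us \<le> sz (caps x)" using length_le_sz[of "caps x"] by simp
    have "table_inv (M x) (zeros (d x)) (0 + length us) ?t" by (rule table_inv_fold[OF table_inv_init])
    then have "sz ?t \<le> (length (M x) + 1) * (sz (zeros (d x)) + sz (M x) + ((0 + length us) * (sz (M x) + 1) + 1) + 2) + 1"
      by (rule table_inv_sz)
    also have "\<dots> \<le> B x" unfolding B_def
      using k length_le_sz[of "M x"] by (intro add_le_mono1 mult_le_mono add_le_mono order_refl) auto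
    finally show "sz ?t \<le> B x" .
  qed (intro ptime_intros caps X d)+
qed

lemma ptime_improvements [ptime_intros]:
  assumes "ptime M" "ptime F" "ptime caps" "ptime d" "ptime l" "ptime X"
  shows "ptime (\<lambda>x. improvements (M x) (F x) (caps x) (d x) (l x) (X x))"
  unfolding improvements_def
  by (intro ptime_intros assms ptime_comp[OF assms(4)] ptime_comp[OF assms(5)] ptime_comp[OF assms(6)])

lemma ptime_improve [ptime_intros]:
  assumes "ptime M" "ptime F" "ptime caps" "ptime d" "ptime l" "ptime X"
  shows "ptime (\<lambda>x. improve (M x) (F x) (caps x) (d x) (l x) (X x))"
  unfolding improve_def
  by (intro ptime_intros assms ptime_comp[OF assms(5)] ptime_comp[OF assms(6)])

lemma sz_power2_le: "sz ((2::int) ^ k) \<le> 4 * k + 9"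
  using sz_int_le[of "2 ^ k" "Suc k"] by simp

lemma ptime_step_lengths [ptime_intros]:
  assumes d: "ptime d"
  shows "ptime (\<lambda>x. step_lengths (d x))"
  unfolding step_lengths_def
proof (rule ptime_fold[where f = "\<lambda>x _ ls. (2 * head_or 1 ls) # ls" and
      B = "\<lambda>x. (sz (bits (nat (sum_list (d x)))) + 1) * (4 * sz (bits (nat (sum_list (d x)))) + 10) + 1"])
  fix x us vs assume us: "bits (nat (sum_list (d x))) = us @ vs"
  let ?n = "sz (bits (nat (sum_list (d x))))"
  have n: "length us \<le> ?n" using length_le_sz[of "us @ vs"] unfolding us by simp
  have eq: "fold (\<lambda>_ ls. (2 * head_or 1 ls) # ls) us (rev (map (\<lambda>k. 2 ^ k) [0..<Suc n])) = rev (map (\<lambda>k. (2::int) ^ k) [0..<Suc (n + length us)])"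
    for n and us :: "bool list"
  proof (induction us arbitrary: n)
    case (Cons u us)
    show ?case using Cons[of "Suc n"] by simp
  qed simp
  have "sz (rev (map (\<lambda>k. (2::int) ^ k) [0..<Suc (length us)])) \<le> length (rev (map (\<lambda>k. (2::int) ^ k) [0..<Suc (length us)])) * (4 * ?n + 9 + 1) + 1"
  proof (rule sz_list_le)
    fix a assume "a \<in> set (rev (map (\<lambda>k. (2::int) ^ k) [0..<Suc (length us)]))"
    then obtain k where "k \<le> length us" "a = 2 ^ k" by auto
    then show "sz a \<le> 4 * ?n + 9" using sz_power2_le[of k] n by simp
  qed
  also have "\<dots> \<le> (?n + 1) * (4 * ?n + 10) + 1" using n by (intro add_le_mono1 mult_le_mono) auto
  finally show "sz (fold (\<lambda>_ ls. (2 * head_or 1 ls) # ls) us [1 :: int]) \<le> (?n + 1) * (4 * ?n + 10) + 1"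
    using eq[of us 0] by simp
qed (intro ptime_intros ptime_bits poly_bounded_intros d)+

definition entries_le :: "nat \<Rightarrow> nat \<Rightarrow> int \<Rightarrow> int list list \<Rightarrow> bool" where
  "entries_le m n b X \<longleftrightarrow> length X \<le> m \<and> (\<forall>x\<in>set X. length x \<le> n \<and> (\<forall>a\<in>set x. \<bar>a\<bar> \<le> b))"

lemma entries_le_sz:
  assumes "entries_le m n b X" "b < 2 ^ k"
  shows "sz X \<le> m * (n * (4 * k + 6) + 2) + 1"
proof -
  have "sz x \<le> n * (4 * k + 6) + 1" if "x \<in> set X" for x
  proof -
    have "sz a \<le> 4 * k + 5" if "a \<in> set x" for a
      using assms \<open>x \<in> set X\<close> that by (intro sz_int_le) (force simp: entries_le_def)
    then have "sz x \<le> length x * (4 * k + 5 + 1) + 1" by (rule sz_list_le)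
    also have "\<dots> \<le> n * (4 * k + 5 + 1) + 1"
      using assms(1) that by (intro add_le_mono1 mult_le_mono1) (auto simp: entries_le_def)
    finally show ?thesis by (simp add: add.commute)
  qed
  then have "sz X \<le> length X * (n * (4 * k + 6) + 1 + 1) + 1" by (rule sz_list_le)
  also have "\<dots> \<le> m * (n * (4 * k + 6) + 1 + 1) + 1"
    using assms(1) by (intro add_le_mono1 mult_le_mono1) (auto simp: entries_le_def)
  finally show ?thesis by simp
qed

text \<open>Moves come from \<open>M\<close>, so one step changes an entry by a bounded amount.
  Magnitudes grow additively, and their bit lengths stay polynomial over the whole run.\<close>

lemma entries_le_improve:
  assumes X: "entries_le m n b X" and l: "\<bar>l\<bar> \<le> b'" and b': "0 \<le> b'"
  shows "entries_le m n (b + b' * 2 ^ sz M) (improve M F caps d l X)"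
proof (cases "improvements M F caps d l X")
  case Nil
  have "b \<le> b + b' * 2 ^ sz M" using b' by simp
  then show ?thesis using X Nil unfolding improve_def entries_le_def by fastforce
next
  case (Cons c cs)
  then have "c \<in> set (full_table M F caps d l X)"
    unfolding improvements_def by (auto dest!: filter_eq_ConsD)
  then have c: "set (snd c) \<subseteq> set M"
    using table_inv_fold[OF table_inv_init, where M = M and z = "zeros d" and F = F and l = l and us = "zip caps X"]
    unfolding full_table_def table_inv_def by blast
  show ?thesis unfolding entries_le_def
  proof (intro conjI ballI)
    show "length (improve M F caps d l X) \<le> m"
      using X Cons by (auto simp: improve_def entries_le_def)
    fix y assume "y \<in> set (improve M F caps d l X)"
    then obtain x g where y: "y = move l x g" "(x, g) \<in> set (zip X (rev (snd c)))"
      using Cons by (auto simp: improve_def)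
    then have y: "y = move l x g" "x \<in> set X" "g \<in> set M"
      using c set_zip_leftD[OF y(2)] set_zip_rightD[OF y(2)] by auto
    show "length y \<le> n" using y X by (auto simp: entries_le_def)
    fix a assume "a \<in> set y"
    then obtain u v where a: "a = u + l * v" "u \<in> set x" "v \<in> set g"
      unfolding y(1) move_def by (auto elim: in_set_zipE)
    have "sz v < sz M" using sz_member[OF a(3)] sz_member[OF y(3)] by simp
    then have "(2::int) ^ sz v \<le> 2 ^ sz M" by (intro power_increasing) auto
    then have "\<bar>v\<bar> \<le> 2 ^ sz M" using int_less_sz[of v] by linarith
    then have "\<bar>l * v\<bar> \<le> b' * 2 ^ sz M" unfolding abs_mult using l b' by (intro mult_mono) auto
    moreover have "\<bar>u\<bar> \<le> b" using X y(2) a(2) by (auto simp: entries_le_def)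
    ultimately show "\<bar>a\<bar> \<le> b + b' * 2 ^ sz M" unfolding a(1) by linarith
  qed
qed

theorem ptime_maxpack [ptime_intros]:
  assumes M: "ptime M" and F: "ptime F" and caps: "ptime caps" and d: "ptime d" and tries: "ptime tries"
  shows "ptime (\<lambda>x. maxpack (M x) (F x) (caps x) (d x) (tries x))"
proof -
  \<comment> \<open>The two nested loops are flattened into one over a list of step lengths, so that
    one size bound covers the entire computation.\<close>
  define steps where "steps x = concat (map (\<lambda>l. map (\<lambda>_. l) (tries x)) (step_lengths (d x)))" for x
  have steps: "ptime steps" unfolding steps_def
    by (intro ptime_intros tries d ptime_comp[OF tries])
  have eq: "fold (\<lambda>l X. fold (\<lambda>_ X. f l X) ts X) ls X = fold f (concat (map (\<lambda>l. map (\<lambda>_. l) ts) ls)) X"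
    for f :: "int \<Rightarrow> int list list \<Rightarrow> int list list" and ts :: "bool list" and ls X
  proof (induction ls arbitrary: X)
    case (Cons l ls)
    have "fold f (map (\<lambda>_. l) ts) X = fold (\<lambda>_ X. f l X) ts X" for X by (induction ts arbitrary: X) auto
    then show ?case using Cons by simp
  qed simp
  define k where "k x = sz (steps x) + sz (steps x) + sz (M x)" for x
  define B where "B x = sz (caps x) * (sz (d x) * (4 * k x + 6) + 2) + 1" for x
  have "ptime (\<lambda>x. fold (improve (M x) (F x) (caps x) (d x)) (steps x) (map (\<lambda>_. zeros (d x)) (caps x)))"
  proof (rule ptime_fold[where f = "\<lambda>x. improve (M x) (F x) (caps x) (d x)" and B = B])
    show "poly_bounded B" unfolding B_def k_def by (intro poly_bounded_intros caps d M steps)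
    show "ptime (\<lambda>p. improve (M (fst (fst p))) (F (fst (fst p))) (caps (fst (fst p))) (d (fst (fst p))) (snd (fst p)) (snd p))"
      by (intro ptime_intros ptime_comp[OF M] ptime_comp[OF F] ptime_comp[OF caps] ptime_comp[OF d])
    fix x us vs assume us: "steps x = us @ vs"
    define s where "s = (2::int) ^ sz (steps x)"
    have "entries_le (length (caps x)) (length (d x)) (b + int (length us) * (s * 2 ^ sz (M x)))
        (fold (improve (M x) (F x) (caps x) (d x)) us X)"
      if "set us \<subseteq> set (steps x)" "entries_le (length (caps x)) (length (d x)) b X" for us b X
      using that
    proof (induction us arbitrary: b X)
      case (Cons u us)
      have "sz u \<le> sz (steps x)" using Cons.prems(1) by (simp add: sz_member less_imp_le)
      then have "(2::int) ^ sz u \<le> s" unfolding s_def by (intro power_increasing) auto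
      then have "\<bar>u\<bar> \<le> s" using int_less_sz[of u] by linarith
      from entries_le_improve[OF Cons.prems(2) this]
      have "entries_le (length (caps x)) (length (d x)) (b + s * 2 ^ sz (M x)) (improve (M x) (F x) (caps x) (d x) u X)"
        by (simp add: s_def)
      from Cons.IH[OF _ this] Cons.prems(1) show ?case by (simp add: algebra_simps)
    qed simp
    from this[of us 0 "map (\<lambda>_. zeros (d x)) (caps x)"] us
    have "entries_le (length (caps x)) (length (d x)) (int (length us) * (s * 2 ^ sz (M x)))
        (fold (improve (M x) (F x) (caps x) (d x)) us (map (\<lambda>_. zeros (d x)) (caps x)))"
      by (auto simp: entries_le_def zeros_def)
    moreover have "int (length us) * (s * 2 ^ sz (M x)) < 2 ^ k x"
    proof -
      have "length us < 2 ^ sz (steps x)"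
      proof -
        have "length us \<le> sz (steps x)" using length_le_sz[of "us @ vs"] unfolding us by simp
        also have "\<dots> < 2 ^ sz (steps x)" by (rule less_exp)
        finally show ?thesis .
      qed
      then have "int (length us) < int (2 ^ sz (steps x))" by (simp only: of_nat_less_iff)
      then have "int (length us) < 2 ^ sz (steps x)" by (simp only: of_nat_power of_nat_numeral)
      then have "int (length us) * (s * 2 ^ sz (M x)) < 2 ^ sz (steps x) * (s * 2 ^ sz (M x))"
        by (intro mult_strict_right_mono) (auto simp: s_def)
      then show ?thesis by (simp add: k_def s_def power_add mult.assoc)
    qed
    ultimately have "sz (fold (improve (M x) (F x) (caps x) (d x)) us (map (\<lambda>_. zeros (d x)) (caps x)))
      \<le> length (caps x) * (length (d x) * (4 * k x + 6) + 2) + 1" by (rule entries_le_sz)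
    also have "\<dots> \<le> B x" unfolding B_def
      by (intro add_le_mono1 mult_le_mono add_le_mono order_refl length_le_sz)
    finally show "sz (fold (improve (M x) (F x) (caps x) (d x)) us (map (\<lambda>_. zeros (d x)) (caps x))) \<le> B x" .
  qed (intro ptime_intros steps caps d ptime_comp[OF d])+
  then show ?thesis unfolding maxpack_def eq steps_def .
qed

section \<open>Rounding a bipartite degree matrix\<close>

text \<open>Divided by \<open>n\<close>, the residues form a fractional matrix with entries in
  \<open>[0,1)\<close> and integral margins. The aim is a 0-1 matrix with the same margins that
  vanishes where the residue does: integrality of a transportation polytope.\<close>

locale rounding =
  fixes \<rho> :: "nat \<Rightarrow> nat \<Rightarrow> nat" and m a n :: nat and U C :: "nat \<Rightarrow> nat"
  assumes n: "n > 0" and rho_less: "\<And>i k. i < m \<Longrightarrow> k < a \<Longrightarrow> \<rho> i k < n"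
    and col: "\<And>i. i < m \<Longrightarrow> (\<Sum>k<a. \<rho> i k) = n * U i"
    and row: "\<And>k. k < a \<Longrightarrow> (\<Sum>i<m. \<rho> i k) = n * C k"
begin

definition hi :: "nat \<Rightarrow> nat \<Rightarrow> nat" where
  "hi i k = (if \<rho> i k = 0 then 0 else 1)"

text \<open>The sums for each \<open>i\<close> are right from the start; only the sums for each
  \<open>k\<close> have to be repaired.\<close>

definition ok :: "(nat \<Rightarrow> nat \<Rightarrow> nat) \<Rightarrow> bool" where
  "ok y \<longleftrightarrow> (\<forall>i<m. (\<forall>k<a. y i k \<le> hi i k) \<and> (\<Sum>k<a. y i k) = U i)"

text \<open>A unit of some \<open>i\<close> can be moved from \<open>k\<close> to \<open>k'\<close>,
  which keeps the sum for that \<open>i\<close>.\<close>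

definition arc :: "(nat \<Rightarrow> nat \<Rightarrow> nat) \<Rightarrow> nat \<Rightarrow> nat \<Rightarrow> bool" where
  "arc y k k' \<longleftrightarrow> k < a \<and> k' < a \<and> (\<exists>i<m. 0 < y i k \<and> y i k' < hi i k')"

lemma rho_le_hi: "i < m \<Longrightarrow> k < a \<Longrightarrow> \<rho> i k \<le> n * hi i k"
  using rho_less[of i k] by (simp add: hi_def less_imp_le)

lemma ok_exists: "\<exists>y. ok y"
proof -
  have "\<exists>b. (\<forall>k. b k \<le> hi i k) \<and> sum b {..<a} = U i" if i: "i < m" for i
  proof (rule choose_below)
    have "n * U i \<le> (\<Sum>k<a. n * hi i k)" unfolding col[OF i, symmetric] by (intro sum_mono rho_le_hi i) auto
    then have "n * U i \<le> n * (\<Sum>k<a. hi i k)" by (simp only: sum_distrib_left)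
    then show "U i \<le> sum (hi i) {..<a}" using n by simp
  qed
  then have "\<exists>b. i < m \<longrightarrow> (\<forall>k. b k \<le> hi i k) \<and> sum b {..<a} = U i" for i by blast
  then obtain y where "\<And>i. i < m \<Longrightarrow> (\<forall>k. y i k \<le> hi i k) \<and> sum (y i) {..<a} = U i" by metis
  then show ?thesis unfolding ok_def by blast
qed

text \<open>Shifting along the last arc first keeps the earlier arcs of a simple path available.\<close>

lemma shift_path:
  "ok y \<Longrightarrow> ks \<noteq> [] \<Longrightarrow> distinct ks \<Longrightarrow> successively (arc y) ks \<Longrightarrow>
   \<exists>y'. ok y' \<and> (\<forall>k<a. (\<Sum>i<m. y' i k) + of_bool (k = hd ks) = (\<Sum>i<m. y i k) + of_bool (k = last ks))"
proof (induction ks arbitrary: y rule: rev_induct)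
  case (snoc b ks)
  show ?case
  proof (cases "ks = []")
    case False
    define p where "p = last ks"
    have "arc y p b" using snoc.prems(4) False by (simp add: successively_append_iff p_def)
    then obtain i where i: "i < m" "0 < y i p" "y i b < hi i b" and pb: "p < a" "b < a"
      by (auto simp: arc_def)
    have neq: "p \<noteq> b" "b \<notin> set ks" using snoc.prems(3) False by (auto simp: p_def)
    define y' where "y' = y(i := (y i)(p := y i p - 1, b := y i b + 1))"
    have y': "y' j k = (if j = i \<and> k = p then y i p - 1 else if j = i \<and> k = b then y i b + 1 else y j k)" for j k
      using neq by (simp add: y'_def)
    have two: "sum f {..<a} = f p + f b + sum f ({..<a} - {p, b})" for f :: "nat \<Rightarrow> nat"
    proof -
      have "sum f {..<a} = f p + sum f ({..<a} - {p})" by (rule sum.remove) (use pb in auto)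
      also have "sum f ({..<a} - {p}) = f b + sum f ({..<a} - {p} - {b})"
        by (rule sum.remove) (use pb neq in auto)
      also have "{..<a} - {p} - {b} = {..<a} - {p, b}" by auto
      finally show ?thesis by (simp add: add.assoc)
    qed
    have cols: "(\<Sum>k<a. y' i k) = (\<Sum>k<a. y i k)"
    proof -
      have "sum (y' i) ({..<a} - {p, b}) = sum (y i) ({..<a} - {p, b})"
        by (intro sum.cong) (auto simp: y')
      then show ?thesis unfolding two using i neq by (simp add: y')
    qed
    have ok': "ok y'" unfolding ok_def
    proof (intro allI impI conjI)
      fix j assume j: "j < m"
      show "(\<Sum>k<a. y' j k) = U j"
        using cols snoc.prems(1) j by (cases "j = i") (auto simp: ok_def y')
      fix k assume "k < a"
      then have "y j k \<le> hi j k" using snoc.prems(1) j by (simp add: ok_def)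
      then show "y' j k \<le> hi j k" using i(3) by (auto simp: y')
    qed
    have rows: "(\<Sum>j<m. y' j k) + of_bool (k = p) = (\<Sum>j<m. y j k) + of_bool (k = b)" for k
    proof -
      have "(\<Sum>j<m. y' j k) = y' i k + sum (\<lambda>j. y j k) ({..<m} - {i})"
        "(\<Sum>j<m. y j k) = y i k + sum (\<lambda>j. y j k) ({..<m} - {i})"
        using i(1) by (subst sum.remove[of _ i], auto simp: y' intro!: sum.cong)+
      then show ?thesis using i(2) neq by (auto simp: y')
    qed
    have dist: "distinct ks" using snoc.prems(3) by simp
    have "successively (arc y) ks" using snoc.prems(4) by (simp add: successively_append_iff)
    \<comment> \<open>Only entries at \<open>p\<close> and \<open>b\<close> have changed. No earlier
      arc starts in \<open>p\<close> or touches \<open>b\<close>, and one that ends in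
      \<open>p\<close> has gained room.\<close>
    moreover have "arc y' k k'" if "arc y k k'" "k \<in> set (butlast ks)" "k' \<in> set ks" for k k'
    proof -
      have "k \<noteq> p" using that(2) dist False unfolding p_def
        by (metis append_butlast_last_id distinct_append disjoint_iff list.set_intros(1))
      moreover have "k \<noteq> b" "k' \<noteq> b" using that(2,3) neq(2) in_set_butlastD by fast+
      ultimately show ?thesis using that(1) unfolding arc_def y' by (auto intro: le_less_trans[OF diff_le_self])
    qed
    moreover have "successively Q ks" if "successively P ks" "\<And>k k'. P k k' \<Longrightarrow> k \<in> set (butlast ks) \<Longrightarrow> k' \<in> set ks \<Longrightarrow> Q k k'"
      for P Q :: "nat \<Rightarrow> nat \<Rightarrow> bool" and ks
      using that
    proof (induction ks)
      case (Cons x xs)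
      then show ?case by (cases xs) auto
    qed simp
    ultimately have "successively (arc y') ks" by blast
    from snoc.IH[OF ok' False dist this] obtain y'' where y'': "ok y''"
      "\<And>k. k < a \<Longrightarrow> (\<Sum>i<m. y'' i k) + of_bool (k = hd ks) = (\<Sum>i<m. y' i k) + of_bool (k = p)"
      unfolding p_def by blast
    then show ?thesis using rows False by (intro exI[of _ y'']) (auto simp: hd_append)
  qed (use snoc in auto)
qed simp

text \<open>Augmenting paths as in bipartite flow: a unit is shifted from an overfull
  \<open>s\<close> to a deficient \<open>b\<close> reachable from it, which lowers the total excess.
  If nothing reachable is deficient, the reachable set contradicts the fractional solution.\<close>

lemma rounding_exists:
  "\<exists>y. (\<forall>i<m. \<forall>k<a. y i k \<le> hi i k) \<and> (\<forall>i<m. (\<Sum>k<a. y i k) = U i) \<and> (\<forall>k<a. (\<Sum>i<m. y i k) = C k)"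
proof -
  define r where "r y k = (\<Sum>i<m. y i k)" for y :: "nat \<Rightarrow> nat \<Rightarrow> nat" and k
  have total: "(\<Sum>k<a. r y k) = (\<Sum>k<a. C k)" if "ok y" for y
  proof -
    have "(\<Sum>k<a. r y k) = (\<Sum>i<m. U i)" using that unfolding r_def by (subst sum.swap) (simp add: ok_def)
    moreover have "n * (\<Sum>i<m. U i) = n * (\<Sum>k<a. C k)"
      unfolding sum_distrib_left using col row sum.swap[of \<rho> "{..<a}" "{..<m}"] by simp
    ultimately show ?thesis using n by simp
  qed
  have step: "\<exists>y'. ok y' \<and> (\<Sum>k<a. r y' k - C k) < (\<Sum>k<a. r y k - C k)"
    if y: "ok y" and excess: "(\<Sum>k<a. r y k - C k) > 0" for y
  proof -
    from excess obtain s where s: "s < a" "r y s > C s"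
      by (metis (no_types, lifting) diff_is_0_eq lessThan_iff not_less sum.neutral less_numeral_extra(3) linorder_not_less)
    define S where "S = {k. \<exists>ks. ks \<noteq> [] \<and> hd ks = s \<and> last ks = k \<and> distinct ks \<and> successively (arc y) ks \<and> set ks \<subseteq> {..<a}}"
    have sS: "s \<in> S" unfolding S_def using s by (auto intro!: exI[of _ "[s]"])
    have Sa: "S \<subseteq> {..<a}" unfolding S_def using last_in_set by blast
    have closed: "k' \<in> S" if "k \<in> S" "arc y k k'" for k k'
    proof -
      from that(1) obtain ks where ks: "ks \<noteq> []" "hd ks = s" "last ks = k" "distinct ks" "successively (arc y) ks" "set ks \<subseteq> {..<a}"
        unfolding S_def by blast
      show ?thesis
      proof (cases "k' \<in> set ks")
        case True
        then obtain us vs where uv: "ks = us @ k' # vs" by (meson split_list)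
        have "hd (us @ [k']) = s" using ks(2) uv by (cases us) auto
        moreover have "distinct (us @ [k'])" using ks(4) uv by simp
        moreover have "ks = (us @ [k']) @ vs" using uv by simp
        then have "successively (arc y) (us @ [k'])" using ks(5) successively_append_iff by metis
        moreover have "set (us @ [k']) \<subseteq> {..<a}" using ks(6) uv by auto
        ultimately show ?thesis unfolding S_def by (auto intro!: exI[of _ "us @ [k']"])
      next
        case False
        have "k' < a" using that(2) by (simp add: arc_def)
        then show ?thesis using ks False that(2) unfolding S_def
          by (auto intro!: exI[of _ "ks @ [k']"] simp: successively_append_iff)
      qed
    qed
    have "\<exists>b\<in>S. r y b < C b"
    proof (rule ccontr)
      assume "\<not> ?thesis"
      then have ge: "\<And>k. k \<in> S \<Longrightarrow> C k \<le> r y k" by force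
      have finS: "finite S" using Sa finite_subset by blast
      have 1: "(\<Sum>k\<in>S. C k) < (\<Sum>k\<in>S. r y k)"
        using ge s sS finS by (intro sum_strict_mono_ex1) auto
      \<comment> \<open>If \<open>i\<close> has a unit inside \<open>S\<close>, it is saturated
        outside, as no arc leaves \<open>S\<close>. Outside it then has at least its fractional
        share, and hence inside at most that share.\<close>
      have coli: "(\<Sum>k\<in>S. n * y i k) \<le> (\<Sum>k\<in>S. \<rho> i k)" if i: "i < m" for i
      proof (cases "\<exists>k\<in>S. 0 < y i k")
        case True
        then obtain k where k: "k \<in> S" "0 < y i k" by blast
        have ge': "\<rho> i k' \<le> n * y i k'" if k': "k' \<in> {..<a} - S" for k'
        proof -
          have "\<not> arc y k k'" using closed[OF k(1)] k' by blast
          then have "hi i k' \<le> y i k'" using k Sa k' i unfolding arc_def by fastforce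
          then have "n * hi i k' \<le> n * y i k'" by (rule mult_le_mono2)
          moreover have "\<rho> i k' \<le> n * hi i k'" using k' by (intro rho_le_hi i) simp
          ultimately show ?thesis by (rule order_trans[rotated])
        qed
        have "(\<Sum>k<a. n * y i k) = (\<Sum>k<a. \<rho> i k)"
          using y i col[OF i] by (simp add: ok_def flip: sum_distrib_left)
        then have "(\<Sum>k\<in>S. n * y i k) + (\<Sum>k\<in>{..<a} - S. n * y i k) = (\<Sum>k\<in>S. \<rho> i k) + (\<Sum>k\<in>{..<a} - S. \<rho> i k)"
          using Sa by (simp add: sum.subset_diff[OF Sa] add.commute)
        moreover have "(\<Sum>k\<in>{..<a} - S. \<rho> i k) \<le> (\<Sum>k\<in>{..<a} - S. n * y i k)"
          using ge' by (rule sum_mono)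
        ultimately show ?thesis by linarith
      next
        case False
        then show ?thesis by simp
      qed
      have "n * (\<Sum>k\<in>S. r y k) = (\<Sum>i<m. \<Sum>k\<in>S. n * y i k)"
        unfolding r_def sum_distrib_left by (rule sum.swap)
      also have "\<dots> \<le> (\<Sum>i<m. \<Sum>k\<in>S. \<rho> i k)" by (rule sum_mono) (simp add: coli)
      also have "\<dots> = (\<Sum>k\<in>S. \<Sum>i<m. \<rho> i k)" by (rule sum.swap)
      also have "\<dots> = n * (\<Sum>k\<in>S. C k)" unfolding sum_distrib_left using row Sa by (intro sum.cong) auto
      finally show False using 1 n by simp
    qed
    then obtain b where b: "b \<in> S" "r y b < C b" by blast
    then obtain ks where ks: "ks \<noteq> []" "hd ks = s" "last ks = b" "distinct ks" "successively (arc y) ks"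
      unfolding S_def by blast
    from shift_path[OF y ks(1,4,5)] obtain y' where y': "ok y'"
      "\<And>k. k < a \<Longrightarrow> r y' k + of_bool (k = s) = r y k + of_bool (k = b)" unfolding ks r_def by blast
    have "s \<noteq> b" using s b by auto
    have "(\<Sum>k<a. r y' k - C k) < (\<Sum>k<a. r y k - C k)"
    proof (rule sum_strict_mono_ex1)
      show "\<forall>k\<in>{..<a}. r y' k - C k \<le> r y k - C k"
      proof
        fix k assume "k \<in> {..<a}"
        then have "r y' k + of_bool (k = s) = r y k + of_bool (k = b)" using y'(2) by simp
        then show "r y' k - C k \<le> r y k - C k" using b(2) by (cases "k = b"; cases "k = s") auto
      qed
      have "r y' s - C s < r y s - C s" using y'(2)[OF s(1)] \<open>s \<noteq> b\<close> s(2) by simp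
      then show "\<exists>k\<in>{..<a}. r y' k - C k < r y k - C k" using s(1) by blast
    qed simp
    with y'(1) show ?thesis by blast
  qed
  have "\<exists>y'. ok y' \<and> (\<Sum>k<a. r y' k - C k) = 0" if "ok y" for y
    using that
  proof (induction "\<Sum>k<a. r y k - C k" arbitrary: y rule: less_induct)
    case less
    show ?case
    proof (cases "(\<Sum>k<a. r y k - C k) = 0")
      case False
      then show ?thesis using step[OF less.prems] less.hyps by blast
    qed (use less.prems in blast)
  qed
  then obtain y where y: "ok y" "(\<Sum>k<a. r y k - C k) = 0" using ok_exists by blast
  \<comment> \<open>Without excess all sums are at most \<open>C\<close>, and equal totals turn this
    into equality.\<close>
  have le: "r y k \<le> C k" if "k < a" for k using y(2) that by simp
  have "r y k = C k" if k: "k < a" for k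
  proof (rule ccontr)
    assume "r y k \<noteq> C k"
    then have "(\<Sum>k<a. r y k) < (\<Sum>k<a. C k)" using le k
      by (intro sum_strict_mono_ex1) (auto intro!: bexI[of _ k] simp: less_le)
    with total[OF y(1)] show False by simp
  qed
  then show ?thesis using y(1) unfolding ok_def r_def by (intro exI[of _ y]) auto
qed

end

section \<open>Decomposing a multiple into few patterns\<close>

text \<open>The singletons turn the bound of each entry into a brick constraint; the last mask is
  the sum over the brick.\<close>

definition unit_masks :: "nat list \<Rightarrow> bool list list" where
  "unit_masks ks = map (\<lambda>k. map (\<lambda>e. e = k) ks) ks @ [map (\<lambda>_. True) ks]"

text \<open>Only entries with nonzero remainder may be rounded up. The last capacity counts the
  units that rounding down leaves missing from the margin of one pattern.\<close>

definition round_caps :: "nat \<Rightarrow> nat list \<Rightarrow> int list" where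
  "round_caps n x = map (\<lambda>q. if q mod n = 0 then 0 else 1) x @
     [int (sum_list x div n - sum_list (map (\<lambda>q. q div n) x))]"

definition round_rows :: "nat \<Rightarrow> nat list \<Rightarrow> nat list list \<Rightarrow> int list" where
  "round_rows n ks Z = map (\<lambda>k. int (sum_list (map (\<lambda>x. nth_or 0 x k) Z) div n -
     sum_list (map (\<lambda>x. nth_or 0 x k div n) Z))) ks"

definition round_up ::
    "int list list \<Rightarrow> bool list \<Rightarrow> nat list \<Rightarrow> nat \<Rightarrow> nat list list \<Rightarrow> int list list" where
  "round_up M tries ks n Z =
     maxpack M (unit_masks ks) (map (round_caps n) Z) (round_rows n ks Z) tries"

definition slice :: "nat \<Rightarrow> nat list list \<Rightarrow> int list list \<Rightarrow> nat list list" where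
  "slice n Z Y = map2 (\<lambda>x y. map2 (\<lambda>q r. q div n + nat r) x y) Z Y"

text \<open>For \<open>q = n * b + r\<close>, an entry rounded up can be peeled \<open>r\<close>
  times until its remainder is used up, one rounded down \<open>n - r\<close> times until the
  remainder equals the number of consumers left. In both cases the entry becomes a multiple of that
  number.\<close>

definition multiplicity :: "nat \<Rightarrow> nat list list \<Rightarrow> int list list \<Rightarrow> nat" where
  "multiplicity n Z Y =
     fold min (concat (map2 (\<lambda>x y. map2 (\<lambda>q r. if 0 < r then q mod n else n - q mod n) x y) Z Y)) n"

definition peel ::
    "int list list \<Rightarrow> bool list \<Rightarrow> nat list \<Rightarrow> nat \<times> nat list list \<Rightarrow> nat \<times> nat list list" where
  "peel M tries ks s = (let n = fst s; Z = snd s; Y = round_up M tries ks n Z in (multiplicity n Z Y, slice n Z Y))"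

definition remaining :: "nat \<times> nat list list \<Rightarrow> nat \<times> nat list list \<Rightarrow> nat \<times> nat list list" where
  "remaining s p = (fst s - fst p, map2 (\<lambda>x z. map2 (\<lambda>q w. q - fst p * w) x z) (snd s) (snd p))"

text \<open>Rounds after the last consumer has been served contribute patterns of multiplicity 0.\<close>

definition decompose ::
    "int list list \<Rightarrow> bool list \<Rightarrow> nat list \<Rightarrow> 'a list \<Rightarrow> nat \<Rightarrow> nat list list \<Rightarrow> (nat \<times> nat list list) list" where
  "decompose M tries ks us n Z =
     snd (fold (\<lambda>_ a. (remaining (fst a) (peel M tries ks (fst a)), peel M tries ks (fst a) # snd a)) us ((n, Z), []))"

lemma fold_min: "fold min xs (n::nat) \<le> n" "x \<in> set xs \<Longrightarrow> fold min xs n \<le> x" "fold min xs n \<in> insert n (set xs)"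
proof -
  have 1: "fold min xs n \<le> n" for xs and n :: nat
  proof (induction xs arbitrary: n)
    case (Cons x xs)
    show ?case using Cons[of "min x n"] by simp
  qed simp
  then show "fold min xs n \<le> n" .
  show "x \<in> set xs \<Longrightarrow> fold min xs n \<le> x"
  proof (induction xs arbitrary: n)
    case (Cons y ys)
    then show ?case using 1[of ys "min y n"] by auto
  qed simp
  show "fold min xs n \<in> insert n (set xs)"
  proof (induction xs arbitrary: n)
    case (Cons y ys)
    show ?case using Cons[of "min y n"] by (auto simp: min_def)
  qed simp
qed

section \<open>Correctness of rounding and peeling\<close>

lemma map2_nth_conv:
  "length xs = n \<Longrightarrow> length ys = n \<Longrightarrow> map2 f xs ys = map (\<lambda>i. f (xs ! i) (ys ! i)) [0..<n]"
  by (rule nth_equalityI) auto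

text \<open>A brick has \<open>a\<close> entries and \<open>a + 1\<close> constraints from
  \<open>unit_masks\<close>, whence the arguments of the bounds. In the application \<open>a\<close>
  is the number of commodities plus one for the slack.\<close>

locale decomposition =
  fixes M :: "int list list" and tries :: "bool list" and a m :: nat and u c :: "nat \<Rightarrow> nat"
  assumes M_length: "\<And>g. g \<in> set M \<Longrightarrow> length g = a"
    and M_box: "\<And>g. length g = a \<Longrightarrow> (\<And>e. e < a \<Longrightarrow> \<bar>g ! e\<bar> \<le> int (step_bound a (a + 1))) \<Longrightarrow> g \<in> set M"
    and tries: "length tries \<ge> 2 * (m + 1) * gap_bound a (a + 1)"
begin

definition shaped :: "nat list list \<Rightarrow> bool" where
  "shaped Z \<longleftrightarrow> length Z = m \<and> (\<forall>i<m. length (Z ! i) = a)"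

text \<open>\<open>margins n\<close> fits the sum of \<open>n\<close> patterns,
  \<open>margins 1\<close> a single pattern.\<close>

definition margins :: "nat \<Rightarrow> nat list list \<Rightarrow> bool" where
  "margins n Z \<longleftrightarrow> shaped Z \<and> (\<forall>i<m. (\<Sum>k<a. Z ! i ! k) = n * u i) \<and> (\<forall>k<a. (\<Sum>i<m. Z ! i ! k) = n * c k)"

definition fractional :: "nat \<Rightarrow> nat list list \<Rightarrow> (nat \<times> nat) set" where
  "fractional n Z = {(i, k). i < m \<and> k < a \<and> Z ! i ! k mod n \<noteq> 0}"

lemma packing: "shaped Z \<Longrightarrow> packing M (unit_masks [0..<a]) (map (round_caps n) Z) (round_rows n [0..<a] Z)"
  unfolding packing_def
proof (intro conjI allI impI)
  let ?F = "unit_masks [0..<a]" and ?d = "round_rows n [0..<a] Z"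
  have d: "length ?d = a" by (simp add: round_rows_def)
  have F: "length ?F = a + 1" by (simp add: unit_masks_def)
  fix g :: "int list" assume "length g = length ?d" "\<forall>e. e < length ?d \<longrightarrow> \<bar>g ! e\<bar> \<le> int (step_bound (length ?d) (length ?F))"
  then show "g \<in> set M" unfolding d F by (intro M_box) auto
next
  fix cap assume Z: "shaped Z" and "cap \<in> set (map (round_caps n) Z)"
  then obtain x where x: "cap = round_caps n x" "length x = a"
    by (auto simp: shaped_def in_set_conv_nth)
  then show "length cap = length (unit_masks [0..<a])" by (simp add: round_caps_def unit_masks_def)
  fix b assume "b \<in> set cap"
  then show "0 \<le> b" using x by (auto simp: round_caps_def)
qed (auto simp: unit_masks_def round_rows_def M_length)

lemma round_up_shape:
  assumes "shaped Z"
  shows "length (round_up M tries [0..<a] n Z) = m" "i < m \<Longrightarrow> length (round_up M tries [0..<a] n Z ! i) = a"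
proof -
  interpret packing M "unit_masks [0..<a]" "map (round_caps n) Z" "round_rows n [0..<a] Z"
    by (rule packing[OF assms])
  have l: "length (map (round_caps n) Z) = m" "length (round_rows n [0..<a] Z) = a" "length (unit_masks [0..<a]) = a + 1"
    using assms by (auto simp: shaped_def round_rows_def unit_masks_def)
  have "valid (round_up M tries [0..<a] n Z)" unfolding round_up_def
    by (rule maxpack_optimal(1)) (use tries l in simp)
  then show "length (round_up M tries [0..<a] n Z) = m" "i < m \<Longrightarrow> length (round_up M tries [0..<a] n Z ! i) = a"
    using valid_lengths l by auto
qed

lemma sum_list_nth: "length xs = k \<Longrightarrow> sum_list xs = (\<Sum>i<k. xs ! i)" for xs :: "'b::comm_monoid_add list"
  by (simp add: sum_list_sum_nth atLeast0LessThan)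

text \<open>By \<open>rounding_exists\<close> some packing meets all margins. A packing of maximal
  total has at least the same total, and since every margin is an upper bound, it meets all of them
  as well.\<close>

lemma round_up_correct:
  assumes Z: "margins n Z" and n: "n > 0"
  defines "Y \<equiv> round_up M tries [0..<a] n Z"
  shows "\<And>i k. i < m \<Longrightarrow> k < a \<Longrightarrow> 0 \<le> Y ! i ! k \<and> Y ! i ! k \<le> (if Z ! i ! k mod n = 0 then 0 else 1)"
    and "\<And>i. i < m \<Longrightarrow> (\<Sum>k<a. Z ! i ! k div n + nat (Y ! i ! k)) = u i"
    and "\<And>k. k < a \<Longrightarrow> (\<Sum>i<m. Z ! i ! k div n + nat (Y ! i ! k)) = c k"
proof -
  have sh: "shaped Z" using Z by (simp add: margins_def)
  let ?caps = "map (round_caps n) Z" and ?d = "round_rows n [0..<a] Z" and ?F = "unit_masks [0..<a]"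
  interpret packing M ?F ?caps ?d by (rule packing[OF sh])
  have l: "length ?caps = m" "length ?d = a" "length ?F = a + 1"
    using sh by (auto simp: shaped_def round_rows_def unit_masks_def)
  define U where "U i = u i - (\<Sum>k<a. Z ! i ! k div n)" for i
  define C where "C k = c k - (\<Sum>i<m. Z ! i ! k div n)" for k
  have Ui: "(\<Sum>k<a. Z ! i ! k div n) + U i = u i" "(\<Sum>k<a. Z ! i ! k mod n) = n * U i" if i: "i < m" for i
  proof -
    have *: "n * u i = n * (\<Sum>k<a. Z ! i ! k div n) + (\<Sum>k<a. Z ! i ! k mod n)"
      using Z i by (simp add: margins_def sum_distrib_left sum.distrib[symmetric])
    then have "n * (\<Sum>k<a. Z ! i ! k div n) \<le> n * u i" by simp
    then have le: "(\<Sum>k<a. Z ! i ! k div n) \<le> u i" using n by simp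
    then show 1: "(\<Sum>k<a. Z ! i ! k div n) + U i = u i" by (simp add: U_def)
    show "(\<Sum>k<a. Z ! i ! k mod n) = n * U i" using * unfolding 1[symmetric] by (simp add: distrib_left)
  qed
  have Ck: "(\<Sum>i<m. Z ! i ! k div n) + C k = c k" "(\<Sum>i<m. Z ! i ! k mod n) = n * C k" if k: "k < a" for k
  proof -
    have *: "n * c k = n * (\<Sum>i<m. Z ! i ! k div n) + (\<Sum>i<m. Z ! i ! k mod n)"
      using Z k by (simp add: margins_def sum_distrib_left sum.distrib[symmetric])
    then have "n * (\<Sum>i<m. Z ! i ! k div n) \<le> n * c k" by simp
    then have le: "(\<Sum>i<m. Z ! i ! k div n) \<le> c k" using n by simp
    then show 1: "(\<Sum>i<m. Z ! i ! k div n) + C k = c k" by (simp add: C_def)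
    show "(\<Sum>i<m. Z ! i ! k mod n) = n * C k" using * unfolding 1[symmetric] by (simp add: distrib_left)
  qed
  have d: "?d ! k = int (C k)" if k: "k < a" for k
  proof -
    have "sum_list (map (\<lambda>x. nth_or 0 x k) Z) = (\<Sum>i<m. Z ! i ! k)"
      "sum_list (map (\<lambda>x. nth_or 0 x k div n) Z) = (\<Sum>i<m. Z ! i ! k div n)"
      using sh k by (auto simp: shaped_def sum_list_nth[where k = m])
    then show ?thesis using k n Z by (simp add: round_rows_def C_def margins_def)
  qed
  have cap_k: "?caps ! i ! k = (if Z ! i ! k mod n = 0 then 0 else 1)" if "i < m" "k < a" for i k
    using sh that by (simp add: shaped_def round_caps_def nth_append)
  have cap_a: "?caps ! i ! a = int (U i)" if i: "i < m" for i
  proof -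
    have "sum_list (Z ! i) = (\<Sum>k<a. Z ! i ! k)" "sum_list (map (\<lambda>q. q div n) (Z ! i)) = (\<Sum>k<a. Z ! i ! k div n)"
      using sh i by (auto simp: shaped_def sum_list_nth[where k = a])
    then show ?thesis using sh i n Z by (simp add: round_caps_def U_def margins_def shaped_def nth_append)
  qed
  have edges_k: "edges k = {k}" if "k < a" for k
    unfolding edges_def using that l by (auto simp: unit_masks_def nth_append)
  have edges_a: "edges a = {..<a}"
    unfolding edges_def using l by (auto simp: unit_masks_def nth_append)
  have valid_iff: "valid Y \<longleftrightarrow> length Y = m \<and> (\<forall>i<m. length (Y ! i) = a \<and>
      (\<forall>k<a. 0 \<le> Y ! i ! k \<and> Y ! i ! k \<le> (if Z ! i ! k mod n = 0 then 0 else 1)) \<and>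
      (\<Sum>k<a. Y ! i ! k) \<le> int (U i)) \<and> (\<forall>k<a. (\<Sum>i<m. Y ! i ! k) \<le> int (C k))" for Y
  proof -
    have "brick_fits {..<a} {..<a + 1} edges (\<lambda>f. ?caps ! i ! f) x \<longleftrightarrow>
        (\<forall>k<a. 0 \<le> x k \<and> x k \<le> (if Z ! i ! k mod n = 0 then 0 else 1)) \<and> (\<Sum>k<a. x k) \<le> int (U i)" if "i < m" for i x
    proof -
      have "(\<forall>f\<in>{..<a + 1}. sum x (edges f) \<le> ?caps ! i ! f) \<longleftrightarrow>
          (\<forall>k<a. sum x (edges k) \<le> ?caps ! i ! k) \<and> sum x (edges a) \<le> ?caps ! i ! a"
        by (auto simp: less_Suc_eq)
      also have "\<dots> \<longleftrightarrow> (\<forall>k<a. x k \<le> (if Z ! i ! k mod n = 0 then 0 else 1)) \<and> (\<Sum>k<a. x k) \<le> int (U i)"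
        using cap_k[OF that] cap_a[OF that] edges_k edges_a by simp
      finally show ?thesis unfolding brick_fits_def by auto
    qed
    then show ?thesis unfolding valid_def valid_brick_def l by (auto simp: d)
  qed
  have tot: "total Y = (\<Sum>i<m. \<Sum>k<a. Y ! i ! k)" for Y unfolding total_def l ..
  have vY: "valid Y" and opt: "\<And>Y'. valid Y' \<Longrightarrow> total Y' \<le> total Y"
    using maxpack_optimal[of tries] tries l unfolding Y_def round_up_def by auto
  interpret rounding "\<lambda>i k. Z ! i ! k mod n" m a n U C
    by unfold_locales (use n Ui Ck in auto)
  from rounding_exists obtain y where y: "\<And>i k. i < m \<Longrightarrow> k < a \<Longrightarrow> y i k \<le> hi i k"
    "\<And>i. i < m \<Longrightarrow> (\<Sum>k<a. y i k) = U i" "\<And>k. k < a \<Longrightarrow> (\<Sum>i<m. y i k) = C k" by blast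
  define Y' where "Y' = map (\<lambda>i. map (\<lambda>k. int (y i k)) [0..<a]) [0..<m]"
  have Y': "Y' ! i ! k = int (y i k)" if "i < m" "k < a" for i k using that by (simp add: Y'_def)
  have y01: "int (y i k) \<le> (if Z ! i ! k mod n = 0 then 0 else 1)" if "i < m" "k < a" for i k
    using y(1)[OF that] by (simp add: hi_def split: if_splits)
  have "valid Y'" unfolding valid_iff
    using y(2,3) y01 by (simp add: Y' flip: of_nat_sum) (simp add: Y'_def)
  then have "total Y' \<le> total Y" by (rule opt)
  moreover have "total Y' = int (\<Sum>k<a. C k)" unfolding tot using y(3) by (subst sum.swap) (simp add: Y' flip: of_nat_sum)
  moreover have eqUC: "(\<Sum>k<a. C k) = (\<Sum>i<m. U i)"
    using y(2,3) sum.swap[of y "{..<a}" "{..<m}"] by simp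
  ultimately have "int (\<Sum>k<a. C k) \<le> total Y" "int (\<Sum>i<m. U i) \<le> total Y" by linarith+
  then have ge: "(\<Sum>k<a. int (C k)) \<le> total Y" "(\<Sum>i<m. int (U i)) \<le> total Y"
    by (simp_all only: of_nat_sum)
  show b: "0 \<le> Y ! i ! k \<and> Y ! i ! k \<le> (if Z ! i ! k mod n = 0 then 0 else 1)" if "i < m" "k < a" for i k
    using vY that unfolding valid_iff by blast
  have tight_U: "(\<Sum>k<a. Y ! i ! k) = int (U i)" if i: "i < m" for i
  proof (rule ccontr)
    assume "(\<Sum>k<a. Y ! i ! k) \<noteq> int (U i)"
    then have "total Y < (\<Sum>i<m. int (U i))" unfolding tot
      using vY i unfolding valid_iff by (intro sum_strict_mono_ex1) (auto intro!: bexI[of _ i] simp: less_le)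
    with ge show False by simp
  qed
  have tight_C: "(\<Sum>i<m. Y ! i ! k) = int (C k)" if k: "k < a" for k
  proof (rule ccontr)
    assume "(\<Sum>i<m. Y ! i ! k) \<noteq> int (C k)"
    then have "total Y < (\<Sum>k<a. int (C k))" unfolding tot sum.swap[of _ "{..<a}" "{..<m}"]
      using vY k unfolding valid_iff by (intro sum_strict_mono_ex1) (auto intro!: bexI[of _ k] simp: less_le)
    with ge show False by simp
  qed
  show "(\<Sum>k<a. Z ! i ! k div n + nat (Y ! i ! k)) = u i" if i: "i < m" for i
  proof -
    have "int (\<Sum>k<a. nat (Y ! i ! k)) = (\<Sum>k<a. Y ! i ! k)" using b[OF i] by simp
    then have "(\<Sum>k<a. nat (Y ! i ! k)) = U i" unfolding tight_U[OF i] by (simp only: of_nat_eq_iff)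
    then show ?thesis using Ui(1)[OF i] by (simp add: sum.distrib)
  qed
  show "(\<Sum>i<m. Z ! i ! k div n + nat (Y ! i ! k)) = c k" if k: "k < a" for k
  proof -
    have "int (\<Sum>i<m. nat (Y ! i ! k)) = (\<Sum>i<m. Y ! i ! k)" using b[OF _ k] by simp
    then have "(\<Sum>i<m. nat (Y ! i ! k)) = C k" unfolding tight_C[OF k] by (simp only: of_nat_eq_iff)
    then show ?thesis using Ck(1)[OF k] by (simp add: sum.distrib)
  qed
qed

lemma slice_nth:
  assumes "shaped Z" "i < m" "k < a"
  shows "slice n Z (round_up M tries [0..<a] n Z) ! i ! k = Z ! i ! k div n + nat (round_up M tries [0..<a] n Z ! i ! k)"
  using assms round_up_shape[OF assms(1)] by (simp add: slice_def shaped_def)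

lemma slice_shaped: "shaped Z \<Longrightarrow> shaped (slice n Z (round_up M tries [0..<a] n Z))"
  using round_up_shape(1)[of Z n] round_up_shape(2)[of Z _ n] by (simp add: slice_def shaped_def)

lemma remaining_shaped:
  assumes "shaped Z" "shaped z"
  shows "shaped (snd (remaining (n, Z) (\<mu>, z)))"
    "i < m \<Longrightarrow> k < a \<Longrightarrow> snd (remaining (n, Z) (\<mu>, z)) ! i ! k = Z ! i ! k - \<mu> * z ! i ! k"
  using assms by (auto simp: remaining_def shaped_def)

text \<open>After \<open>\<mu>\<close> copies, \<open>(n - \<mu>) * b + (r - \<mu> * y)\<close> is
  left. A zero remainder stays zero, and at the limit the second summand is either 0 or
  \<open>n - \<mu>\<close>.\<close>

lemma mod_sub_mult:
  fixes q r n :: nat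
  assumes q: "q = n * b + r" "r < n" and mu: "\<mu> \<le> n" and y: "y \<le> (if r = 0 then 0 else 1)"
    and le: "\<mu> \<le> (if y = 1 then r else n - r)"
  shows "\<mu> * (b + y) \<le> q" "r = 0 \<Longrightarrow> (q - \<mu> * (b + y)) mod (n - \<mu>) = 0"
    "\<mu> = (if y = 1 then r else n - r) \<Longrightarrow> (q - \<mu> * (b + y)) mod (n - \<mu>) = 0"
proof -
  have mb: "\<mu> * b \<le> n * b" using mu by (rule mult_le_mono1)
  have diff: "q - \<mu> * (b + y) = (n - \<mu>) * b + (r - \<mu> * y)" if "\<mu> * y \<le> r"
    using that mb by (simp add: q(1) diff_mult_distrib add_mult_distrib2)
  have my: "\<mu> * y \<le> r"
  proof (cases "y = 1")
    case False
    then have "y = 0" using y by (auto split: if_splits)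
    then show ?thesis by simp
  qed (use le in simp)
  show "\<mu> * (b + y) \<le> q" using mb my by (simp add: q(1) add_mult_distrib2 add_mono)
  show "r = 0 \<Longrightarrow> (q - \<mu> * (b + y)) mod (n - \<mu>) = 0" unfolding diff[OF my] by simp
  show "(q - \<mu> * (b + y)) mod (n - \<mu>) = 0" if "\<mu> = (if y = 1 then r else n - r)"
  proof (cases "y = 1")
    case True
    then show ?thesis unfolding diff[OF my] using that by simp
  next
    case False
    then have "y = 0" using y by (auto split: if_splits)
    then show ?thesis unfolding diff[OF my] using that False q(2) by simp
  qed
qed

text \<open>The entry that attains the minimum turns into a multiple of the number of consumers
  left, and multiples stay multiples. So the set of fractional entries shrinks properly unless all
  consumers are served.\<close>

lemma peel_step:
  assumes Z: "margins n Z" and n: "n > 0"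
  defines "p \<equiv> peel M tries [0..<a] (n, Z)"
  defines "s \<equiv> remaining (n, Z) p"
  shows "margins 1 (snd p)" and "fst p \<le> n" and "fst p > 0" and "margins (fst s) (snd s)"
    and "\<And>i k. i < m \<Longrightarrow> k < a \<Longrightarrow> fst p * snd p ! i ! k \<le> Z ! i ! k"
    and "fst s = 0 \<or> card (fractional (fst s) (snd s)) < card (fractional n Z)"
proof -
  have sh: "shaped Z" using Z by (simp add: margins_def)
  define Y where "Y = round_up M tries [0..<a] n Z"
  define \<mu> where "\<mu> = multiplicity n Z Y"
  define z where "z = slice n Z Y"
  have p: "p = (\<mu>, z)" by (simp add: p_def peel_def Y_def \<mu>_def z_def Let_def)
  note Yc = round_up_correct[OF Z n, folded Y_def]
  define y where "y i k = nat (Y ! i ! k)" for i k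
  have y: "y i k \<le> (if Z ! i ! k mod n = 0 then 0 else 1)" if "i < m" "k < a" for i k
    using Yc(1)[OF that] by (auto simp: y_def split: if_splits)
  have z_nth: "z ! i ! k = Z ! i ! k div n + y i k" if "i < m" "k < a" for i k
    using slice_nth[OF sh that, of n] by (simp add: z_def Y_def y_def)
  have z_sh: "shaped z" using slice_shaped[OF sh] by (simp add: z_def Y_def)
  show 1: "margins 1 (snd p)"
    using Yc(2,3) z_sh by (simp add: margins_def p z_nth y_def)
  define lim where "lim i k = (if y i k = 1 then Z ! i ! k mod n else n - Z ! i ! k mod n)" for i k
  have Yl: "length Y = m" "\<And>i. i < m \<Longrightarrow> length (Y ! i) = a" using round_up_shape[OF sh] by (auto simp: Y_def)
  have pos_iff: "0 < Y ! i ! k \<longleftrightarrow> y i k = 1" if "i < m" "k < a" for i k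
    using Yc(1)[OF that] by (auto simp: y_def split: if_splits)
  let ?L = "concat (map2 (\<lambda>x y. map2 (\<lambda>q r. if 0 < r then q mod n else n - q mod n) x y) Z Y)"
  have L: "set ?L = {lim i k | i k. i < m \<and> k < a}"
  proof -
    have "?L = concat (map (\<lambda>i. map (\<lambda>k. if 0 < Y ! i ! k then Z ! i ! k mod n else n - Z ! i ! k mod n) [0..<a]) [0..<m])"
      using sh Yl by (auto simp: shaped_def map2_nth_conv[where n = m] map2_nth_conv[where n = a] intro!: arg_cong[where f = concat])
    also have "\<dots> = concat (map (\<lambda>i. map (lim i) [0..<a]) [0..<m])"
      using pos_iff by (intro arg_cong[where f = concat] map_cong) (auto simp: lim_def)
    finally have eq: "?L = concat (map (\<lambda>i. map (lim i) [0..<a]) [0..<m])" .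
    show ?thesis unfolding eq by fastforce
  qed
  have \<mu>_le: "\<mu> \<le> n" "\<And>i k. i < m \<Longrightarrow> k < a \<Longrightarrow> \<mu> \<le> lim i k"
    using fold_min(1)[where xs = ?L and n = n] fold_min(2)[where xs = ?L and n = n] L
    unfolding \<mu>_def multiplicity_def by blast+
  have \<mu>_in: "\<mu> = n \<or> (\<exists>i<m. \<exists>k<a. \<mu> = lim i k)"
    using fold_min(3)[where xs = ?L and n = n] unfolding L \<mu>_def multiplicity_def by blast
  have lim_pos: "lim i k > 0" if "i < m" "k < a" for i k
    using y[OF that] n by (auto simp: lim_def split: if_splits)
  show "fst p \<le> n" using \<mu>_le by (simp add: p)
  show "fst p > 0" using \<mu>_in lim_pos n by (auto simp: p)
  have *: "\<mu> * z ! i ! k \<le> Z ! i ! k"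
    "Z ! i ! k mod n = 0 \<Longrightarrow> (Z ! i ! k - \<mu> * z ! i ! k) mod (n - \<mu>) = 0"
    "\<mu> = lim i k \<Longrightarrow> (Z ! i ! k - \<mu> * z ! i ! k) mod (n - \<mu>) = 0" if "i < m" "k < a" for i k
  proof -
    have "Z ! i ! k = n * (Z ! i ! k div n) + Z ! i ! k mod n" "Z ! i ! k mod n < n" using n by simp_all
    note msm = mod_sub_mult[OF this \<mu>_le(1) y[OF that] \<mu>_le(2)[OF that, unfolded lim_def]]
    show "\<mu> * z ! i ! k \<le> Z ! i ! k" unfolding z_nth[OF that] by (rule msm(1))
    show "Z ! i ! k mod n = 0 \<Longrightarrow> (Z ! i ! k - \<mu> * z ! i ! k) mod (n - \<mu>) = 0"
      unfolding z_nth[OF that] by (rule msm(2))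
    show "\<mu> = lim i k \<Longrightarrow> (Z ! i ! k - \<mu> * z ! i ! k) mod (n - \<mu>) = 0"
      unfolding z_nth[OF that] lim_def by (rule msm(3))
  qed
  show "\<And>i k. i < m \<Longrightarrow> k < a \<Longrightarrow> fst p * snd p ! i ! k \<le> Z ! i ! k" using *(1) by (simp add: p)
  define Z' where "Z' = snd s"
  have Z': "Z' ! i ! k = Z ! i ! k - \<mu> * z ! i ! k" if "i < m" "k < a" for i k
    using remaining_shaped(2)[OF sh z_sh that] by (simp add: Z'_def s_def p)
  have s: "fst s = n - \<mu>" by (simp add: s_def p remaining_def)
  have "shaped Z'" using remaining_shaped(1)[OF sh z_sh] by (simp add: Z'_def s_def p)
  moreover have "(\<Sum>k<a. Z' ! i ! k) = (n - \<mu>) * u i" if i: "i < m" for i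
  proof -
    have "(\<Sum>k<a. Z' ! i ! k) = (\<Sum>k<a. Z ! i ! k) - (\<Sum>k<a. \<mu> * z ! i ! k)"
      using Z'[OF i] *(1)[OF i] by (subst sum_subtractf_nat[symmetric]) auto
    also have "(\<Sum>k<a. \<mu> * z ! i ! k) = \<mu> * u i" using 1 i by (simp add: margins_def p sum_distrib_left[symmetric])
    finally show ?thesis using Z i by (simp add: margins_def diff_mult_distrib)
  qed
  moreover have "(\<Sum>i<m. Z' ! i ! k) = (n - \<mu>) * c k" if k: "k < a" for k
  proof -
    have "(\<Sum>i<m. Z' ! i ! k) = (\<Sum>i<m. Z ! i ! k) - (\<Sum>i<m. \<mu> * z ! i ! k)"
      using Z'[OF _ k] *(1)[OF _ k] by (subst sum_subtractf_nat[symmetric]) auto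
    also have "(\<Sum>i<m. \<mu> * z ! i ! k) = \<mu> * c k" using 1 k by (simp add: margins_def p sum_distrib_left[symmetric])
    finally show ?thesis using Z k by (simp add: margins_def diff_mult_distrib)
  qed
  ultimately show "margins (fst s) (snd s)" unfolding s Z'_def[symmetric] by (simp add: margins_def)
  show "fst s = 0 \<or> card (fractional (fst s) (snd s)) < card (fractional n Z)"
  proof (cases "\<mu> = n")
    case False
    then obtain i k where ik: "i < m" "k < a" "\<mu> = lim i k" using \<mu>_in by blast
    have fin: "finite (fractional n Z)" by (rule finite_subset[of _ "{..<m} \<times> {..<a}"]) (auto simp: fractional_def)
    have "fractional (n - \<mu>) Z' \<subseteq> fractional n Z"
    proof
      fix p assume "p \<in> fractional (n - \<mu>) Z'"
      then obtain i k where p: "p = (i, k)" "i < m" "k < a" "Z' ! i ! k mod (n - \<mu>) \<noteq> 0"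
        by (auto simp: fractional_def)
      then have "Z ! i ! k mod n \<noteq> 0" using *(2)[OF p(2,3)] Z'[OF p(2,3)] by metis
      then show "p \<in> fractional n Z" using p by (simp add: fractional_def)
    qed
    moreover have "(i, k) \<notin> fractional (n - \<mu>) Z'" using *(3)[OF ik] Z' ik by (simp add: fractional_def)
    moreover have "(i, k) \<in> fractional n Z"
    proof (rule ccontr)
      assume "(i, k) \<notin> fractional n Z"
      then have "Z ! i ! k mod n = 0" using ik by (simp add: fractional_def)
      then have "lim i k = n" using y[OF ik(1,2)] by (simp add: lim_def)
      then show False using ik False by simp
    qed
    ultimately show ?thesis unfolding s Z'_def[symmetric] using psubset_card_mono[OF fin] by blast
  qed (simp add: s)
qed

lemma peel_zero: "shaped Z \<Longrightarrow> shaped (snd (peel M tries [0..<a] (n, Z)))"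
  "fst (peel M tries [0..<a] (0, Z)) = 0"
  using slice_shaped fold_min(1)[of _ 0] by (auto simp: peel_def Let_def multiplicity_def)

text \<open>While consumers remain, rounds done plus fractional entries never exceed
  \<open>m * a\<close>. More rounds than that exhaust the consumers, and then zero margins force the
  remaining matrix to be 0.\<close>

lemma decompose_correct:
  assumes Z: "margins n Z" and us: "length us > m * a"
  defines "ps \<equiv> decompose M tries [0..<a] us n Z"
  shows "\<And>\<mu> z. (\<mu>, z) \<in> set ps \<Longrightarrow> shaped z \<and> (\<mu> > 0 \<longrightarrow> margins 1 z)"
    and "(\<Sum>(\<mu>, z)\<leftarrow>ps. \<mu>) = n"
    and "\<And>i k. i < m \<Longrightarrow> k < a \<Longrightarrow> (\<Sum>(\<mu>, z)\<leftarrow>ps. \<mu> * z ! i ! k) = Z ! i ! k"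
proof -
  define f where "f = (\<lambda>(_::'a) b. (remaining (fst b) (peel M tries [0..<a] (fst b)), peel M tries [0..<a] (fst b) # snd b))"
  define inv where "inv j s ps \<longleftrightarrow> margins (fst s) (snd s) \<and>
      (fst s > 0 \<longrightarrow> card (fractional (fst s) (snd s)) + j \<le> m * a) \<and>
      (\<forall>(\<mu>, z)\<in>set ps. shaped z \<and> (\<mu> > 0 \<longrightarrow> margins 1 z)) \<and>
      (\<Sum>(\<mu>, z)\<leftarrow>ps. \<mu>) + fst s = n \<and>
      (\<forall>i<m. \<forall>k<a. (\<Sum>(\<mu>, z)\<leftarrow>ps. \<mu> * z ! i ! k) + snd s ! i ! k = Z ! i ! k)" for j s ps
  have step: "inv (Suc j) (fst (f v (s, ps))) (snd (f v (s, ps)))" if inv: "inv j s ps" for j s ps v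
  proof -
    obtain n' Z' where s: "s = (n', Z')" by (cases s)
    define p where "p = peel M tries [0..<a] (n', Z')"
    obtain \<mu> z where mz: "p = (\<mu>, z)" by (cases p)
    have f: "fst (f v (s, ps)) = remaining s p" "snd (f v (s, ps)) = p # ps" by (simp_all add: f_def s p_def)
    have sh: "shaped Z'" using inv by (simp add: inv_def s margins_def)
    show ?thesis
    proof (cases "n' = 0")
      case True
      \<comment> \<open>With no consumers left the multiplicity is 0 and the state does not change;
        a pattern of the right shape is still recorded.\<close>
      have z: "shaped z" "\<mu> = 0" using peel_zero(1)[OF sh, of n'] peel_zero(2)[of Z'] True mz by (auto simp: p_def)
      have r: "snd (remaining (0, Z') (0, z)) = Z'"
      proof (rule nth_equalityI)
        show l: "length (snd (remaining (0, Z') (0, z))) = length Z'"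
          using remaining_shaped(1)[OF sh z(1), of 0 0] sh by (simp add: shaped_def)
        fix i assume "i < length (snd (remaining (0, Z') (0, z)))"
        then have i: "i < m" using l sh by (simp add: shaped_def)
        show "snd (remaining (0, Z') (0, z)) ! i = Z' ! i"
        proof (rule nth_equalityI)
          show l': "length (snd (remaining (0, Z') (0, z)) ! i) = length (Z' ! i)"
            using remaining_shaped(1)[OF sh z(1), of 0 0] sh i by (simp add: shaped_def)
          fix k assume "k < length (snd (remaining (0, Z') (0, z)) ! i)"
          then have "k < a" using l' sh i by (simp add: shaped_def)
          then show "snd (remaining (0, Z') (0, z)) ! i ! k = Z' ! i ! k"
            using remaining_shaped(2)[OF sh z(1) i] by simp
        qed
      qed
      then have "remaining s p = s" using z(2) by (simp add: s mz True remaining_def)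
      then show ?thesis using inv z unfolding inv_def f mz by (simp add: s True)
    next
      case False
      have mg: "margins n' Z'" using inv by (simp add: inv_def s)
      note ps' = peel_step[OF mg, folded p_def]
      have z: "margins 1 z" "\<mu> \<le> n'" "shaped z" using ps'(1,2) False mz by (auto simp: margins_def)
      have rem: "fst (remaining s p) = n' - \<mu>" by (simp add: s mz remaining_def)
      have nth: "snd (remaining s p) ! i ! k + \<mu> * z ! i ! k = Z' ! i ! k" if "i < m" "k < a" for i k
        using remaining_shaped(2)[OF sh z(3) that, of n' \<mu>] ps'(5)[OF _ that] False by (simp add: s mz)
      show ?thesis unfolding inv_def f
      proof (intro conjI allI impI)
        show "margins (fst (remaining s p)) (snd (remaining s p))" using ps'(4) False by (simp add: s)
        show "card (fractional (fst (remaining s p)) (snd (remaining s p))) + Suc j \<le> m * a"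
          if "0 < fst (remaining s p)"
          using ps'(6) inv that False by (auto simp: inv_def s)
        show "\<forall>(\<mu>, z)\<in>set (p # ps). shaped z \<and> (0 < \<mu> \<longrightarrow> margins 1 z)"
          using inv z by (auto simp: inv_def mz)
        show "(\<Sum>(\<mu>, z)\<leftarrow>p # ps. \<mu>) + fst (remaining s p) = n"
          using inv z(2) unfolding rem by (simp add: inv_def s mz)
        fix i k assume ik: "i < m" "k < a"
        show "(\<Sum>(\<mu>, z)\<leftarrow>p # ps. \<mu> * z ! i ! k) + snd (remaining s p) ! i ! k = Z ! i ! k"
        proof -
          have "(\<Sum>(\<mu>, z)\<leftarrow>ps. \<mu> * z ! i ! k) + Z' ! i ! k = Z ! i ! k" using inv ik by (simp add: inv_def s)
          then show ?thesis using nth[OF ik] by (simp add: mz)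
        qed
      qed
    qed
  qed
  have "inv (j + length vs) (fst (fold f vs (s, ps))) (snd (fold f vs (s, ps)))" if "inv j s ps" for j s ps vs
    using that
  proof (induction vs arbitrary: j s ps)
    case (Cons v vs)
    from Cons.IH[OF step[OF Cons.prems, of v]] show ?case by simp
  qed simp
  moreover have "card (fractional n Z) \<le> m * a"
    using card_mono[of "{..<m} \<times> {..<a}" "fractional n Z"] by (auto simp: fractional_def)
  then have "inv 0 (n, Z) []" using Z by (simp add: inv_def)
  ultimately have fin: "inv (length us) (fst (fold f us ((n, Z), []))) ps"
    unfolding ps_def decompose_def f_def[symmetric] by (metis add_0)
  obtain n' Z' where s: "fst (fold f us ((n, Z), [])) = (n', Z')" by (cases "fst (fold f us ((n, Z), []))")
  have n': "n' = 0" using fin us unfolding s inv_def by (cases "n' = 0") auto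
  then have "(\<Sum>k<a. Z' ! i ! k) = 0" if "i < m" for i using fin that unfolding s inv_def margins_def by simp
  then have Z': "Z' ! i ! k = 0" if "i < m" "k < a" for i k using that by simp
  show "\<And>\<mu> z. (\<mu>, z) \<in> set ps \<Longrightarrow> shaped z \<and> (\<mu> > 0 \<longrightarrow> margins 1 z)"
    "(\<Sum>(\<mu>, z)\<leftarrow>ps. \<mu>) = n"
    "\<And>i k. i < m \<Longrightarrow> k < a \<Longrightarrow> (\<Sum>(\<mu>, z)\<leftarrow>ps. \<mu> * z ! i ! k) = Z ! i ! k"
    using fin Z' n' unfolding s inv_def by auto
qed

end

section \<open>Polynomial running time of the peeling loop\<close>

lemma ptime_fold_emit:
  fixes h :: "'x::encodable \<Rightarrow> 'b::encodable \<Rightarrow> 's::encodable \<Rightarrow> 's" and w :: "'x \<Rightarrow> 'b \<Rightarrow> 's \<Rightarrow> 'c::encodable"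
  assumes h: "ptime (\<lambda>p. h (fst (fst p)) (snd (fst p)) (snd p))"
    and w: "ptime (\<lambda>p. w (fst (fst p)) (snd (fst p)) (snd p))"
    and xs: "ptime xs" and s: "ptime s" and B: "poly_bounded B"
    and le: "\<And>x us vs. xs x = us @ vs \<Longrightarrow> sz (fold (h x) us (s x)) \<le> B x"
  shows "ptime (\<lambda>x. fold (\<lambda>y a. (h x y (fst a), w x y (fst a) # snd a)) (xs x) (s x, []))"
proof -
  let ?f = "\<lambda>x y a. (h x y (fst a), w x y (fst a) # snd a)"
  from poly_bounded_ptime[OF w] obtain C q
    where C: "\<And>p. sz (w (fst (fst p)) (snd (fst p)) (snd p)) \<le> C * sz p ^ q"
    unfolding poly_bounded_def by blast
  \<comment> \<open>Bounds one emitted item: \<open>w\<close> is polynomial, and the state that it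
    reads has size at most \<open>B x\<close>.\<close>
  define G where "G x = C * (sz x + sz (xs x) + B x + 2) ^ q" for x
  show ?thesis
  proof (rule ptime_fold[where f = ?f and B = "\<lambda>x. B x + (sz (xs x) * (G x + 1) + 1) + 1"])
    show "poly_bounded (\<lambda>x. B x + (sz (xs x) * (G x + 1) + 1) + 1)"
      unfolding G_def by (intro poly_bounded_intros B xs)
    have "ptime (\<lambda>p::('x \<times> 'b) \<times> 's \<times> 'c list. (fst p, fst (snd p)))" by (intro ptime_intros)
    from ptime_comp[OF h this] ptime_comp[OF w this]
    show "ptime (\<lambda>p. ?f (fst (fst p)) (snd (fst p)) (snd p))"
      unfolding fst_conv snd_conv by (intro ptime_intros)
    fix x us vs assume us: "xs x = us @ vs"
    have "fst (fold (?f x) us (s x, [])) = fold (h x) us (s x) \<and>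
        length (snd (fold (?f x) us (s x, []))) = length us \<and>
        (\<forall>c\<in>set (snd (fold (?f x) us (s x, []))). sz c \<le> G x)"
      using us
    proof (induction us arbitrary: vs rule: rev_induct)
      case (snoc u us)
      then have IH: "fst (fold (?f x) us (s x, [])) = fold (h x) us (s x)"
        "length (snd (fold (?f x) us (s x, []))) = length us"
        "\<forall>c\<in>set (snd (fold (?f x) us (s x, []))). sz c \<le> G x" by auto
      have "sz u \<le> sz (xs x)" using snoc.prems by (simp add: sz_member less_imp_le)
      moreover have "sz (fold (h x) us (s x)) \<le> B x" using le[of x us "[u] @ vs"] snoc.prems by simp
      ultimately have "sz ((x, u), fold (h x) us (s x)) \<le> sz x + sz (xs x) + B x + 2" by simp
      then have "C * sz ((x, u), fold (h x) us (s x)) ^ q \<le> G x"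
        unfolding G_def by (intro mult_le_mono2 power_mono) auto
      with C[of "((x, u), fold (h x) us (s x))"] have "sz (w x u (fold (h x) us (s x))) \<le> G x"
        by (simp only: fst_conv snd_conv)
      with IH show ?case by simp
    qed simp
    then have *: "fst (fold (?f x) us (s x, [])) = fold (h x) us (s x)"
      "length (snd (fold (?f x) us (s x, []))) = length us"
      "\<And>c. c \<in> set (snd (fold (?f x) us (s x, []))) \<Longrightarrow> sz c \<le> G x" by auto
    have "sz (snd (fold (?f x) us (s x, []))) \<le> length us * (G x + 1) + 1"
      unfolding *(2)[symmetric] by (rule sz_list_le) (rule *(3))
    also have "\<dots> \<le> sz (xs x) * (G x + 1) + 1"
      using length_le_sz[of "xs x"] us by (intro add_le_mono1 mult_le_mono1) simp
    finally have "sz (snd (fold (?f x) us (s x, []))) \<le> sz (xs x) * (G x + 1) + 1" .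
    moreover have "sz (fst (fold (?f x) us (s x, []))) \<le> B x" unfolding *(1) using us by (rule le)
    moreover have "sz p = 1 + sz (fst p) + sz (snd p)" for p :: "'s \<times> 'c list" by (cases p) simp
    note this[of "fold (?f x) us (s x, [])"]
    ultimately show "sz (fold (?f x) us (s x, [])) \<le> B x + (sz (xs x) * (G x + 1) + 1) + 1"
      by linarith
  qed (intro ptime_intros xs s)+
qed

lemma ptime_unit_masks [ptime_intros]:
  assumes "ptime ks" shows "ptime (\<lambda>x. unit_masks (ks x))"
  unfolding unit_masks_def by (intro ptime_intros assms ptime_comp[OF assms])

lemma ptime_round_caps [ptime_intros]:
  assumes "ptime n" "ptime xs" shows "ptime (\<lambda>x. round_caps (n x) (xs x))"
  unfolding round_caps_def by (intro ptime_intros assms ptime_comp[OF assms(1)])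

lemma ptime_round_rows [ptime_intros]:
  assumes "ptime n" "ptime ks" "ptime Z" shows "ptime (\<lambda>x. round_rows (n x) (ks x) (Z x))"
  unfolding round_rows_def by (intro ptime_intros assms ptime_comp[OF assms(1)] ptime_comp[OF assms(3)])

lemma ptime_round_up [ptime_intros]:
  assumes "ptime M" "ptime tries" "ptime ks" "ptime n" "ptime Z"
  shows "ptime (\<lambda>x. round_up (M x) (tries x) (ks x) (n x) (Z x))"
  unfolding round_up_def by (intro ptime_intros assms ptime_comp[OF assms(4)])

lemma ptime_slice [ptime_intros]:
  assumes "ptime n" "ptime Z" "ptime Y" shows "ptime (\<lambda>x. slice (n x) (Z x) (Y x))"
  unfolding slice_def by (intro ptime_intros assms ptime_comp[OF assms(1)])

lemma ptime_multiplicity [ptime_intros]: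
  assumes n: "ptime n" and Z: "ptime Z" and Y: "ptime Y"
  shows "ptime (\<lambda>x. multiplicity (n x) (Z x) (Y x))"
proof -
  define L where "L x = concat (map2 (\<lambda>x' y. map2 (\<lambda>q r. if 0 < r then q mod n x else n x - q mod n x) x' y) (Z x) (Y x))" for x
  have L: "ptime L" unfolding L_def by (intro ptime_intros assms ptime_comp[OF n])
  have "ptime (\<lambda>x. fold min (L x) (n x))"
  proof (rule ptime_fold[where f = "\<lambda>_. min" and B = "\<lambda>x. sz (n x) + sz (L x)"])
    fix x us vs assume us: "L x = us @ vs"
    have "fold min us (n x) = n x \<or> fold min us (n x) \<in> set (L x)"
      using fold_min(3)[where xs = us and n = "n x"] us by auto
    then show "sz (fold min us (n x)) \<le> sz (n x) + sz (L x)" by (auto dest: sz_member)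
  qed (intro ptime_intros poly_bounded_intros n L)+
  then show ?thesis unfolding multiplicity_def L_def .
qed

lemma ptime_peel [ptime_intros]:
  assumes "ptime M" "ptime tries" "ptime ks" "ptime s"
  shows "ptime (\<lambda>x. peel (M x) (tries x) (ks x) (s x))"
  unfolding peel_def by (intro ptime_intros assms ptime_comp[OF assms(1)] ptime_comp[OF assms(2)] ptime_comp[OF assms(3)] ptime_comp[OF assms(4)])

lemma ptime_remaining [ptime_intros]:
  assumes "ptime s" "ptime p" shows "ptime (\<lambda>x. remaining (s x) (p x))"
  unfolding remaining_def by (intro ptime_intros assms ptime_comp[OF assms(1)] ptime_comp[OF assms(2)])

definition below :: "nat \<Rightarrow> nat \<Rightarrow> nat \<Rightarrow> nat list list \<Rightarrow> bool" where
  "below m n k X \<longleftrightarrow> length X \<le> m \<and> (\<forall>x\<in>set X. length x \<le> n \<and> (\<forall>a\<in>set x. a < 2 ^ k))"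

lemma below_sz:
  assumes "below m n k X"
  shows "sz X \<le> m * (n * (4 * k + 2) + 2) + 1"
proof -
  have "sz x \<le> n * (4 * k + 2) + 1" if "x \<in> set X" for x
  proof -
    have "sz a \<le> 4 * k + 1" if "a \<in> set x" for a
      using assms \<open>x \<in> set X\<close> that by (intro sz_nat_le) (auto simp: below_def)
    then have "sz x \<le> length x * (4 * k + 1 + 1) + 1" by (rule sz_list_le)
    also have "\<dots> \<le> n * (4 * k + 1 + 1) + 1"
      using assms that by (intro add_le_mono1 mult_le_mono1) (auto simp: below_def)
    finally show ?thesis by simp
  qed
  then have "sz X \<le> length X * (n * (4 * k + 2) + 1 + 1) + 1" by (rule sz_list_le)
  also have "\<dots> \<le> m * (n * (4 * k + 2) + 1 + 1) + 1"
    using assms by (intro add_le_mono1 mult_le_mono1) (auto simp: below_def)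
  finally show ?thesis by simp
qed

lemma below_self: "below (length X) (sz X) (sz X) X"
  unfolding below_def
proof (intro conjI ballI)
  fix x assume x: "x \<in> set X"
  from sz_member[OF x] show "length x \<le> sz X" using length_le_sz[of x] by linarith
  fix a assume "a \<in> set x"
  then have "sz a < sz X" using sz_member[OF x] sz_member[of a x] by linarith
  then have "(2::nat) ^ sz a \<le> 2 ^ sz X" by (intro power_increasing) auto
  with nat_less_sz[of a] show "a < 2 ^ sz X" by linarith
qed simp

lemma below_remaining:
  assumes "below m n k (snd s)"
  shows "below m n k (snd (remaining s p))"
proof -
  have "length y \<le> n \<and> (\<forall>a\<in>set y. a < 2 ^ k)" if "y \<in> set (snd (remaining s p))" for y
  proof -
    from that obtain x z where "(x, z) \<in> set (zip (snd s) (snd p))" and y: "y = map2 (\<lambda>q w. q - fst p * w) x z"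
      by (auto simp: remaining_def)
    then have x: "length x \<le> n" "\<forall>a\<in>set x. a < 2 ^ k"
      using assms set_zip_leftD by (fastforce simp: below_def)+
    have "a < 2 ^ k" if "a \<in> set y" for a
    proof -
      from that obtain q w where "(q, w) \<in> set (zip x z)" "a = q - fst p * w" unfolding y by auto
      then show ?thesis using x(2) set_zip_leftD[of q w x z] by (auto intro: le_less_trans[OF diff_le_self])
    qed
    then show ?thesis using x(1) by (simp add: y)
  qed
  then show ?thesis using assms by (auto simp: below_def) (auto simp: remaining_def)
qed

text \<open>Truncated subtraction never increases the number of consumers or an entry, which bounds
  the state of the loop by the initial one.\<close>

lemma ptime_decompose [ptime_intros]:
  fixes us :: "'x::encodable \<Rightarrow> 'b::encodable list"
  assumes M: "ptime M" and tries: "ptime tries" and ks: "ptime ks" and us: "ptime us" and n: "ptime n" and Z: "ptime Z"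
  shows "ptime (\<lambda>x. decompose (M x) (tries x) (ks x) (us x) (n x) (Z x))"
proof -
  let ?h = "\<lambda>x (_ :: 'b) s. remaining s (peel (M x) (tries x) (ks x) s)"
  let ?B = "\<lambda>x. (4 * sz (n x) + 1) + (sz (Z x) * (sz (Z x) * (4 * sz (Z x) + 2) + 2) + 1) + 1"
  have "ptime (\<lambda>x. fold (\<lambda>y a. (?h x y (fst a), peel (M x) (tries x) (ks x) (fst a) # snd a)) (us x) ((n x, Z x), []))"
  proof (rule ptime_fold_emit[where h = ?h and w = "\<lambda>x _ s. peel (M x) (tries x) (ks x) s" and B = ?B])
    fix x vs ws
    have "fst (fold (?h x) vs s) \<le> fst s" for vs s
    proof (induction vs arbitrary: s)
      case (Cons v vs)
      show ?case using Cons[of "?h x v s"] by (simp add: remaining_def)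
    qed simp
    then have "fst (fold (?h x) vs (n x, Z x)) < 2 ^ sz (n x)"
      using nat_less_sz[of "n x"] by (metis fst_conv le_less_trans)
    then have 1: "sz (fst (fold (?h x) vs (n x, Z x))) \<le> 4 * sz (n x) + 1" by (rule sz_nat_le)
    have "below (length (Z x)) (sz (Z x)) (sz (Z x)) (snd (fold (?h x) vs s))"
      if "below (length (Z x)) (sz (Z x)) (sz (Z x)) (snd s)" for s vs
      using that by (induction vs arbitrary: s) (simp_all add: below_remaining)
    from this[of "(n x, Z x)"] have "below (length (Z x)) (sz (Z x)) (sz (Z x)) (snd (fold (?h x) vs (n x, Z x)))"
      using below_self by simp
    then have "sz (snd (fold (?h x) vs (n x, Z x))) \<le> length (Z x) * (sz (Z x) * (4 * sz (Z x) + 2) + 2) + 1"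
      by (rule below_sz)
    also have "\<dots> \<le> sz (Z x) * (sz (Z x) * (4 * sz (Z x) + 2) + 2) + 1"
      by (intro add_le_mono1 mult_le_mono1 length_le_sz)
    finally have 2: "sz (snd (fold (?h x) vs (n x, Z x))) \<le> sz (Z x) * (sz (Z x) * (4 * sz (Z x) + 2) + 2) + 1" .
    have "sz p = 1 + sz (fst p) + sz (snd p)" for p :: "nat \<times> nat list list" by (cases p) simp
    from this[of "fold (?h x) vs (n x, Z x)"] 1 2
    show "sz (fold (?h x) vs (n x, Z x)) \<le> ?B x" by linarith
  qed (intro ptime_intros poly_bounded_intros us n Z ptime_comp[OF M] ptime_comp[OF tries] ptime_comp[OF ks])+
  then show ?thesis unfolding decompose_def by (rule ptime_snd)
qed

section \<open>The box of step vectors\<close>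

text \<open>Digits of \<open>j\<close> in base \<open>2 * b + 1\<close>, shifted to run from
  \<open>- b\<close> to \<open>b\<close>, least significant last; \<open>es\<close> fixes their
  number.\<close>

definition digits :: "nat \<Rightarrow> 'a list \<Rightarrow> nat \<Rightarrow> int list" where
  "digits b es j = snd (fold (\<lambda>_ a. (fst a div (2 * b + 1), (int (fst a mod (2 * b + 1)) - int b) # snd a)) es (j, []))"

text \<open>Enumerating numbers up to a unary length avoids nested loops of variable depth. If
  \<open>N\<close> is long enough, the whole box of radius \<open>length bs\<close> appears; further
  numbers repeat its vectors.\<close>

definition box :: "bool list \<Rightarrow> bool list \<Rightarrow> 'a list \<Rightarrow> int list list" where
  "box bs N es = map (digits (length bs) es) [0..<length N]"

lemma fold_emit_append:
  "snd (fold (\<lambda>_ a. (g (fst a), h (fst a) # snd a)) es (j, out)) =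
   snd (fold (\<lambda>_ a. (g (fst a), h (fst a) # snd a)) es (j, [])) @ out"
proof (induction es arbitrary: j out)
  case (Cons e es)
  show ?case using Cons[of "g j" "h j # out"] Cons[of "g j" "[h j]"] by simp
qed simp

lemma digits_simps [simp]:
  "digits b [] j = []"
  "digits b (e # es) j = digits b es (j div (2 * b + 1)) @ [int (j mod (2 * b + 1)) - int b]"
proof -
  show "digits b [] j = []" by (simp add: digits_def)
  show "digits b (e # es) j = digits b es (j div (2 * b + 1)) @ [int (j mod (2 * b + 1)) - int b]"
    unfolding digits_def fold_simps fst_conv snd_conv
    by (rule fold_emit_append[where g = "\<lambda>q. q div (2 * b + 1)" and h = "\<lambda>q. int (q mod (2 * b + 1)) - int b"])
qed

lemma length_digits [simp]: "length (digits b es j) = length es"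
  by (induction es arbitrary: j) auto

lemma digits_surj:
  assumes "length v = length es" "\<And>c. c \<in> set v \<Longrightarrow> \<bar>c\<bar> \<le> int b"
  shows "\<exists>j<(2 * b + 1) ^ length es. digits b es j = v"
  using assms
proof (induction es arbitrary: v)
  case (Cons e es)
  then obtain w c where v: "v = w @ [c]" by (cases v rule: rev_cases) auto
  then obtain j where j: "j < (2 * b + 1) ^ length es" "digits b es j = w" using Cons by auto
  define W r where "W = 2 * b + 1" and "r = nat (c + int b)"
  have c: "\<bar>c\<bar> \<le> int b" using Cons.prems v by simp
  then have r: "r < W" "int r = c + int b" by (auto simp: W_def r_def)
  let ?j = "j * W + r"
  have d: "?j div W = j" "?j mod W = r" using r(1) by simp_all
  have "digits b (e # es) ?j = v"
    unfolding digits_simps W_def[symmetric] d j(2) r(2) v by simp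
  moreover have "?j < W ^ length (e # es)"
  proof -
    have "(j + 1) * W \<le> W ^ length es * W" using j(1) unfolding W_def by (intro mult_le_mono1) simp
    moreover have "?j < (j + 1) * W" using r(1) by (simp add: add_mult_distrib)
    ultimately have "?j < W ^ length es * W" by linarith
    then show ?thesis by (simp add: mult.commute)
  qed
  ultimately show ?case unfolding W_def by blast
qed simp

lemma box_length: "g \<in> set (box bs N es) \<Longrightarrow> length g = length es"
  by (auto simp: box_def)

lemma box_complete:
  assumes "length N \<ge> (2 * length bs + 1) ^ length es" "length g = length es"
    and "\<And>e. e < length es \<Longrightarrow> \<bar>g ! e\<bar> \<le> int (length bs)"
  shows "g \<in> set (box bs N es)"
proof -
  obtain j where "j < (2 * length bs + 1) ^ length es" "digits (length bs) es j = g"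
    using digits_surj[of g es "length bs"] assms(2,3) by (auto simp: in_set_conv_nth)
  then show ?thesis using assms(1) by (auto simp: box_def intro!: image_eqI[of _ _ j])
qed

lemma ptime_digits [ptime_intros]:
  fixes es :: "'x::encodable \<Rightarrow> 'b::encodable list"
  assumes b: "ptime b" and es: "ptime es" and j: "ptime j"
  shows "ptime (\<lambda>x. digits (b x) (es x) (j x))"
proof -
  let ?h = "\<lambda>x (_ :: 'b) q. q div (2 * b x + 1)"
  have "ptime (\<lambda>x. fold (\<lambda>y a. (?h x y (fst a), (int (fst a mod (2 * b x + 1)) - int (b x)) # snd a)) (es x) (j x, []))"
  proof (rule ptime_fold_emit[where h = ?h and w = "\<lambda>x _ q. int (q mod (2 * b x + 1)) - int (b x)" and B = "\<lambda>x. 4 * sz (j x) + 1"])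
    fix x us vs
    have "fold (?h x) us q \<le> q" for us q
    proof (induction us arbitrary: q)
      case (Cons u us)
      show ?case using order_trans[OF Cons[of "?h x u q"] div_le_dividend] by simp
    qed simp
    then have "fold (?h x) us (j x) < 2 ^ sz (j x)" using nat_less_sz by (rule le_less_trans)
    then show "sz (fold (?h x) us (j x)) \<le> 4 * sz (j x) + 1" by (rule sz_nat_le)
  qed (intro ptime_intros poly_bounded_intros es j ptime_comp[OF b])+
  then show ?thesis unfolding digits_def by (rule ptime_snd)
qed

lemma ptime_box [ptime_intros]:
  assumes "ptime bs" "ptime N" "ptime es"
  shows "ptime (\<lambda>x. box (bs x) (N x) (es x))"
  unfolding box_def by (intro ptime_intros assms ptime_comp[OF assms(1)] ptime_comp[OF assms(3)])

section \<open>The algorithm for huge multicommodity flow\<close>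

text \<open>The final \<open>unit\<close> is encoded like the end of a list, so the first component
  has the very encoding of the seven-element list of an instance. The other two components are the
  box radius and the budget in unary.\<close>

type_synonym input =
  "(nat \<times> bool list \<times> nat \<times> nat list list \<times> nat list list \<times> nat list list \<times> nat list \<times> unit) \<times> bool list \<times> bool list"

text \<open>The numbers of suppliers, commodities and types are read off as lengths of lists, since
  a binary count cannot drive a polynomial loop.\<close>

definition in_sups :: "input \<Rightarrow> nat list" where "in_sups x = [0..<length (fst (snd (fst x)))]"
definition in_supply :: "input \<Rightarrow> nat \<Rightarrow> nat \<Rightarrow> nat" where
  "in_supply x k i = nth_or 0 (nth_or [] (fst (snd (snd (snd (fst x))))) k) i"
definition in_coms :: "input \<Rightarrow> nat list" where "in_coms x = [0..<length (fst (snd (snd (snd (fst x)))))]"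
definition in_demand :: "input \<Rightarrow> nat \<Rightarrow> nat \<Rightarrow> nat" where
  "in_demand x k r = nth_or 0 (nth_or [] (fst (snd (snd (snd (snd (fst x)))))) k) r"
definition in_cap :: "input \<Rightarrow> nat \<Rightarrow> nat \<Rightarrow> nat" where
  "in_cap x i r = nth_or 0 (nth_or [] (fst (snd (snd (snd (snd (snd (fst x))))))) i) r"
definition in_count :: "input \<Rightarrow> nat \<Rightarrow> nat" where
  "in_count x r = nth_or 0 (fst (snd (snd (snd (snd (snd (snd (fst x)))))))) r"
definition in_types :: "input \<Rightarrow> nat list" where
  "in_types x = [0..<length (fst (snd (snd (snd (snd (snd (snd (fst x))))))))]"
definition in_range :: "input \<Rightarrow> bool list" where "in_range x = fst (snd x)"
definition in_budget :: "input \<Rightarrow> bool list" where "in_budget x = snd (snd x)"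

lemma ptime_input [ptime_intros]:
  assumes "ptime x"
  shows "ptime (\<lambda>z. in_sups (x z))" "ptime (\<lambda>z. in_coms (x z))" "ptime (\<lambda>z. in_types (x z))"
    "ptime (\<lambda>z. in_range (x z))" "ptime (\<lambda>z. in_budget (x z))"
    "ptime k \<Longrightarrow> ptime i \<Longrightarrow> ptime (\<lambda>z. in_supply (x z) (k z) (i z))"
    "ptime k \<Longrightarrow> ptime i \<Longrightarrow> ptime (\<lambda>z. in_demand (x z) (k z) (i z))"
    "ptime k \<Longrightarrow> ptime i \<Longrightarrow> ptime (\<lambda>z. in_cap (x z) (k z) (i z))"
    "ptime k \<Longrightarrow> ptime (\<lambda>z. in_count (x z) (k z))"
  unfolding in_sups_def in_coms_def in_types_def in_range_def in_budget_def in_supply_def in_demand_def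
    in_cap_def in_count_def
  by (intro ptime_intros assms; assumption)+

text \<open>
  Stage 1 packs the total flows of commodity \<open>k\<close> from supplier \<open>i\<close> to all consumers of type
  \<open>r\<close>; suppliers are the bricks, and \<open>(k, r)\<close> is the edge with number \<open>k * t + r\<close>.
\<close>

definition flow_edges :: "input \<Rightarrow> nat list" where
  "flow_edges x = [0..<length (concat (map (\<lambda>_. in_types x) (in_coms x)))]"

text \<open>The first masks collect all types of one commodity, bounded by the supply; the others
  collect all commodities of one type, bounded by the capacity towards all its consumers.\<close>

definition flow_masks :: "input \<Rightarrow> bool list list" where
  "flow_masks x = map (\<lambda>k. map (\<lambda>e. e div length (in_types x) = k) (flow_edges x)) (in_coms x) @
     map (\<lambda>r. map (\<lambda>e. e mod length (in_types x) = r) (flow_edges x)) (in_types x)"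

definition flow_caps :: "input \<Rightarrow> int list list" where
  "flow_caps x = map (\<lambda>i. map (\<lambda>k. int (in_supply x k i)) (in_coms x) @
     map (\<lambda>r. int (in_count x r * in_cap x i r)) (in_types x)) (in_sups x)"

definition flow_demands :: "input \<Rightarrow> int list" where
  "flow_demands x = map (\<lambda>e. int (in_count x (e mod length (in_types x)) *
     in_demand x (e div length (in_types x)) (e mod length (in_types x)))) (flow_edges x)"

text \<open>The admissible gap grows with the number of bricks, so the budget is repeated once per
  supplier and once more.\<close>

definition tries :: "input \<Rightarrow> bool list" where
  "tries x = concat (map (\<lambda>_. in_budget x) (in_sups x)) @ in_budget x"

definition total_flow :: "input \<Rightarrow> int list list" where
  "total_flow x = maxpack (box (in_range x) (in_budget x) (flow_edges x)) (flow_masks x) (flow_caps x) (flow_demands x) (tries x)"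

definition flow_entry :: "input \<Rightarrow> int list list \<Rightarrow> nat \<Rightarrow> nat \<Rightarrow> nat \<Rightarrow> int" where
  "flow_entry x X k i r = nth_or 0 (nth_or [] X i) (k * length (in_types x) + r)"

text \<open>No supply and no demand is left open; capacities remain inequalities.\<close>

definition saturated :: "input \<Rightarrow> int list list \<Rightarrow> bool" where
  "saturated x X \<longleftrightarrow> column_sums (flow_demands x) X = flow_demands x \<and>
     list_all (\<lambda>i. list_all (\<lambda>k. sum_list (map (\<lambda>r. flow_entry x X k i r) (in_types x)) = int (in_supply x k i))
       (in_coms x)) (in_sups x)"

text \<open>Stage 2 splits the flow to the consumers of one type, with the unused capacity as an additional commodity.\<close>

definition type_matrix :: "input \<Rightarrow> int list list \<Rightarrow> nat \<Rightarrow> nat list list" where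
  "type_matrix x X r = map (\<lambda>i. map (\<lambda>k. nat (flow_entry x X k i r)) (in_coms x) @
     [in_count x r * in_cap x i r - sum_list (map (\<lambda>k. nat (flow_entry x X k i r)) (in_coms x))]) (in_sups x)"

definition slack_coms :: "input \<Rightarrow> nat list" where
  "slack_coms x = [0..<length (0 # in_coms x)]"

text \<open>The round counter is one longer than the number of matrix entries, including those of
  the slack commodity.\<close>

definition type_decomposition :: "input \<Rightarrow> int list list \<Rightarrow> nat \<Rightarrow> (nat \<times> nat list list) list" where
  "type_decomposition x X r =
     decompose (box (in_range x) (in_budget x) (slack_coms x)) (tries x) (slack_coms x)
       (0 # concat (map (\<lambda>_. slack_coms x) (in_sups x))) (in_count x r) (type_matrix x X r)"

text \<open>Transposes slices, which are listed by supplier, into patterns listed by commodity, and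
  drops the slack.\<close>

definition type_answer :: "input \<Rightarrow> int list list \<Rightarrow> nat \<Rightarrow> (nat \<times> pattern) list" where
  "type_answer x X r = map (\<lambda>p. (fst p, map (\<lambda>k. map (\<lambda>z. nth_or 0 z k) (snd p)) (in_coms x)))
     (type_decomposition x X r)"

definition solve :: "input \<Rightarrow> compact option" where
  "solve x = (let X = total_flow x in
     if saturated x X then Some (map (\<lambda>r. type_answer x X r) (in_types x)) else None)"

lemma ptime_flow_edges [ptime_intros]: "ptime x \<Longrightarrow> ptime (\<lambda>z. flow_edges (x z))"
  by (rule ptime_comp[of flow_edges]) (unfold flow_edges_def, intro ptime_intros, assumption)

lemma ptime_flow_masks [ptime_intros]: "ptime x \<Longrightarrow> ptime (\<lambda>z. flow_masks (x z))"
  by (rule ptime_comp[of flow_masks]) (unfold flow_masks_def, intro ptime_intros, assumption)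

lemma ptime_flow_caps [ptime_intros]: "ptime x \<Longrightarrow> ptime (\<lambda>z. flow_caps (x z))"
  by (rule ptime_comp[of flow_caps]) (unfold flow_caps_def, intro ptime_intros, assumption)

lemma ptime_flow_demands [ptime_intros]: "ptime x \<Longrightarrow> ptime (\<lambda>z. flow_demands (x z))"
  by (rule ptime_comp[of flow_demands]) (unfold flow_demands_def, intro ptime_intros, assumption)

lemma ptime_tries [ptime_intros]: "ptime x \<Longrightarrow> ptime (\<lambda>z. tries (x z))"
  by (rule ptime_comp[of tries]) (unfold tries_def, intro ptime_intros, assumption)

lemma ptime_slack_coms [ptime_intros]: "ptime x \<Longrightarrow> ptime (\<lambda>z. slack_coms (x z))"
  by (rule ptime_comp[of slack_coms]) (unfold slack_coms_def, intro ptime_intros, assumption)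

lemma ptime_total_flow [ptime_intros]: "ptime x \<Longrightarrow> ptime (\<lambda>z. total_flow (x z))"
  by (rule ptime_comp[of total_flow]) (unfold total_flow_def, intro ptime_intros, assumption)

lemma ptime_flow_entry [ptime_intros]:
  assumes "ptime x" "ptime X" "ptime k" "ptime i" "ptime r"
  shows "ptime (\<lambda>z. flow_entry (x z) (X z) (k z) (i z) (r z))"
  unfolding flow_entry_def by (intro ptime_intros assms)

lemma ptime_saturated [ptime_intros]:
  assumes "ptime x" "ptime X"
  shows "ptime (\<lambda>z. saturated (x z) (X z))"
  unfolding saturated_def by (intro ptime_intros assms ptime_comp[OF assms(1)] ptime_comp[OF assms(2)])

lemma ptime_type_answer [ptime_intros]:
  assumes "ptime x" "ptime X" "ptime r"
  shows "ptime (\<lambda>z. type_answer (x z) (X z) (r z))"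
  unfolding type_answer_def type_decomposition_def type_matrix_def
  by (intro ptime_intros assms ptime_comp[OF assms(1)] ptime_comp[OF assms(2)] ptime_comp[OF assms(3)])

theorem ptime_solve: "ptime solve"
  unfolding solve_def[abs_def] by (intro ptime_intros)

section \<open>Correctness of the algorithm on an instance\<close>

definition instance_input :: "huge_mcf \<Rightarrow> bool list \<Rightarrow> bool list \<Rightarrow> input" where
  "instance_input I bs N = ((commodities I, replicate (suppliers I) True, types I,
     map (\<lambda>k. map (\<lambda>i. supplies I k i) [0..<suppliers I]) [0..<commodities I],
     map (\<lambda>k. map (\<lambda>r. consumptions I k r) [0..<types I]) [0..<commodities I],
     map (\<lambda>i. map (\<lambda>r. capacities I i r) [0..<types I]) [0..<suppliers I],
     map (\<lambda>r. type_count I r) [0..<types I], ()), bs, N)"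

lemma sum_edges:
  fixes f :: "nat \<Rightarrow> 'b::comm_monoid_add"
  shows "sum f {..<l * t} = (\<Sum>k<l. \<Sum>r<t. f (k * t + r))"
proof -
  have "sum f {k * t..<k * t + t} = (\<Sum>r<t. f (k * t + r))" for k
    using sum.shift_bounds_nat_ivl[of f 0 "k * t" t] by (simp add: atLeast0LessThan add.commute)
  then show ?thesis by (simp flip: sum.nat_group)
qed

lemma edge_less: "k < l \<Longrightarrow> r < t \<Longrightarrow> k * t + r < l * t" for t :: nat
proof -
  assume "k < l" "r < t"
  then have "k * t + r < (k + 1) * t" "(k + 1) * t \<le> l * t" by (simp, intro mult_le_mono1, simp)
  then show ?thesis by linarith
qed

lemma edge_cases:
  assumes "e < l * (t::nat)"
  obtains k r where "k < l" "r < t" "e = k * t + r"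
proof -
  have "t > 0" using assms by (cases t) auto
  then have "e div t < l" "e mod t < t" using assms by (auto simp: less_mult_imp_div_less)
  then show ?thesis using that[of "e div t" "e mod t"] by simp
qed

lemma all_edges: "(\<forall>e<l * t. P e) \<longleftrightarrow> (\<forall>k<l. \<forall>r<t. P (k * t + r))" for t :: nat
  by (auto simp: edge_less elim!: edge_cases)

lemma sum_list_map_concat: "sum_list (map g (concat (map f xs))) = (\<Sum>x\<leftarrow>xs. sum_list (map g (f x)))"
  by (induction xs) auto

lemma sum_list_weighted:
  fixes g :: "'b \<Rightarrow> nat"
  shows "sum_list (map g (concat (map (\<lambda>p. replicate (fst p) (snd p)) ps))) = (\<Sum>p\<leftarrow>ps. fst p * g (snd p))"
  by (induction ps) (auto simp: sum_list_replicate)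

text \<open>Each bound occurs twice: for the total flows with \<open>l * t\<close> edges and
  \<open>l + t\<close> constraints per brick, and for the splitting with \<open>l + 1\<close> edges
  and \<open>l + 2\<close> constraints.\<close>

locale huge_instance =
  fixes I :: huge_mcf and bs N :: "bool list"
  assumes inst: "I \<in> huge_mcf_instances"
    and bs: "step_bound (commodities I * types I) (commodities I + types I) \<le> length bs"
      "step_bound (commodities I + 1) (commodities I + 2) \<le> length bs"
    and N_box: "(2 * length bs + 1) ^ (commodities I * types I) \<le> length N"
      "(2 * length bs + 1) ^ (commodities I + 1) \<le> length N"
    and N_gap: "2 * gap_bound (commodities I * types I) (commodities I + types I) \<le> length N"
      "2 * gap_bound (commodities I + 1) (commodities I + 2) \<le> length N"
begin

abbreviation l :: nat where "l \<equiv> commodities I"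
abbreviation m :: nat where "m \<equiv> suppliers I"
abbreviation t :: nat where "t \<equiv> types I"
abbreviation s :: "nat \<Rightarrow> nat \<Rightarrow> nat" where "s \<equiv> supplies I"
abbreviation c :: "nat \<Rightarrow> nat \<Rightarrow> nat" where "c \<equiv> consumptions I"
abbreviation u :: "nat \<Rightarrow> nat \<Rightarrow> nat" where "u \<equiv> capacities I"
abbreviation n :: "nat \<Rightarrow> nat" where "n \<equiv> type_count I"
abbreviation x :: input where "x \<equiv> instance_input I bs N"

lemma input [simp]:
  "in_sups x = [0..<m]" "in_coms x = [0..<l]" "in_types x = [0..<t]" "in_range x = bs" "in_budget x = N"
  "k < l \<Longrightarrow> i < m \<Longrightarrow> in_supply x k i = s k i"
  "k < l \<Longrightarrow> r < t \<Longrightarrow> in_demand x k r = c k r"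
  "i < m \<Longrightarrow> r < t \<Longrightarrow> in_cap x i r = u i r"
  "r < t \<Longrightarrow> in_count x r = n r"
  by (simp_all add: instance_input_def in_sups_def in_coms_def in_types_def in_range_def in_budget_def
      in_supply_def in_demand_def in_cap_def in_count_def)

lemma flow_edges_eq: "flow_edges x = [0..<l * t]"
  by (simp add: flow_edges_def length_concat comp_def sum_list_triv)

lemma lengths:
  "length (flow_demands x) = l * t" "length (flow_masks x) = l + t" "length (flow_caps x) = m"
  by (simp_all add: flow_demands_def flow_edges_eq flow_masks_def flow_caps_def)

lemma tries_length: "length (tries x) = (m + 1) * length N"
  by (simp add: tries_def length_concat comp_def sum_list_triv)

sublocale packing "box bs N (flow_edges x)" "flow_masks x" "flow_caps x" "flow_demands x"
  rewrites "length (flow_caps x) = m" and "length (flow_demands x) = l * t"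
proof -
  show "packing (box bs N (flow_edges x)) (flow_masks x) (flow_caps x) (flow_demands x)"
  proof
    fix g :: "int list"
    assume "length g = length (flow_demands x)"
      "\<And>e. e < length (flow_demands x) \<Longrightarrow> \<bar>g ! e\<bar> \<le> int (step_bound (length (flow_demands x)) (length (flow_masks x)))"
    then show "g \<in> set (box bs N (flow_edges x))"
      using bs(1) N_box(1) unfolding lengths
      by (intro box_complete) (force simp: flow_edges_eq)+
  qed (auto simp: flow_masks_def flow_edges_eq flow_caps_def flow_demands_def dest!: box_length)
qed (simp_all add: lengths)

lemma edges_row: "k < l \<Longrightarrow> edges k = (\<lambda>r. k * t + r) ` {..<t}"
proof -
  assume k: "k < l"
  have "edges k = {e. e < l * t \<and> e div t = k}"
    unfolding edges_def using k by (auto simp: flow_masks_def flow_edges_eq nth_append)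
  also have "\<dots> = (\<lambda>r. k * t + r) ` {..<t}"
  proof (intro equalityI subsetI)
    fix e assume "e \<in> {e. e < l * t \<and> e div t = k}"
    then show "e \<in> (\<lambda>r. k * t + r) ` {..<t}" by (auto elim!: edge_cases)
  qed (auto simp: edge_less[OF k])
  finally show ?thesis .
qed

lemma edges_column: "r < t \<Longrightarrow> edges (l + r) = (\<lambda>k. k * t + r) ` {..<l}"
proof -
  assume r: "r < t"
  have "edges (l + r) = {e. e < l * t \<and> e mod t = r}"
    unfolding edges_def using r by (auto simp: flow_masks_def flow_edges_eq nth_append)
  also have "\<dots> = (\<lambda>k. k * t + r) ` {..<l}"
  proof (intro equalityI subsetI)
    fix e assume "e \<in> {e. e < l * t \<and> e mod t = r}"
    then show "e \<in> (\<lambda>k. k * t + r) ` {..<l}" by (auto elim!: edge_cases)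
  qed (use r in \<open>auto simp: edge_less\<close>)
  finally show ?thesis .
qed

lemma sum_edges_row: "k < l \<Longrightarrow> sum f (edges k) = (\<Sum>r<t. f (k * t + r))" for f :: "nat \<Rightarrow> int"
  by (simp add: edges_row sum.reindex inj_on_def)

lemma sum_edges_column: "r < t \<Longrightarrow> sum f (edges (l + r)) = (\<Sum>k<l. f (k * t + r))" for f :: "nat \<Rightarrow> int"
proof -
  assume r: "r < t"
  have "inj_on (\<lambda>k. k * t + r) {..<l}" using r by (auto simp: inj_on_def)
  then show ?thesis by (simp add: edges_column[OF r] sum.reindex)
qed

lemma valid_brick_iff:
  assumes i: "i < m"
  shows "valid_brick i y \<longleftrightarrow> length y = l * t \<and> (\<forall>k<l. \<forall>r<t. 0 \<le> y ! (k * t + r)) \<and>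
    (\<forall>k<l. (\<Sum>r<t. y ! (k * t + r)) \<le> int (s k i)) \<and>
    (\<forall>r<t. (\<Sum>k<l. y ! (k * t + r)) \<le> int (n r * u i r))"
proof -
  have cap: "flow_caps x ! i ! k = int (s k i)" if "k < l" for k
    using i that by (simp add: flow_caps_def nth_append)
  have cap': "flow_caps x ! i ! (l + r) = int (n r * u i r)" if "r < t" for r
    using i that by (simp add: flow_caps_def nth_append)
  have nonneg: "(\<forall>e\<in>{..<l * t}. 0 \<le> y ! e) \<longleftrightarrow> (\<forall>k<l. \<forall>r<t. 0 \<le> y ! (k * t + r))"
    by (auto simp: edge_less elim!: edge_cases)
  have "{..<l + t} = {..<l} \<union> (\<lambda>r. l + r) ` {..<t}"
  proof (intro equalityI subsetI)
    fix f assume "f \<in> {..<l + t}"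
    then show "f \<in> {..<l} \<union> (\<lambda>r. l + r) ` {..<t}" by (cases "f < l") (auto intro!: image_eqI[of _ _ "f - l"])
  qed auto
  then have caps: "(\<forall>f\<in>{..<l + t}. sum (\<lambda>e. y ! e) (edges f) \<le> flow_caps x ! i ! f) \<longleftrightarrow>
      (\<forall>k<l. (\<Sum>r<t. y ! (k * t + r)) \<le> int (s k i)) \<and> (\<forall>r<t. (\<Sum>k<l. y ! (k * t + r)) \<le> int (n r * u i r))"
    by (simp add: ball_Un sum_edges_row sum_edges_column cap cap') (auto simp: Ball_def)
  show ?thesis unfolding valid_brick_def brick_fits_def lengths(2) nonneg caps by blast
qed

lemma demand_nth: "k < l \<Longrightarrow> r < t \<Longrightarrow> flow_demands x ! (k * t + r) = int (n r * c k r)"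
  by (simp add: flow_demands_def flow_edges_eq edge_less)

lemma valid_iff:
  "valid Y \<longleftrightarrow> length Y = m \<and> (\<forall>i<m. length (Y ! i) = l * t \<and> (\<forall>k<l. \<forall>r<t. 0 \<le> Y ! i ! (k * t + r)) \<and>
    (\<forall>k<l. (\<Sum>r<t. Y ! i ! (k * t + r)) \<le> int (s k i)) \<and>
    (\<forall>r<t. (\<Sum>k<l. Y ! i ! (k * t + r)) \<le> int (n r * u i r))) \<and>
    (\<forall>k<l. \<forall>r<t. (\<Sum>i<m. Y ! i ! (k * t + r)) \<le> int (n r * c k r))"
proof -
  have "(\<forall>e<l * t. (\<Sum>i<m. Y ! i ! e) \<le> flow_demands x ! e) \<longleftrightarrow>
    (\<forall>k<l. \<forall>r<t. (\<Sum>i<m. Y ! i ! (k * t + r)) \<le> int (n r * c k r))"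
    unfolding all_edges by (simp add: demand_nth)
  then show ?thesis unfolding valid_def using valid_brick_iff by auto
qed

lemma total_eq: "total Y = (\<Sum>i<m. \<Sum>k<l. \<Sum>r<t. Y ! i ! (k * t + r))"
  by (simp add: total_def sum_edges)

lemma total_flow_optimal: "valid (total_flow x)" "valid Y \<Longrightarrow> total Y \<le> total (total_flow x)"
proof -
  have "2 * (m + 1) * gap_bound (l * t) (length (flow_masks x)) \<le> length (tries x)"
    using mult_le_mono2[OF N_gap(1), of "m + 1"] unfolding tries_length lengths(2) by (simp add: algebra_simps)
  from maxpack_optimal[OF this] show "valid (total_flow x)" "valid Y \<Longrightarrow> total Y \<le> total (total_flow x)"
    unfolding total_flow_def by auto
qed

lemma flow_entry_eq: "valid Y \<Longrightarrow> i < m \<Longrightarrow> k < l \<Longrightarrow> r < t \<Longrightarrow> flow_entry x Y k i r = Y ! i ! (k * t + r)"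
  using valid_lengths[of Y] by (simp add: flow_entry_def edge_less)

lemma saturated_iff:
  assumes Y: "valid Y"
  shows "saturated x Y \<longleftrightarrow> (\<forall>k<l. \<forall>r<t. (\<Sum>i<m. Y ! i ! (k * t + r)) = int (n r * c k r)) \<and>
    (\<forall>i<m. \<forall>k<l. (\<Sum>r<t. Y ! i ! (k * t + r)) = int (s k i))"
proof -
  have "column_sums (flow_demands x) Y = flow_demands x \<longleftrightarrow> (\<forall>e<l * t. (\<Sum>i<m. Y ! i ! e) = flow_demands x ! e)"
    using column_sums_nth[OF Y] by (auto simp: list_eq_iff_nth_eq column_sums_def lengths)
  also have "\<dots> \<longleftrightarrow> (\<forall>k<l. \<forall>r<t. (\<Sum>i<m. Y ! i ! (k * t + r)) = int (n r * c k r))"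
    unfolding all_edges by (simp add: demand_nth)
  finally have 1: "column_sums (flow_demands x) Y = flow_demands x \<longleftrightarrow>
    (\<forall>k<l. \<forall>r<t. (\<Sum>i<m. Y ! i ! (k * t + r)) = int (n r * c k r))" .
  have "sum_list (map (\<lambda>r. flow_entry x Y k i r) [0..<t]) = (\<Sum>r<t. Y ! i ! (k * t + r))" if "i < m" "k < l" for i k
    using flow_entry_eq[OF Y that] by (simp add: sum_list_sum_nth atLeast0LessThan)
  then show ?thesis unfolding saturated_def 1 by (auto simp: list_all_iff)
qed

definition consumers :: "nat list" where
  "consumers = concat (map (\<lambda>r. replicate (n r) r) [0..<t])"

lemma length_consumers: "length consumers = num_consumers I"
  by (simp add: consumers_def num_consumers_def length_concat comp_def sum_list_sum_nth atLeast0LessThan)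

lemma consumer_type_eq: "consumer_type I j = consumers ! j"
  by (simp add: consumer_type_def consumers_def)

lemma consumer_type_less: "j < num_consumers I \<Longrightarrow> consumer_type I j < t"
  using nth_mem[of j consumers] unfolding consumer_type_eq length_consumers[symmetric]
  by (auto simp: consumers_def)

lemma card_consumers: "r < t \<Longrightarrow> card {j. j < num_consumers I \<and> consumer_type I j = r} = n r"
proof -
  assume r: "r < t"
  have "card {j. j < num_consumers I \<and> consumer_type I j = r} = length (filter (\<lambda>r'. r' = r) consumers)"
    unfolding consumer_type_eq length_consumers[symmetric] by (simp add: length_filter_conv_card)
  also have "filter (\<lambda>r'. r' = r) consumers = concat (map (\<lambda>r'. if r' = r then replicate (n r) r else []) [0..<t])"
    unfolding consumers_def filter_concat map_map comp_def
    by (intro arg_cong[where f = concat] map_cong) auto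
  also have "length \<dots> = (\<Sum>r'<t. if r' = r then n r else 0)"
    by (simp add: length_concat comp_def if_distrib[where f = length] sum_list_sum_nth atLeast0LessThan cong: if_cong)
  also have "\<dots> = n r" using r by simp
  finally show ?thesis .
qed

text \<open>Summing a feasible flow over the consumers of each type gives a packing that meets all
  supplies and demands. An optimal packing has at least this total, so it can leave no supply or
  demand open.\<close>

lemma feasible_saturated:
  assumes z: "feasible_flow I z"
  shows "saturated x (total_flow x)"
proof -
  let ?n = "num_consumers I"
  define f where "f k i r = (\<Sum>j\<in>{j. j < ?n \<and> consumer_type I j = r}. z k i j)" for k i r
  have fr: "(\<Sum>r<t. f k i r) = s k i" if "i < m" "k < l" for k i
  proof -
    have "(\<Sum>r<t. f k i r) = (\<Sum>r<t. sum (z k i) {j\<in>{..<?n}. consumer_type I j = r})" by (simp add: f_def)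
    also have "\<dots> = (\<Sum>j<?n. z k i j)" using consumer_type_less by (intro sum.group) auto
    also have "\<dots> = s k i" using z that by (simp add: feasible_flow_def)
    finally show ?thesis .
  qed
  have fi: "(\<Sum>i<m. f k i r) = n r * c k r" if "k < l" "r < t" for k r
  proof -
    have "(\<Sum>i<m. f k i r) = (\<Sum>j\<in>{j. j < ?n \<and> consumer_type I j = r}. \<Sum>i<m. z k i j)"
      unfolding f_def by (rule sum.swap)
    also have "\<dots> = (\<Sum>j\<in>{j. j < ?n \<and> consumer_type I j = r}. c k r)"
      using z that by (intro sum.cong) (auto simp: feasible_flow_def)
    finally show ?thesis using card_consumers[OF that(2)] by simp
  qed
  have fk: "(\<Sum>k<l. f k i r) \<le> n r * u i r" if "i < m" "r < t" for i r
  proof -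
    have "(\<Sum>k<l. f k i r) = (\<Sum>j\<in>{j. j < ?n \<and> consumer_type I j = r}. \<Sum>k<l. z k i j)"
      unfolding f_def by (rule sum.swap)
    also have "\<dots> \<le> (\<Sum>j\<in>{j. j < ?n \<and> consumer_type I j = r}. u i r)"
      using z that by (intro sum_mono) (auto simp: feasible_flow_def)
    finally show ?thesis using card_consumers[OF that(2)] by simp
  qed
  define Y where "Y = map (\<lambda>i. map (\<lambda>e. int (f (e div t) i (e mod t))) [0..<l * t]) [0..<m]"
  have Y: "Y ! i ! (k * t + r) = int (f k i r)" if "i < m" "k < l" "r < t" for i k r
    using that by (simp add: Y_def edge_less)
  have "valid Y" unfolding valid_iff
  proof (intro conjI allI impI)
    fix i r assume "i < m" "r < t"
    then show "(\<Sum>k<l. Y ! i ! (k * t + r)) \<le> int (n r * u i r)"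
      using fk[of i r] by (simp add: Y flip: of_nat_sum of_nat_mult)
  next
    fix i k assume "i < m" "k < l"
    then show "(\<Sum>r<t. Y ! i ! (k * t + r)) \<le> int (s k i)"
      using fr[of i k] by (simp add: Y flip: of_nat_sum)
  next
    fix k r assume "k < l" "r < t"
    then show "(\<Sum>i<m. Y ! i ! (k * t + r)) \<le> int (n r * c k r)"
      using fi[of k r] by (simp add: Y flip: of_nat_sum of_nat_mult)
  qed (auto simp: Y, auto simp: Y_def)
  define X where "X = total_flow x"
  have X: "valid X" and le: "total Y \<le> total X" using total_flow_optimal \<open>valid Y\<close> by (auto simp: X_def)
  have tY: "total Y = (\<Sum>i<m. \<Sum>k<l. \<Sum>r<t. int (f k i r))"
    unfolding total_eq by (intro sum.cong) (auto simp: Y)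
  have tY1: "total Y = (\<Sum>i<m. \<Sum>k<l. int (s k i))" unfolding tY
    using fr by (intro sum.cong) (auto simp flip: of_nat_sum)
  have swap: "(\<Sum>i<m. \<Sum>k<l. \<Sum>r<t. g i k r) = (\<Sum>k<l. \<Sum>r<t. \<Sum>i<m. g i k r)" for g :: "nat \<Rightarrow> nat \<Rightarrow> nat \<Rightarrow> int"
  proof -
    have "(\<Sum>i<m. \<Sum>k<l. \<Sum>r<t. g i k r) = (\<Sum>k<l. \<Sum>i<m. \<Sum>r<t. g i k r)" by (rule sum.swap)
    also have "\<dots> = (\<Sum>k<l. \<Sum>r<t. \<Sum>i<m. g i k r)" by (rule sum.cong[OF refl]) (rule sum.swap)
    finally show ?thesis .
  qed
  have tY2: "total Y = (\<Sum>k<l. \<Sum>r<t. int (n r * c k r))" unfolding tY swap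
    using fi by (intro sum.cong) (auto simp flip: of_nat_sum)
  have tX: "total X = (\<Sum>i<m. \<Sum>k<l. \<Sum>r<t. X ! i ! (k * t + r))" by (rule total_eq)
  \<comment> \<open>One open supply would push the total below the sum of all supplies, which is the
    total of \<open>Y\<close>.\<close>
  have 1: "(\<Sum>r<t. X ! i ! (k * t + r)) = int (s k i)" if "i < m" "k < l" for i k
  proof (rule ccontr)
    assume "(\<Sum>r<t. X ! i ! (k * t + r)) \<noteq> int (s k i)"
    then have lt: "(\<Sum>r<t. X ! i ! (k * t + r)) < int (s k i)" using X that unfolding valid_iff by (simp add: less_le)
    have leX: "(\<Sum>r<t. X ! i ! (k * t + r)) \<le> int (s k i)" if "i < m" "k < l" for i k
      using X that unfolding valid_iff by blast
    have "(\<Sum>k<l. \<Sum>r<t. X ! i ! (k * t + r)) < (\<Sum>k<l. int (s k i))"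
      by (intro sum_strict_mono_ex1) (use leX that lt in auto)
    then have "total X < total Y" unfolding tX tY1
      by (intro sum_strict_mono_ex1) (use leX that in \<open>auto intro!: sum_mono\<close>)
    then show False using le by simp
  qed
  have 2: "(\<Sum>i<m. X ! i ! (k * t + r)) = int (n r * c k r)" if "k < l" "r < t" for k r
  proof (rule ccontr)
    assume "(\<Sum>i<m. X ! i ! (k * t + r)) \<noteq> int (n r * c k r)"
    then have lt: "(\<Sum>i<m. X ! i ! (k * t + r)) < int (n r * c k r)" using X that unfolding valid_iff by (simp add: less_le)
    have leX: "(\<Sum>i<m. X ! i ! (k * t + r)) \<le> int (n r * c k r)" if "k < l" "r < t" for k r
      using X that unfolding valid_iff by blast
    have "(\<Sum>r<t. \<Sum>i<m. X ! i ! (k * t + r)) < (\<Sum>r<t. int (n r * c k r))"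
      by (intro sum_strict_mono_ex1) (use leX that lt in auto)
    then have "total X < total Y" unfolding tX tY2 swap
      by (intro sum_strict_mono_ex1) (use leX that in \<open>auto intro!: sum_mono\<close>)
    then show False using le by simp
  qed
  show ?thesis unfolding X_def[symmetric] saturated_iff[OF X] using 1 2 by blast
qed

definition slack :: "nat \<Rightarrow> nat \<Rightarrow> nat" where
  "slack r k = (if k < l then c k r else (\<Sum>i<m. u i r) - (\<Sum>k<l. c k r))"

lemma decomposition: "decomposition (box bs N (slack_coms x)) (tries x) (l + 1) m"
proof
  have es: "slack_coms x = [0..<l + 1]" by (simp add: slack_coms_def del: upt_Suc)
  show "length g = l + 1" if "g \<in> set (box bs N (slack_coms x))" for g
    using box_length[OF that] by (simp add: es del: upt_Suc)
  show "g \<in> set (box bs N (slack_coms x))"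
    if "length g = l + 1" "\<And>e. e < l + 1 \<Longrightarrow> \<bar>g ! e\<bar> \<le> int (step_bound (l + 1) (l + 1 + 1))" for g
  proof (rule box_complete)
    show "\<bar>g ! e\<bar> \<le> int (length bs)" if "e < length (slack_coms x)" for e
      using \<open>\<And>e. e < l + 1 \<Longrightarrow> \<bar>g ! e\<bar> \<le> int (step_bound (l + 1) (l + 1 + 1))\<close>[of e] bs(2) that
      by (simp add: es del: upt_Suc)
  qed (use that N_box(2) in \<open>simp_all add: es del: upt_Suc\<close>)
  show "2 * (m + 1) * gap_bound (l + 1) (l + 1 + 1) \<le> length (tries x)"
    using mult_le_mono2[OF N_gap(2), of "m + 1"] unfolding tries_length by (simp add: algebra_simps)
qed

text \<open>Patterns of positive multiplicity are slices with margins 1. Those of multiplicity 0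
  stem from rounds after the last consumer, where the shape alone is guaranteed; hence the
  guard.\<close>

lemma type_answer_correct:
  assumes X: "valid X" and sat: "saturated x X" and r: "r < t"
  shows "\<And>\<mu> z. (\<mu>, z) \<in> set (type_answer x X r) \<Longrightarrow> is_pattern I z \<and>
      (\<mu> > 0 \<longrightarrow> (\<forall>k<l. (\<Sum>i<m. z ! k ! i) = c k r) \<and> (\<forall>i<m. (\<Sum>k<l. z ! k ! i) \<le> u i r))"
    and "(\<Sum>(\<mu>, z)\<leftarrow>type_answer x X r. \<mu>) = n r"
    and "\<And>k i. k < l \<Longrightarrow> i < m \<Longrightarrow> int (\<Sum>(\<mu>, z)\<leftarrow>type_answer x X r. \<mu> * z ! k ! i) = X ! i ! (k * t + r)"
proof -
  interpret D: decomposition "box bs N (slack_coms x)" "tries x" "l + 1" m "\<lambda>i. u i r" "slack r"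
    by (rule decomposition)
  have es: "slack_coms x = [0..<l + 1]" by (simp add: slack_coms_def del: upt_Suc)
  let ?Z = "type_matrix x X r"
  define f where "f i k = nat (X ! i ! (k * t + r))" for i k
  have f: "int (f i k) = X ! i ! (k * t + r)" if "i < m" "k < l" for i k
    using X that r unfolding valid_iff by (simp add: f_def)
  have f_le: "(\<Sum>k<l. f i k) \<le> n r * u i r" if "i < m" for i
  proof -
    have "int (\<Sum>k<l. f i k) \<le> int (n r * u i r)" using X that r f[OF that] unfolding valid_iff by simp
    then show ?thesis by (simp only: of_nat_le_iff)
  qed
  have f_sum: "(\<Sum>i<m. f i k) = n r * c k r" if "k < l" for k
  proof -
    have "int (\<Sum>i<m. f i k) = int (n r * c k r)" using sat that r f[OF _ that] unfolding saturated_iff[OF X] by simp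
    then show ?thesis by (simp only: of_nat_eq_iff)
  qed
  have map_f: "map (\<lambda>k. nat (flow_entry x X k i r)) [0..<l] = map (f i) [0..<l]" if "i < m" for i
    using flow_entry_eq[OF X that _ r] by (simp add: f_def)
  have Z_len: "length ?Z = m" "i < m \<Longrightarrow> length (?Z ! i) = l + 1" for i by (simp_all add: type_matrix_def)
  have Z: "?Z ! i ! k = (if k < l then f i k else n r * u i r - (\<Sum>k<l. f i k))" if "i < m" "k < l + 1" for i k
    using that r map_f[OF that(1)] by (simp add: type_matrix_def nth_append sum_list_sum_nth atLeast0LessThan)
  have "D.margins (n r) ?Z" unfolding D.margins_def D.shaped_def
  proof (intro conjI allI impI)
    fix i assume i: "i < m"
    show "length (?Z ! i) = l + 1" using Z_len(2)[OF i] .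
    show "(\<Sum>k<l + 1. ?Z ! i ! k) = n r * u i r" using Z[OF i] f_le[OF i] by simp
  next
    fix k assume k: "k < l + 1"
    show "(\<Sum>i<m. ?Z ! i ! k) = n r * slack r k"
    proof (cases "k < l")
      case True
      then show ?thesis using Z f_sum by (simp add: slack_def)
    next
      case False
      have "(\<Sum>i<m. ?Z ! i ! k) = (\<Sum>i<m. n r * u i r - (\<Sum>k<l. f i k))" using Z k False by simp
      also have "\<dots> = (\<Sum>i<m. n r * u i r) - (\<Sum>i<m. \<Sum>k<l. f i k)"
        using f_le by (subst sum_subtractf_nat[symmetric]) auto
      also have "(\<Sum>i<m. \<Sum>k<l. f i k) = (\<Sum>k<l. n r * c k r)"
        using f_sum by (subst sum.swap) simp
      finally show ?thesis using False
        by (simp add: slack_def diff_mult_distrib2 sum_distrib_left)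
    qed
  qed (simp_all add: Z_len)
  note dec = D.decompose_correct[OF this, of "0 # concat (map (\<lambda>_. slack_coms x) (in_sups x))"]
  define ps where "ps = type_decomposition x X r"
  have len: "m * (l + 1) < length (0 # concat (map (\<lambda>_. slack_coms x) (in_sups x)))"
    by (simp add: length_concat comp_def es sum_list_triv del: upt_Suc)
  have ps: "decompose (box bs N (slack_coms x)) (tries x) [0..<l + 1] (0 # concat (map (\<lambda>_. slack_coms x) (in_sups x))) (n r) ?Z = ps"
    using r by (simp add: ps_def type_decomposition_def es del: upt_Suc)
  note dec = dec[OF len, unfolded ps]
  define patt where "patt z = map (\<lambda>k. map (\<lambda>y. nth_or 0 y k) z) [0..<l]" for z :: "nat list list"
  have ans: "type_answer x X r = map (\<lambda>p. (fst p, patt (snd p))) ps"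
    by (simp add: type_answer_def ps_def patt_def)
  have patt: "is_pattern I (patt z)" "\<And>k i. k < l \<Longrightarrow> i < m \<Longrightarrow> patt z ! k ! i = z ! i ! k" if "D.shaped z" for z
    using that[unfolded D.shaped_def] by (auto simp: is_pattern_def patt_def)
  show "is_pattern I z \<and> (\<mu> > 0 \<longrightarrow> (\<forall>k<l. (\<Sum>i<m. z ! k ! i) = c k r) \<and> (\<forall>i<m. (\<Sum>k<l. z ! k ! i) \<le> u i r))"
    if "(\<mu>, z) \<in> set (type_answer x X r)" for \<mu> z
  proof -
    from that obtain z' where z': "(\<mu>, z') \<in> set ps" "z = patt z'" unfolding ans by auto
    have sh: "D.shaped z'" and mg: "\<mu> > 0 \<Longrightarrow> D.margins 1 z'" using dec(1)[OF z'(1)] by auto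
    show ?thesis unfolding z'(2)
    proof (intro conjI impI allI)
      fix k assume "\<mu> > 0" "k < l"
      then show "(\<Sum>i<m. patt z' ! k ! i) = c k r"
        using mg[unfolded D.margins_def] patt(2)[OF sh] by (simp add: slack_def)
    next
      fix i assume "\<mu> > 0" "i < m"
      then have "(\<Sum>k<l + 1. z' ! i ! k) = u i r" using mg[unfolded D.margins_def] by simp
      then show "(\<Sum>k<l. patt z' ! k ! i) \<le> u i r" using patt(2)[OF sh _ \<open>i < m\<close>] by simp
    qed (rule patt(1)[OF sh])
  qed
  show "(\<Sum>(\<mu>, z)\<leftarrow>type_answer x X r. \<mu>) = n r"
    using dec(2) by (simp add: ans comp_def case_prod_unfold)
  show "int (\<Sum>(\<mu>, z)\<leftarrow>type_answer x X r. \<mu> * z ! k ! i) = X ! i ! (k * t + r)" if ki: "k < l" "i < m" for k i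
  proof -
    have "(\<Sum>(\<mu>, z)\<leftarrow>type_answer x X r. \<mu> * z ! k ! i) = (\<Sum>(\<mu>, z)\<leftarrow>ps. \<mu> * z ! i ! k)"
      unfolding ans map_map comp_def case_prod_unfold fst_conv snd_conv
    proof (intro arg_cong[where f = sum_list] map_cong refl)
      fix p assume "p \<in> set ps"
      then have "D.shaped (snd p)" using dec(1)[of "fst p" "snd p"] by simp
      then show "fst p * patt (snd p) ! k ! i = fst p * snd p ! i ! k" using patt(2) ki by simp
    qed
    also have "\<dots> = ?Z ! i ! k" using dec(3)[OF ki(2), of k] ki(1) by simp
    also have "\<dots> = f i k" using Z ki by simp
    finally show ?thesis using f ki by simp
  qed
qed

lemma pattern_eq_iff:
  assumes "is_pattern I z" "is_pattern I w"
  shows "(\<forall>k<l. \<forall>i<m. w ! k ! i = z ! k ! i) \<longleftrightarrow> w = z"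
  using assms unfolding is_pattern_def by (auto intro!: nth_equalityI)

text \<open>The lists are expanded to one pattern per consumer, in the order of types fixed by
  \<open>consumer_type\<close>. The expansion may be exponentially long and occurs only in the
  proof.\<close>

lemma saturated_answer:
  assumes X: "valid X" and sat: "saturated x X"
  defines "R \<equiv> map (\<lambda>r. type_answer x X r) [0..<t]"
  shows "\<exists>z. feasible_flow I z \<and> represents I R z"
proof -
  have R: "R ! r = type_answer x X r" if "r < t" for r using that by (simp add: R_def)
  note ta = type_answer_correct[OF X sat]
  define ex where "ex r = concat (map (\<lambda>p. replicate (fst p) (snd p)) (R ! r))" for r
  define L where "L = concat (map (\<lambda>r. map (Pair r) (ex r)) [0..<t])"
  define z where "z k i j = snd (L ! j) ! k ! i" for k i j
  have ex_len: "length (ex r) = n r" if "r < t" for r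
    using ta(2)[OF that] that by (simp add: ex_def length_concat comp_def R case_prod_unfold)
  have "map fst L = consumers" unfolding L_def consumers_def map_concat map_map comp_def
  proof (intro arg_cong[where f = concat] map_cong refl)
    fix r assume "r \<in> set [0..<t]"
    then show "map (\<lambda>y. fst (r, y)) (ex r) = replicate (n r) r" using ex_len[of r] by (simp add: map_replicate_const)
  qed
  then have L_len: "length L = num_consumers I" and L_fst: "\<And>j. j < num_consumers I \<Longrightarrow> fst (L ! j) = consumer_type I j"
    unfolding consumer_type_eq using length_consumers by (metis length_map, metis length_map nth_map)
  have L_snd: "is_pattern I (snd (L ! j)) \<and> (\<forall>k<l. (\<Sum>i<m. snd (L ! j) ! k ! i) = c k (consumer_type I j)) \<and>
      (\<forall>i<m. (\<Sum>k<l. snd (L ! j) ! k ! i) \<le> u i (consumer_type I j))" if j: "j < num_consumers I" for j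
  proof -
    have "L ! j \<in> set L" using j L_len by simp
    then obtain r w where rw: "r < t" "L ! j = (r, w)" "w \<in> set (ex r)" by (auto simp: L_def)
    then obtain p where "p \<in> set (R ! r)" "fst p > 0" "w = snd p" by (auto simp: ex_def)
    then show ?thesis using ta(1)[OF rw(1), of "fst p" "snd p"] R[OF rw(1)] L_fst[OF j] rw(2) by simp
  qed
  \<comment> \<open>Sums over consumers become weighted sums over the compact lists; this yields
    both the supplies and the multiplicities in \<open>represents\<close>.\<close>
  have sum_L: "(\<Sum>j<num_consumers I. g (L ! j)) = (\<Sum>r<t. \<Sum>p\<leftarrow>R ! r. fst p * g (r, snd p))" for g :: "nat \<times> pattern \<Rightarrow> nat"
  proof -
    have "(\<Sum>j<num_consumers I. g (L ! j)) = sum_list (map g L)" by (simp add: sum_list_sum_nth L_len atLeast0LessThan)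
    also have "\<dots> = (\<Sum>r\<leftarrow>[0..<t]. sum_list (map (\<lambda>w. g (r, w)) (ex r)))"
      unfolding L_def sum_list_map_concat map_map comp_def ..
    also have "\<dots> = (\<Sum>r<t. sum_list (map (\<lambda>w. g (r, w)) (ex r)))" by (simp add: sum_list_sum_nth atLeast0LessThan)
    finally show ?thesis unfolding ex_def sum_list_weighted .
  qed
  have "feasible_flow I z" unfolding feasible_flow_def
  proof (intro conjI allI impI)
    fix i k assume ik: "i < m" "k < l"
    have "(\<Sum>j<num_consumers I. z k i j) = (\<Sum>r<t. \<Sum>p\<leftarrow>R ! r. fst p * snd p ! k ! i)"
      unfolding z_def using sum_L[of "\<lambda>p. snd p ! k ! i"] by simp
    then have "int (\<Sum>j<num_consumers I. z k i j) = (\<Sum>r<t. int (\<Sum>(\<mu>, z)\<leftarrow>R ! r. \<mu> * z ! k ! i))"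
      by (simp add: case_prod_unfold)
    also have "\<dots> = (\<Sum>r<t. X ! i ! (k * t + r))"
      using ta(3)[OF _ ik(2,1)] R by (intro sum.cong) auto
    also have "\<dots> = int (s k i)" using sat ik unfolding saturated_iff[OF X] by blast
    finally show "(\<Sum>j<num_consumers I. z k i j) = s k i" by (simp only: of_nat_eq_iff)
  qed (use L_snd in \<open>auto simp: z_def\<close>)
  moreover have "represents I R z" unfolding represents_def
  proof (intro conjI allI impI)
    show "length R = t" by (simp add: R_def)
    fix r assume r: "r < t"
    show "\<forall>(\<mu>, z)\<in>set (R ! r). is_pattern I z" using ta(1)[OF r] R[OF r] by auto
    show "(\<Sum>(\<mu>, z)\<leftarrow>R ! r. \<mu>) = n r" using ta(2)[OF r] R[OF r] by simp
    fix w assume w: "is_pattern I w"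
    have "card {j. j < num_consumers I \<and> consumer_type I j = r \<and> (\<forall>k<l. \<forall>i<m. z k i j = w ! k ! i)} =
        card {j. j < num_consumers I \<and> L ! j = (r, w)}"
    proof (rule arg_cong[where f = card], rule Collect_cong, rule conj_cong[OF refl])
      fix j assume j: "j < num_consumers I"
      show "(consumer_type I j = r \<and> (\<forall>k<l. \<forall>i<m. z k i j = w ! k ! i)) = (L ! j = (r, w))"
        using pattern_eq_iff[OF w] L_snd[OF j] L_fst[OF j] unfolding z_def prod_eq_iff by auto
    qed
    also have "\<dots> = (\<Sum>j<num_consumers I. of_bool (L ! j = (r, w)))"
      by (simp add: of_bool_def sum.If_cases Collect_conj_eq lessThan_def)
    also have "\<dots> = (\<Sum>r'<t. \<Sum>p\<leftarrow>R ! r'. fst p * of_bool ((r', snd p) = (r, w)))" by (rule sum_L)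
    also have "\<dots> = (\<Sum>r'<t. if r' = r then \<Sum>p\<leftarrow>R ! r. fst p * of_bool (snd p = w) else 0)"
      by (intro sum.cong) auto
    also have "\<dots> = (\<Sum>p\<leftarrow>R ! r. fst p * of_bool (snd p = w))" using r by simp
    also have "\<dots> = (\<Sum>(\<mu>, v)\<leftarrow>R ! r. if v = w then \<mu> else 0)"
      by (intro arg_cong[where f = sum_list] map_cong) auto
    finally show "(\<Sum>(\<mu>, v)\<leftarrow>R ! r. if v = w then \<mu> else 0) =
      card {j. j < num_consumers I \<and> consumer_type I j = r \<and> (\<forall>k<l. \<forall>i<m. z k i j = w ! k ! i)}" ..
  qed
  ultimately show ?thesis by blast
qed

theorem solve_correct: "solve x \<in> huge_mcf_answers I"
proof (cases "saturated x (total_flow x)")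
  case True
  from saturated_answer[OF total_flow_optimal(1) True] obtain z where
    "feasible_flow I z" "represents I (map (\<lambda>r. type_answer x (total_flow x) r) [0..<t]) z" by blast
  then show ?thesis using True unfolding solve_def huge_mcf_answers_def Let_def by auto
next
  case False
  then have "\<nexists>z. feasible_flow I z" using feasible_saturated by blast
  then show ?thesis using False by (simp add: solve_def huge_mcf_answers_def Let_def)
qed

end

section \<open>Computing the budgets\<close>

definition exp_list :: "bool list \<Rightarrow> bool list" where
  "exp_list xs = replicate (2 ^ length xs) True"

lemma sz_replicate_True: "sz (replicate k True) = 4 * k + 1"
  by (induction k) auto

lemma sz_exp_list: "sz (exp_list xs) = 4 * 2 ^ length xs + 1"
  by (simp add: exp_list_def sz_replicate_True)

lemma sz_le_exp_list: "sz xs \<le> sz (exp_list xs)"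
proof -
  have "4 * length xs + 1 \<le> sz (exp_list xs)"
    using less_exp[of "length xs"] unfolding sz_exp_list by linarith
  then show ?thesis using sz_bool_list(1)[of xs] by linarith
qed

lemma fold_double: "fold (\<lambda>_ a. a @ a) us (replicate k True) = replicate (2 ^ length us * k) True" for us :: "'b list"
proof (induction us arbitrary: k)
  case (Cons u us)
  show ?case using Cons[of "k + k"] by (simp add: replicate_add[symmetric] algebra_simps)
qed simp

text \<open>The output is exponentially longer than the input, so this is no \<open>ptime\<close>
  function. Its time is measured against the output, whose length will depend on the parameters
  alone.\<close>

lemma computes_exp_list: "\<exists>\<tau>. computes exp_list \<tau> \<and> (\<exists>C q. \<forall>x. \<tau> x \<le> C * sz (exp_list x) ^ q)"
proof -
  have "ptime (\<lambda>p::(bool list \<times> bool) \<times> bool list. snd p @ snd p)" by (intro ptime_intros)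
  then obtain \<sigma> where \<sigma>: "computes (\<lambda>p::(bool list \<times> bool) \<times> bool list. snd p @ snd p) \<sigma>" "poly_bounded \<sigma>"
    unfolding ptime_def by blast
  from \<sigma>(2) obtain C q where C: "\<And>p. \<sigma> p \<le> C * sz p ^ q" unfolding poly_bounded_def by blast
  have "ptime (\<lambda>x::bool list. (x, x, [True]))" by (intro ptime_intros)
  then obtain \<rho> where \<rho>: "computes (\<lambda>x::bool list. (x, x, [True])) \<rho>" "poly_bounded \<rho>"
    unfolding ptime_def by blast
  from \<rho>(2) obtain D r where D: "\<And>p. \<rho> p \<le> D * sz p ^ r" unfolding poly_bounded_def by blast
  let ?S = "\<lambda>x. C * (5 * sz (exp_list x)) ^ q"
  have B: "sz (fold (\<lambda>y a. snd ((x, y), a) @ snd ((x, y), a)) us [True]) \<le> sz (exp_list x)" if "x = us @ vs" for x us vs :: "bool list"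
  proof -
    have "(2::nat) ^ length us \<le> 2 ^ length x" using that by (intro power_increasing) auto
    then show ?thesis using fold_double[of us 1] by (simp add: sz_exp_list sz_replicate_True)
  qed
  have "computes (\<lambda>x. fold (\<lambda>y a. snd ((x, y), a) @ snd ((x, y), a)) x [True])
    (\<lambda>x. \<rho> x + sz x * (?S x + 3 * sz x + 9 * sz x + 5 * sz (exp_list x) + 5) + 8 * sz (x, x, [True]) + sz (exp_list x) + 2)"
  proof (rule computes_fold[OF \<sigma>(1) \<rho>(1)])
    fix x us y and vs :: "bool list" assume x: "x = us @ y # vs"
    let ?a = "fold (\<lambda>y a. snd ((x, y), a) @ snd ((x, y), a)) us [True]"
    have "sz ((x, y), ?a) \<le> 5 * sz (exp_list x)"
      using B[OF x] sz_le_exp_list[of x] sz_member[of y x] sz_ge_1[of "exp_list x"] x by simp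
    then have "C * sz ((x, y), ?a) ^ q \<le> ?S x" by (intro mult_le_mono2 power_mono) auto
    with C[of "((x, y), ?a)"] show "\<sigma> ((x, y), ?a) \<le> ?S x" by (rule order_trans)
  qed (rule B)
  then have "computes exp_list
    (\<lambda>x. \<rho> x + sz x * (?S x + 3 * sz x + 9 * sz x + 5 * sz (exp_list x) + 5) + 8 * sz (x, x, [True]) + sz (exp_list x) + 2)"
    (is "computes _ ?\<tau>")
  proof -
    have "(\<lambda>x. fold (\<lambda>y a. snd ((x, y), a) @ snd ((x, y), a)) x [True]) = exp_list"
      using fold_double[where 'b = bool, of _ 1] by (simp add: exp_list_def fun_eq_iff)
    with \<open>computes (\<lambda>x. fold (\<lambda>y a. snd ((x, y), a) @ snd ((x, y), a)) x [True]) _\<close> show ?thesis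
      by (simp only:)
  qed
  moreover have "\<exists>C q. \<forall>x. ?\<tau> x \<le> C * sz (exp_list x) ^ q"
  proof -
    have "poly_bounded (\<lambda>y::bool list. D * sz y ^ r + sz y * (C * (5 * sz y) ^ q + 3 * sz y + 9 * sz y + 5 * sz y + 5) + 8 * (2 * sz y + 7) + sz y + 2)"
      (is "poly_bounded ?g") by (intro poly_bounded_intros)
    then obtain E s where E: "\<And>y. ?g y \<le> E * sz y ^ s" unfolding poly_bounded_def by blast
    have "?\<tau> x \<le> ?g (exp_list x)" for x
    proof -
      have le: "sz x \<le> sz (exp_list x)" by (rule sz_le_exp_list)
      then have "D * sz x ^ r \<le> D * sz (exp_list x) ^ r" by (intro mult_le_mono2 power_mono) auto
      then have 1: "\<rho> x \<le> D * sz (exp_list x) ^ r" using D[of x] by linarith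
      have 2: "sz x * (?S x + 3 * sz x + 9 * sz x + 5 * sz (exp_list x) + 5) \<le>
          sz (exp_list x) * (C * (5 * sz (exp_list x)) ^ q + 3 * sz (exp_list x) + 9 * sz (exp_list x) + 5 * sz (exp_list x) + 5)"
        using le by (intro mult_le_mono add_le_mono order_refl) auto
      have 3: "sz (x, x, [True]) \<le> 2 * sz (exp_list x) + 7" using le by simp
      show ?thesis by (intro add_mono 1 2 mult_le_mono2[OF 3] order_refl)
    qed
    then show ?thesis using E order_trans by blast
  qed
  ultimately show ?thesis by blast
qed

definition square_list :: "bool list \<Rightarrow> bool list" where
  "square_list w = concat (map (\<lambda>_. w) w)"

lemma length_square_list: "length (square_list w) = length w ^ 2"
  by (simp add: square_list_def length_concat comp_def sum_list_triv power2_eq_square)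

lemma ptime_square_list [ptime_intros]:
  assumes "ptime w" shows "ptime (\<lambda>x. square_list (w x))"
  unfolding square_list_def by (intro ptime_intros assms ptime_comp[OF assms])

type_synonym raw_input = "nat \<times> bool list \<times> nat \<times> nat list list \<times> nat list list \<times> nat list list \<times> nat list \<times> unit"

text \<open>Of length \<open>(l + t + 4)\<^sup>2\<close>, with \<open>l\<close> and \<open>t\<close>
  read off the number of supply rows and of type counts. Square and offset are what
  \<open>budget_bounds\<close> asks for.\<close>

definition seed :: "raw_input \<Rightarrow> bool list" where
  "seed x = square_list ([True, True, True, True] @ map (\<lambda>_. True) (fst (snd (snd (snd x)))) @
     map (\<lambda>_. True) (fst (snd (snd (snd (snd (snd (snd x))))))))"

text \<open>Two exponentials cover \<open>step_bound\<close>; the main budget takes a third one, for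
  \<open>gap_bound\<close> and the number of vectors in the box.\<close>

definition range_budget :: "raw_input \<Rightarrow> bool list" where
  "range_budget x = exp_list (exp_list (seed x))"

definition main_budget :: "raw_input \<Rightarrow> bool list" where
  "main_budget x = exp_list (range_budget x)"

definition solve_raw :: "raw_input \<Rightarrow> compact option" where
  "solve_raw x = solve (x, range_budget x, main_budget x)"

text \<open>No auxiliary list is larger than the main budget, so the time is polynomial in instance
  and budget together. Bounding the sum of the two sizes by a product separates the parameter from
  the instance.\<close>

lemma computes_solve_raw:
  "\<exists>\<tau> C q. computes solve_raw \<tau> \<and> (\<forall>x. \<tau> x \<le> C * ((2 + sz (main_budget x)) ^ q * sz x ^ q))"
proof -
  from computes_exp_list obtain \<epsilon> C q where \<epsilon>: "computes exp_list \<epsilon>" "\<And>x. \<epsilon> x \<le> C * sz (exp_list x) ^ q"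
    by blast
  have "ptime seed" unfolding seed_def[abs_def] by (intro ptime_intros)
  then obtain \<sigma> where \<sigma>: "computes seed \<sigma>" "poly_bounded \<sigma>" unfolding ptime_def by blast
  from ptime_solve obtain \<rho> where \<rho>: "computes solve \<rho>" "poly_bounded \<rho>" unfolding ptime_def by blast
  from \<sigma>(2) obtain D r where D: "\<And>x. \<sigma> x \<le> D * sz x ^ r" unfolding poly_bounded_def by blast
  from \<rho>(2) obtain E s where E: "\<And>x. \<rho> x \<le> E * sz x ^ s" unfolding poly_bounded_def by blast
  let ?\<tau>b = "\<lambda>x. \<sigma> x + \<epsilon> (seed x) + \<epsilon> (exp_list (seed x))"
  have b: "computes range_budget ?\<tau>b"
    unfolding range_budget_def[abs_def] by (rule computes_comp[OF computes_comp[OF \<sigma>(1) \<epsilon>(1)] \<epsilon>(1)])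
  let ?\<tau>N = "\<lambda>x. ?\<tau>b x + \<epsilon> (range_budget x)"
  have N: "computes main_budget ?\<tau>N"
    unfolding main_budget_def[abs_def] by (rule computes_comp[OF b \<epsilon>(1)])
  let ?\<tau>p = "\<lambda>x. ?\<tau>b x + ?\<tau>N x + 2 * sz x + 2 * sz (range_budget x) + 2 * sz (main_budget x) + 3"
  have p: "computes (\<lambda>x. (range_budget x, main_budget x)) ?\<tau>p" by (rule computes_Pair[OF b N])
  let ?\<tau>i = "\<lambda>x. sz x + ?\<tau>p x + 2 * sz x + 2 * sz x + 2 * sz (range_budget x, main_budget x) + 3"
  have i: "computes (\<lambda>x. (x, range_budget x, main_budget x)) ?\<tau>i" by (rule computes_Pair[OF computes_id p])
  let ?\<tau> = "\<lambda>x. ?\<tau>i x + \<rho> (x, range_budget x, main_budget x)"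
  have "computes solve_raw ?\<tau>"
    unfolding solve_raw_def[abs_def] by (rule computes_comp[OF i \<rho>(1)])
  moreover have "\<exists>C q. \<forall>x. ?\<tau> x \<le> C * ((2 + sz (main_budget x)) ^ q * sz x ^ q)"
  proof -
    let ?b = "\<lambda>y::raw_input \<times> bool list. D * sz (fst y) ^ r + C * sz (snd y) ^ q + C * sz (snd y) ^ q"
    let ?g = "\<lambda>y. sz (fst y) + (?b y + (?b y + C * sz (snd y) ^ q) + 2 * sz (fst y) + 2 * sz (snd y) + 2 * sz (snd y) + 3) +
      2 * sz (fst y) + 2 * sz (fst y) + 2 * (1 + sz (snd y) + sz (snd y)) + 3 + E * (2 + sz (fst y) + sz (snd y) + sz (snd y)) ^ s"
    have "poly_bounded ?g" by (intro poly_bounded_intros ptime_intros)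
    then obtain G k where G: "\<And>y. ?g y \<le> G * sz y ^ k" unfolding poly_bounded_def by blast
    have "?\<tau> x \<le> G * ((2 + sz (main_budget x)) ^ k * sz x ^ k)" for x
    proof -
      let ?N = "main_budget x"
      have le1: "sz (range_budget x) \<le> sz ?N" unfolding main_budget_def by (rule sz_le_exp_list)
      have le2: "sz (exp_list (seed x)) \<le> sz ?N"
        using le1 sz_le_exp_list[of "exp_list (seed x)"] unfolding range_budget_def by linarith
      have pw: "C * a ^ q \<le> C * sz ?N ^ q" if "a \<le> sz ?N" for a
        using that by (intro mult_le_mono2 power_mono) auto
      have e: "\<epsilon> (seed x) \<le> C * sz ?N ^ q" "\<epsilon> (exp_list (seed x)) \<le> C * sz ?N ^ q" "\<epsilon> (range_budget x) \<le> C * sz ?N ^ q"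
        using order_trans[OF \<epsilon>(2) pw[OF le2]] order_trans[OF \<epsilon>(2)[of "exp_list (seed x)"] pw[OF le1[unfolded range_budget_def]]]
          \<epsilon>(2)[of "range_budget x"] unfolding main_budget_def by blast+
      have "E * sz (x, range_budget x, ?N) ^ s \<le> E * (2 + sz x + sz ?N + sz ?N) ^ s"
        using le1 by (intro mult_le_mono2 power_mono) auto
      with E[of "(x, range_budget x, ?N)"] have rho: "\<rho> (x, range_budget x, ?N) \<le> E * (2 + sz x + sz ?N + sz ?N) ^ s"
        by (rule order_trans)
      have "sz (range_budget x, ?N) \<le> 1 + sz ?N + sz ?N" using le1 by simp
      then have "?\<tau> x \<le> ?g (x, ?N)" unfolding fst_conv snd_conv
        by (intro add_mono mult_le_mono2 order_refl D e rho le1)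
      also have "\<dots> \<le> G * sz (x, ?N) ^ k" by (rule G)
      also have "\<dots> \<le> G * ((2 + sz ?N) * sz x) ^ k"
      proof (intro mult_le_mono2 power_mono)
        have "(1 + sz ?N) * 1 \<le> (1 + sz ?N) * sz x" by (intro mult_le_mono2) simp
        then show "sz (x, ?N) \<le> (2 + sz ?N) * sz x" by simp
      qed simp
      finally show ?thesis by (simp only: power_mult_distrib)
    qed
    then show ?thesis by blast
  qed
  ultimately show ?thesis by blast
qed

definition height :: "nat \<Rightarrow> nat" where
  "height p = (p + 4) ^ 2"

lemma self_le_exp: "k \<le> 2 ^ k" for k :: nat
  using less_exp[of k] by simp

lemma mult_le_exp2: "a \<le> 2 ^ i \<Longrightarrow> b \<le> 2 ^ j \<Longrightarrow> a * b \<le> 2 ^ (i + j)" for a b :: nat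
  by (simp add: power_add mult_le_mono)

lemma power_le_exp2: "a \<le> 2 ^ i \<Longrightarrow> a ^ b \<le> 2 ^ (i * b)" for a b :: nat
  by (simp add: power_mult power_mono)

lemma exp2_mono: "i \<le> j \<Longrightarrow> (2::nat) ^ i \<le> 2 ^ j"
  by (simp add: power_increasing)

lemma add_le_exp2: "a \<le> 2 ^ i \<Longrightarrow> b \<le> 2 ^ i \<Longrightarrow> a + b \<le> 2 ^ (i + 1)" for a b :: nat
  by simp

text \<open>With \<open>a \<le> p ^ 2\<close> and \<open>F \<le> p\<close> both stages are covered
  at once. The number of step types is a power whose exponent is itself doubly exponential, which is
  the source of the third exponential.\<close>

lemma budget_bounds:
  assumes a: "a \<le> p ^ 2" and F: "F \<le> p" and p: "p \<ge> 2" and h: "p ^ 2 + 4 * p + 4 \<le> h"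
  shows "step_bound a F \<le> 2 ^ 2 ^ h"
    and "2 * gap_bound a F \<le> 2 ^ 2 ^ 2 ^ h"
    and "(2 * 2 ^ 2 ^ h + 1) ^ a \<le> (2::nat) ^ 2 ^ 2 ^ h"
proof -
  have eq: "2 * block_bound F = 2 ^ 2 ^ F"
    by (simp add: block_bound_def power_Suc[symmetric] del: power_Suc)
  have bb2: "2 * block_bound F \<le> 2 ^ 2 ^ p" unfolding eq by (intro exp2_mono F)
  then have bb: "block_bound F \<le> 2 ^ 2 ^ p" by linarith
  \<comment> \<open>Collects the exponents coming from \<open>block_bound\<close> and from the
    \<open>a + 1\<close> functionals in \<open>mixed_bound\<close>.\<close>
  let ?w = "p ^ 2 + p + 1"
  have "mixed_bound a F \<le> 2 ^ (2 ^ p * (2 ^ (a + 1) - 1))"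
    unfolding mixed_bound_def by (rule power_le_exp2[OF bb2])
  also have "\<dots> \<le> 2 ^ 2 ^ ?w"
  proof (rule exp2_mono)
    have "2 ^ p * (2 ^ (a + 1) - 1) \<le> 2 ^ p * (2::nat) ^ (p ^ 2 + 1)"
      using a by (intro mult_le_mono2 order_trans[OF diff_le_self] exp2_mono) simp
    also have "\<dots> = 2 ^ ?w" by (simp add: power_add)
    finally show "2 ^ p * (2 ^ (a + 1) - 1) \<le> (2::nat) ^ ?w" .
  qed
  finally have mixed: "mixed_bound a F \<le> 2 ^ 2 ^ ?w" .
  have "step_bound a F \<le> 2 ^ (2 ^ p + 2 ^ ?w)"
    unfolding step_bound_def by (rule mult_le_exp2[OF bb mixed])
  also have "\<dots> \<le> 2 ^ 2 ^ (?w + 1)" by (intro exp2_mono add_le_exp2) auto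
  finally have step: "step_bound a F \<le> 2 ^ 2 ^ (?w + 1)" .
  also have "\<dots> \<le> 2 ^ 2 ^ h" using h by (intro exp2_mono) simp
  finally show "step_bound a F \<le> 2 ^ 2 ^ h" .
  have p2: "p ^ 2 \<le> 2 ^ (2 * p)"
    using power_mono[OF self_le_exp[of p], of 2] by (simp add: power_mult[symmetric] mult.commute)
  have "mixed_bound a F + 1 \<le> 2 ^ (2 ^ ?w + 1)" using mixed by (intro add_le_exp2) auto
  also have "\<dots> \<le> 2 ^ 2 ^ (?w + 1)" by (intro exp2_mono add_le_exp2) auto
  finally have m1: "mixed_bound a F + 1 \<le> 2 ^ 2 ^ (?w + 1)" .
  have "2 * block_bound F + 1 \<le> 2 ^ (2 ^ p + 1)" using bb2 by (intro add_le_exp2) auto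
  then have "(2 * block_bound F + 1) ^ a \<le> 2 ^ ((2 ^ p + 1) * a)" by (rule power_le_exp2)
  also have "\<dots> \<le> 2 ^ 2 ^ (3 * p + 1)"
  proof (rule exp2_mono)
    have "(2 ^ p + 1) * a \<le> 2 ^ (p + 1) * (2::nat) ^ (2 * p)"
      using a p2 by (intro mult_le_mono add_le_exp2) auto
    then show "(2 ^ p + 1) * a \<le> 2 ^ (3 * p + 1)" by (simp add: power_add[symmetric] algebra_simps)
  qed
  finally have e: "(2 * block_bound F + 1) ^ a \<le> 2 ^ 2 ^ (3 * p + 1)" .
  \<comment> \<open>There are at most \<open>2 ^ 2 ^ ?v\<close> types of steps.\<close>
  let ?v = "?w + 1 + 2 ^ (3 * p + 1)"
  have "(mixed_bound a F + 1) ^ ((2 * block_bound F + 1) ^ a) \<le> 2 ^ (2 ^ (?w + 1) * (2 * block_bound F + 1) ^ a)"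
    by (rule power_le_exp2[OF m1])
  also have "\<dots> \<le> 2 ^ 2 ^ ?v"
  proof (rule exp2_mono)
    show "2 ^ (?w + 1) * (2 * block_bound F + 1) ^ a \<le> 2 ^ ?v" by (rule mult_le_exp2[OF order_refl e])
  qed
  finally have "gap_bound a F \<le> 2 ^ (2 ^ ?v + 2 ^ (?w + 1))"
    unfolding gap_bound_def using step by (rule mult_le_exp2)
  then have "2 * gap_bound a F \<le> 2 ^ 1 * 2 ^ (2 ^ ?v + 2 ^ (?w + 1))" by simp
  also have "\<dots> \<le> 2 ^ (1 + (2 ^ ?v + 2 ^ (?w + 1)))" by (rule mult_le_exp2) simp_all
  also have "\<dots> \<le> 2 ^ 2 ^ (?v + 2)"
  proof (rule exp2_mono)
    have "2 ^ ?v + 2 ^ (?w + 1) \<le> (2::nat) ^ (?v + 1)" by (intro add_le_exp2 exp2_mono) auto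
    then have "1 + (2 ^ ?v + 2 ^ (?w + 1)) \<le> (2::nat) ^ (?v + 1 + 1)" by (intro add_le_exp2) auto
    then show "1 + (2 ^ ?v + 2 ^ (?w + 1)) \<le> (2::nat) ^ (?v + 2)" by simp
  qed
  also have "\<dots> \<le> 2 ^ 2 ^ 2 ^ h"
  proof (intro exp2_mono)
    have "?w + 3 \<le> 2 ^ (3 * p + 1)"
    proof -
      have "p + 4 \<le> 2 ^ (2 * p + 1)"
      proof -
        have "p + 4 \<le> 2 * p + 2" using p by simp
        then show ?thesis using self_le_exp[of "2 * p + 1"] less_exp[of "2 * p + 1"] p by linarith
      qed
      moreover have "p ^ 2 \<le> 2 ^ (2 * p + 1)" using p2 by simp
      ultimately have "p ^ 2 + (p + 4) \<le> 2 ^ (2 * p + 1 + 1)" using add_le_exp2 by blast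
      also have "\<dots> \<le> 2 ^ (3 * p + 1)" using p by (intro exp2_mono) simp
      finally show ?thesis by simp
    qed
    from add_le_exp2[OF this order_refl] have "?w + 3 + 2 ^ (3 * p + 1) \<le> 2 ^ (3 * p + 1 + 1)" .
    also have "\<dots> \<le> 2 ^ h" using h by (intro exp2_mono) simp
    finally show "?v + 2 \<le> 2 ^ h" by simp
  qed
  finally show "2 * gap_bound a F \<le> 2 ^ 2 ^ 2 ^ h" .
  have "2 * 2 ^ 2 ^ h + 1 \<le> (2::nat) ^ (1 + 2 ^ h + 1)" by (intro add_le_exp2) simp_all
  then have "(2 * 2 ^ 2 ^ h + 1) ^ a \<le> (2::nat) ^ ((1 + 2 ^ h + 1) * a)" by (rule power_le_exp2)
  also have "\<dots> \<le> 2 ^ 2 ^ 2 ^ h"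
  proof (rule exp2_mono)
    have h1: "2 \<le> h" using h by simp
    have "1 + 2 ^ h + 1 \<le> (2::nat) ^ (h + 1)"
      using exp2_mono[of 1 h] h1 by simp
    moreover have "a \<le> 2 ^ (2 * p)" using a p2 by simp
    ultimately have "(1 + 2 ^ h + 1) * a \<le> 2 ^ (h + 1 + 2 * p)" by (rule mult_le_exp2)
    also have "\<dots> \<le> 2 ^ 2 ^ h"
    proof (rule exp2_mono)
      have "h + 1 + 2 * p \<le> 2 * h" using h by simp
      also have "\<dots> \<le> 2 ^ h"
      proof -
        have "h - 1 < 2 ^ (h - 1)" by (rule less_exp)
        then have "2 * h \<le> 2 * 2 ^ (h - 1)" by linarith
        also have "\<dots> = 2 ^ h" using h1 by (cases h) auto
        finally show ?thesis .
      qed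
      finally show "h + 1 + 2 * p \<le> 2 ^ h" .
    qed
    finally show "(1 + 2 ^ h + 1) * a \<le> 2 ^ 2 ^ h" .
  qed
  finally show "(2 * 2 ^ 2 ^ h + 1) ^ a \<le> (2::nat) ^ 2 ^ 2 ^ h" .
qed

definition raw_instance :: "huge_mcf \<Rightarrow> raw_input" where
  "raw_instance I = fst (instance_input I [] [])"

lemma instance_input_eq: "instance_input I bs N = (raw_instance I, bs, N)"
  by (simp add: raw_instance_def instance_input_def)

lemma length_seed: "length (seed (raw_instance I)) = height (commodities I + types I)"
  by (simp add: seed_def raw_instance_def instance_input_def length_square_list height_def add.commute add.left_commute)

lemma length_budgets:
  "length (range_budget (raw_instance I)) = 2 ^ 2 ^ height (commodities I + types I)"
  "length (main_budget (raw_instance I)) = 2 ^ 2 ^ 2 ^ height (commodities I + types I)"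
  by (simp_all add: main_budget_def range_budget_def exp_list_def length_seed)

lemma solve_raw_correct:
  assumes "I \<in> huge_mcf_instances"
  shows "solve_raw (raw_instance I) \<in> huge_mcf_answers I"
proof -
  \<comment> \<open>The offset 2 ensures \<open>commodities I + 2 \<le> ?p\<close> and
    \<open>2 \<le> ?p\<close>; then \<open>(?p + 2) ^ 2\<close> is exactly
    \<open>?h\<close>.\<close>
  let ?p = "commodities I + types I + 2"
  let ?h = "height (commodities I + types I)"
  have h: "?p ^ 2 + 4 * ?p + 4 \<le> ?h"
    by (simp add: height_def power2_eq_square algebra_simps)
  have "commodities I * types I \<le> (commodities I + types I) * (commodities I + types I)"
    by (intro mult_le_mono) auto
  also have "\<dots> \<le> ?p ^ 2" unfolding power2_eq_square by (intro mult_le_mono) auto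
  finally have a1: "commodities I * types I \<le> ?p ^ 2" .
  have "commodities I + 1 \<le> ?p * 1" by simp
  also have "\<dots> \<le> ?p ^ 2" unfolding power2_eq_square by (intro mult_le_mono2) simp
  finally have a2: "commodities I + 1 \<le> ?p ^ 2" .
  have F1: "commodities I + types I \<le> ?p" and F2: "commodities I + 2 \<le> ?p" and p: "2 \<le> ?p" by auto
  interpret huge_instance I "range_budget (raw_instance I)" "main_budget (raw_instance I)"
    using budget_bounds[OF a1 F1 p h] budget_bounds[OF a2 F2 p h] assms
    by unfold_locales (simp_all only: length_budgets)
  show ?thesis using solve_correct unfolding instance_input_eq solve_raw_def .
qed

section \<open>The parameter function is computable\<close>

text \<open>Mere computability allows any time bound, so costs and sizes along the actual run are
  simply added up.\<close>

lemma computes_fold_any: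
  fixes f :: "('a::encodable \<times> 'b::encodable) \<times> 'c::encodable \<Rightarrow> 'c"
  assumes f: "computes f \<sigma>" and ys: "computes ys \<tau>" and a: "computes a \<upsilon>"
  shows "\<exists>\<rho>. computes (\<lambda>x. fold (\<lambda>y a. f ((x, y), a)) (ys x) (a x)) \<rho>"
proof -
  let ?a = "\<lambda>x i. fold (\<lambda>y a. f ((x, y), a)) (take i (ys x)) (a x)"
  let ?S = "\<lambda>x. \<Sum>i<length (ys x). \<sigma> ((x, ys x ! i), ?a x i)"
  let ?B = "\<lambda>x. \<Sum>i\<le>length (ys x). sz (?a x i)"
  note g = computes_Pair[OF computes_id computes_Pair[OF ys a]]
  have "\<sigma> ((x, y), fold (\<lambda>y a. f ((x, y), a)) us (a x)) \<le> ?S x" if "ys x = us @ y # vs" for x us y vs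
    using that member_le_sum[of "length us" "{..<length (ys x)}" "\<lambda>i. \<sigma> ((x, ys x ! i), ?a x i)"] by simp
  moreover have "sz (fold (\<lambda>y a. f ((x, y), a)) us (a x)) \<le> ?B x" if "ys x = us @ vs" for x us vs
    using that member_le_sum[of "length us" "{..length (ys x)}" "\<lambda>i. sz (?a x i)"] by simp
  ultimately show ?thesis using computes_fold[OF f g, of ?S ?B] by blast
qed

definition unary :: "nat \<Rightarrow> bool list" where
  "unary k = replicate k True"

text \<open>Horner's scheme with lists for numbers: the list is doubled, and one element is appended
  for each bit that is set.\<close>

lemma computes_unary: "\<exists>\<tau>. computes unary \<tau>"
proof -
  define f where "f p = snd p @ snd p @ (if snd (fst p) then [True] else [])" for p :: "(nat \<times> bool) \<times> bool list"
  have "ptime f" unfolding f_def by (intro ptime_intros)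
  moreover have "ptime (\<lambda>k. rev (bits k))" by (intro ptime_intros ptime_bits)
  moreover have "ptime (\<lambda>k::nat. [] :: bool list)" by (intro ptime_intros)
  ultimately obtain \<sigma> \<tau> \<upsilon> where "computes f \<sigma>" "computes (\<lambda>k. rev (bits k)) \<tau>" "computes (\<lambda>k::nat. [] :: bool list) \<upsilon>"
    unfolding ptime_def by blast
  from computes_fold_any[OF this] obtain \<rho> where \<rho>: "computes (\<lambda>k. fold (\<lambda>y a. f ((k, y), a)) (rev (bits k)) []) \<rho>" by blast
  have "fold (\<lambda>y a. f ((k, y), a)) us (replicate v True) = replicate (2 ^ length us * v + val (rev us)) True" for us k v
  proof (induction us arbitrary: v)
    case (Cons u us)
    have "f ((k, u), replicate v True) = replicate (2 * v + of_bool u) True"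
      by (simp add: f_def replicate_add mult_2)
    then show ?case using Cons[of "2 * v + of_bool u"] by (simp add: val_append algebra_simps)
  qed simp
  from this[of _ _ 0] have "fold (\<lambda>y a. f ((k, y), a)) (rev (bits k)) [] = unary k" for k
    by (simp add: unary_def)
  then show ?thesis using \<rho> by auto
qed

text \<open>\<open>4 * k + 1\<close> is the size of a unary number \<open>k\<close>; the base is
  thus 2 plus the size of the main budget, as in \<open>computes_solve_raw\<close>.\<close>

definition fpt_bound :: "nat \<Rightarrow> nat list \<Rightarrow> nat" where
  "fpt_bound q ps = (2 + (4 * 2 ^ 2 ^ 2 ^ height (sum_list ps) + 1)) ^ q"

lemma computable_fpt_bound: "computable (fpt_bound q)"
proof -
  define h where "h w = square_list ([True, True, True, True] @ w)" for w
  define g where "g w = (2 + (4 * length w + 1)) ^ q" for w :: "bool list"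
  have "ptime (\<lambda>w. (2 + (4 * length w + 1)) ^ q)" for w :: "bool list"
  proof (induction q)
    case 0
    show ?case by (simp add: ptime_const)
  next
    case (Suc q)
    then show ?case unfolding power_Suc by (intro ptime_intros)
  qed
  then have "ptime g" unfolding g_def .
  moreover have "ptime (\<lambda>ps::nat list. sum_list ps)" by (intro ptime_intros)
  moreover have "ptime h" unfolding h_def by (intro ptime_intros)
  ultimately obtain \<tau>1 \<tau>2 \<tau>3 where 1: "computes g \<tau>1" "computes (\<lambda>ps::nat list. sum_list ps) \<tau>2" "computes h \<tau>3"
    unfolding ptime_def by blast
  from computes_exp_list computes_unary obtain \<epsilon> \<upsilon> where 2: "computes exp_list \<epsilon>" "computes unary \<upsilon>" by blast
  have "\<exists>\<rho>. computes (\<lambda>ps. g (exp_list (exp_list (exp_list (h (unary (sum_list ps))))))) \<rho>"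
    using computes_comp[OF computes_comp[OF computes_comp[OF computes_comp[OF computes_comp[OF computes_comp[OF 1(2) 2(2)] 1(3)] 2(1)] 2(1)] 2(1)] 1(1)] by blast
  moreover have "g (exp_list (exp_list (exp_list (h (unary (sum_list ps)))))) = fpt_bound q ps" for ps
  proof -
    have "length ([True, True, True, True] @ w) = length w + 4" for w by simp
    then have "length (h (unary k)) = height k" for k
      unfolding h_def length_square_list by (simp only: height_def unary_def length_replicate)
    then show ?thesis by (simp add: g_def exp_list_def fpt_bound_def)
  qed
  ultimately obtain \<rho> where "computes (fpt_bound q) \<rho>" by auto
  then obtain P where "\<And>ps. \<exists>T\<le>\<rho> ps. exec P (init (enc ps)) T (init (enc (fpt_bound q ps)))"
    unfolding computes_def by blast
  then have "\<exists>T. runs P (Defs.enc_list enc_binary ps) (enc_binary (fpt_bound q ps)) T" for ps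
    unfolding runs_def by (metis enc_list_def enc_nat_def fun_upd_same init_def)
  then show ?thesis unfolding computable_def by blast
qed

lemma enc_list_map: "Defs.enc_list e (map f xs) = Defs.enc_list (\<lambda>x. e (f x)) xs"
  by (induction xs) (simp_all add: Defs.enc_list_def)

text \<open>The tuple type was chosen for this equation: the program runs on the given input without
  conversion.\<close>

lemma enc_raw_instance: "enc (raw_instance I) = enc_huge_mcf I"
proof -
  have bit: "enc = enc_bit" by (simp add: fun_eq_iff enc_bool_def)
  show ?thesis
    by (simp add: raw_instance_def instance_input_def enc_huge_mcf_def enc_list_def enc_list_map
        enc_unary_def enc_nat_def bit) (simp add: Defs.enc_list_def)
qed

lemma enc_answer: "enc = enc_huge_mcf_answer"
proof -
  have "(enc :: nat \<times> pattern \<Rightarrow> tree) = (\<lambda>(\<mu>, z). Node (enc_binary \<mu>) (Defs.enc_list (Defs.enc_list enc_binary) z))"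
    by (simp add: fun_eq_iff enc_prod_def enc_list_def enc_nat_def)
  then show ?thesis unfolding enc_huge_mcf_answer_def
    by (simp only: enc_option_def[abs_def] enc_list_def[abs_def])
qed

theorem corollary3p2:
  "fixed_parameter_tractable huge_mcf_instances
     (\<lambda>I. [commodities I, types I]) enc_huge_mcf
     huge_mcf_answers enc_huge_mcf_answer"
proof -
  from computes_solve_raw obtain \<tau> C q where \<tau>: "computes solve_raw \<tau>"
    "\<And>x. \<tau> x \<le> C * ((2 + sz (main_budget x)) ^ q * sz x ^ q)" by blast
  from \<tau>(1) obtain P where P: "\<And>x. \<exists>T\<le>\<tau> x. exec P (init (enc x)) T (init (enc (solve_raw x)))"
    unfolding computes_def by blast
  have "\<exists>T. runs P (enc_huge_mcf I) (enc_huge_mcf_answer (solve_raw (raw_instance I))) T \<and>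
      T \<le> C * (fpt_bound q [commodities I, types I] * tree_size (enc_huge_mcf I) ^ q)" for I
  proof -
    let ?x = "raw_instance I"
    obtain T where T: "T \<le> \<tau> ?x" "exec P (init (enc ?x)) T (init (enc (solve_raw ?x)))" using P by blast
    have "sz (main_budget ?x) = 4 * length (main_budget ?x) + 1"
      by (simp add: main_budget_def exp_list_def sz_replicate_True)
    then have "(2 + sz (main_budget ?x)) ^ q = fpt_bound q [commodities I, types I]"
      by (simp add: fpt_bound_def length_budgets)
    then have "T \<le> C * (fpt_bound q [commodities I, types I] * tree_size (enc_huge_mcf I) ^ q)"
      using order_trans[OF T(1) \<tau>(2)] by (simp add: sz_def enc_raw_instance)
    moreover have "runs P (enc_huge_mcf I) (enc_huge_mcf_answer (solve_raw ?x)) T"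
      unfolding runs_def using T(2) by (auto simp: init_def enc_raw_instance enc_answer)
    ultimately show ?thesis by blast
  qed
  then show ?thesis
    unfolding fixed_parameter_tractable_def using computable_fpt_bound solve_raw_correct by blast
qed

end
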